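(* Let $A\subset C$ and $B\subset D$ be unital inclusions of unital $C^*$-algebras which are strongly Morita equivalent. Suppose that there is a conditional expectation of Watatani index-finite type from $C$ onto $A$. Then the paragroups of $A\subset C$ and $B\subset D$ are isomorphic.
   Context: An equivalence bimodule is an imprimitivity bimodule; ${}_C\langle\ ,\ \rangle$ and $\langle\ ,\ \rangle_D$ are its inner products; for sets $\langle U,V\rangle$ is the linear span. Unital inclusions $A\subset C$, $B\subset D$ are strongly Morita equivalent if there are a $C-D$-equivalence bimodule $Y$ and a closed subspace $X\subset Y$ such that (1) $a\cdot x\in X$ and ${}_C\langle x,y\rangle\in A$ for $a\in A$, $x,y\in X$, and $\overline{{}_C\langle X,X\rangle}=A$, $\overline{{}_C\langle Y,X\rangle}=C$; (2) $x\cdot b\in X$ and $\langle x,y\rangle_D\in B$ for $b\in B$, $x,y\in X$, and $\overline{\langle X,X\rangle_D}=B$, $\overline{\langle Y,X\rangle_D}=D$. A conditional expectation $E^A:C\to A$ is of Watatani index-finite type if there is a finite family $\{(u_i,u_i^* )\}$ (a quasi-basis) with $u_i\in C$ and $\sum_i u_iE^A(u_i^*c)=c=\sum_i E^A(cu_i)u_i^*$ for all $c\in C$; $\mathrm{Ind}_W(E^A)=\sum_i u_iu_i^*$. Its $C^*$-basic construction $C_1$ (with Jones projection $e_A$) is the linear span of $\{c_1e_Ac_2:c_1,c_2\in C\}$, $e_Ace_A=E^A(c)e_A$, equivalently the algebra of adjointable right $A$-linear operators on $C$; it contains $C$ unitally, and $E^C(c_1e_Ac_2)=\mathrm{Ind}_W(E^A)^{-1}c_1c_2$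 is a conditional expectation of Watatani index-finite type from $C_1$ onto $C$, so the construction can be iterated to give the tower $A\subset C=C_0\subset C_1\subset C_2\subset\cdots$. Up to isomorphism the tower of algebras does not depend on the choice of $E^A$. If $A\subset C$ and $B\subset D$ are strongly Morita equivalent and a conditional expectation of index-finite type from $C$ onto $A$ exists, then one from $D$ onto $B$ also exists, giving the tower $B\subset D=D_0\subset D_1\subset\cdots$. The paragroup of $A\subset C$ is the system of higher relative commutants $A'\cap C_n\supset C'\cap C_n$ ($n\ge 0$) together with the inclusions $A'\cap C_n\subset A'\cap C_{n+1}$ and $C'\cap C_n\subset C'\cap C_{n+1}$. The paragroups of $A\subset C$ and $B\subset D$ are isomorphic if there are $*$-isomorphisms $\theta_n:A'\cap C_n\to B'\cap D_n$ ($n\ge0$) with $\theta_{n+1}|_{A'\cap C_n}=\theta_n$ and $\theta_n(C'\cap C_n)=D'\cap D_n$. *)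

theory Defs
  imports "HOL-Analysis.Analysis" "HOL-Algebra.Module" "HOL-Algebra.Subrings"
begin

section \<open>Unital C*-algebras\<close>

text \<open>C*-algebras are records with explicit carriers, because subalgebras and an infinite
  tower of algebras occur in one statement. Complex vector spaces are modules, in the sense of
  HOL-Algebra, over the following field.\<close>

definition complex_ring :: "complex ring" where
  "complex_ring = \<lparr>carrier = UNIV, mult = (*), one = 1, ring.zero = 0, add = (+)\<rparr>"

text \<open>The distance of a norm, cut off outside the carrier since the locale
  \<^locale>\<open>Metric_space\<close> asks for symmetry and nonnegativity on the whole type.\<close>

definition ndist :: "('a, 'm) ring_scheme \<Rightarrow> ('a \<Rightarrow> real) \<Rightarrow> 'a \<Rightarrow> 'a \<Rightarrow> real" where
  "ndist M N x y = (if x \<in> carrier M \<and> y \<in> carrier M then N (x \<ominus>\<^bsub>M\<^esub> y) else 0)"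

abbreviation ntopology :: "('a, 'm) ring_scheme \<Rightarrow> ('a \<Rightarrow> real) \<Rightarrow> 'a topology" where
  "ntopology M N \<equiv> Metric_space.mtopology (carrier M) (ndist M N)"

abbreviation ncomplete :: "('a, 'm) ring_scheme \<Rightarrow> ('a \<Rightarrow> real) \<Rightarrow> bool" where
  "ncomplete M N \<equiv> Metric_space.mcomplete (carrier M) (ndist M N)"

definition complex_span :: "(complex, 'a, 'm) module_scheme \<Rightarrow> 'a set \<Rightarrow> 'a set" where
  "complex_span M S = \<Inter>{H. submodule H complex_ring M \<and> S \<subseteq> H}"

record 'a cstar = "(complex, 'a) module" +
  star :: "'a \<Rightarrow> 'a"
  nrm :: "'a \<Rightarrow> real"

locale unital_cstar_algebra = ring M for M :: "('a, 'm) cstar_scheme" (structure) +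
  assumes complex_module: "module complex_ring M"
    and smult_mult_left: "\<lbrakk>x \<in> carrier M; y \<in> carrier M\<rbrakk> \<Longrightarrow> (z \<odot> x) \<otimes> y = z \<odot> (x \<otimes> y)"
    and smult_mult_right: "\<lbrakk>x \<in> carrier M; y \<in> carrier M\<rbrakk> \<Longrightarrow> x \<otimes> (z \<odot> y) = z \<odot> (x \<otimes> y)"
    and star_closed: "x \<in> carrier M \<Longrightarrow> star M x \<in> carrier M"
    and star_star: "x \<in> carrier M \<Longrightarrow> star M (star M x) = x"
    and star_add: "\<lbrakk>x \<in> carrier M; y \<in> carrier M\<rbrakk> \<Longrightarrow> star M (x \<oplus> y) = star M x \<oplus> star M y"
    and star_smult: "x \<in> carrier M \<Longrightarrow> star M (z \<odot> x) = cnj z \<odot> star M x"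
    and star_mult: "\<lbrakk>x \<in> carrier M; y \<in> carrier M\<rbrakk> \<Longrightarrow> star M (x \<otimes> y) = star M y \<otimes> star M x"
    and nrm_nonneg: "x \<in> carrier M \<Longrightarrow> nrm M x \<ge> 0"
    and nrm_eq_0_iff: "x \<in> carrier M \<Longrightarrow> nrm M x = 0 \<longleftrightarrow> x = \<zero>"
    and nrm_triangle: "\<lbrakk>x \<in> carrier M; y \<in> carrier M\<rbrakk> \<Longrightarrow> nrm M (x \<oplus> y) \<le> nrm M x + nrm M y"
    and nrm_smult: "x \<in> carrier M \<Longrightarrow> nrm M (z \<odot> x) = cmod z * nrm M x"
    and nrm_mult: "\<lbrakk>x \<in> carrier M; y \<in> carrier M\<rbrakk> \<Longrightarrow> nrm M (x \<otimes> y) \<le> nrm M x * nrm M y"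
    and cstar_identity: "x \<in> carrier M \<Longrightarrow> nrm M (star M x \<otimes> x) = (nrm M x)\<^sup>2"
    and complete: "ncomplete M (nrm M)"

definition cstar_positive :: "('a, 'm) cstar_scheme \<Rightarrow> 'a \<Rightarrow> bool" where
  "cstar_positive M x \<longleftrightarrow> (\<exists>z\<in>carrier M. x = star M z \<otimes>\<^bsub>M\<^esub> z)"

definition cstar_closure :: "('a, 'm) cstar_scheme \<Rightarrow> 'a set \<Rightarrow> 'a set" where
  "cstar_closure M S = ntopology M (nrm M) closure_of S"

text \<open>The locale \<^locale>\<open>subring\<close> includes that the unit of \<open>C\<close> lies in \<open>A\<close>.\<close>

definition unital_inclusion :: "'a set \<Rightarrow> ('a, 'm) cstar_scheme \<Rightarrow> bool" where
  "unital_inclusion A C \<longleftrightarrow>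
     unital_cstar_algebra C \<and> subring A C \<and> submodule A complex_ring C \<and>
     (\<forall>a\<in>A. star C a \<in> A) \<and> closedin (ntopology C (nrm C)) A"

text \<open>A *-isomorphism between the *-subalgebras \<open>U\<close> of \<open>M\<close> and \<open>V\<close> of \<open>N\<close>.\<close>

definition star_iso ::
  "('a, 'm) cstar_scheme \<Rightarrow> ('b, 'n) cstar_scheme \<Rightarrow> 'a set \<Rightarrow> 'b set \<Rightarrow> ('a \<Rightarrow> 'b) \<Rightarrow> bool" where
  "star_iso M N U V f \<longleftrightarrow> bij_betw f U V \<and>
     (\<forall>x\<in>U. \<forall>y\<in>U. f (x \<oplus>\<^bsub>M\<^esub> y) = f x \<oplus>\<^bsub>N\<^esub> f y) \<and>
     (\<forall>x\<in>U. \<forall>y\<in>U. f (x \<otimes>\<^bsub>M\<^esub> y) = f x \<otimes>\<^bsub>N\<^esub> f y) \<and>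
     (\<forall>z. \<forall>x\<in>U. f (z \<odot>\<^bsub>M\<^esub> x) = z \<odot>\<^bsub>N\<^esub> f x) \<and>
     (\<forall>x\<in>U. f (star M x) = star N (f x))"

section \<open>Equivalence bimodules and strong Morita equivalence of inclusions\<close>

text \<open>The fields for multiplication and unit that are inherited from the record of rings are not
  used.\<close>

record ('c, 'd, 'y) bimodule = "(complex, 'y) module" +
  lact :: "'c \<Rightarrow> 'y \<Rightarrow> 'y"
  ract :: "'y \<Rightarrow> 'd \<Rightarrow> 'y"
  linner :: "'y \<Rightarrow> 'y \<Rightarrow> 'c"
  rinner :: "'y \<Rightarrow> 'y \<Rightarrow> 'd"

definition left_norm :: "('c, 'm) cstar_scheme \<Rightarrow> ('c, 'd, 'y, 'k) bimodule_scheme \<Rightarrow> 'y \<Rightarrow> real" where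
  "left_norm C Y x = sqrt (nrm C (linner Y x x))"

definition right_norm :: "('d, 'm) cstar_scheme \<Rightarrow> ('c, 'd, 'y, 'k) bimodule_scheme \<Rightarrow> 'y \<Rightarrow> real" where
  "right_norm D Y x = sqrt (nrm D (rinner Y x x))"

locale equivalence_bimodule =
  C: unital_cstar_algebra C + D: unital_cstar_algebra D
  for C :: "('c, 'm) cstar_scheme" and D :: "('d, 'n) cstar_scheme"
    and Y :: "('c, 'd, 'y, 'k) bimodule_scheme" +
  assumes complex_module: "module complex_ring Y"
    \<comment> \<open>bimodule structure\<close>
    and lact_closed: "\<lbrakk>c \<in> carrier C; x \<in> carrier Y\<rbrakk> \<Longrightarrow> lact Y c x \<in> carrier Y"
    and ract_closed: "\<lbrakk>x \<in> carrier Y; d \<in> carrier D\<rbrakk> \<Longrightarrow> ract Y x d \<in> carrier Y"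
    and lact_add_left: "\<lbrakk>c \<in> carrier C; c' \<in> carrier C; x \<in> carrier Y\<rbrakk> \<Longrightarrow>
      lact Y (c \<oplus>\<^bsub>C\<^esub> c') x = lact Y c x \<oplus>\<^bsub>Y\<^esub> lact Y c' x"
    and lact_add_right: "\<lbrakk>c \<in> carrier C; x \<in> carrier Y; y \<in> carrier Y\<rbrakk> \<Longrightarrow>
      lact Y c (x \<oplus>\<^bsub>Y\<^esub> y) = lact Y c x \<oplus>\<^bsub>Y\<^esub> lact Y c y"
    and lact_mult: "\<lbrakk>c \<in> carrier C; c' \<in> carrier C; x \<in> carrier Y\<rbrakk> \<Longrightarrow>
      lact Y (c \<otimes>\<^bsub>C\<^esub> c') x = lact Y c (lact Y c' x)"
    and lact_smult_left: "\<lbrakk>c \<in> carrier C; x \<in> carrier Y\<rbrakk> \<Longrightarrow>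
      lact Y (z \<odot>\<^bsub>C\<^esub> c) x = z \<odot>\<^bsub>Y\<^esub> lact Y c x"
    and lact_smult_right: "\<lbrakk>c \<in> carrier C; x \<in> carrier Y\<rbrakk> \<Longrightarrow>
      lact Y c (z \<odot>\<^bsub>Y\<^esub> x) = z \<odot>\<^bsub>Y\<^esub> lact Y c x"
    and ract_add_left: "\<lbrakk>x \<in> carrier Y; y \<in> carrier Y; d \<in> carrier D\<rbrakk> \<Longrightarrow>
      ract Y (x \<oplus>\<^bsub>Y\<^esub> y) d = ract Y x d \<oplus>\<^bsub>Y\<^esub> ract Y y d"
    and ract_add_right: "\<lbrakk>x \<in> carrier Y; d \<in> carrier D; d' \<in> carrier D\<rbrakk> \<Longrightarrow>
      ract Y x (d \<oplus>\<^bsub>D\<^esub> d') = ract Y x d \<oplus>\<^bsub>Y\<^esub> ract Y x d'"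
    and ract_mult: "\<lbrakk>x \<in> carrier Y; d \<in> carrier D; d' \<in> carrier D\<rbrakk> \<Longrightarrow>
      ract Y x (d \<otimes>\<^bsub>D\<^esub> d') = ract Y (ract Y x d) d'"
    and ract_smult_left: "\<lbrakk>x \<in> carrier Y; d \<in> carrier D\<rbrakk> \<Longrightarrow>
      ract Y (z \<odot>\<^bsub>Y\<^esub> x) d = z \<odot>\<^bsub>Y\<^esub> ract Y x d"
    and ract_smult_right: "\<lbrakk>x \<in> carrier Y; d \<in> carrier D\<rbrakk> \<Longrightarrow>
      ract Y x (z \<odot>\<^bsub>D\<^esub> d) = z \<odot>\<^bsub>Y\<^esub> ract Y x d"
    and lact_ract: "\<lbrakk>c \<in> carrier C; x \<in> carrier Y; d \<in> carrier D\<rbrakk> \<Longrightarrow>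
      ract Y (lact Y c x) d = lact Y c (ract Y x d)"
    \<comment> \<open>full left Hilbert \<open>C\<close>-module\<close>
    and linner_closed: "\<lbrakk>x \<in> carrier Y; y \<in> carrier Y\<rbrakk> \<Longrightarrow> linner Y x y \<in> carrier C"
    and linner_add: "\<lbrakk>x \<in> carrier Y; x' \<in> carrier Y; y \<in> carrier Y\<rbrakk> \<Longrightarrow>
      linner Y (x \<oplus>\<^bsub>Y\<^esub> x') y = linner Y x y \<oplus>\<^bsub>C\<^esub> linner Y x' y"
    and linner_smult: "\<lbrakk>x \<in> carrier Y; y \<in> carrier Y\<rbrakk> \<Longrightarrow>
      linner Y (z \<odot>\<^bsub>Y\<^esub> x) y = z \<odot>\<^bsub>C\<^esub> linner Y x y"
    and linner_lact: "\<lbrakk>c \<in> carrier C; x \<in> carrier Y; y \<in> carrier Y\<rbrakk> \<Longrightarrow>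
      linner Y (lact Y c x) y = c \<otimes>\<^bsub>C\<^esub> linner Y x y"
    and linner_star: "\<lbrakk>x \<in> carrier Y; y \<in> carrier Y\<rbrakk> \<Longrightarrow>
      star C (linner Y x y) = linner Y y x"
    and linner_positive: "x \<in> carrier Y \<Longrightarrow> cstar_positive C (linner Y x x)"
    and linner_definite: "\<lbrakk>x \<in> carrier Y; linner Y x x = \<zero>\<^bsub>C\<^esub>\<rbrakk> \<Longrightarrow> x = \<zero>\<^bsub>Y\<^esub>"
    and left_complete: "ncomplete Y (left_norm C Y)"
    and left_full: "cstar_closure C
      (complex_span C {linner Y x y | x y. x \<in> carrier Y \<and> y \<in> carrier Y}) = carrier C"
    \<comment> \<open>full right Hilbert \<open>D\<close>-module\<close>
    and rinner_closed: "\<lbrakk>x \<in> carrier Y; y \<in> carrier Y\<rbrakk> \<Longrightarrow> rinner Y x y \<in> carrier D"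
    and rinner_add: "\<lbrakk>x \<in> carrier Y; y \<in> carrier Y; y' \<in> carrier Y\<rbrakk> \<Longrightarrow>
      rinner Y x (y \<oplus>\<^bsub>Y\<^esub> y') = rinner Y x y \<oplus>\<^bsub>D\<^esub> rinner Y x y'"
    and rinner_smult: "\<lbrakk>x \<in> carrier Y; y \<in> carrier Y\<rbrakk> \<Longrightarrow>
      rinner Y x (z \<odot>\<^bsub>Y\<^esub> y) = z \<odot>\<^bsub>D\<^esub> rinner Y x y"
    and rinner_ract: "\<lbrakk>x \<in> carrier Y; y \<in> carrier Y; d \<in> carrier D\<rbrakk> \<Longrightarrow>
      rinner Y x (ract Y y d) = rinner Y x y \<otimes>\<^bsub>D\<^esub> d"
    and rinner_star: "\<lbrakk>x \<in> carrier Y; y \<in> carrier Y\<rbrakk> \<Longrightarrow>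
      star D (rinner Y x y) = rinner Y y x"
    and rinner_positive: "x \<in> carrier Y \<Longrightarrow> cstar_positive D (rinner Y x x)"
    and rinner_definite: "\<lbrakk>x \<in> carrier Y; rinner Y x x = \<zero>\<^bsub>D\<^esub>\<rbrakk> \<Longrightarrow> x = \<zero>\<^bsub>Y\<^esub>"
    and right_complete: "ncomplete Y (right_norm D Y)"
    and right_full: "cstar_closure D
      (complex_span D {rinner Y x y | x y. x \<in> carrier Y \<and> y \<in> carrier Y}) = carrier D"
    \<comment> \<open>compatibility\<close>
    and rinner_lact: "\<lbrakk>c \<in> carrier C; x \<in> carrier Y; y \<in> carrier Y\<rbrakk> \<Longrightarrow>
      rinner Y (lact Y c x) y = rinner Y x (lact Y (star C c) y)"
    and linner_ract: "\<lbrakk>x \<in> carrier Y; y \<in> carrier Y; d \<in> carrier D\<rbrakk> \<Longrightarrow>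
      linner Y (ract Y x d) y = linner Y x (ract Y y (star D d))"
    and imprimitivity: "\<lbrakk>x \<in> carrier Y; y \<in> carrier Y; w \<in> carrier Y\<rbrakk> \<Longrightarrow>
      lact Y (linner Y x y) w = ract Y x (rinner Y y w)"

text \<open>The two norms of an equivalence bimodule coincide, so closedness of \<open>V\<close> does not depend on
  which of them is used.\<close>

definition strongly_Morita_equivalent_via ::
  "'c set \<Rightarrow> ('c, 'm) cstar_scheme \<Rightarrow> 'd set \<Rightarrow> ('d, 'n) cstar_scheme \<Rightarrow>
   ('c, 'd, 'y, 'k) bimodule_scheme \<Rightarrow> 'y set \<Rightarrow> bool" where
  "strongly_Morita_equivalent_via A C B D Y V \<longleftrightarrow>
     equivalence_bimodule C D Y \<and>
     submodule V complex_ring Y \<and> closedin (ntopology Y (right_norm D Y)) V \<and>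
     (\<forall>a\<in>A. \<forall>x\<in>V. lact Y a x \<in> V) \<and>
     (\<forall>x\<in>V. \<forall>y\<in>V. linner Y x y \<in> A) \<and>
     cstar_closure C (complex_span C {linner Y x y | x y. x \<in> V \<and> y \<in> V}) = A \<and>
     cstar_closure C (complex_span C {linner Y y x | x y. y \<in> carrier Y \<and> x \<in> V}) = carrier C \<and>
     (\<forall>b\<in>B. \<forall>x\<in>V. ract Y x b \<in> V) \<and>
     (\<forall>x\<in>V. \<forall>y\<in>V. rinner Y x y \<in> B) \<and>
     cstar_closure D (complex_span D {rinner Y x y | x y. x \<in> V \<and> y \<in> V}) = B \<and>
     cstar_closure D (complex_span D {rinner Y y x | x y. y \<in> carrier Y \<and> x \<in> V}) = carrier D"

section \<open>Conditional expectations of Watatani index-finite type\<close>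

definition conditional_expectation ::
  "('c, 'm) cstar_scheme \<Rightarrow> 'c set \<Rightarrow> ('c \<Rightarrow> 'c) \<Rightarrow> bool" where
  "conditional_expectation C A E \<longleftrightarrow>
     unital_inclusion A C \<and>
     E \<in> carrier C \<rightarrow> A \<and> (\<forall>a\<in>A. E a = a) \<and>
     (\<forall>x\<in>carrier C. \<forall>y\<in>carrier C. E (x \<oplus>\<^bsub>C\<^esub> y) = E x \<oplus>\<^bsub>C\<^esub> E y) \<and>
     (\<forall>z. \<forall>x\<in>carrier C. E (z \<odot>\<^bsub>C\<^esub> x) = z \<odot>\<^bsub>C\<^esub> E x) \<and>
     (\<forall>a\<in>A. \<forall>x\<in>carrier C. \<forall>b\<in>A. E (a \<otimes>\<^bsub>C\<^esub> x \<otimes>\<^bsub>C\<^esub> b) = a \<otimes>\<^bsub>C\<^esub> E x \<otimes>\<^bsub>C\<^esub> b) \<and>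
     (\<forall>x. cstar_positive C x \<longrightarrow> cstar_positive (C\<lparr>carrier := A\<rparr>) (E x))"

definition quasi_basis ::
  "('c, 'm) cstar_scheme \<Rightarrow> ('c \<Rightarrow> 'c) \<Rightarrow> nat \<Rightarrow> (nat \<Rightarrow> 'c) \<Rightarrow> bool" where
  "quasi_basis C E k u \<longleftrightarrow> u \<in> {..<k} \<rightarrow> carrier C \<and>
     (\<forall>c\<in>carrier C.
        (\<Oplus>\<^bsub>C\<^esub>i\<in>{..<k}. u i \<otimes>\<^bsub>C\<^esub> E (star C (u i) \<otimes>\<^bsub>C\<^esub> c)) = c \<and>
        (\<Oplus>\<^bsub>C\<^esub>i\<in>{..<k}. E (c \<otimes>\<^bsub>C\<^esub> u i) \<otimes>\<^bsub>C\<^esub> star C (u i)) = c)"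

definition index_finite_expectation ::
  "('c, 'm) cstar_scheme \<Rightarrow> 'c set \<Rightarrow> ('c \<Rightarrow> 'c) \<Rightarrow> bool" where
  "index_finite_expectation C A E \<longleftrightarrow>
     conditional_expectation C A E \<and> (\<exists>k u. quasi_basis C E k u)"

text \<open>The index does not depend on the quasi-basis.\<close>

definition watatani_index :: "('c, 'm) cstar_scheme \<Rightarrow> ('c \<Rightarrow> 'c) \<Rightarrow> 'c" where
  "watatani_index C E = (THE w. \<exists>k u. quasi_basis C E k u \<and>
     w = (\<Oplus>\<^bsub>C\<^esub>i\<in>{..<k}. u i \<otimes>\<^bsub>C\<^esub> star C (u i)))"

section \<open>The basic construction and the tower\<close>

text \<open>The algebra \<open>C\<close> is a right Hilbert \<open>A\<close>-module with inner product \<open>E (star C x \<otimes> y)\<close>.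
  The operators are extensional functions, so that equality is equality on \<open>C\<close>.\<close>

definition adjoint_pair ::
  "('c, 'm) cstar_scheme \<Rightarrow> ('c \<Rightarrow> 'c) \<Rightarrow> ('c \<Rightarrow> 'c) \<Rightarrow> ('c \<Rightarrow> 'c) \<Rightarrow> bool" where
  "adjoint_pair C E t s \<longleftrightarrow> (\<forall>x\<in>carrier C. \<forall>y\<in>carrier C.
     E (star C (t x) \<otimes>\<^bsub>C\<^esub> y) = E (star C x \<otimes>\<^bsub>C\<^esub> s y))"

definition adjointable_operators ::
  "('c, 'm) cstar_scheme \<Rightarrow> 'c set \<Rightarrow> ('c \<Rightarrow> 'c) \<Rightarrow> ('c \<Rightarrow> 'c) set" where
  "adjointable_operators C A E = {t \<in> carrier C \<rightarrow>\<^sub>E carrier C.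
     (\<forall>x\<in>carrier C. \<forall>y\<in>carrier C. t (x \<oplus>\<^bsub>C\<^esub> y) = t x \<oplus>\<^bsub>C\<^esub> t y) \<and>
     (\<forall>z. \<forall>x\<in>carrier C. t (z \<odot>\<^bsub>C\<^esub> x) = z \<odot>\<^bsub>C\<^esub> t x) \<and>
     (\<forall>x\<in>carrier C. \<forall>a\<in>A. t (x \<otimes>\<^bsub>C\<^esub> a) = t x \<otimes>\<^bsub>C\<^esub> a) \<and>
     (\<exists>s\<in>carrier C \<rightarrow> carrier C. adjoint_pair C E t s)}"

text \<open>\<open>C1\<close> with the embedding \<open>\<iota>\<close> of \<open>C\<close> and the Jones projection \<open>e\<close> is a basic construction of
  \<open>E\<close> if it is spanned by the elements \<open>c\<^sub>1 e c\<^sub>2\<close> and there is a *-isomorphism \<open>p\<close> onto the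
  adjointable operators under which \<open>\<iota> c\<close> acts by left multiplication and \<open>e\<close> acts as \<open>E\<close>.
  (A *-isomorphism of C*-algebras is isometric, so nothing is said about norms.)\<close>

definition basic_construction ::
  "('c, 'm) cstar_scheme \<Rightarrow> 'c set \<Rightarrow> ('c \<Rightarrow> 'c) \<Rightarrow> ('t, 'n) cstar_scheme \<Rightarrow> ('c \<Rightarrow> 't) \<Rightarrow> 't \<Rightarrow> bool" where
  "basic_construction C A E C1 \<iota> e \<longleftrightarrow>
     unital_cstar_algebra C1 \<and> \<iota> \<in> carrier C \<rightarrow> carrier C1 \<and> e \<in> carrier C1 \<and>
     complex_span C1 {\<iota> c \<otimes>\<^bsub>C1\<^esub> e \<otimes>\<^bsub>C1\<^esub> \<iota> c' | c c'. c \<in> carrier C \<and> c' \<in> carrier C} = carrier C1 \<and>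
     (\<exists>p. bij_betw p (carrier C1) (adjointable_operators C A E) \<and>
        (\<forall>s\<in>carrier C1. \<forall>t\<in>carrier C1. \<forall>x\<in>carrier C. p (s \<oplus>\<^bsub>C1\<^esub> t) x = p s x \<oplus>\<^bsub>C\<^esub> p t x) \<and>
        (\<forall>s\<in>carrier C1. \<forall>t\<in>carrier C1. \<forall>x\<in>carrier C. p (s \<otimes>\<^bsub>C1\<^esub> t) x = p s (p t x)) \<and>
        (\<forall>z. \<forall>t\<in>carrier C1. \<forall>x\<in>carrier C. p (z \<odot>\<^bsub>C1\<^esub> t) x = z \<odot>\<^bsub>C\<^esub> p t x) \<and>
        (\<forall>t\<in>carrier C1. adjoint_pair C E (p t) (p (star C1 t))) \<and>
        (\<forall>c\<in>carrier C. \<forall>x\<in>carrier C. p (\<iota> c) x = c \<otimes>\<^bsub>C\<^esub> x) \<and>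
        (\<forall>x\<in>carrier C. p e x = E x))"

text \<open>A tower has all its algebras in one type, connected by embeddings \<open>incl n\<close> of \<open>alg n\<close> into
  \<open>alg (Suc n)\<close> instead of set inclusions. Stage 0 is a copy of \<open>C\<close>, identified with \<open>C\<close> by
  \<open>base\<close>. The expectation \<open>expec 0\<close> maps onto the copy of \<open>A\<close>, and \<open>expec (Suc n)\<close> maps
  \<open>alg (Suc n)\<close> onto the copy of \<open>alg n\<close> in it.\<close>

record ('c, 't) tower =
  alg :: "nat \<Rightarrow> 't cstar"
  base :: "'c \<Rightarrow> 't"
  incl :: "nat \<Rightarrow> 't \<Rightarrow> 't"
  jones :: "nat \<Rightarrow> 't"
  expec :: "nat \<Rightarrow> 't \<Rightarrow> 't"

definition tower_sub :: "('c, 't) tower \<Rightarrow> 'c set \<Rightarrow> nat \<Rightarrow> 't set" where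
  "tower_sub T A n = (case n of 0 \<Rightarrow> base T ` A | Suc m \<Rightarrow> incl T m ` carrier (alg T m))"

definition jones_tower :: "'c set \<Rightarrow> ('c, 'm) cstar_scheme \<Rightarrow> ('c, 't) tower \<Rightarrow> bool" where
  "jones_tower A C T \<longleftrightarrow>
     star_iso C (alg T 0) (carrier C) (carrier (alg T 0)) (base T) \<and>
     (\<forall>n. index_finite_expectation (alg T n) (tower_sub T A n) (expec T n)) \<and>
     (\<forall>n. basic_construction (alg T n) (tower_sub T A n) (expec T n)
            (alg T (Suc n)) (incl T n) (jones T n)) \<and>
     (\<forall>n. \<forall>c\<in>carrier (alg T n). \<forall>c'\<in>carrier (alg T n).
        expec T (Suc n)
          (incl T n c \<otimes>\<^bsub>alg T (Suc n)\<^esub> jones T n \<otimes>\<^bsub>alg T (Suc n)\<^esub> incl T n c') =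
        incl T n (inv\<^bsub>alg T n\<^esub> (watatani_index (alg T n) (expec T n))
          \<otimes>\<^bsub>alg T n\<^esub> c \<otimes>\<^bsub>alg T n\<^esub> c'))"

section \<open>Paragroups\<close>

primrec tower_emb :: "('c, 't) tower \<Rightarrow> nat \<Rightarrow> 'c \<Rightarrow> 't" where
  "tower_emb T 0 c = base T c"
| "tower_emb T (Suc n) c = incl T n (tower_emb T n c)"

text \<open>\<open>S' \<inter> C\<^sub>n\<close> for a subset \<open>S\<close> of \<open>C\<close>\<close>

definition relative_commutant :: "('c, 't) tower \<Rightarrow> 'c set \<Rightarrow> nat \<Rightarrow> 't set" where
  "relative_commutant T S n = {x \<in> carrier (alg T n).
     \<forall>s\<in>S. tower_emb T n s \<otimes>\<^bsub>alg T n\<^esub> x = x \<otimes>\<^bsub>alg T n\<^esub> tower_emb T n s}"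

definition isomorphic_paragroups ::
  "'c set \<Rightarrow> ('c, 'm) cstar_scheme \<Rightarrow> ('c, 's) tower \<Rightarrow>
   'd set \<Rightarrow> ('d, 'n) cstar_scheme \<Rightarrow> ('d, 't) tower \<Rightarrow> bool" where
  "isomorphic_paragroups A C S B D T \<longleftrightarrow>
     (\<exists>\<theta>. \<forall>n.
        star_iso (alg S n) (alg T n) (relative_commutant S A n) (relative_commutant T B n) (\<theta> n) \<and>
        (\<forall>x\<in>relative_commutant S A n. \<theta> (Suc n) (incl S n x) = incl T n (\<theta> n x)) \<and>
        \<theta> n ` relative_commutant S (carrier C) n = relative_commutant T (carrier D) n)"

end

theory Submission
  imports Defs
begin

text \<open>Strongly Morita equivalent inclusions are complementary full corners of one and the same
  inclusion, and paragroups do not change under passage to a full corner.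

  Let \<open>V \<subseteq> Y\<close> implement the equivalence of \<open>A \<subseteq> C\<close> and \<open>B \<subseteq> D\<close>. The inner products of \<open>V\<close> span
  dense subspaces of the unital algebras \<open>A\<close> and \<open>B\<close>, so there are finite families in \<open>V\<close> whose left,
  respectively right, inner squares sum up to the unit (\<open>unit_frame\<close>). Let \<open>L\<close> be the algebra of
  adjointable operators on the Hilbert \<open>D\<close>-module \<open>Y \<oplus> D\<close>, the linking algebra of \<open>Y\<close>; then \<open>C\<close> and \<open>D\<close>
  are its diagonal corners. The operators with all matrix coefficients against the second family in
  \<open>A\<close> form a subalgebra \<open>L0\<close>, and \<open>A \<subseteq> C\<close> and \<open>B \<subseteq> D\<close> are full corners of \<open>L0 \<subseteq> L\<close>
  (\<open>linking_corner\<close>, \<open>opposite_corner\<close>). An expectation of \<open>C\<close> onto \<open>A\<close> acts on the coefficients and gives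
  one of \<open>L\<close> onto \<open>L0\<close> (\<open>F_index_finite\<close>), which in turn restricts to one of \<open>D\<close> onto \<open>B\<close>
  (\<open>corner_index_finite\<close>).

  Now let \<open>q \<in> L0\<close> be a projection and \<open>a i \<in> L0\<close> with \<open>\<Sum> a i q (a i)* = 1\<close>, and let \<open>A \<subseteq> C\<close> be the
  corner \<open>q L0 q \<subseteq> q L q\<close>. Compressing words \<open>x e y\<close> by \<open>q\<close> shows that the basic construction of \<open>C\<close> is
  the corner of the basic construction \<open>L1\<close> of \<open>L\<close>. The two basic constructions may come from
  unrelated expectations; but any two expectations are related by \<open>E' x = E (\<kappa>* x \<kappa>)\<close> with an
  invertible \<open>\<kappa>\<close> commuting with \<open>A\<close> (\<open>compare_expectations\<close>), and \<open>c e d \<mapsto> c \<kappa> e \<kappa>* d\<close> absorbs the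
  difference (\<open>corner_step\<close>). The new corner \<open>C \<subseteq> C1\<close> of \<open>L \<subseteq> L1\<close> has the same \<open>q\<close> and \<open>a i\<close>, so the
  step can be iterated along the towers (\<open>corner_tower\<close>). At each stage multiplication by \<open>q\<close>
  identifies the relative commutants of \<open>L0\<close> and \<open>L\<close> with those of \<open>A\<close> and \<open>C\<close>; the inverse is
  \<open>c \<mapsto> \<Sum> a i c (a i)*\<close> (\<open>commutant_iso\<close>).

  Everything rests on the order structure of C*-algebras, namely on square roots of positive
  elements and on the fact that \<open>z* z\<close> has nonnegative spectrum (\<open>star_mult_npos\<close>), and on the fact
  that the adjointable operators on a Hilbert module with a finite frame form a C*-algebra
  (\<open>opalg_cstar\<close>). The latter provides both the linking algebra and the basic constructions.\<close>

section \<open>Normed modules as metric spaces\<close>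

lemma cring_complex_ring: "cring complex_ring"
  by (rule cringI, rule abelian_groupI)
    (auto simp: complex_ring_def comm_monoid_def comm_monoid_axioms_def monoid_def algebra_simps
      intro: exI[of _ "- x" for x])

lemma (in abelian_group) diff_eq_zero_iff:
  assumes "x \<in> carrier G" "y \<in> carrier G" shows "x \<ominus> y = \<zero> \<longleftrightarrow> x = y"
  by (metis (no_types, lifting) assms a_inv_closed a_minus_def minus_minus minus_equality r_neg)

lemma (in abelian_group) Metric_space_ndist:
  assumes "\<And>x. x \<in> carrier G \<Longrightarrow> 0 \<le> N x"
    and "\<And>x. x \<in> carrier G \<Longrightarrow> N x = 0 \<longleftrightarrow> x = \<zero>"
    and "\<And>x. x \<in> carrier G \<Longrightarrow> N (\<ominus> x) = N x"
    and "\<And>x y. \<lbrakk>x \<in> carrier G; y \<in> carrier G\<rbrakk> \<Longrightarrow> N (x \<oplus> y) \<le> N x + N y"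
  shows "Metric_space (carrier G) (ndist G N)"
proof
  fix x y show "0 \<le> ndist G N x y" using assms(1) by (simp add: ndist_def)
next
  fix x y
  have "N (x \<ominus> y) = N (y \<ominus> x)" if "x \<in> carrier G" "y \<in> carrier G"
    using assms(3)[of "x \<ominus> y"] that by (simp add: minus_eq minus_add a_comm)
  then show "ndist G N x y = ndist G N y x" by (simp add: ndist_def)
next
  fix x y assume "x \<in> carrier G" "y \<in> carrier G"
  then show "ndist G N x y = 0 \<longleftrightarrow> x = y"
    using assms(2)[of "x \<ominus> y"] diff_eq_zero_iff by (simp add: ndist_def)
next
  fix x y z assume xyz: "x \<in> carrier G" "y \<in> carrier G" "z \<in> carrier G"
  have "x \<ominus> z = (x \<ominus> y) \<oplus> (y \<ominus> z)"
    using xyz by (simp add: minus_eq a_assoc r_neg1)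
  then show "ndist G N x z \<le> ndist G N x y + ndist G N y z"
    using assms(4)[of "x \<ominus> y" "y \<ominus> z"] xyz by (simp add: ndist_def)
qed

text \<open>Limits and completeness are used in this sequential form throughout, so that no further reference
  to metric spaces is needed.\<close>

lemma ncomplete_iff:
  assumes "Metric_space (carrier M) (ndist M N)"
  shows "ncomplete M N \<longleftrightarrow> (\<forall>f. (\<forall>n. f n \<in> carrier M) \<and>
      (\<forall>e>0. \<exists>K. \<forall>m\<ge>K. \<forall>n\<ge>K. N (f m \<ominus>\<^bsub>M\<^esub> f n) < e) \<longrightarrow>
      (\<exists>l\<in>carrier M. (\<lambda>n. N (f n \<ominus>\<^bsub>M\<^esub> l)) \<longlonglongrightarrow> 0))" (is "_ \<longleftrightarrow> (\<forall>f. ?cau f \<longrightarrow> ?con f)")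
proof -
  interpret Metric_space "carrier M" "ndist M N" by fact
  have 1: "MCauchy f \<longleftrightarrow> ?cau f" for f
    unfolding MCauchy_def by (auto simp: ndist_def image_subset_iff)
  have nn: "0 \<le> N (x \<ominus>\<^bsub>M\<^esub> y)" if "x \<in> carrier M" "y \<in> carrier M" for x y
    using nonneg[of x y] that by (simp add: ndist_def)
  have 2: "(\<exists>l. limitin mtopology f l sequentially) \<longleftrightarrow> ?con f" if "\<forall>n. f n \<in> carrier M" for f
    using that nn unfolding limit_metric_sequentially by (auto simp: ndist_def LIMSEQ_iff Bex_def)
  show ?thesis unfolding mcomplete_def 1 using 2 by auto
qed

section \<open>Positive elements of a unital C*-algebra\<close>

context unital_cstar_algebra
begin

lemma smult_cl [simp]: "x \<in> carrier M \<Longrightarrow> z \<odot> x \<in> carrier M"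
  using module.smult_closed[OF complex_module] by (simp add: complex_ring_def)

lemma smult_addl: "x \<in> carrier M \<Longrightarrow> (z + w) \<odot> x = z \<odot> x \<oplus> w \<odot> x"
  using module.smult_l_distr[OF complex_module] by (simp add: complex_ring_def)

lemma smult_addr: "\<lbrakk>x \<in> carrier M; y \<in> carrier M\<rbrakk> \<Longrightarrow> z \<odot> (x \<oplus> y) = z \<odot> x \<oplus> z \<odot> y"
  using module.smult_r_distr[OF complex_module] by (simp add: complex_ring_def)

lemma smult_smult [simp]: "x \<in> carrier M \<Longrightarrow> z \<odot> (w \<odot> x) = (z * w) \<odot> x"
  using module.smult_assoc1[OF complex_module] by (simp add: complex_ring_def)

lemma smult_one [simp]: "x \<in> carrier M \<Longrightarrow> 1 \<odot> x = x"
  using module.smult_one[OF complex_module] by (simp add: complex_ring_def)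

lemma smult_zl [simp]: "x \<in> carrier M \<Longrightarrow> 0 \<odot> x = \<zero>"
  using module.smult_l_null[OF complex_module] by (simp add: complex_ring_def)

lemma smult_zr [simp]: "z \<odot> \<zero> = \<zero>"
  using module.smult_r_null[OF complex_module] by (simp add: complex_ring_def)

lemma smult_neg: "x \<in> carrier M \<Longrightarrow> (- z) \<odot> x = \<ominus> (z \<odot> x)"
  using smult_addl[of x "-z" z] by (simp add: minus_equality)

lemma smult_neg_one: "x \<in> carrier M \<Longrightarrow> (- 1) \<odot> x = \<ominus> x"
  using smult_neg[of x 1] by simp

lemma smult_a_inv: "x \<in> carrier M \<Longrightarrow> z \<odot> (\<ominus> x) = \<ominus> (z \<odot> x)"
  by (metis mult.commute mult_minus_left mult_1 smult_cl smult_neg smult_neg_one smult_smult)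

lemma double_add: "x \<in> carrier M \<Longrightarrow> x \<oplus> x = 2 \<odot> x"
  using smult_addl[of x 1 1] by simp

lemmas [simp] = star_closed star_star

lemma star_zero [simp]: "star M \<zero> = \<zero>"
  using star_smult[of \<zero> 0] by simp

lemma star_minus [simp]: "x \<in> carrier M \<Longrightarrow> star M (\<ominus> x) = \<ominus> star M x"
  using star_smult[of x "-1"] by (simp add: smult_neg_one)

lemma star_diff: "\<lbrakk>x \<in> carrier M; y \<in> carrier M\<rbrakk> \<Longrightarrow> star M (x \<ominus> y) = star M x \<ominus> star M y"
  by (simp add: minus_eq star_add)

lemma star_one [simp]: "star M \<one> = \<one>"
  using star_mult[of "star M \<one>" \<one>] by simp

lemma smult_mult [simp]:
  "\<lbrakk>x \<in> carrier M; y \<in> carrier M\<rbrakk> \<Longrightarrow> (z \<odot> x) \<otimes> y = z \<odot> (x \<otimes> y)"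
  "\<lbrakk>x \<in> carrier M; y \<in> carrier M\<rbrakk> \<Longrightarrow> x \<otimes> (z \<odot> y) = z \<odot> (x \<otimes> y)"
  by (simp_all add: smult_mult_left smult_mult_right)

lemma nrm_zero [simp]: "nrm M \<zero> = 0"
  by (simp add: nrm_eq_0_iff)

lemma nrm_neg [simp]: "x \<in> carrier M \<Longrightarrow> nrm M (\<ominus> x) = nrm M x"
  using nrm_smult[of x "-1"] by (simp add: smult_neg_one)

lemma nrm_diff_comm: "\<lbrakk>x \<in> carrier M; y \<in> carrier M\<rbrakk> \<Longrightarrow> nrm M (x \<ominus> y) = nrm M (y \<ominus> x)"
  using nrm_neg[of "x \<ominus> y"] by (simp add: minus_eq minus_add a_comm)

lemma diff_split: "\<lbrakk>x \<in> carrier M; y \<in> carrier M; z \<in> carrier M\<rbrakk> \<Longrightarrow> x \<ominus> z = (x \<ominus> y) \<oplus> (y \<ominus> z)"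
  by (simp add: minus_eq a_assoc r_neg1)

lemma nrm_diff_triangle:
  "\<lbrakk>x \<in> carrier M; y \<in> carrier M; z \<in> carrier M\<rbrakk> \<Longrightarrow> nrm M (x \<ominus> z) \<le> nrm M (x \<ominus> y) + nrm M (y \<ominus> z)"
  using diff_split[of x y z] nrm_triangle[of "x \<ominus> y" "y \<ominus> z"] by simp

lemma nrm_star [simp]: assumes "x \<in> carrier M" shows "nrm M (star M x) = nrm M x"
proof -
  have le: "nrm M y \<le> nrm M (star M y)" if y: "y \<in> carrier M" for y
  proof (cases "nrm M y = 0")
    case False
    then have "nrm M y > 0" using nrm_nonneg[OF y] by simp
    moreover have "nrm M y * nrm M y \<le> nrm M (star M y) * nrm M y"
      using cstar_identity[OF y] nrm_mult[of "star M y" y] y by (simp add: power2_eq_square)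
    ultimately show ?thesis by simp
  qed (simp add: nrm_nonneg y)
  show ?thesis using le[OF assms] le[of "star M x"] assms by simp
qed

lemma nrm_sa_square: "\<lbrakk>x \<in> carrier M; star M x = x\<rbrakk> \<Longrightarrow> nrm M (x \<otimes> x) = (nrm M x)\<^sup>2"
  using cstar_identity[of x] by simp

lemma nrm_one_le: "nrm M \<one> \<le> 1"
proof -
  have "(nrm M \<one>)\<^sup>2 = nrm M \<one>" using nrm_sa_square[of \<one>] by simp
  then show ?thesis by (auto simp: power2_eq_square)
qed

definition sc :: "real \<Rightarrow> 'a" where "sc r = complex_of_real r \<odot> \<one>"

lemma sc_closed [simp]: "sc r \<in> carrier M" by (simp add: sc_def)
lemma star_sc [simp]: "star M (sc r) = sc r" by (simp add: sc_def star_smult)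
lemma sc_zero [simp]: "sc 0 = \<zero>" by (simp add: sc_def)
lemma sc_one [simp]: "sc 1 = \<one>" by (simp add: sc_def)
lemma sc_add: "sc (r + s) = sc r \<oplus> sc s" by (simp add: sc_def smult_addl)
lemma sc_minus: "sc (- r) = \<ominus> sc r" by (simp add: sc_def smult_neg)
lemma sc_diff: "sc (r - s) = sc r \<ominus> sc s" using sc_add[of r "-s"] by (simp add: sc_minus minus_eq)
lemma smult_sc [simp]: "complex_of_real r \<odot> sc s = sc (r * s)" by (simp add: sc_def)
lemma sc_mult [simp]: "x \<in> carrier M \<Longrightarrow> sc r \<otimes> x = complex_of_real r \<odot> x" by (simp add: sc_def)
lemma mult_sc [simp]: "x \<in> carrier M \<Longrightarrow> x \<otimes> sc r = complex_of_real r \<odot> x" by (simp add: sc_def)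
lemma nrm_sc: "nrm M (sc r) \<le> \<bar>r\<bar>"
  using nrm_one_le by (simp add: sc_def nrm_smult mult_left_le)

subsection \<open>Limits\<close>

lemma Metric_space: "Metric_space (carrier M) (ndist M (nrm M))"
  by (rule Metric_space_ndist) (auto simp: nrm_nonneg nrm_eq_0_iff nrm_triangle)

lemma cauchy_limit:
  assumes "\<And>n. f n \<in> carrier M"
    and "\<And>e. e > 0 \<Longrightarrow> \<exists>K. \<forall>m\<ge>K. \<forall>n\<ge>K. nrm M (f m \<ominus> f n) < e"
  obtains l where "l \<in> carrier M" "(\<lambda>n. nrm M (f n \<ominus> l)) \<longlonglongrightarrow> 0"
  using complete assms unfolding ncomplete_iff[OF Metric_space] by metis

lemma closedin_iff:
  "closedin (ntopology M (nrm M)) S \<longleftrightarrow> S \<subseteq> carrier M \<and>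
    (\<forall>f l. (\<forall>n. f n \<in> S) \<and> l \<in> carrier M \<and> (\<lambda>n. nrm M (f n \<ominus> l)) \<longlonglongrightarrow> 0 \<longrightarrow> l \<in> S)"
proof -
  interpret Metric_space "carrier M" "ndist M (nrm M)" by (rule Metric_space)
  have lim: "limitin mtopology f l sequentially \<longleftrightarrow> l \<in> carrier M \<and> (\<lambda>n. nrm M (f n \<ominus> l)) \<longlonglongrightarrow> 0"
    if "\<forall>n. f n \<in> carrier M" for f l
    using that nrm_nonneg by (auto simp: limit_metric_sequentially ndist_def LIMSEQ_iff)
  show ?thesis
  proof (cases "S \<subseteq> carrier M")
    case True
    then have "range f \<subseteq> S \<and> limitin mtopology f l sequentially \<longleftrightarrow>
        (\<forall>n. f n \<in> S) \<and> l \<in> carrier M \<and> (\<lambda>n. nrm M (f n \<ominus> l)) \<longlonglongrightarrow> 0" for f l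
      using lim[of f l] by blast
    then show ?thesis unfolding metric_closedin_iff_sequentially_closed by simp
  qed (simp add: metric_closedin_iff_sequentially_closed)
qed

lemma in_cstar_closure:
  assumes "S \<subseteq> carrier M"
  shows "x \<in> cstar_closure M S \<longleftrightarrow> x \<in> carrier M \<and> (\<forall>e>0. \<exists>y\<in>S. nrm M (x \<ominus> y) < e)"
proof -
  interpret Metric_space "carrier M" "ndist M (nrm M)" by (rule Metric_space)
  show ?thesis
    using assms unfolding cstar_closure_def metric_closure_of
    by (auto simp: ndist_def subset_iff)
qed

lemma limit_unique:
  assumes "\<And>n. f n \<in> carrier M" "l \<in> carrier M" "l' \<in> carrier M"
    and "(\<lambda>n. nrm M (f n \<ominus> l)) \<longlonglongrightarrow> 0" "(\<lambda>n. nrm M (f n \<ominus> l')) \<longlonglongrightarrow> 0"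
  shows "l = l'"
proof -
  have "nrm M (l \<ominus> l') \<le> nrm M (f n \<ominus> l) + nrm M (f n \<ominus> l')" for n
    using nrm_diff_triangle[of l "f n" l'] nrm_diff_comm[of "f n" l] assms(1-3) by simp
  moreover have "(\<lambda>n. nrm M (f n \<ominus> l) + nrm M (f n \<ominus> l')) \<longlonglongrightarrow> 0"
    using tendsto_add[OF assms(4,5)] by simp
  ultimately have "nrm M (l \<ominus> l') \<le> 0" by (intro LIMSEQ_le_const) auto
  then have "l \<ominus> l' = \<zero>" using nrm_nonneg[of "l \<ominus> l'"] nrm_eq_0_iff[of "l \<ominus> l'"] assms by simp
  then show ?thesis using assms diff_eq_zero_iff by simp
qed

lemma limit_lmult:
  assumes "\<And>n. f n \<in> carrier M" "l \<in> carrier M" "w \<in> carrier M"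
    and "(\<lambda>n. nrm M (f n \<ominus> l)) \<longlonglongrightarrow> 0"
  shows "(\<lambda>n. nrm M (w \<otimes> f n \<ominus> w \<otimes> l)) \<longlonglongrightarrow> 0"
proof (rule tendsto_sandwich[OF _ _ tendsto_const])
  show "(\<lambda>n. nrm M w * nrm M (f n \<ominus> l)) \<longlonglongrightarrow> 0" using tendsto_mult_right_zero[OF assms(4)] .
  have "nrm M (w \<otimes> f n \<ominus> w \<otimes> l) \<le> nrm M w * nrm M (f n \<ominus> l)" for n
    using nrm_mult[of w "f n \<ominus> l"] assms by (simp add: minus_eq r_distr r_minus)
  then show "\<forall>\<^sub>F n in sequentially. nrm M (w \<otimes> f n \<ominus> w \<otimes> l) \<le> nrm M w * nrm M (f n \<ominus> l)" by simp
qed (use assms nrm_nonneg in auto)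

lemma limit_star:
  assumes "\<And>n. f n \<in> carrier M" "l \<in> carrier M" "(\<lambda>n. nrm M (f n \<ominus> l)) \<longlonglongrightarrow> 0"
  shows "(\<lambda>n. nrm M (star M (f n) \<ominus> star M l)) \<longlonglongrightarrow> 0"
proof -
  have "nrm M (star M (f n) \<ominus> star M l) = nrm M (f n \<ominus> l)" for n
    using nrm_star[of "f n \<ominus> l"] assms by (simp add: star_diff)
  then show ?thesis using assms by simp
qed

lemma limit_rmult:
  assumes "\<And>n. f n \<in> carrier M" "l \<in> carrier M" "w \<in> carrier M"
    and "(\<lambda>n. nrm M (f n \<ominus> l)) \<longlonglongrightarrow> 0"
  shows "(\<lambda>n. nrm M (f n \<otimes> w \<ominus> l \<otimes> w)) \<longlonglongrightarrow> 0"
proof (rule tendsto_sandwich[OF _ _ tendsto_const])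
  show "(\<lambda>n. nrm M (f n \<ominus> l) * nrm M w) \<longlonglongrightarrow> 0" using tendsto_mult_left_zero[OF assms(4)] .
  have "nrm M (f n \<otimes> w \<ominus> l \<otimes> w) \<le> nrm M (f n \<ominus> l) * nrm M w" for n
    using nrm_mult[of "f n \<ominus> l" w] assms by (simp add: minus_eq l_distr l_minus)
  then show "\<forall>\<^sub>F n in sequentially. nrm M (f n \<otimes> w \<ominus> l \<otimes> w) \<le> nrm M (f n \<ominus> l) * nrm M w" by simp
qed (use assms nrm_nonneg in auto)

lemma nrm_limit_le:
  assumes "\<And>n. f n \<in> carrier M" "l \<in> carrier M" "(\<lambda>n. nrm M (f n \<ominus> l)) \<longlonglongrightarrow> 0"
    and "w \<in> carrier M" "\<And>n. nrm M (f n \<ominus> w) \<le> s"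
  shows "nrm M (l \<ominus> w) \<le> s"
proof -
  have "nrm M (l \<ominus> w) \<le> nrm M (f n \<ominus> l) + s" for n
    using nrm_diff_triangle[of l "f n" w] nrm_diff_comm[of "f n" l] assms(1,2,4) assms(5)[of n] by simp
  moreover have "(\<lambda>n. nrm M (f n \<ominus> l) + s) \<longlonglongrightarrow> 0 + s"
    using tendsto_add[OF assms(3)] by blast
  ultimately show ?thesis using LIMSEQ_le_const[of "\<lambda>n. nrm M (f n \<ominus> l) + s" "s"] by auto
qed

text \<open>A sequence whose increments are dominated by those of a convergent real sequence is Cauchy. This
  is the convergence criterion behind the square root and the Neumann series.\<close>

lemma dominated_limit:
  assumes y: "\<And>n. y n \<in> carrier M"
    and step: "\<And>n. nrm M (y (Suc n) \<ominus> y n) \<le> s (Suc n) - s n"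
    and s: "convergent (s :: nat \<Rightarrow> real)"
  obtains l where "l \<in> carrier M" "(\<lambda>n. nrm M (y n \<ominus> l)) \<longlonglongrightarrow> 0"
proof -
  have dist: "nrm M (y (n + k) \<ominus> y n) \<le> s (n + k) - s n" for n k
  proof (induction k)
    case 0
    then show ?case using y[of n] by (simp add: minus_eq r_neg)
  next
    case (Suc k)
    then show ?case
      using nrm_diff_triangle[of "y (Suc (n + k))" "y (n + k)" "y n"] step[of "n + k"] y by simp
  qed
  have "\<exists>K. \<forall>m\<ge>K. \<forall>n\<ge>K. nrm M (y m \<ominus> y n) < e" if "e > 0" for e
  proof -
    obtain K where K: "\<bar>s m - s n\<bar> < e" if "m \<ge> K" "n \<ge> K" for m n
      using CauchyD[OF convergent_Cauchy[OF s] \<open>e > 0\<close>] unfolding real_norm_def by blast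
    have "nrm M (y m \<ominus> y n) < e" if "m \<ge> K" "n \<ge> K" for m n
    proof (cases "m \<le> n")
      case True
      then show ?thesis using dist[of m "n - m"] K[OF that(2,1)] nrm_diff_comm[of "y m" "y n"] y by simp
    next
      case False
      then show ?thesis using dist[of n "m - n"] K[OF that] by simp
    qed
    then show ?thesis by blast
  qed
  with cauchy_limit[of y] y that show ?thesis by blast
qed

subsection \<open>Square roots\<close>

text \<open>The iteration for \<open>1 - sqrt (1 - x)\<close>: a fixed point \<open>y\<close> satisfies \<open>2 y = x + y\<^sup>2\<close>, that is
  \<open>(1 - y)\<^sup>2 = 1 - x\<close>. All iterates are polynomials in \<open>x\<close> with nonnegative coefficients.\<close>

primrec sqi :: "'a \<Rightarrow> nat \<Rightarrow> 'a" where
  "sqi x 0 = \<zero>"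
| "sqi x (Suc n) = (1/2) \<odot> (x \<oplus> sqi x n \<otimes> sqi x n)"

lemma sqi_closed [simp]: "x \<in> carrier M \<Longrightarrow> sqi x n \<in> carrier M"
  by (induction n) auto

lemma sqi_star: "\<lbrakk>x \<in> carrier M; star M x = x\<rbrakk> \<Longrightarrow> star M (sqi x n) = sqi x n"
  by (induction n) (auto simp: star_add star_smult star_mult)

lemma sqi_commute:
  "\<lbrakk>x \<in> carrier M; w \<in> carrier M; w \<otimes> x = x \<otimes> w\<rbrakk> \<Longrightarrow> w \<otimes> sqi x n = sqi x n \<otimes> w"
proof (induction n)
  case (Suc n)
  let ?y = "sqi x n"
  have "w \<otimes> (?y \<otimes> ?y) = ?y \<otimes> ?y \<otimes> w"
    using Suc by (metis m_assoc sqi_closed)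
  then show ?case using Suc.prems by (simp add: l_distr r_distr smult_addr)
qed simp

text \<open>The iterates for \<open>x\<close> are dominated in norm by the scalar iterates for \<open>1\<close>, which increase and are
  bounded by \<open>1\<close>; so they converge, and every element commuting with \<open>x\<close> commutes with the limit.\<close>

lemma sqrt_near_one:
  assumes x: "x \<in> carrier M" "star M x = x" "nrm M x \<le> 1"
  obtains y where "y \<in> carrier M" "star M y = y" "y \<otimes> y = \<one> \<ominus> x" "nrm M (\<one> \<ominus> y) \<le> 1"
    "\<And>w. \<lbrakk>w \<in> carrier M; w \<otimes> x = x \<otimes> w\<rbrakk> \<Longrightarrow> w \<otimes> y = y \<otimes> w"
proof -
  \<comment> \<open>the same iteration in the real numbers, at \<open>1\<close>\<close>
  define s :: "nat \<Rightarrow> real" where "s = rec_nat 0 (\<lambda>_ s. (1 + s * s) / 2)"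
  have s0: "s 0 = 0" and sS: "s (Suc n) = (1 + s n * s n) / 2" for n by (auto simp: s_def)
  have s01: "0 \<le> s n \<and> s n \<le> 1" for n
  proof (induction n)
    case (Suc n)
    then have "s n * s n \<le> 1 * 1" by (intro mult_mono) auto
    then show ?case by (simp add: sS)
  qed (simp add: s0)
  have sinc: "s n \<le> s (Suc n)" for n
    using zero_le_power2[of "1 - s n"] unfolding power2_eq_square sS by (simp add: algebra_simps)
  have "convergent s"
  proof -
    have "incseq s" using sinc by (rule incseq_SucI)
    moreover have "\<forall>i. s i \<le> 1" using s01 by blast
    ultimately obtain L where "s \<longlonglongrightarrow> L" by (rule incseq_convergent)
    then show ?thesis by (rule convergentI)
  qed
  define y where "y n = sqi x n" for n
  have y: "y n \<in> carrier M" for n using x by (simp add: y_def)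
  have yS: "y (Suc n) = (1/2) \<odot> (x \<oplus> y n \<otimes> y n)" for n by (simp add: y_def)
  have yn: "nrm M (y n) \<le> s n" for n
  proof (induction n)
    case (Suc n)
    have "nrm M (y (Suc n)) \<le> (nrm M x + nrm M (y n) * nrm M (y n)) / 2"
      using nrm_triangle[of x "y n \<otimes> y n"] nrm_mult[of "y n" "y n"] y x by (simp add: yS nrm_smult)
    also have "\<dots> \<le> (1 + s n * s n) / 2"
      using Suc x(3) s01[of n] nrm_nonneg[OF y[of n]] mult_mono[of "nrm M (y n)" "s n" "nrm M (y n)" "s n"] by simp
    finally show ?case by (simp add: sS)
  qed (simp add: y_def s0)
  have ycom: "y m \<otimes> y n = y n \<otimes> y m" for m n
    using sqi_commute[of x "y m" n] sqi_commute[of x x m] x by (simp add: y_def)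
  have ystep: "nrm M (y (Suc n) \<ominus> y n) \<le> s (Suc n) - s n" for n
  proof (induction n)
    case 0
    then show ?case using x by (simp add: y_def s0 sS minus_eq nrm_smult)
  next
    case (Suc n)
    let ?a = "y (Suc n)" and ?b = "y n"
    have "y (Suc (Suc n)) \<ominus> y (Suc n) = (1/2) \<odot> (x \<oplus> ?a \<otimes> ?a) \<ominus> (1/2) \<odot> (x \<oplus> ?b \<otimes> ?b)"
      by (simp only: yS)
    also have "\<dots> = (1/2) \<odot> ((x \<oplus> ?a \<otimes> ?a) \<ominus> (x \<oplus> ?b \<otimes> ?b))"
      using x y by (simp add: minus_eq smult_addr smult_a_inv)
    also have "(x \<oplus> ?a \<otimes> ?a) \<ominus> (x \<oplus> ?b \<otimes> ?b) = ?a \<otimes> ?a \<ominus> ?b \<otimes> ?b"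
      using x y by (simp add: minus_eq minus_add a_ac r_neg1 r_neg2)
    also have "\<dots> = (?a \<ominus> ?b) \<otimes> (?a \<oplus> ?b)"
      using diff_split[of "?a \<otimes> ?a" "?b \<otimes> ?a" "?b \<otimes> ?b"] y ycom[of "Suc n" n]
      by (simp add: minus_eq l_distr r_distr l_minus a_ac)
    finally have e: "y (Suc (Suc n)) \<ominus> y (Suc n) = (1/2) \<odot> ((?a \<ominus> ?b) \<otimes> (?a \<oplus> ?b))" .
    have "nrm M (y (Suc (Suc n)) \<ominus> y (Suc n)) \<le> nrm M (?a \<ominus> ?b) * nrm M (?a \<oplus> ?b) / 2"
      unfolding e using nrm_mult[of "?a \<ominus> ?b" "?a \<oplus> ?b"] y by (simp add: nrm_smult)
    also have "\<dots> \<le> (s (Suc n) - s n) * (s (Suc n) + s n) / 2"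
    proof (intro divide_right_mono mult_mono Suc.IH)
      show "nrm M (?a \<oplus> ?b) \<le> s (Suc n) + s n"
        using nrm_triangle[OF y[of "Suc n"] y[of n]] yn[of n] yn[of "Suc n"] by linarith
      show "0 \<le> s (Suc n) - s n" using sinc[of n] by simp
      show "0 \<le> nrm M (?a \<oplus> ?b)" using y by (simp add: nrm_nonneg)
    qed simp
    also have "\<dots> = s (Suc (Suc n)) - s (Suc n)"
    proof -
      have "(a - b) * (a + b) / 2 = c - a" if "c = (1 + a * a) / 2" "a = (1 + b * b) / 2" for a b c :: real
      proof -
        have "(a - b) * (a + b) / 2 = (1 + a * a) / 2 - (1 + b * b) / 2" by (simp add: field_simps)
        then show ?thesis unfolding that(1) that(2)[symmetric] .
      qed
      then show ?thesis using sS by blast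
    qed
    finally show ?case .
  qed
  obtain l where l: "l \<in> carrier M" "(\<lambda>n. nrm M (y n \<ominus> l)) \<longlonglongrightarrow> 0"
    using dominated_limit[OF y ystep \<open>convergent s\<close>] by blast
  have lstar: "star M l = l"
    using limit_unique[of y "star M l" l] limit_star[OF _ l] l y sqi_star[of x] x by (simp add: y_def)
  have lcom: "w \<otimes> l = l \<otimes> w" if "w \<in> carrier M" "w \<otimes> x = x \<otimes> w" for w
    using limit_unique[of "\<lambda>n. w \<otimes> y n" "w \<otimes> l" "l \<otimes> w"] limit_lmult[OF y l(1) that(1) l(2)]
      limit_rmult[OF y l(1) that(1) l(2)] sqi_commute[of x w] x that l by (simp add: y_def)
  have lnorm: "nrm M l \<le> 1"
  proof -
    have "nrm M (y n \<ominus> \<zero>) \<le> 1" for n using yn[of n] s01[of n] y[of n] by (simp add: minus_eq)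
    then show ?thesis using nrm_limit_le[OF y l, of \<zero> 1] by (simp add: minus_eq l)
  qed
  have leq: "l = (1/2) \<odot> (x \<oplus> l \<otimes> l)"
  proof (rule limit_unique)
    show "(\<lambda>n. nrm M (y (Suc n) \<ominus> l)) \<longlonglongrightarrow> 0" using l(2) by (rule LIMSEQ_Suc)
    have eq: "y (Suc n) \<ominus> (1/2) \<odot> (x \<oplus> l \<otimes> l) = (1/2) \<odot> ((y n \<otimes> y n \<ominus> y n \<otimes> l) \<oplus> (y n \<otimes> l \<ominus> l \<otimes> l))" for n
    proof -
      have "y (Suc n) \<ominus> (1/2) \<odot> (x \<oplus> l \<otimes> l) = (1/2) \<odot> ((x \<oplus> y n \<otimes> y n) \<ominus> (x \<oplus> l \<otimes> l))"
        using x y l by (simp add: yS minus_eq smult_addr smult_a_inv)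
      also have "(x \<oplus> y n \<otimes> y n) \<ominus> (x \<oplus> l \<otimes> l) = y n \<otimes> y n \<ominus> l \<otimes> l"
        using x y l by (simp add: minus_eq minus_add a_ac r_neg1 r_neg2)
      also have "\<dots> = (y n \<otimes> y n \<ominus> y n \<otimes> l) \<oplus> (y n \<otimes> l \<ominus> l \<otimes> l)"
        using y l by (intro diff_split) auto
      finally show ?thesis .
    qed
    have "nrm M (y n \<otimes> y n \<ominus> y n \<otimes> l) \<le> nrm M (y n \<ominus> l)" for n
    proof -
      have "nrm M (y n \<otimes> y n \<ominus> y n \<otimes> l) \<le> nrm M (y n) * nrm M (y n \<ominus> l)"
        using nrm_mult[of "y n" "y n \<ominus> l"] y l by (simp add: minus_eq r_distr r_minus)
      also have "\<dots> \<le> 1 * nrm M (y n \<ominus> l)"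
        using yn[of n] s01[of n] y l nrm_nonneg by (intro mult_right_mono) auto
      finally show ?thesis by simp
    qed
    moreover have "nrm M (y n \<otimes> l \<ominus> l \<otimes> l) \<le> nrm M (y n \<ominus> l)" for n
    proof -
      have "nrm M (y n \<otimes> l \<ominus> l \<otimes> l) \<le> nrm M (y n \<ominus> l) * nrm M l"
        using nrm_mult[of "y n \<ominus> l" l] y l by (simp add: minus_eq l_distr l_minus)
      also have "\<dots> \<le> nrm M (y n \<ominus> l) * 1"
        using lnorm y l nrm_nonneg by (intro mult_left_mono) auto
      finally show ?thesis by simp
    qed
    ultimately have "nrm M (y n \<otimes> y n \<ominus> y n \<otimes> l \<oplus> (y n \<otimes> l \<ominus> l \<otimes> l)) \<le> nrm M (y n \<ominus> l) + nrm M (y n \<ominus> l)" for n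
      using nrm_triangle[of "y n \<otimes> y n \<ominus> y n \<otimes> l" "y n \<otimes> l \<ominus> l \<otimes> l"] y[of n] l(1)
      by (meson add_mono m_closed minus_closed order_trans)
    then have "nrm M (y (Suc n) \<ominus> (1/2) \<odot> (x \<oplus> l \<otimes> l)) \<le> nrm M (y n \<ominus> l)" for n
      using y[of n] l(1) unfolding eq by (simp add: nrm_smult mult.commute)
    then show "(\<lambda>n. nrm M (y (Suc n) \<ominus> (1/2) \<odot> (x \<oplus> l \<otimes> l))) \<longlonglongrightarrow> 0"
      using x y l by (intro tendsto_sandwich[OF _ _ tendsto_const l(2)]) (auto simp: nrm_nonneg)
  qed (use x y l in auto)
  show ?thesis
  proof
    show "\<one> \<ominus> l \<in> carrier M" using l by simp
    show "star M (\<one> \<ominus> l) = \<one> \<ominus> l" using l lstar by (simp add: star_diff)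
    have "x \<oplus> l \<otimes> l = l \<oplus> l"
    proof -
      have "l \<oplus> l = 2 \<odot> l" using l by (simp add: double_add)
      also have "\<dots> = 2 \<odot> ((1/2) \<odot> (x \<oplus> l \<otimes> l))" using leq by simp
      finally show ?thesis using x l by simp
    qed
    then have "l \<oplus> l \<ominus> x = x \<oplus> l \<otimes> l \<ominus> x" by simp
    also have "\<dots> = l \<otimes> l" using x l by (simp add: minus_eq a_comm[of x] a_assoc r_neg)
    finally have ll: "l \<otimes> l = l \<oplus> l \<ominus> x" by simp
    have "(\<one> \<ominus> l) \<otimes> (\<one> \<ominus> l) = \<one> \<ominus> l \<ominus> l \<oplus> l \<otimes> l"
      using l by (simp add: minus_eq l_distr r_distr l_minus r_minus minus_add a_ac)
    also have "\<dots> = \<one> \<ominus> x"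
      using l x unfolding ll by (simp add: minus_eq minus_add a_ac r_neg1 r_neg2)
    finally show "(\<one> \<ominus> l) \<otimes> (\<one> \<ominus> l) = \<one> \<ominus> x" .
    have "\<one> \<ominus> (\<one> \<ominus> l) = l" using l by (simp add: minus_eq minus_add r_neg2)
    then show "nrm M (\<one> \<ominus> (\<one> \<ominus> l)) \<le> 1" using lnorm by simp
    show "w \<otimes> (\<one> \<ominus> l) = (\<one> \<ominus> l) \<otimes> w" if "w \<in> carrier M" "w \<otimes> x = x \<otimes> w" for w
      using that l lcom[OF that] by (simp add: minus_eq l_distr r_distr l_minus r_minus)
  qed
qed

lemma l_diff: "\<lbrakk>x \<in> carrier M; y \<in> carrier M; z \<in> carrier M\<rbrakk> \<Longrightarrow> (x \<ominus> y) \<otimes> z = x \<otimes> z \<ominus> y \<otimes> z"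
  by (simp add: minus_eq l_distr l_minus)

lemma r_diff: "\<lbrakk>x \<in> carrier M; y \<in> carrier M; z \<in> carrier M\<rbrakk> \<Longrightarrow> z \<otimes> (x \<ominus> y) = z \<otimes> x \<ominus> z \<otimes> y"
  by (simp add: minus_eq r_distr r_minus)

lemma add_diff_cancel_left:
  "\<lbrakk>x \<in> carrier M; y \<in> carrier M; z \<in> carrier M\<rbrakk> \<Longrightarrow> (z \<oplus> x) \<ominus> (z \<oplus> y) = x \<ominus> y"
  by (simp add: minus_eq minus_add a_comm[of z x] a_assoc r_neg2)

lemma eq_add_imp_diff: "\<lbrakk>x \<in> carrier M; y \<in> carrier M; z = x \<oplus> y\<rbrakk> \<Longrightarrow> z \<ominus> y = x"
  by (simp add: minus_eq a_assoc r_neg)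

lemma diff_diff_cancel: "\<lbrakk>x \<in> carrier M; y \<in> carrier M\<rbrakk> \<Longrightarrow> x \<ominus> (x \<ominus> y) = y"
  by (simp add: minus_eq minus_add r_neg2)

subsection \<open>Inverses\<close>

lemma neumann:
  assumes x: "x \<in> carrier M" "nrm M x < 1"
  obtains v where "v \<in> carrier M" "(\<one> \<ominus> x) \<otimes> v = \<one>" "v \<otimes> (\<one> \<ominus> x) = \<one>"
proof -
  define v where "v = rec_nat \<one> (\<lambda>_ y. \<one> \<oplus> x \<otimes> y)"
  have v0: "v 0 = \<one>" and vS: "v (Suc n) = \<one> \<oplus> x \<otimes> v n" for n by (simp_all add: v_def)
  have v: "v n \<in> carrier M" for n by (induction n) (use x in \<open>simp_all add: v0 vS\<close>)
  have vcom: "v n \<otimes> x = x \<otimes> v n" for n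
    by (induction n) (use x v in \<open>simp_all add: v0 vS l_distr r_distr m_assoc\<close>)
  define s where "s n = (\<Sum>i<n. nrm M x ^ i) * nrm M x" for n
  have conv: "convergent s"
    unfolding s_def using summable_geometric[of "nrm M x"] x nrm_nonneg[of x]
    by (intro convergent_mult_const_right_iff[THEN iffD2]
          convergent_mult convergent_const) (simp add: summable_iff_convergent)
  have step: "nrm M (v (Suc n) \<ominus> v n) \<le> s (Suc n) - s n" for n
  proof (induction n)
    case 0
    have "nrm M (v (Suc 0) \<ominus> v 0) = nrm M x"
      using x by (simp add: v0 vS minus_eq a_comm[of \<one>] a_assoc r_neg)
    then show ?case by (simp add: s_def)
  next
    case (Suc n)
    have "v (Suc (Suc n)) \<ominus> v (Suc n) = (\<one> \<oplus> x \<otimes> v (Suc n)) \<ominus> (\<one> \<oplus> x \<otimes> v n)"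
      by (simp only: vS)
    also have "\<dots> = x \<otimes> (v (Suc n) \<ominus> v n)"
      using x v by (simp add: add_diff_cancel_left r_diff)
    finally have "nrm M (v (Suc (Suc n)) \<ominus> v (Suc n)) \<le> nrm M x * nrm M (v (Suc n) \<ominus> v n)"
      using nrm_mult[of x "v (Suc n) \<ominus> v n"] x v by simp
    also have "\<dots> \<le> nrm M x * (s (Suc n) - s n)"
      using Suc nrm_nonneg[of x] x by (intro mult_left_mono) auto
    also have "\<dots> = s (Suc (Suc n)) - s (Suc n)" by (simp add: s_def algebra_simps)
    finally show ?case .
  qed
  obtain l where l: "l \<in> carrier M" "(\<lambda>n. nrm M (v n \<ominus> l)) \<longlonglongrightarrow> 0"
    using dominated_limit[OF v step conv] by blast
  have Suc: "(\<lambda>n. nrm M (v (Suc n) \<ominus> l)) \<longlonglongrightarrow> 0" using l(2) by (rule LIMSEQ_Suc)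
  have "l = \<one> \<oplus> x \<otimes> l"
  proof (rule limit_unique[OF _ _ _ Suc])
    have "nrm M (v (Suc n) \<ominus> (\<one> \<oplus> x \<otimes> l)) = nrm M (x \<otimes> v n \<ominus> x \<otimes> l)" for n
      unfolding vS using x v l by (simp add: add_diff_cancel_left)
    then show "(\<lambda>n. nrm M (v (Suc n) \<ominus> (\<one> \<oplus> x \<otimes> l))) \<longlonglongrightarrow> 0"
      using limit_lmult[OF v l(1) x(1) l(2)] by simp
  qed (use v l x in auto)
  moreover have "l = \<one> \<oplus> l \<otimes> x"
  proof (rule limit_unique[OF _ _ _ Suc])
    have "nrm M (v (Suc n) \<ominus> (\<one> \<oplus> l \<otimes> x)) = nrm M (v n \<otimes> x \<ominus> l \<otimes> x)" for n
      unfolding vS using vcom[of n, symmetric] x v l by (simp add: add_diff_cancel_left)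
    then show "(\<lambda>n. nrm M (v (Suc n) \<ominus> (\<one> \<oplus> l \<otimes> x))) \<longlonglongrightarrow> 0"
      using limit_rmult[OF v l(1) x(1) l(2)] by simp
  qed (use v l x in auto)
  ultimately have "l \<ominus> x \<otimes> l = \<one>" "l \<ominus> l \<otimes> x = \<one>"
    using eq_add_imp_diff[of \<one> "x \<otimes> l" l] eq_add_imp_diff[of \<one> "l \<otimes> x" l] l x by simp_all
  then show ?thesis
    using that[of l] l x by (simp add: minus_eq l_distr r_distr l_minus r_minus)
qed

subsection \<open>Norm-positive elements\<close>

text \<open>For a self-adjoint element the condition says that its spectrum is nonnegative. In this form, with
  norms only, it is stable under sums without any appeal to spectral theory.\<close>

definition npos :: "'a \<Rightarrow> bool" where
  "npos a \<longleftrightarrow> a \<in> carrier M \<and> star M a = a \<and> (\<exists>t\<ge>0. nrm M (sc t \<ominus> a) \<le> t)"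

lemma nposI: "\<lbrakk>a \<in> carrier M; star M a = a; nrm M (sc t \<ominus> a) \<le> t\<rbrakk> \<Longrightarrow> npos a"
  unfolding npos_def using nrm_nonneg[of "sc t \<ominus> a"] by (meson minus_closed order_trans sc_closed)

lemma npos_closed: "npos a \<Longrightarrow> a \<in> carrier M" by (simp add: npos_def)
lemma npos_star: "npos a \<Longrightarrow> star M a = a" by (simp add: npos_def)

lemma scale_inverse: "\<lbrakk>x \<in> carrier M; c \<noteq> 0\<rbrakk> \<Longrightarrow> complex_of_real c \<odot> (complex_of_real (1 / c) \<odot> x) = x"
  by simp

text \<open>After division by \<open>t\<close> the element has the form \<open>1 - x\<close> with norm of \<open>x\<close> at most \<open>1\<close>.\<close>

lemma npos_sqrt:
  assumes "npos a"
  obtains r where "r \<in> carrier M" "star M r = r" "r \<otimes> r = a" "npos r"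
    "\<And>w. \<lbrakk>w \<in> carrier M; w \<otimes> a = a \<otimes> w\<rbrakk> \<Longrightarrow> w \<otimes> r = r \<otimes> w"
proof -
  obtain t where a: "a \<in> carrier M" "star M a = a" and t: "t \<ge> 0" "nrm M (sc t \<ominus> a) \<le> t"
    using assms by (auto simp: npos_def)
  show ?thesis
  proof (cases "t = 0")
    case True
    then have "nrm M a = 0" using t a nrm_nonneg[of a] by (simp add: minus_eq)
    then have "a = \<zero>" using a nrm_eq_0_iff by blast
    moreover have "npos \<zero>" by (rule nposI[of _ 0]) (auto simp: minus_eq)
    ultimately show ?thesis using that[of \<zero>] by simp
  next
    case False
    then have t0: "t > 0" using t by simp
    define x where "x = complex_of_real (1 / t) \<odot> (sc t \<ominus> a)"
    have x: "x \<in> carrier M" "star M x = x" using a by (simp_all add: x_def star_smult star_diff)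
    have "nrm M x \<le> 1" using t0 t a unfolding x_def by (simp add: nrm_smult norm_divide field_simps del: of_real_divide)
    then obtain y where y: "y \<in> carrier M" "star M y = y" "y \<otimes> y = \<one> \<ominus> x" "nrm M (\<one> \<ominus> y) \<le> 1"
      and yc: "\<And>w. \<lbrakk>w \<in> carrier M; w \<otimes> x = x \<otimes> w\<rbrakk> \<Longrightarrow> w \<otimes> y = y \<otimes> w"
      using sqrt_near_one[OF x] by blast
    define r where "r = complex_of_real (sqrt t) \<odot> y"
    have tx: "complex_of_real t \<odot> x = sc t \<ominus> a"
      unfolding x_def using t0 a by (intro scale_inverse) auto
    have "r \<otimes> r = complex_of_real t \<odot> (\<one> \<ominus> x)"
      using x y t0 by (simp add: r_def flip: of_real_mult)
    also have "\<dots> = sc t \<ominus> (sc t \<ominus> a)"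
      using x unfolding tx[symmetric] by (simp add: minus_eq smult_addr smult_a_inv sc_def)
    also have "\<dots> = a" using a by (simp add: minus_eq minus_add r_neg2)
    finally have rr: "r \<otimes> r = a" .
    have "sc (sqrt t) \<ominus> r = complex_of_real (sqrt t) \<odot> (\<one> \<ominus> y)"
      using y by (simp add: r_def minus_eq smult_addr smult_a_inv sc_def)
    then have "nrm M (sc (sqrt t) \<ominus> r) \<le> sqrt t"
      using y t0 by (simp add: nrm_smult mult_left_le)
    then have "npos r" using y by (intro nposI) (auto simp: r_def star_smult)
    moreover have "w \<otimes> r = r \<otimes> w" if w: "w \<in> carrier M" "w \<otimes> a = a \<otimes> w" for w
    proof -
      have "w \<otimes> x = x \<otimes> w"
        using w a by (simp add: x_def minus_eq l_distr r_distr l_minus r_minus)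
      then have "w \<otimes> y = y \<otimes> w" using yc w by blast
      then show ?thesis using y w by (simp add: r_def)
    qed
    ultimately show ?thesis using that[of r] y rr by (simp add: r_def star_smult)
  qed
qed

lemma npos_add: assumes "npos a" "npos b" shows "npos (a \<oplus> b)"
proof -
  obtain t s where t: "nrm M (sc t \<ominus> a) \<le> t" and s: "nrm M (sc s \<ominus> b) \<le> s"
    and ab: "a \<in> carrier M" "b \<in> carrier M" "star M a = a" "star M b = b"
    using assms by (auto simp: npos_def)
  have "sc (t + s) \<ominus> (a \<oplus> b) = (sc t \<ominus> a) \<oplus> (sc s \<ominus> b)"
    using ab by (simp add: sc_add minus_eq minus_add a_ac)
  then have "nrm M (sc (t + s) \<ominus> (a \<oplus> b)) \<le> t + s"
    using nrm_triangle[of "sc t \<ominus> a" "sc s \<ominus> b"] t s ab by simp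
  then show ?thesis using ab by (intro nposI) (auto simp: star_add)
qed

lemma npos_scale: assumes "npos a" "r \<ge> 0" shows "npos (complex_of_real r \<odot> a)"
proof -
  obtain t where t: "nrm M (sc t \<ominus> a) \<le> t" and a: "a \<in> carrier M" "star M a = a"
    using assms by (auto simp: npos_def)
  have "sc (r * t) \<ominus> complex_of_real r \<odot> a = complex_of_real r \<odot> (sc t \<ominus> a)"
    using a by (simp add: minus_eq smult_addr smult_a_inv)
  then have "nrm M (sc (r * t) \<ominus> complex_of_real r \<odot> a) \<le> r * t"
    using t a assms(2) by (simp add: nrm_smult mult_left_mono)
  then show ?thesis using a by (intro nposI) (auto simp: star_smult)
qed

lemma npos_norm_minus:
  assumes "x \<in> carrier M" "star M x = x" "nrm M x \<le> s" shows "npos (sc s \<ominus> x)"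
proof (rule nposI)
  have "sc s \<ominus> (sc s \<ominus> x) = x" using assms by (simp add: minus_eq minus_add r_neg2)
  then show "nrm M (sc s \<ominus> (sc s \<ominus> x)) \<le> s" using assms by simp
qed (use assms in \<open>auto simp: star_diff\<close>)

text \<open>The element \<open>u = y + \<i> w\<close> satisfies \<open>u* u = y\<^sup>2 + w\<^sup>2\<close>, and \<open>y\<close> is the real part of \<open>u\<close>.\<close>

lemma sum_squares_norm:
  assumes "y \<in> carrier M" "w \<in> carrier M" "star M y = y" "star M w = w" "y \<otimes> w = w \<otimes> y"
    and "y \<otimes> y \<oplus> w \<otimes> w = sc s" "s \<ge> 0"
  shows "nrm M (y \<otimes> y) \<le> s"
proof -
  define u where "u = y \<oplus> \<i> \<odot> w"
  have u: "u \<in> carrier M" and us: "star M u = y \<oplus> (- \<i>) \<odot> w"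
    using assms by (simp_all add: u_def star_add star_smult)
  have "star M u \<otimes> u = y \<otimes> y \<oplus> \<i> \<odot> (w \<otimes> y) \<oplus> ((- \<i>) \<odot> (w \<otimes> y) \<oplus> w \<otimes> w)"
    using assms by (subst us, unfold u_def) (simp add: l_distr r_distr smult_addr a_ac)
  also have "\<dots> = y \<otimes> y \<oplus> w \<otimes> w"
    using assms(1,2) smult_neg[of "w \<otimes> y" \<i>] by (simp add: a_assoc r_neg2)
  finally have "(nrm M u)\<^sup>2 \<le> s"
    using cstar_identity[OF u] nrm_sc[of s] assms by simp
  moreover have "nrm M y \<le> nrm M u"
  proof -
    have "u \<oplus> star M u = y \<oplus> y \<oplus> (\<i> \<odot> w \<oplus> (- \<i>) \<odot> w)"
      using assms by (subst us, unfold u_def) (simp add: a_ac)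
    also have "\<dots> = 2 \<odot> y" using assms smult_neg[of w \<i>] by (simp add: r_neg double_add)
    finally have "2 * nrm M y \<le> 2 * nrm M u"
      using nrm_triangle[of u "star M u"] u assms(1) by (simp add: nrm_smult)
    then show ?thesis by simp
  qed
  then have "(nrm M y)\<^sup>2 \<le> (nrm M u)\<^sup>2" using nrm_nonneg[OF assms(1)] by (intro power_mono)
  ultimately show ?thesis using nrm_sa_square[of y] assms by simp
qed

lemma sc_minus_cancel: "x \<in> carrier M \<Longrightarrow> x \<oplus> (sc s \<ominus> x) = sc s"
  by (simp add: minus_eq a_comm[of "sc s"] r_neg2)

text \<open>The square roots of \<open>a\<close> and of \<open>s - a\<close> commute and their squares add up to \<open>s\<close>.\<close>

lemma npos_norm_le:
  assumes "npos a" "npos (sc s \<ominus> a)" "s \<ge> 0" shows "nrm M a \<le> s"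
proof -
  obtain y where y: "y \<in> carrier M" "star M y = y" "y \<otimes> y = a"
    using npos_sqrt[OF assms(1)] by metis
  obtain w where w: "w \<in> carrier M" "star M w = w" "w \<otimes> w = sc s \<ominus> a"
    and wc: "\<And>x. \<lbrakk>x \<in> carrier M; x \<otimes> (sc s \<ominus> a) = (sc s \<ominus> a) \<otimes> x\<rbrakk> \<Longrightarrow> x \<otimes> w = w \<otimes> x"
    using npos_sqrt[OF assms(2)] by metis
  have "y \<otimes> (sc s \<ominus> a) = (sc s \<ominus> a) \<otimes> y"
    using y(1) unfolding y(3)[symmetric] by (simp add: minus_eq l_distr r_distr l_minus r_minus m_assoc)
  then have "y \<otimes> w = w \<otimes> y" using wc y(1) by blast
  then show ?thesis
    using sum_squares_norm[of y w s] y w assms sc_minus_cancel[of a s] npos_closed[OF assms(1)] by simp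
qed

lemma npos_square: assumes "x \<in> carrier M" "star M x = x" shows "npos (x \<otimes> x)"
proof -
  define s where "s = nrm M (x \<otimes> x)"
  have xx: "x \<otimes> x \<in> carrier M" "star M (x \<otimes> x) = x \<otimes> x" using assms by (auto simp: star_mult)
  have "npos (sc s \<ominus> x \<otimes> x)" using npos_norm_minus[OF xx] by (simp add: s_def)
  then obtain w where w: "w \<in> carrier M" "star M w = w" "w \<otimes> w = sc s \<ominus> x \<otimes> x"
    and wc: "\<And>y. \<lbrakk>y \<in> carrier M; y \<otimes> (sc s \<ominus> x \<otimes> x) = (sc s \<ominus> x \<otimes> x) \<otimes> y\<rbrakk> \<Longrightarrow> y \<otimes> w = w \<otimes> y"
    using npos_sqrt by metis
  have "x \<otimes> w = w \<otimes> x"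
    using assms by (intro wc) (simp_all add: minus_eq l_distr r_distr l_minus r_minus m_assoc)
  then have "nrm M (w \<otimes> w) \<le> s"
    using sum_squares_norm[of w x s] w assms xx nrm_nonneg[OF xx(1)] sc_minus_cancel[OF xx(1), of s]
    by (simp add: s_def a_comm)
  then show ?thesis using nposI[OF xx] w by simp
qed

lemma npos_bound:
  assumes "npos a" "nrm M a \<le> t" shows "nrm M (sc t \<ominus> a) \<le> t"
proof -
  have a: "a \<in> carrier M" "star M a = a" using assms by (auto simp: npos_def)
  have "sc t \<ominus> (sc t \<ominus> a) = a" using a by (simp add: minus_eq minus_add r_neg2)
  then show ?thesis
    using npos_norm_le[OF npos_norm_minus[OF a assms(2)], of t] assms nrm_nonneg[OF a(1)] by simp
qed

text \<open>Below, spectra are replaced by lower bounds: \<open>b \<ge> \<epsilon>\<close> makes \<open>b\<close> invertible by the Neumann series.\<close>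

lemma npos_invertible:
  assumes "b \<in> carrier M" "npos (b \<ominus> sc \<epsilon>)" "\<epsilon> > 0"
  obtains v where "v \<in> carrier M" "b \<otimes> v = \<one>" "v \<otimes> b = \<one>"
proof -
  define t where "t = nrm M (b \<ominus> sc \<epsilon>)"
  define T where "T = t + \<epsilon>"
  have t: "nrm M (sc t \<ominus> (b \<ominus> sc \<epsilon>)) \<le> t" using npos_bound[OF assms(2)] by (simp add: t_def)
  have T: "T > 0" "t < T" using assms nrm_nonneg[of "b \<ominus> sc \<epsilon>"] by (auto simp: T_def t_def)
  have "sc T \<ominus> b = sc t \<ominus> (b \<ominus> sc \<epsilon>)"
    using assms(1) by (simp add: T_def sc_add minus_eq minus_add a_ac)
  then have nT: "nrm M (sc T \<ominus> b) \<le> t" using t by simp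
  define x where "x = complex_of_real (1 / T) \<odot> (sc T \<ominus> b)"
  have x: "x \<in> carrier M" using assms by (simp add: x_def)
  have "nrm M x < 1" using nT T assms unfolding x_def by (simp add: nrm_smult norm_divide field_simps del: of_real_divide)
  then obtain v where v: "v \<in> carrier M" "(\<one> \<ominus> x) \<otimes> v = \<one>" "v \<otimes> (\<one> \<ominus> x) = \<one>"
    using neumann[OF x] by blast
  have "complex_of_real T \<odot> x = sc T \<ominus> b"
    unfolding x_def using T assms by (intro scale_inverse) auto
  then have "complex_of_real T \<odot> (\<one> \<ominus> x) = sc T \<ominus> (sc T \<ominus> b)"
    using x by (simp add: minus_eq smult_addr smult_a_inv sc_def)
  also have "\<dots> = b" using assms by (simp add: minus_eq minus_add r_neg2)
  finally have b: "b = complex_of_real T \<odot> (\<one> \<ominus> x)" by simp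
  show ?thesis
    using that[of "complex_of_real (1 / T) \<odot> v"] v x T unfolding b by simp
qed

text \<open>Conversely, an invertible element with nonnegative spectrum is bounded below by the inverse of the
  norm of its inverse.\<close>

lemma npos_invertible_bound:
  assumes e: "npos e" and f: "f \<in> carrier M" "e \<otimes> f = \<one>" "f \<otimes> e = \<one>" and T: "T > 0" "T \<ge> nrm M f"
  shows "npos (e \<ominus> sc (1 / T))"
proof -
  have ec: "e \<in> carrier M" "star M e = e" using e by (auto simp: npos_def)
  obtain s where s: "s \<in> carrier M" "star M s = s" "s \<otimes> s = e" using npos_sqrt[OF e] by metis
  have se: "s \<otimes> e = e \<otimes> s" using s by (metis m_assoc)
  have sf: "s \<otimes> f = f \<otimes> s"
  proof -
    have "s \<otimes> f = f \<otimes> e \<otimes> s \<otimes> f" using s f by simp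
    also have "\<dots> = f \<otimes> s \<otimes> (e \<otimes> f)" using s f ec se by (metis m_assoc m_closed)
    finally show ?thesis using s f by simp
  qed
  have fs: "star M f = f"
  proof -
    have "star M f \<otimes> e = \<one>" using star_mult[of e f] f ec by simp
    then have "star M f \<otimes> e \<otimes> f = f" using f by simp
    then show ?thesis using f ec by (simp add: m_assoc)
  qed
  have "s \<otimes> f \<otimes> (s \<otimes> f) = f"
  proof -
    have "f \<otimes> s \<otimes> (s \<otimes> f) = f \<otimes> (s \<otimes> s) \<otimes> f" using s(1) f(1) by (simp add: m_assoc)
    then show ?thesis using s f sf by simp
  qed
  have "npos (sc T \<ominus> f)" using npos_norm_minus[OF f(1) fs T(2)] .
  then obtain r where r: "r \<in> carrier M" "star M r = r" "r \<otimes> r = sc T \<ominus> f"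
    and rc: "\<And>w. \<lbrakk>w \<in> carrier M; w \<otimes> (sc T \<ominus> f) = (sc T \<ominus> f) \<otimes> w\<rbrakk> \<Longrightarrow> w \<otimes> r = r \<otimes> w"
    using npos_sqrt by metis
  have sr: "s \<otimes> r = r \<otimes> s"
    using s f sf by (intro rc) (simp_all add: minus_eq l_distr r_distr l_minus r_minus)
  have "s \<otimes> r \<otimes> (s \<otimes> r) = s \<otimes> s \<otimes> (r \<otimes> r)" using s r sr by (metis m_assoc m_closed)
  also have "\<dots> = complex_of_real T \<odot> e \<ominus> \<one>"
    using ec f unfolding s r by (simp add: minus_eq r_distr r_minus)
  finally have sq: "s \<otimes> r \<otimes> (s \<otimes> r) = complex_of_real T \<odot> e \<ominus> \<one>" .
  have "npos (complex_of_real (1 / T) \<odot> (s \<otimes> r \<otimes> (s \<otimes> r)))"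
    using T s r sr by (intro npos_scale npos_square) (auto simp: star_mult)
  moreover have "complex_of_real (1 / T) \<odot> (s \<otimes> r \<otimes> (s \<otimes> r)) = e \<ominus> sc (1 / T)"
    using ec T unfolding sq by (simp add: minus_eq smult_addr smult_a_inv sc_def)
  ultimately show ?thesis by simp
qed

text \<open>The argument of Kaplansky. Let \<open>x = z* z\<close>, let \<open>m = \<bar>x\<bar>\<close> be the square root of \<open>x\<^sup>2\<close> and \<open>n = m - x\<close>
  twice the negative part, so that \<open>n x = - n m\<close>. For \<open>w = z n\<close> one has \<open>w* w = - g\<^sup>2\<close> with \<open>g\<close> self-adjoint,
  whereas \<open>w w* + w* w\<close> is a sum of squares, so that \<open>w w*\<close> is positive. Since \<open>w w*\<close> and \<open>w* w\<close> have the same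
  nonzero spectrum, \<open>g\<^sup>2 = 0\<close>, hence \<open>w = 0\<close> and finally \<open>n = 0\<close>.\<close>

lemma star_mult_npos: assumes z: "z \<in> carrier M" shows "npos (star M z \<otimes> z)"
proof -
  define x where "x = star M z \<otimes> z"
  have x: "x \<in> carrier M" "star M x = x" using z by (auto simp: x_def star_mult)
  obtain m where m: "m \<in> carrier M" "star M m = m" "m \<otimes> m = x \<otimes> x" "npos m"
      and mc: "\<And>w. \<lbrakk>w \<in> carrier M; w \<otimes> (x \<otimes> x) = (x \<otimes> x) \<otimes> w\<rbrakk> \<Longrightarrow> w \<otimes> m = m \<otimes> w"
    using npos_sqrt[OF npos_square[OF x]] by metis
  have xm: "x \<otimes> m = m \<otimes> x" using x by (intro mc) (auto simp: m_assoc)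
  obtain r where r: "r \<in> carrier M" "star M r = r" "r \<otimes> r = m"
      and rc: "\<And>w. \<lbrakk>w \<in> carrier M; w \<otimes> m = m \<otimes> w\<rbrakk> \<Longrightarrow> w \<otimes> r = r \<otimes> w"
    using npos_sqrt[OF m(4)] by metis
  \<comment> \<open>twice the negative part of \<open>x\<close>\<close>
  define n where "n = m \<ominus> x"
  have n: "n \<in> carrier M" "star M n = n" using m x by (auto simp: n_def star_diff)
  have nm: "n \<otimes> m = m \<otimes> n" using m x xm by (simp add: n_def minus_eq l_distr r_distr l_minus r_minus)
  have nr: "n \<otimes> r = r \<otimes> n" using rc n nm by blast
  have nx: "n \<otimes> x = \<ominus> (n \<otimes> m)"
    using m x xm by (simp add: n_def minus_eq l_distr r_distr l_minus r_minus minus_add a_comm)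
  have xn: "x \<otimes> n = n \<otimes> x" using m x xm by (simp add: n_def minus_eq l_distr r_distr l_minus r_minus)
  define w where "w = z \<otimes> n"
  define g where "g = r \<otimes> n"
  have w: "w \<in> carrier M" using z n by (simp add: w_def)
  have g: "g \<in> carrier M" "star M g = g" using r n nr by (auto simp: g_def star_mult)
  have ww: "star M w \<otimes> w = \<ominus> (g \<otimes> g)"
  proof -
    have "star M w \<otimes> w = n \<otimes> x \<otimes> n" using z n by (simp add: w_def x_def star_mult m_assoc)
    also have "\<dots> = \<ominus> (n \<otimes> (r \<otimes> r) \<otimes> n)" using n m r nx by (simp add: l_minus)
    also have "n \<otimes> (r \<otimes> r) \<otimes> n = g \<otimes> g" unfolding g_def using n r nr by (metis m_assoc m_closed)
    finally show ?thesis .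
  qed
  define c where "c = w \<oplus> star M w"
  define d where "d = \<i> \<odot> (w \<ominus> star M w)"
  have c: "c \<in> carrier M" "star M c = c" using w by (auto simp: c_def star_add a_comm)
  have d: "d \<in> carrier M" "star M d = d"
    using w smult_neg[of "star M w \<ominus> w" \<i>] smult_a_inv[of "w \<ominus> star M w" \<i>]
    by (auto simp: d_def star_smult star_add minus_eq minus_add a_comm)
  let ?p = "w \<otimes> star M w" and ?q = "star M w \<otimes> w"
  have "c \<otimes> c \<oplus> d \<otimes> d = c \<otimes> c \<ominus> (w \<ominus> star M w) \<otimes> (w \<ominus> star M w)"
    using w smult_neg_one by (simp add: d_def minus_eq)
  also have "\<dots> = (w \<otimes> w \<oplus> star M w \<otimes> star M w \<oplus> (?p \<oplus> ?q)) \<ominus> (w \<otimes> w \<oplus> star M w \<otimes> star M w \<ominus> (?p \<oplus> ?q))"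
    using w by (simp add: c_def minus_eq l_distr r_distr l_minus r_minus minus_add a_ac)
  also have "\<dots> = 2 \<odot> (?p \<oplus> ?q)"
  proof -
    have "(a \<oplus> b) \<ominus> (a \<ominus> b) = 2 \<odot> b" if "a \<in> carrier M" "b \<in> carrier M" for a b
      using that double_add[of b] add_diff_cancel_left[of b "\<ominus> b" a] by (simp add: minus_eq)
    then show ?thesis using w by simp
  qed
  finally have "complex_of_real (1/2) \<odot> (c \<otimes> c \<oplus> d \<otimes> d) = ?p \<oplus> ?q" using w by simp
  then have "?p = complex_of_real (1/2) \<odot> (c \<otimes> c \<oplus> d \<otimes> d) \<oplus> g \<otimes> g"
    using w g ww by (simp add: a_assoc l_neg)
  then have alpha: "npos ?p"
    using npos_add[OF npos_scale[OF npos_add[OF npos_square[OF c] npos_square[OF d]], of "1/2"] npos_square[OF g]]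
    by simp
  have gg: "g \<otimes> g \<in> carrier M" "star M (g \<otimes> g) = g \<otimes> g" using g by (auto simp: star_mult)
  have "nrm M (g \<otimes> g) = 0"
  proof (rule ccontr)
    define N where "N = nrm M (g \<otimes> g)"
    assume "nrm M (g \<otimes> g) \<noteq> 0"
    then have N: "N > 0" using nrm_nonneg[OF gg(1)] by (simp add: N_def)
    have "sc N \<oplus> ?p \<ominus> sc N = ?p" using w by (simp add: minus_eq a_comm[of "sc N"] a_assoc r_neg)
    then obtain v where v: "v \<in> carrier M" "(sc N \<oplus> ?p) \<otimes> v = \<one>" "v \<otimes> (sc N \<oplus> ?p) = \<one>"
      using npos_invertible[of "sc N \<oplus> ?p" N] alpha N w by auto
    define e where "e = sc N \<ominus> g \<otimes> g"
    have e: "npos e" using npos_norm_minus[OF gg] by (simp add: e_def N_def)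
    have eq: "e = sc N \<oplus> ?q" using w g ww by (simp add: e_def minus_eq)
    \<comment> \<open>from an inverse of \<open>N + w w*\<close> one obtains an inverse of \<open>N + w* w\<close>\<close>
    define k where "k = star M w \<otimes> v \<otimes> w"
    have k: "k \<in> carrier M" using w v by (simp add: k_def)
    have "e \<otimes> k = star M w \<otimes> ((sc N \<oplus> ?p) \<otimes> v) \<otimes> w"
      unfolding eq k_def using w v(1) by (simp add: l_distr r_distr m_assoc)
    then have ek: "e \<otimes> k = ?q" unfolding v(2) using w by simp
    have "k \<otimes> e = star M w \<otimes> (v \<otimes> (sc N \<oplus> ?p)) \<otimes> w"
      unfolding eq k_def using w v(1) by (simp add: l_distr r_distr m_assoc)
    then have ke: "k \<otimes> e = ?q" unfolding v(3) using w by simp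
    define f where "f = complex_of_real (1 / N) \<odot> (\<one> \<ominus> k)"
    have f: "f \<in> carrier M" using k by (simp add: f_def)
    have "e \<ominus> ?q = sc N" unfolding eq using w by (simp add: minus_eq a_assoc r_neg)
    then have "e \<otimes> (\<one> \<ominus> k) = sc N" "(\<one> \<ominus> k) \<otimes> e = sc N"
      using npos_closed[OF e] k ek ke by (auto simp: minus_eq l_distr r_distr l_minus r_minus)
    then have ef: "e \<otimes> f = \<one>" "f \<otimes> e = \<one>"
      using npos_closed[OF e] k N by (auto simp: f_def sc_def)
    define T where "T = nrm M f + 1 / N"
    have T: "T > 0" "T \<ge> nrm M f" "1 / T \<le> N"
      using N nrm_nonneg[OF f] by (auto simp: T_def field_simps add_pos_nonneg)
    have "npos (e \<ominus> sc (1 / T))" using npos_invertible_bound[OF e f ef T(1,2)] .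
    moreover have "e \<ominus> sc (1 / T) = sc (N - 1 / T) \<ominus> g \<otimes> g"
      using gg by (simp add: e_def sc_diff minus_eq a_ac)
    ultimately have "N \<le> N - 1 / T"
      using npos_norm_le[OF npos_square[OF g], of "N - 1 / T"] T by (simp add: N_def)
    then show False using T by simp
  qed
  then have "(nrm M w)\<^sup>2 = 0" using cstar_identity[OF w] ww gg nrm_neg by simp
  then have "w = \<zero>" using nrm_eq_0_iff[OF w] by simp
  then have "x \<otimes> n = \<zero>" using z n by (simp add: x_def w_def m_assoc)
  then have nx0: "n \<otimes> x = \<zero>" using xn by simp
  then have "\<ominus> (\<ominus> (n \<otimes> m)) = \<zero>" using nx by simp
  then have "n \<otimes> m = \<zero>" using n m by simp
  then have "n \<otimes> n = \<zero>" using nx0 n m x by (subst (2) n_def) (simp add: minus_eq r_distr r_minus)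
  then have "n = \<zero>" using nrm_sa_square[OF n] nrm_eq_0_iff[OF n(1)] by simp
  then have "m = x" using m x diff_eq_zero_iff by (simp add: n_def)
  then show ?thesis using m(4) by (simp add: x_def)
qed

subsection \<open>The positive cone\<close>

abbreviation pos :: "'a \<Rightarrow> bool" where "pos \<equiv> cstar_positive M"

lemma pos_iff_npos: "pos a \<longleftrightarrow> npos a"
proof
  show "npos a" if "pos a" using that star_mult_npos unfolding cstar_positive_def by blast
  assume "npos a"
  then obtain r where "r \<in> carrier M" "star M r = r" "r \<otimes> r = a" using npos_sqrt by metis
  then show "pos a" unfolding cstar_positive_def by metis
qed

lemma pos_star_mult [intro]: "z \<in> carrier M \<Longrightarrow> pos (star M z \<otimes> z)"
  unfolding cstar_positive_def by blast

lemma pos_mult_star: "z \<in> carrier M \<Longrightarrow> pos (z \<otimes> star M z)"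
  using pos_star_mult[of "star M z"] by simp

lemma pos_closed: "pos a \<Longrightarrow> a \<in> carrier M" by (simp add: pos_iff_npos npos_closed)
lemma pos_star: "pos a \<Longrightarrow> star M a = a" by (simp add: pos_iff_npos npos_star)
lemma pos_add: "\<lbrakk>pos a; pos b\<rbrakk> \<Longrightarrow> pos (a \<oplus> b)" by (simp add: pos_iff_npos npos_add)
lemma pos_scale: "\<lbrakk>pos a; r \<ge> 0\<rbrakk> \<Longrightarrow> pos (complex_of_real r \<odot> a)" by (simp add: pos_iff_npos npos_scale)
lemma pos_zero [simp]: "pos \<zero>" using pos_star_mult[of \<zero>] by simp
lemma pos_one [simp]: "pos \<one>" using pos_star_mult[of \<one>] by simp
lemma pos_sc: "r \<ge> 0 \<Longrightarrow> pos (sc r)" using pos_scale[OF pos_one] by (simp add: sc_def)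

lemma pos_finsum: "\<lbrakk>finite I; \<And>i. i \<in> I \<Longrightarrow> pos (f i)\<rbrakk> \<Longrightarrow> pos (finsum M f I)"
proof (induction I rule: finite_induct)
  case (insert i I)
  then have "f \<in> I \<rightarrow> carrier M" "f i \<in> carrier M" using pos_closed by auto
  then show ?case using insert pos_add by simp
qed simp

lemma pos_conj: assumes "pos a" "c \<in> carrier M" shows "pos (star M c \<otimes> a \<otimes> c)"
proof -
  obtain z where z: "z \<in> carrier M" "a = star M z \<otimes> z" using assms unfolding cstar_positive_def by blast
  then have "star M c \<otimes> a \<otimes> c = star M (z \<otimes> c) \<otimes> (z \<otimes> c)"
    using assms by (simp add: star_mult m_assoc)
  then show ?thesis using z assms by auto
qed

lemma pos_norm_minus:
  "\<lbrakk>x \<in> carrier M; star M x = x; nrm M x \<le> s\<rbrakk> \<Longrightarrow> pos (sc s \<ominus> x)"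
  by (simp add: pos_iff_npos npos_norm_minus)

lemma pos_norm_le: "\<lbrakk>pos a; pos (sc s \<ominus> a); s \<ge> 0\<rbrakk> \<Longrightarrow> nrm M a \<le> s"
  by (simp add: pos_iff_npos npos_norm_le)

lemma pos_diff_trans:
  assumes "pos (b \<ominus> a)" "pos (c \<ominus> b)" "a \<in> carrier M" "b \<in> carrier M" "c \<in> carrier M"
  shows "pos (c \<ominus> a)"
  using pos_add[OF assms(2,1)] diff_split[of c b a] assms by simp

lemma pos_norm_mono:
  assumes "pos a" "pos (b \<ominus> a)" "b \<in> carrier M" shows "nrm M a \<le> nrm M b"
proof -
  note ac = pos_closed[OF assms(1)]
  have "b = a \<oplus> (b \<ominus> a)" using ac assms(3) by (simp add: minus_eq a_comm[of b] r_neg2)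
  then have b: "pos b" using pos_add[OF assms(1,2)] by simp
  have "pos (sc (nrm M b) \<ominus> a)"
    using pos_diff_trans[OF assms(2) pos_norm_minus[OF assms(3) pos_star[OF b] order_refl]] ac assms(3) by simp
  then show ?thesis using pos_norm_le[OF assms(1)] nrm_nonneg[OF assms(3)] by blast
qed

lemma pos_inverse_sqrt:
  assumes "b \<in> carrier M" "pos (b \<ominus> sc \<epsilon>)" "\<epsilon> > 0"
  obtains h k where "h \<in> carrier M" "k \<in> carrier M" "star M h = h" "star M k = k"
    "h \<otimes> k = \<one>" "k \<otimes> h = \<one>" "k \<otimes> k = b"
    "\<And>w. \<lbrakk>w \<in> carrier M; w \<otimes> b = b \<otimes> w\<rbrakk> \<Longrightarrow> w \<otimes> k = k \<otimes> w"
    "\<And>w. \<lbrakk>w \<in> carrier M; w \<otimes> b = b \<otimes> w\<rbrakk> \<Longrightarrow> w \<otimes> h = h \<otimes> w"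
proof -
  have "b = (b \<ominus> sc \<epsilon>) \<oplus> sc \<epsilon>" using assms(1) by (simp add: minus_eq a_assoc l_neg)
  then have "npos b" using pos_add[OF assms(2) pos_sc[of \<epsilon>]] assms(3) pos_iff_npos by simp
  then obtain k where k: "k \<in> carrier M" "star M k = k" "k \<otimes> k = b"
    and kc: "\<And>w. \<lbrakk>w \<in> carrier M; w \<otimes> b = b \<otimes> w\<rbrakk> \<Longrightarrow> w \<otimes> k = k \<otimes> w"
    using npos_sqrt by metis
  obtain v where v: "v \<in> carrier M" "b \<otimes> v = \<one>" "v \<otimes> b = \<one>"
    using npos_invertible[OF assms(1) _ assms(3)] assms(2) pos_iff_npos by blast
  define h where "h = v \<otimes> k"
  have h: "h \<in> carrier M" "h \<otimes> k = \<one>" using v k by (auto simp: h_def m_assoc)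
  have kv: "k \<otimes> (k \<otimes> v) = \<one>" using v k by (simp flip: m_assoc)
  have "h = h \<otimes> (k \<otimes> (k \<otimes> v))" unfolding kv using h by simp
  also have "\<dots> = (h \<otimes> k) \<otimes> (k \<otimes> v)" using h(1) k(1) v(1) by (simp add: m_assoc)
  also have "\<dots> = k \<otimes> v" using h k v by simp
  finally have kh: "k \<otimes> h = \<one>" using kv by simp
  have "star M h \<otimes> k = \<one>" using star_mult[of k h] h k kh by simp
  then have "star M h \<otimes> (k \<otimes> h) = h" using h k by (simp flip: m_assoc)
  then have hs: "star M h = h" using h kh by simp
  have hc: "w \<otimes> h = h \<otimes> w" if w: "w \<in> carrier M" "w \<otimes> b = b \<otimes> w" for w
  proof -
    have "w \<otimes> h = (h \<otimes> k) \<otimes> (w \<otimes> h)" using w h by simp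
    also have "\<dots> = h \<otimes> (w \<otimes> k) \<otimes> h" using w h(1) k(1) kc[OF w] by (simp add: m_assoc)
    also have "\<dots> = h \<otimes> w \<otimes> (k \<otimes> h)" using w h(1) k(1) by (simp add: m_assoc)
    finally show ?thesis using w h kh by simp
  qed
  show ?thesis using that[OF h(1) k(1) hs k(2) h(2) kh k(3) kc hc] .
qed

lemma star_finsum:
  "\<lbrakk>finite I; f \<in> I \<rightarrow> carrier M\<rbrakk> \<Longrightarrow> star M (finsum M f I) = (\<Oplus>i\<in>I. star M (f i))"
proof (induction I rule: finite_induct)
  case (insert i I)
  then have "f \<in> I \<rightarrow> carrier M" "f i \<in> carrier M" "(\<lambda>i. star M (f i)) \<in> I \<rightarrow> carrier M"
    by (simp_all add: Pi_def)
  then show ?case using insert by (simp add: star_add)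
qed simp

lemma smult_finsum:
  "\<lbrakk>finite I; f \<in> I \<rightarrow> carrier M\<rbrakk> \<Longrightarrow> z \<odot> (finsum M f I) = (\<Oplus>i\<in>I. z \<odot> f i)"
proof (induction I rule: finite_induct)
  case (insert i I)
  then have "f \<in> I \<rightarrow> carrier M" "f i \<in> carrier M" "(\<lambda>i. z \<odot> f i) \<in> I \<rightarrow> carrier M"
    by (simp_all add: Pi_def)
  then show ?case using insert by (simp add: smult_addr)
qed simp

end

text \<open>A *-homomorphism preserves \<open>x* x \<le> s\<close>, since it maps \<open>z* z\<close> to an element of the same form.\<close>

lemma star_hom_contractive:
  fixes M :: "('a, 'm) cstar_scheme" and N :: "('b, 'n) cstar_scheme" (structure)
  assumes "unital_cstar_algebra M" "unital_cstar_algebra N"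
    and f: "f \<in> carrier M \<rightarrow> carrier N"
    and add: "\<And>x y. \<lbrakk>x \<in> carrier M; y \<in> carrier M\<rbrakk> \<Longrightarrow> f (x \<oplus>\<^bsub>M\<^esub> y) = f x \<oplus>\<^bsub>N\<^esub> f y"
    and smult: "\<And>z x. x \<in> carrier M \<Longrightarrow> f (z \<odot>\<^bsub>M\<^esub> x) = z \<odot>\<^bsub>N\<^esub> f x"
    and mult: "\<And>x y. \<lbrakk>x \<in> carrier M; y \<in> carrier M\<rbrakk> \<Longrightarrow> f (x \<otimes>\<^bsub>M\<^esub> y) = f x \<otimes>\<^bsub>N\<^esub> f y"
    and star: "\<And>x. x \<in> carrier M \<Longrightarrow> f (star M x) = star N (f x)"
    and one: "f \<one>\<^bsub>M\<^esub> = \<one>\<^bsub>N\<^esub>"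
    and x: "x \<in> carrier M"
  shows "nrm N (f x) \<le> nrm M x"
proof -
  interpret M: unital_cstar_algebra M by fact
  interpret N: unital_cstar_algebra N by fact
  let ?b = "star M x \<otimes>\<^bsub>M\<^esub> x" and ?s = "(nrm M x)\<^sup>2"
  have fx: "f x \<in> carrier N" using f x by blast
  have b: "?b \<in> carrier M" "star M ?b = ?b" using x by (simp_all add: M.star_mult)
  have "M.pos (M.sc ?s \<ominus>\<^bsub>M\<^esub> ?b)" using M.pos_norm_minus[OF b] M.cstar_identity[OF x] by simp
  then obtain z where z: "z \<in> carrier M" "M.sc ?s \<ominus>\<^bsub>M\<^esub> ?b = star M z \<otimes>\<^bsub>M\<^esub> z"
    unfolding cstar_positive_def by blast
  have "f (M.sc ?s) = N.sc ?s" unfolding M.sc_def N.sc_def by (simp add: smult one)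
  moreover have "f (M.sc ?s \<ominus>\<^bsub>M\<^esub> ?b) = f (M.sc ?s) \<ominus>\<^bsub>N\<^esub> star N (f x) \<otimes>\<^bsub>N\<^esub> f x"
  proof -
    have "f (M.sc ?s \<oplus>\<^bsub>M\<^esub> (- 1) \<odot>\<^bsub>M\<^esub> ?b) = f (M.sc ?s) \<oplus>\<^bsub>N\<^esub> (- 1) \<odot>\<^bsub>N\<^esub> f ?b"
      using b by (simp add: add smult del: M.smult_mult)
    then show ?thesis
      using b x fx unfolding M.smult_neg_one[OF b(1)]
      by (subst (asm) N.smult_neg_one) (auto simp: M.minus_eq N.minus_eq mult star)
  qed
  ultimately have "N.sc ?s \<ominus>\<^bsub>N\<^esub> star N (f x) \<otimes>\<^bsub>N\<^esub> f x = star N (f z) \<otimes>\<^bsub>N\<^esub> f z"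
    using z by (simp add: mult star)
  then have "N.pos (N.sc ?s \<ominus>\<^bsub>N\<^esub> star N (f x) \<otimes>\<^bsub>N\<^esub> f x)" using z f by auto
  then have "nrm N (star N (f x) \<otimes>\<^bsub>N\<^esub> f x) \<le> ?s"
    using N.pos_norm_le[OF N.pos_star_mult[OF fx]] by simp
  then have "(nrm N (f x))\<^sup>2 \<le> ?s" using N.cstar_identity[OF fx] by simp
  then show ?thesis using M.nrm_nonneg[OF x] power2_le_imp_le by blast
qed

section \<open>Finite sums in abelian groups\<close>

lemma additive_finsum:
  assumes "abelian_group G" "abelian_group K" "f \<in> carrier G \<rightarrow> carrier K"
    and add: "\<And>x y. \<lbrakk>x \<in> carrier G; y \<in> carrier G\<rbrakk> \<Longrightarrow> f (x \<oplus>\<^bsub>G\<^esub> y) = f x \<oplus>\<^bsub>K\<^esub> f y"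
    and "finite I" "g \<in> I \<rightarrow> carrier G"
  shows "f (finsum G g I) = finsum K (\<lambda>i. f (g i)) I"
proof -
  interpret G: abelian_group G by fact
  interpret K: abelian_group K by fact
  have f: "f x \<in> carrier K" if "x \<in> carrier G" for x using assms that by blast
  have "f \<zero>\<^bsub>G\<^esub> \<oplus>\<^bsub>K\<^esub> f \<zero>\<^bsub>G\<^esub> = f \<zero>\<^bsub>G\<^esub>" using add[of "\<zero>\<^bsub>G\<^esub>" "\<zero>\<^bsub>G\<^esub>"] by simp
  then have f0: "f \<zero>\<^bsub>G\<^esub> = \<zero>\<^bsub>K\<^esub>" using f[of "\<zero>\<^bsub>G\<^esub>"] by simp
  show ?thesis using assms(5,6)
  proof (induction I rule: finite_induct)
    case (insert i I)
    then have "g \<in> I \<rightarrow> carrier G" "g i \<in> carrier G" "(\<lambda>i. f (g i)) \<in> I \<rightarrow> carrier K"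
      using f by (simp_all add: Pi_def)
    then show ?case using insert add f by simp
  qed (simp add: f0)
qed

lemma (in abelian_group) finsum_diff:
  assumes "finite I" "f \<in> I \<rightarrow> carrier G" "g \<in> I \<rightarrow> carrier G"
  shows "finsum G f I \<ominus> finsum G g I = (\<Oplus>i\<in>I. f i \<ominus> g i)"
proof -
  have "(\<ominus> finsum G g I) = (\<Oplus>i\<in>I. \<ominus> g i)"
    using assms by (intro additive_finsum[of G G]) (auto simp: minus_add intro: abelian_group_axioms)
  moreover have "(\<Oplus>i\<in>I. f i \<ominus> g i) = finsum G f I \<oplus> (\<Oplus>i\<in>I. \<ominus> g i)"
    unfolding minus_eq using assms by (subst finsum_addf) (auto simp: Pi_def)
  ultimately show ?thesis by (simp add: minus_eq)
qed

lemma (in abelian_monoid) finsum_swap: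
  assumes "finite I" "finite J" "\<And>i j. \<lbrakk>i \<in> I; j \<in> J\<rbrakk> \<Longrightarrow> f i j \<in> carrier G"
  shows "(\<Oplus>i\<in>I. \<Oplus>j\<in>J. f i j) = (\<Oplus>j\<in>J. \<Oplus>i\<in>I. f i j)"
  using assms(1,3)
proof (induction I rule: finite_induct)
  case (insert i I)
  have "(\<Oplus>j\<in>J. \<Oplus>i\<in>insert i I. f i j) = (\<Oplus>j\<in>J. f i j \<oplus> (\<Oplus>i\<in>I. f i j))"
    using insert assms(2) by (intro finsum_cong') (auto simp: Pi_def)
  also have "\<dots> = (\<Oplus>j\<in>J. f i j) \<oplus> (\<Oplus>j\<in>J. \<Oplus>i\<in>I. f i j)"
    using insert assms(2) by (intro finsum_addf) (auto simp: Pi_def)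
  finally show ?case using insert assms(2) by (simp add: Pi_def)
qed (simp add: finsum_zero)

lemma (in abelian_monoid) finsum_times:
  assumes "finite I" "finite J" "\<And>i j. \<lbrakk>i \<in> I; j \<in> J\<rbrakk> \<Longrightarrow> f i j \<in> carrier G"
  shows "(\<Oplus>x\<in>I \<times> J. f (fst x) (snd x)) = (\<Oplus>i\<in>I. \<Oplus>j\<in>J. f i j)"
  using assms(1,3)
proof (induction I rule: finite_induct)
  case (insert i I)
  have "insert i I \<times> J = Pair i ` J \<union> I \<times> J" by auto
  then have "(\<Oplus>x\<in>insert i I \<times> J. f (fst x) (snd x))
      = (\<Oplus>x\<in>Pair i ` J. f (fst x) (snd x)) \<oplus> (\<Oplus>x\<in>I \<times> J. f (fst x) (snd x))"
    using insert assms(2) by (simp only:, intro finsum_Un_disjoint) auto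
  also have "(\<Oplus>x\<in>Pair i ` J. f (fst x) (snd x)) = (\<Oplus>j\<in>J. f (fst (i, j)) (snd (i, j)))"
    using insert by (intro finsum_reindex) (auto simp: inj_on_def)
  finally show ?case using insert assms(2) by (simp add: Pi_def finsum_closed)
qed simp

lemma (in abelian_monoid) finsum_lessThan_Suc:
  assumes "\<And>i. i < Suc n \<Longrightarrow> f i \<in> carrier G"
  shows "(\<Oplus>i\<in>{..<Suc n}. f i) = f 0 \<oplus> (\<Oplus>i\<in>{..<n}. f (Suc i))"
proof -
  have "(\<Oplus>i\<in>Suc ` {..<n}. f i) = (\<Oplus>i\<in>{..<n}. f (Suc i))"
    using assms by (intro finsum_reindex) auto
  moreover have "(\<Oplus>i\<in>insert 0 (Suc ` {..<n}). f i) = f 0 \<oplus> (\<Oplus>i\<in>Suc ` {..<n}. f i)"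
    using assms by (intro finsum_insert) auto
  ultimately show ?thesis by (simp add: lessThan_Suc_eq_insert_0)
qed

section \<open>Inclusions\<close>

lemma cstar_sub_simps [simp]:
  "star (C\<lparr>carrier := A\<rparr>) = star C" "nrm (C\<lparr>carrier := A\<rparr>) = nrm C"
  by (cases C, simp)+

locale cstar_inclusion = C: unital_cstar_algebra C for A and C :: "('c, 'm) cstar_scheme" (structure) +
  assumes incl: "unital_inclusion A C"
begin

lemma sub_subring: "subring A C" and sub_submodule: "submodule A complex_ring C"
  and sub_star: "a \<in> A \<Longrightarrow> star C a \<in> A" and sub_closedin: "closedin (ntopology C (nrm C)) A"
  using incl by (simp_all add: unital_inclusion_def)

lemma sub_carrier: "a \<in> A \<Longrightarrow> a \<in> carrier C" and sub_zero: "\<zero> \<in> A" and sub_one: "\<one> \<in> A"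
  and sub_uminus: "a \<in> A \<Longrightarrow> \<ominus> a \<in> A"
  and sub_add: "\<lbrakk>a \<in> A; b \<in> A\<rbrakk> \<Longrightarrow> a \<oplus> b \<in> A"
  and sub_mult: "\<lbrakk>a \<in> A; b \<in> A\<rbrakk> \<Longrightarrow> a \<otimes> b \<in> A"
  using subringE[OF sub_subring] by blast+

lemma sub_diff: "\<lbrakk>a \<in> A; b \<in> A\<rbrakk> \<Longrightarrow> a \<ominus> b \<in> A"
  by (simp add: C.minus_eq sub_add sub_uminus)

lemma sub_smult: "a \<in> A \<Longrightarrow> z \<odot> a \<in> A"
  using submodule.smult_closed[OF sub_submodule] by (simp add: complex_ring_def)

lemma sub_finsum: "\<lbrakk>finite I; \<And>i. i \<in> I \<Longrightarrow> f i \<in> A\<rbrakk> \<Longrightarrow> finsum C f I \<in> A"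
proof (induction I rule: finite_induct)
  case (insert i I)
  then show ?case using sub_add sub_carrier by (simp add: Pi_def)
qed (simp add: sub_zero)

lemma sub_limit:
  "\<lbrakk>\<And>n. f n \<in> A; l \<in> carrier C; (\<lambda>n. nrm C (f n \<ominus> l)) \<longlonglongrightarrow> 0\<rbrakk> \<Longrightarrow> l \<in> A"
  using sub_closedin unfolding C.closedin_iff by blast

abbreviation "CA \<equiv> C\<lparr>carrier := A\<rparr>"

lemma sub_a_minus: assumes "a \<in> A" "b \<in> A" shows "a \<ominus>\<^bsub>CA\<^esub> b = a \<ominus> b"
proof -
  interpret S: ring CA using C.subring_is_ring[OF sub_subring] .
  have "b \<oplus> (\<ominus>\<^bsub>CA\<^esub> b) = \<zero>" "(\<ominus>\<^bsub>CA\<^esub> b) \<in> A"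
    using S.r_neg[of b] S.a_inv_closed[of b] assms by simp_all
  then have "(\<ominus>\<^bsub>CA\<^esub> b) = \<ominus> b"
    using assms sub_carrier C.minus_equality[of "\<ominus>\<^bsub>CA\<^esub> b" b] C.a_comm[of b] by simp
  then show ?thesis by (simp add: a_minus_def)
qed

lemma sub_cstar: "unital_cstar_algebra CA"
proof (intro unital_cstar_algebra.intro unital_cstar_algebra_axioms.intro)
  show "ring CA" using C.subring_is_ring[OF sub_subring] .
  then interpret S: ring CA .
  show "module complex_ring CA"
    using submodule.submodule_is_module[OF sub_submodule C.complex_module] .
  have neg: "(\<ominus>\<^bsub>CA\<^esub> b) = \<ominus> b" if "b \<in> A" for b
    using sub_a_minus[OF sub_zero that] S.a_inv_closed[of b] that sub_carrier[of "\<ominus>\<^bsub>CA\<^esub> b"] sub_carrier[OF that]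
    by (simp add: a_minus_def)
  have ms: "Metric_space (carrier CA) (ndist CA (nrm CA))"
    by (rule S.Metric_space_ndist)
      (auto simp: C.nrm_nonneg C.nrm_eq_0_iff sub_carrier C.nrm_triangle neg)
  show "ncomplete CA (nrm CA)"
    unfolding ncomplete_iff[OF ms]
  proof (intro allI impI, elim conjE)
    fix f :: "nat \<Rightarrow> 'c"
    assume f: "\<forall>n. f n \<in> carrier CA"
      and c: "\<forall>e>0. \<exists>K. \<forall>m\<ge>K. \<forall>n\<ge>K. nrm CA (f m \<ominus>\<^bsub>CA\<^esub> f n) < e"
    have f: "f n \<in> A" for n using f by simp
    obtain l where l: "l \<in> carrier C" "(\<lambda>n. nrm C (f n \<ominus> l)) \<longlonglongrightarrow> 0"
      using C.cauchy_limit[of f] c f sub_carrier by (auto simp: sub_a_minus)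
    have "l \<in> A" using sub_limit[OF f l] .
    then show "\<exists>l\<in>carrier CA. (\<lambda>n. nrm CA (f n \<ominus>\<^bsub>CA\<^esub> l)) \<longlonglongrightarrow> 0"
      using l f by (intro bexI[of _ l]) (auto simp: sub_a_minus)
  qed
qed (auto simp: sub_carrier sub_star C.star_add C.star_smult C.star_mult C.nrm_nonneg C.nrm_eq_0_iff
  C.nrm_triangle C.nrm_smult C.nrm_mult C.cstar_identity)

sublocale S: unital_cstar_algebra CA by (rule sub_cstar)

lemma sub_sc: "S.sc r = C.sc r" unfolding S.sc_def C.sc_def by simp

text \<open>The criterion by norms is the same in \<open>A\<close> and in \<open>C\<close>.\<close>

lemma sub_pos: "cstar_positive CA a \<longleftrightarrow> a \<in> A \<and> cstar_positive C a"
proof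
  assume "cstar_positive CA a"
  then show "a \<in> A \<and> cstar_positive C a"
    unfolding cstar_positive_def using sub_carrier sub_mult sub_star by auto
next
  assume a: "a \<in> A \<and> cstar_positive C a"
  then obtain t where "t \<ge> 0" "nrm C (C.sc t \<ominus> a) \<le> t" "star C a = a"
    unfolding C.pos_iff_npos C.npos_def by blast
  moreover have "C.sc t \<in> A" unfolding C.sc_def using sub_smult sub_one by simp
  ultimately show "cstar_positive CA a"
    using a unfolding S.pos_iff_npos S.npos_def by (auto simp: sub_sc sub_a_minus)
qed

end

lemma (in unital_cstar_algebra) unital_inclusionI:
  assumes "A \<subseteq> carrier M" "\<one> \<in> A"
    and "\<And>a b. \<lbrakk>a \<in> A; b \<in> A\<rbrakk> \<Longrightarrow> a \<oplus> b \<in> A" "\<And>a b. \<lbrakk>a \<in> A; b \<in> A\<rbrakk> \<Longrightarrow> a \<otimes> b \<in> A"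
    and smult: "\<And>z a. a \<in> A \<Longrightarrow> z \<odot> a \<in> A" and "\<And>a. a \<in> A \<Longrightarrow> star M a \<in> A"
    and "\<And>(f :: nat \<Rightarrow> 'a) l. \<lbrakk>\<And>n. f n \<in> A; l \<in> carrier M; (\<lambda>n. nrm M (f n \<ominus> l)) \<longlonglongrightarrow> 0\<rbrakk> \<Longrightarrow> l \<in> A"
  shows "unital_inclusion A M"
proof -
  have neg: "\<ominus> a \<in> A" if "a \<in> A" for a
    using smult[OF that, of "-1"] smult_neg_one that assms(1) by auto
  have "\<zero> \<in> A" using smult[OF assms(2), of 0] by simp
  then have "submodule A complex_ring M"
    using assms neg by (intro module.submoduleI[OF complex_module]) auto
  moreover have "subring A M" using assms neg by (intro subringI) auto
  moreover have "closedin (ntopology M (nrm M)) A"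
    unfolding closedin_iff using assms(1,7) by blast
  ultimately show ?thesis
    unfolding unital_inclusion_def using assms(6) unital_cstar_algebra_axioms by auto
qed

lemma (in unital_cstar_algebra) carrier_inclusion: "unital_inclusion (carrier M) M"
  by (rule unital_inclusionI) auto

section \<open>Finitely generated Hilbert modules\<close>

text \<open>A Hilbert module with a finite frame \<open>u\<close>, that is \<open>x = \<Sum> u i \<langle>u i, x\<rangle>\<close> for all \<open>x\<close>. The frame makes the
  module complete, and every operator on it is determined by finitely many elements. The three
  modules in question have one: \<open>C\<close> over \<open>A\<close> for an expectation of index-finite type, where the frame is a
  quasi-basis, and the sum \<open>Y \<oplus> D\<close>.\<close>

locale framed_hilbert_module = A: unital_cstar_algebra A
  for A :: "('a, 'm) cstar_scheme" (structure) +
  fixes H :: "(complex, 'h, 'k) module_scheme" and ra :: "'h \<Rightarrow> 'a \<Rightarrow> 'h" and ip :: "'h \<Rightarrow> 'h \<Rightarrow> 'a"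
    and k :: nat and u :: "nat \<Rightarrow> 'h"
  assumes H_module: "module complex_ring H"
    and ra_closed [simp]: "\<lbrakk>x \<in> carrier H; a \<in> carrier A\<rbrakk> \<Longrightarrow> ra x a \<in> carrier H"
    and ip_closed [simp]: "\<lbrakk>x \<in> carrier H; y \<in> carrier H\<rbrakk> \<Longrightarrow> ip x y \<in> carrier A"
    and ip_add: "\<lbrakk>x \<in> carrier H; y \<in> carrier H; y' \<in> carrier H\<rbrakk> \<Longrightarrow> ip x (y \<oplus>\<^bsub>H\<^esub> y') = ip x y \<oplus> ip x y'"
    and ip_smult: "\<lbrakk>x \<in> carrier H; y \<in> carrier H\<rbrakk> \<Longrightarrow> ip x (z \<odot>\<^bsub>H\<^esub> y) = z \<odot> ip x y"
    and ip_ra: "\<lbrakk>x \<in> carrier H; y \<in> carrier H; a \<in> carrier A\<rbrakk> \<Longrightarrow> ip x (ra y a) = ip x y \<otimes> a"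
    and ip_star: "\<lbrakk>x \<in> carrier H; y \<in> carrier H\<rbrakk> \<Longrightarrow> star A (ip x y) = ip y x"
    and ip_pos: "x \<in> carrier H \<Longrightarrow> cstar_positive A (ip x x)"
    and u_closed: "i < k \<Longrightarrow> u i \<in> carrier H"
    and frame: "x \<in> carrier H \<Longrightarrow> x = (\<Oplus>\<^bsub>H\<^esub>i\<in>{..<k}. ra (u i) (ip (u i) x))"
begin

sublocale H: abelian_group H using H_module by (simp add: module_def)

lemma hsmult_closed [simp]: "x \<in> carrier H \<Longrightarrow> z \<odot>\<^bsub>H\<^esub> x \<in> carrier H"
  using module.smult_closed[OF H_module] by (simp add: complex_ring_def)

lemma hsmult_addl: "x \<in> carrier H \<Longrightarrow> (z + w) \<odot>\<^bsub>H\<^esub> x = z \<odot>\<^bsub>H\<^esub> x \<oplus>\<^bsub>H\<^esub> w \<odot>\<^bsub>H\<^esub> x"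
  using module.smult_l_distr[OF H_module] by (simp add: complex_ring_def)

lemma hsmult_addr: "\<lbrakk>x \<in> carrier H; y \<in> carrier H\<rbrakk> \<Longrightarrow> z \<odot>\<^bsub>H\<^esub> (x \<oplus>\<^bsub>H\<^esub> y) = z \<odot>\<^bsub>H\<^esub> x \<oplus>\<^bsub>H\<^esub> z \<odot>\<^bsub>H\<^esub> y"
  using module.smult_r_distr[OF H_module] by (simp add: complex_ring_def)

lemma hsmult_smult [simp]: "x \<in> carrier H \<Longrightarrow> z \<odot>\<^bsub>H\<^esub> (w \<odot>\<^bsub>H\<^esub> x) = (z * w) \<odot>\<^bsub>H\<^esub> x"
  using module.smult_assoc1[OF H_module] by (simp add: complex_ring_def)

lemma hsmult_one [simp]: "x \<in> carrier H \<Longrightarrow> 1 \<odot>\<^bsub>H\<^esub> x = x"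
  using module.smult_one[OF H_module] by (simp add: complex_ring_def)

lemma hsmult_zl [simp]: "x \<in> carrier H \<Longrightarrow> 0 \<odot>\<^bsub>H\<^esub> x = \<zero>\<^bsub>H\<^esub>"
  using module.smult_l_null[OF H_module] by (simp add: complex_ring_def)

lemma hsmult_neg_one: "x \<in> carrier H \<Longrightarrow> (- 1) \<odot>\<^bsub>H\<^esub> x = \<ominus>\<^bsub>H\<^esub> x"
  using hsmult_addl[of x "-1" 1] H.minus_equality[of "(-1) \<odot>\<^bsub>H\<^esub> x" x] by simp

lemma frame_ext:
  assumes "x \<in> carrier H" "y \<in> carrier H" "\<And>i. i < k \<Longrightarrow> ip (u i) x = ip (u i) y" shows "x = y"
proof -
  have "x = (\<Oplus>\<^bsub>H\<^esub>i\<in>{..<k}. ra (u i) (ip (u i) x))" by (rule frame[OF assms(1)])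
  also have "\<dots> = (\<Oplus>\<^bsub>H\<^esub>i\<in>{..<k}. ra (u i) (ip (u i) y))"
    using assms u_closed by (intro H.finsum_cong') auto
  also have "\<dots> = y" by (rule frame[OF assms(2), symmetric])
  finally show ?thesis .
qed

lemma ip_ext:
  assumes "x \<in> carrier H" "y \<in> carrier H" "\<And>z. z \<in> carrier H \<Longrightarrow> ip z x = ip z y" shows "x = y"
  using frame_ext assms u_closed by blast

lemma ip_add_left: "\<lbrakk>x \<in> carrier H; x' \<in> carrier H; y \<in> carrier H\<rbrakk> \<Longrightarrow> ip (x \<oplus>\<^bsub>H\<^esub> x') y = ip x y \<oplus> ip x' y"
  using ip_star[of y "x \<oplus>\<^bsub>H\<^esub> x'"] ip_star[of y x] ip_star[of y x'] by (simp add: ip_add A.star_add)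

lemma ip_smult_left: "\<lbrakk>x \<in> carrier H; y \<in> carrier H\<rbrakk> \<Longrightarrow> ip (z \<odot>\<^bsub>H\<^esub> x) y = cnj z \<odot> ip x y"
  using ip_star[of y "z \<odot>\<^bsub>H\<^esub> x"] ip_star[of y x] by (simp add: ip_smult A.star_smult)

lemma ip_ra_left: "\<lbrakk>x \<in> carrier H; y \<in> carrier H; a \<in> carrier A\<rbrakk> \<Longrightarrow> ip (ra x a) y = star A a \<otimes> ip x y"
  using ip_star[of y "ra x a"] ip_star[of y x] by (simp add: ip_ra A.star_mult)

lemma ip_neg: "\<lbrakk>x \<in> carrier H; y \<in> carrier H\<rbrakk> \<Longrightarrow> ip x (\<ominus>\<^bsub>H\<^esub> y) = \<ominus> ip x y"
  using ip_smult[of x y "-1"] by (simp add: hsmult_neg_one A.smult_neg_one)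

lemma ip_neg_left: "\<lbrakk>x \<in> carrier H; y \<in> carrier H\<rbrakk> \<Longrightarrow> ip (\<ominus>\<^bsub>H\<^esub> x) y = \<ominus> ip x y"
  using ip_smult_left[of x y "-1"] by (simp add: hsmult_neg_one A.smult_neg_one)

lemma ip_zero [simp]: "x \<in> carrier H \<Longrightarrow> ip x \<zero>\<^bsub>H\<^esub> = \<zero>"
  using ip_smult[of x "\<zero>\<^bsub>H\<^esub>" 0] by simp

lemma ip_diff: "\<lbrakk>x \<in> carrier H; y \<in> carrier H; z \<in> carrier H\<rbrakk> \<Longrightarrow> ip x (y \<ominus>\<^bsub>H\<^esub> z) = ip x y \<ominus> ip x z"
  by (simp add: H.minus_eq A.minus_eq ip_add ip_neg)

lemma ip_diff_left: "\<lbrakk>x \<in> carrier H; y \<in> carrier H; z \<in> carrier H\<rbrakk> \<Longrightarrow> ip (y \<ominus>\<^bsub>H\<^esub> z) x = ip y x \<ominus> ip z x"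
  by (simp add: H.minus_eq A.minus_eq ip_add_left ip_neg_left)

definition hn :: "'h \<Rightarrow> real" where "hn x = sqrt (nrm A (ip x x))"

lemma hn_nonneg [simp]: "x \<in> carrier H \<Longrightarrow> 0 \<le> hn x" by (simp add: hn_def A.nrm_nonneg)

lemma hn_square: "x \<in> carrier H \<Longrightarrow> (hn x)\<^sup>2 = nrm A (ip x x)"
  by (simp add: hn_def A.nrm_nonneg)

text \<open>As usual, from the positivity of the inner square of \<open>y - x \<langle>x, y\<rangle> / N\<close> for any \<open>N\<close> above the norm of
  \<open>\<langle>x, x\<rangle>\<close>.\<close>

lemma cauchy_schwarz:
  assumes x: "x \<in> carrier H" and y: "y \<in> carrier H"
  shows "nrm A (ip x y) \<le> hn x * hn y"
proof -
  define b c d where "b = ip x x" and "c = ip x y" and "d = ip y y"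
  have bcd: "b \<in> carrier A" "c \<in> carrier A" "d \<in> carrier A" "star A b = b" "A.pos b" "A.pos d"
    using x y ip_star ip_pos by (simp_all add: b_def c_def d_def)
  have key: "(nrm A c)\<^sup>2 \<le> N * nrm A d" if N: "N > 0" "nrm A b \<le> N" for N
  proof -
    define a where "a = complex_of_real (1 / N) \<odot> c"
    define p where "p = star A a \<otimes> b \<otimes> a"
    define q where "q = complex_of_real (1 / N) \<odot> (star A c \<otimes> c)"
    have apq: "a \<in> carrier A" "p \<in> carrier A" "q \<in> carrier A" using bcd by (simp_all add: a_def p_def q_def)
    have yx: "ip y x = star A c" using ip_star x y by (simp add: c_def)
    have "ip (ra x a \<ominus>\<^bsub>H\<^esub> y) (ra x a \<ominus>\<^bsub>H\<^esub> y)
        = (star A a \<otimes> (b \<otimes> a) \<ominus> star A a \<otimes> c) \<ominus> (star A c \<otimes> a \<ominus> d)"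
      using x y apq bcd by (simp add: ip_diff ip_diff_left ip_ra ip_ra_left yx b_def[symmetric] c_def[symmetric]
         d_def[symmetric] A.m_assoc A.r_distr A.r_minus A.l_distr A.l_minus A.minus_eq A.minus_add A.a_ac)
    also have "\<dots> = (p \<ominus> q) \<ominus> (q \<ominus> d)"
      using bcd by (simp add: p_def q_def a_def A.star_smult A.m_assoc)
    finally have v: "A.pos ((p \<ominus> q) \<ominus> (q \<ominus> d))" using ip_pos[of "ra x a \<ominus>\<^bsub>H\<^esub> y"] x y apq by simp
    have "star A a \<otimes> (A.sc N \<ominus> b) \<otimes> a = q \<ominus> p"
      using bcd N by (simp add: p_def q_def a_def A.star_smult A.minus_eq A.l_distr A.r_distr A.l_minus A.r_minus
        A.smult_addr A.smult_a_inv A.m_assoc)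
    then have w: "A.pos (q \<ominus> p)" using A.pos_conj[OF A.pos_norm_minus[OF bcd(1,4) N(2)] apq(1)] by simp
    have "(q \<ominus> p) \<oplus> ((p \<ominus> q) \<ominus> (q \<ominus> d)) = d \<ominus> q"
    proof -
      have "(q \<ominus> p) \<oplus> ((p \<ominus> q) \<ominus> (q \<ominus> d)) = ((q \<ominus> p) \<oplus> (p \<ominus> q)) \<ominus> (q \<ominus> d)"
        using apq bcd by (simp add: A.minus_eq A.a_assoc)
      also have "(q \<ominus> p) \<oplus> (p \<ominus> q) = \<zero>" using A.diff_split[of q p q] apq by (simp add: A.minus_eq A.r_neg)
      finally show ?thesis using apq bcd by (simp add: A.minus_eq A.minus_add A.a_comm)
    qed
    then have "A.pos (d \<ominus> q)" using A.pos_add[OF w v] by simp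
    then have "nrm A q \<le> nrm A d"
      using A.pos_norm_mono[OF A.pos_scale[OF A.pos_star_mult[OF bcd(2)], of "1/N"], of d] N bcd
      by (simp add: q_def)
    moreover have "nrm A q = (nrm A c)\<^sup>2 / N"
      using bcd N A.cstar_identity[of c] by (simp add: q_def A.nrm_smult norm_divide del: of_real_divide)
    ultimately show ?thesis using N by (simp add: field_simps)
  qed
  have "(nrm A c)\<^sup>2 \<le> nrm A b * nrm A d"
  proof (rule field_le_epsilon)
    fix e :: real assume e: "e > 0"
    define \<delta> where "\<delta> = e / (nrm A d + 1)"
    have nd: "nrm A d \<ge> 0" "nrm A b \<ge> 0" using bcd A.nrm_nonneg by auto
    then have d0: "\<delta> > 0" "\<delta> * nrm A d \<le> e" using e by (simp_all add: \<delta>_def field_simps)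
    have "(nrm A c)\<^sup>2 \<le> (nrm A b + \<delta>) * nrm A d" using key[of "nrm A b + \<delta>"] d0 nd by simp
    also have "\<dots> \<le> nrm A b * nrm A d + e" using d0 by (simp add: algebra_simps)
    finally show "(nrm A c)\<^sup>2 \<le> nrm A b * nrm A d + e" .
  qed
  then have "(nrm A c)\<^sup>2 \<le> (hn x * hn y)\<^sup>2"
    using x y by (simp add: power_mult_distrib hn_square b_def d_def)
  then show ?thesis using x y by (auto simp: c_def intro: power2_le_imp_le)
qed

lemma hn_zero [simp]: "hn \<zero>\<^bsub>H\<^esub> = 0" by (simp add: hn_def)

lemma hn_eq_0: assumes x: "x \<in> carrier H" "hn x = 0" shows "x = \<zero>\<^bsub>H\<^esub>"
proof (rule frame_ext[OF x(1) H.zero_closed])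
  fix i assume "i < k"
  then have ui: "u i \<in> carrier H" by (rule u_closed)
  then have "nrm A (ip (u i) x) = 0" using cauchy_schwarz[OF ui x(1)] A.nrm_nonneg[of "ip (u i) x"] x by simp
  then show "ip (u i) x = ip (u i) \<zero>\<^bsub>H\<^esub>" using ui x A.nrm_eq_0_iff by simp
qed

lemma hn_triangle: assumes x: "x \<in> carrier H" and y: "y \<in> carrier H" shows "hn (x \<oplus>\<^bsub>H\<^esub> y) \<le> hn x + hn y"
proof -
  have "(hn (x \<oplus>\<^bsub>H\<^esub> y))\<^sup>2 = nrm A ((ip x x \<oplus> ip x y) \<oplus> (ip y x \<oplus> ip y y))"
    using x y by (simp add: hn_square ip_add ip_add_left A.a_ac)
  also have "\<dots> \<le> (nrm A (ip x x) + nrm A (ip x y)) + (nrm A (ip y x) + nrm A (ip y y))"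
    using x y by (intro order_trans[OF A.nrm_triangle] add_mono A.nrm_triangle) auto
  also have "\<dots> \<le> (hn x)\<^sup>2 + 2 * (hn x * hn y) + (hn y)\<^sup>2"
    using cauchy_schwarz[OF x y] cauchy_schwarz[OF y x] hn_square[OF x] hn_square[OF y]
    by (simp add: mult.commute[of "hn y"])
  also have "\<dots> = (hn x + hn y)\<^sup>2" by (simp add: power2_sum)
  finally show ?thesis using x y power2_le_imp_le by auto
qed

lemma hn_smult: "x \<in> carrier H \<Longrightarrow> hn (z \<odot>\<^bsub>H\<^esub> x) = cmod z * hn x"
  by (simp add: hn_def ip_smult ip_smult_left A.nrm_smult real_sqrt_mult complex_mod_mult_cnj)

lemma hn_neg [simp]: "x \<in> carrier H \<Longrightarrow> hn (\<ominus>\<^bsub>H\<^esub> x) = hn x"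
  using hn_smult[of x "-1"] by (simp add: hsmult_neg_one)

lemma hn_diff_triangle:
  assumes "x \<in> carrier H" "y \<in> carrier H" "z \<in> carrier H"
  shows "hn (x \<ominus>\<^bsub>H\<^esub> z) \<le> hn (x \<ominus>\<^bsub>H\<^esub> y) + hn (y \<ominus>\<^bsub>H\<^esub> z)"
proof -
  have "x \<ominus>\<^bsub>H\<^esub> z = (x \<ominus>\<^bsub>H\<^esub> y) \<oplus>\<^bsub>H\<^esub> (y \<ominus>\<^bsub>H\<^esub> z)"
    using assms by (simp add: H.minus_eq H.a_assoc H.r_neg1)
  then show ?thesis using hn_triangle[of "x \<ominus>\<^bsub>H\<^esub> y" "y \<ominus>\<^bsub>H\<^esub> z"] assms by simp
qed

lemma hn_ra: assumes x: "x \<in> carrier H" and a: "a \<in> carrier A" shows "hn (ra x a) \<le> hn x * nrm A a"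
proof -
  have "(hn (ra x a))\<^sup>2 = nrm A (star A a \<otimes> (ip x x \<otimes> a))"
    using x a by (simp add: hn_square ip_ra ip_ra_left A.m_assoc)
  also have "\<dots> \<le> nrm A a * (nrm A (ip x x) * nrm A a)"
    using x a A.nrm_mult[of "star A a" "ip x x \<otimes> a"] A.nrm_mult[of "ip x x" a]
      mult_left_mono[of "nrm A (ip x x \<otimes> a)" "nrm A (ip x x) * nrm A a" "nrm A a"] A.nrm_nonneg[of a] by simp
  also have "\<dots> = (hn x * nrm A a)\<^sup>2" using x by (simp add: power_mult_distrib hn_square power2_eq_square[of "nrm A a"])
  finally show ?thesis using x a A.nrm_nonneg by (auto intro: power2_le_imp_le)
qed

lemma hn_finsum: "\<lbrakk>finite I; f \<in> I \<rightarrow> carrier H\<rbrakk> \<Longrightarrow> hn (finsum H f I) \<le> (\<Sum>i\<in>I. hn (f i))"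
proof (induction I rule: finite_induct)
  case (insert i I)
  then have f: "f \<in> I \<rightarrow> carrier H" "f i \<in> carrier H" by (simp_all add: Pi_def)
  have "hn (finsum H f (insert i I)) \<le> hn (f i) + hn (finsum H f I)"
    using insert f hn_triangle[of "f i" "finsum H f I"] by simp
  then show ?case using insert f by simp
qed simp

subsection \<open>Adjointable operators\<close>

definition ops :: "('h \<Rightarrow> 'h) set" where
  "ops = {t \<in> carrier H \<rightarrow>\<^sub>E carrier H. \<exists>s\<in>carrier H \<rightarrow> carrier H.
     \<forall>x\<in>carrier H. \<forall>y\<in>carrier H. ip (t x) y = ip x (s y)}"

definition hadj :: "('h \<Rightarrow> 'h) \<Rightarrow> 'h \<Rightarrow> 'h" where
  "hadj t = (THE s. s \<in> carrier H \<rightarrow>\<^sub>E carrier H \<and> (\<forall>x\<in>carrier H. \<forall>y\<in>carrier H. ip (t x) y = ip x (s y)))"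

lemma opsI:
  assumes "\<And>x. x \<in> carrier H \<Longrightarrow> t x \<in> carrier H" "\<And>x. x \<in> carrier H \<Longrightarrow> s x \<in> carrier H"
    and "\<And>x y. \<lbrakk>x \<in> carrier H; y \<in> carrier H\<rbrakk> \<Longrightarrow> ip (t x) y = ip x (s y)"
  shows "restrict t (carrier H) \<in> ops"
  using assms unfolding ops_def by (auto intro!: bexI[of _ s])

lemma ops_closed [simp]: "\<lbrakk>t \<in> ops; x \<in> carrier H\<rbrakk> \<Longrightarrow> t x \<in> carrier H"
  unfolding ops_def by auto

lemma ops_PiE: "t \<in> ops \<Longrightarrow> t \<in> carrier H \<rightarrow>\<^sub>E carrier H"
  by (simp add: ops_def)

lemma ops_eqI: "\<lbrakk>s \<in> ops; t \<in> ops; \<And>x. x \<in> carrier H \<Longrightarrow> s x = t x\<rbrakk> \<Longrightarrow> s = t"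
  unfolding ops_def by (auto intro: PiE_ext)

lemma hadj_unique:
  assumes t: "t \<in> ops" and s: "s \<in> carrier H \<rightarrow>\<^sub>E carrier H"
    and ts: "\<And>x y. \<lbrakk>x \<in> carrier H; y \<in> carrier H\<rbrakk> \<Longrightarrow> ip (t x) y = ip x (s y)"
  shows "hadj t = s"
  unfolding hadj_def
proof (rule the_equality)
  fix s' assume s': "s' \<in> carrier H \<rightarrow>\<^sub>E carrier H \<and> (\<forall>x\<in>carrier H. \<forall>y\<in>carrier H. ip (t x) y = ip x (s' y))"
  then have c: "s' \<in> carrier H \<rightarrow>\<^sub>E carrier H" and e: "\<And>x y. \<lbrakk>x \<in> carrier H; y \<in> carrier H\<rbrakk> \<Longrightarrow> ip (t x) y = ip x (s' y)"
    by auto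
  show "s' = s"
  proof (rule PiE_ext[OF c s])
    fix y assume y: "y \<in> carrier H"
    show "s' y = s y"
      using ts e y by (intro ip_ext) (auto intro: PiE_mem[OF c] PiE_mem[OF s])
  qed
qed (use s ts in auto)

lemma hadj:
  assumes t: "t \<in> ops"
  shows hadj_ops [simp]: "hadj t \<in> ops"
    and ip_hadj: "\<And>x y. \<lbrakk>x \<in> carrier H; y \<in> carrier H\<rbrakk> \<Longrightarrow> ip (t x) y = ip x (hadj t y)"
    and ip_hadj_left: "\<And>x y. \<lbrakk>x \<in> carrier H; y \<in> carrier H\<rbrakk> \<Longrightarrow> ip (hadj t x) y = ip x (t y)"
proof -
  obtain s where s: "s \<in> carrier H \<rightarrow> carrier H" "\<And>x y. \<lbrakk>x \<in> carrier H; y \<in> carrier H\<rbrakk> \<Longrightarrow> ip (t x) y = ip x (s y)"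
    using t unfolding ops_def by blast
  let ?s = "restrict s (carrier H)"
  have eq: "hadj t = ?s" using s by (intro hadj_unique[OF t]) auto
  show 1: "ip (t x) y = ip x (hadj t y)" if "x \<in> carrier H" "y \<in> carrier H" for x y
    using s(2)[OF that] that by (simp add: eq)
  have sc: "s x \<in> carrier H" if "x \<in> carrier H" for x using s(1) that by blast
  show 2: "ip (hadj t x) y = ip x (t y)" if "x \<in> carrier H" "y \<in> carrier H" for x y
    using 1[of y x] ip_star[of "t y" x] ip_star[of y "s x"] that t sc by (simp add: eq)
  show "hadj t \<in> ops"
    using 2 sc t unfolding eq by (intro opsI[of s t]) auto
qed

lemma hadj_hadj [simp]: "t \<in> ops \<Longrightarrow> hadj (hadj t) = t"
  by (intro hadj_unique) (simp_all add: ip_hadj_left ops_PiE)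

lemma ops_additive:
  assumes t: "t \<in> ops" and x: "x \<in> carrier H" and y: "y \<in> carrier H"
  shows "t (x \<oplus>\<^bsub>H\<^esub> y) = t x \<oplus>\<^bsub>H\<^esub> t y"
proof (rule ip_ext)
  fix z assume z: "z \<in> carrier H"
  show "ip z (t (x \<oplus>\<^bsub>H\<^esub> y)) = ip z (t x \<oplus>\<^bsub>H\<^esub> t y)"
    using t x y z by (simp add: ip_add flip: ip_hadj_left)
qed (use assms in auto)

lemma ops_smult:
  assumes t: "t \<in> ops" and x: "x \<in> carrier H" shows "t (z \<odot>\<^bsub>H\<^esub> x) = z \<odot>\<^bsub>H\<^esub> t x"
proof (rule ip_ext)
  fix w assume w: "w \<in> carrier H"
  show "ip w (t (z \<odot>\<^bsub>H\<^esub> x)) = ip w (z \<odot>\<^bsub>H\<^esub> t x)"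
    using t x w by (simp add: ip_smult flip: ip_hadj_left)
qed (use assms in auto)

lemma ops_ra:
  assumes t: "t \<in> ops" and x: "x \<in> carrier H" and a: "a \<in> carrier A" shows "t (ra x a) = ra (t x) a"
proof (rule ip_ext)
  fix w assume w: "w \<in> carrier H"
  show "ip w (t (ra x a)) = ip w (ra (t x) a)"
    using t x w a by (simp add: ip_ra flip: ip_hadj_left)
qed (use assms in auto)

lemma ops_zero [simp]: "t \<in> ops \<Longrightarrow> t \<zero>\<^bsub>H\<^esub> = \<zero>\<^bsub>H\<^esub>"
  using ops_smult[of t "\<zero>\<^bsub>H\<^esub>" 0] by simp

lemma ops_frame:
  assumes t: "t \<in> ops" and x: "x \<in> carrier H"
  shows "t x = (\<Oplus>\<^bsub>H\<^esub>i\<in>{..<k}. ra (t (u i)) (ip (u i) x))"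
proof -
  have "t x = t (\<Oplus>\<^bsub>H\<^esub>i\<in>{..<k}. ra (u i) (ip (u i) x))" by (simp flip: frame[OF x])
  also have "\<dots> = (\<Oplus>\<^bsub>H\<^esub>i\<in>{..<k}. t (ra (u i) (ip (u i) x)))"
    using t x u_closed by (intro additive_finsum H.abelian_group_axioms) (auto simp: ops_additive)
  also have "\<dots> = (\<Oplus>\<^bsub>H\<^esub>i\<in>{..<k}. ra (t (u i)) (ip (u i) x))"
    using t x u_closed by (intro H.finsum_cong') (auto simp: ops_ra)
  finally show ?thesis .
qed

lemma ops_bounded:
  assumes t: "t \<in> ops" shows "\<exists>K\<ge>0. \<forall>x\<in>carrier H. hn (t x) \<le> K * hn x"
proof (intro exI conjI ballI)
  let ?K = "\<Sum>i<k. hn (t (u i)) * hn (u i)"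
  show "?K \<ge> 0" using t u_closed by (intro sum_nonneg mult_nonneg_nonneg) auto
  fix x assume x: "x \<in> carrier H"
  have "hn (t x) \<le> (\<Sum>i<k. hn (ra (t (u i)) (ip (u i) x)))"
    unfolding ops_frame[OF t x] using t x u_closed by (intro hn_finsum) auto
  also have "\<dots> \<le> (\<Sum>i<k. hn (t (u i)) * hn (u i) * hn x)"
  proof (rule sum_mono)
    fix i assume "i \<in> {..<k}"
    then have ui: "u i \<in> carrier H" using u_closed by simp
    have "hn (ra (t (u i)) (ip (u i) x)) \<le> hn (t (u i)) * nrm A (ip (u i) x)"
      using t ui x by (intro hn_ra) auto
    also have "\<dots> \<le> hn (t (u i)) * (hn (u i) * hn x)"
      using t ui x by (intro mult_left_mono cauchy_schwarz) auto
    finally show "hn (ra (t (u i)) (ip (u i) x)) \<le> hn (t (u i)) * hn (u i) * hn x" by (simp add: mult.assoc)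
  qed
  finally show "hn (t x) \<le> ?K * hn x" by (simp add: sum_distrib_right)
qed

definition onrm :: "('h \<Rightarrow> 'h) \<Rightarrow> real" where
  "onrm t = Sup {hn (t x) | x. x \<in> carrier H \<and> hn x \<le> 1}"

lemma onrm_bdd: assumes "t \<in> ops" shows "bdd_above {hn (t x) | x. x \<in> carrier H \<and> hn x \<le> 1}"
proof -
  obtain K where K: "K \<ge> 0" "\<And>x. x \<in> carrier H \<Longrightarrow> hn (t x) \<le> K * hn x" using ops_bounded[OF assms] by blast
  show ?thesis
  proof (rule bdd_aboveI[of _ K], clarify)
    fix x assume x: "x \<in> carrier H" "hn x \<le> 1"
    then show "hn (t x) \<le> K" using K(2)[OF x(1)] mult_left_mono[OF x(2) K(1)] by simp
  qed
qed

lemma onrm_nonneg: assumes "t \<in> ops" shows "onrm t \<ge> 0"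
  unfolding onrm_def using assms
  by (intro cSup_upper2[OF _ _ onrm_bdd[OF assms], of 0]) (auto intro!: exI[of _ "\<zero>\<^bsub>H\<^esub>"])

lemma onrm: assumes t: "t \<in> ops" and x: "x \<in> carrier H" shows "hn (t x) \<le> onrm t * hn x"
proof (cases "hn x = 0")
  case True
  then have "x = \<zero>\<^bsub>H\<^esub>" using hn_eq_0 x by simp
  then show ?thesis using t by simp
next
  case False
  then have pos: "hn x > 0" using hn_nonneg[OF x] by linarith
  define y where "y = complex_of_real (1 / hn x) \<odot>\<^bsub>H\<^esub> x"
  have y: "y \<in> carrier H" "hn y = 1" using x pos by (simp_all add: y_def hn_smult norm_divide del: of_real_divide)
  have "hn (t y) \<le> onrm t"
    unfolding onrm_def using y by (intro cSup_upper onrm_bdd[OF t]) auto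
  moreover have "hn (t y) = hn (t x) / hn x"
    using t x pos by (simp add: y_def ops_smult hn_smult norm_divide del: of_real_divide)
  ultimately show ?thesis using pos by (simp add: field_simps)
qed

lemma onrm_le:
  assumes "\<And>x. x \<in> carrier H \<Longrightarrow> hn (t x) \<le> K * hn x" "K \<ge> 0" shows "onrm t \<le> K"
  unfolding onrm_def
proof (rule cSup_least)
  show "{hn (t x) |x. x \<in> carrier H \<and> hn x \<le> 1} \<noteq> {}" by (auto intro!: exI[of _ "\<zero>\<^bsub>H\<^esub>"])
  fix r assume "r \<in> {hn (t x) |x. x \<in> carrier H \<and> hn x \<le> 1}"
  then obtain x where x: "x \<in> carrier H" "hn x \<le> 1" "r = hn (t x)" by blast
  then show "r \<le> K" using assms(1)[OF x(1)] mult_left_mono[OF x(2) assms(2)] by simp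
qed

definition opalg :: "('h \<Rightarrow> 'h) cstar" where
  "opalg = \<lparr>carrier = ops, mult = (\<lambda>s t. \<lambda>x\<in>carrier H. s (t x)), one = (\<lambda>x\<in>carrier H. x),
     ring.zero = (\<lambda>x\<in>carrier H. \<zero>\<^bsub>H\<^esub>), add = (\<lambda>s t. \<lambda>x\<in>carrier H. s x \<oplus>\<^bsub>H\<^esub> t x),
     smult = (\<lambda>z t. \<lambda>x\<in>carrier H. z \<odot>\<^bsub>H\<^esub> t x), star = hadj, nrm = onrm\<rparr>"

lemma opalg_simps [simp]:
  "carrier opalg = ops" "star opalg = hadj" "nrm opalg = onrm"
  "s \<otimes>\<^bsub>opalg\<^esub> t = (\<lambda>x\<in>carrier H. s (t x))" "\<one>\<^bsub>opalg\<^esub> = (\<lambda>x\<in>carrier H. x)"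
  "\<zero>\<^bsub>opalg\<^esub> = (\<lambda>x\<in>carrier H. \<zero>\<^bsub>H\<^esub>)" "s \<oplus>\<^bsub>opalg\<^esub> t = (\<lambda>x\<in>carrier H. s x \<oplus>\<^bsub>H\<^esub> t x)"
  "z \<odot>\<^bsub>opalg\<^esub> t = (\<lambda>x\<in>carrier H. z \<odot>\<^bsub>H\<^esub> t x)"
  by (simp_all add: opalg_def)

lemma ip_zero_left [simp]: "x \<in> carrier H \<Longrightarrow> ip \<zero>\<^bsub>H\<^esub> x = \<zero>"
  using ip_smult_left[of "\<zero>\<^bsub>H\<^esub>" x 0] by simp

lemma ops_mult [simp]: "\<lbrakk>s \<in> ops; t \<in> ops\<rbrakk> \<Longrightarrow> (\<lambda>x\<in>carrier H. s (t x)) \<in> ops"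
  by (rule opsI[of _ "\<lambda>x. hadj t (hadj s x)"]) (auto simp: ip_hadj)

lemma ops_one [simp]: "(\<lambda>x\<in>carrier H. x) \<in> ops"
  by (rule opsI[of _ "\<lambda>x. x"]) auto

lemma ops_zero_op [simp]: "(\<lambda>x\<in>carrier H. \<zero>\<^bsub>H\<^esub>) \<in> ops"
  by (rule opsI[of _ "\<lambda>x. \<zero>\<^bsub>H\<^esub>"]) auto

lemma ops_add [simp]: "\<lbrakk>s \<in> ops; t \<in> ops\<rbrakk> \<Longrightarrow> (\<lambda>x\<in>carrier H. s x \<oplus>\<^bsub>H\<^esub> t x) \<in> ops"
  by (rule opsI[of _ "\<lambda>x. hadj s x \<oplus>\<^bsub>H\<^esub> hadj t x"]) (auto simp: ip_hadj ip_add ip_add_left)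

lemma ops_scale [simp]: "t \<in> ops \<Longrightarrow> (\<lambda>x\<in>carrier H. z \<odot>\<^bsub>H\<^esub> t x) \<in> ops"
  by (rule opsI[of _ "\<lambda>x. cnj z \<odot>\<^bsub>H\<^esub> hadj t x"]) (auto simp: ip_hadj ip_smult ip_smult_left)

lemma ops_ext: "t \<in> ops \<Longrightarrow> (\<lambda>x\<in>carrier H. t x) = t"
  by (rule ops_eqI) (auto intro!: opsI[of _ "hadj t"] simp: ip_hadj)

lemma opalg_abelian_group: "abelian_group opalg"
proof (rule abelian_groupI)
  fix t assume "t \<in> carrier opalg"
  then show "\<exists>s\<in>carrier opalg. s \<oplus>\<^bsub>opalg\<^esub> t = \<zero>\<^bsub>opalg\<^esub>"
    by (intro bexI[of _ "(-1) \<odot>\<^bsub>opalg\<^esub> t"]) (auto simp: hsmult_neg_one H.l_neg intro!: restrict_ext)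
next
  fix t assume "t \<in> carrier opalg"
  then show "\<zero>\<^bsub>opalg\<^esub> \<oplus>\<^bsub>opalg\<^esub> t = t" by (auto intro!: trans[OF restrict_ext ops_ext])
qed (auto intro!: restrict_ext simp: H.a_ac)

lemma opalg_ring: "ring opalg"
proof (rule ringI[OF opalg_abelian_group])
  show "monoid opalg" by (rule monoidI) (auto intro!: restrict_ext trans[OF restrict_ext ops_ext])
qed (auto intro!: restrict_ext simp: ops_additive)

lemma opalg_module: "module complex_ring opalg"
  by (rule moduleI[OF cring_complex_ring opalg_abelian_group])
    (auto intro!: restrict_ext trans[OF restrict_ext ops_ext] simp: complex_ring_def hsmult_addl hsmult_addr)

lemma opalg_uminus: assumes "t \<in> ops" shows "\<ominus>\<^bsub>opalg\<^esub> t = (\<lambda>x\<in>carrier H. \<ominus>\<^bsub>H\<^esub> t x)"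
proof -
  interpret O: ring opalg by (rule opalg_ring)
  let ?s = "(-1) \<odot>\<^bsub>opalg\<^esub> t"
  have "?s \<oplus>\<^bsub>opalg\<^esub> t = \<zero>\<^bsub>opalg\<^esub>" using assms by (auto simp: hsmult_neg_one H.l_neg intro!: restrict_ext)
  then have "\<ominus>\<^bsub>opalg\<^esub> t = ?s" using O.minus_equality[of ?s t] assms by simp
  then show ?thesis using assms by (auto simp: hsmult_neg_one intro!: restrict_ext)
qed

lemma opalg_diff: "\<lbrakk>s \<in> ops; t \<in> ops\<rbrakk> \<Longrightarrow> s \<ominus>\<^bsub>opalg\<^esub> t = (\<lambda>x\<in>carrier H. s x \<ominus>\<^bsub>H\<^esub> t x)"
  by (auto simp: a_minus_def[of opalg] opalg_uminus H.minus_eq intro!: restrict_ext)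

text \<open>This is half of the C*-identity; together with submultiplicativity it yields the other half and
  the invariance of the norm under adjoints.\<close>

lemma onrm_hadj_le: assumes t: "t \<in> ops" shows "(onrm t)\<^sup>2 \<le> onrm (\<lambda>x\<in>carrier H. hadj t (t x))"
proof -
  let ?s = "\<lambda>x\<in>carrier H. hadj t (t x)"
  have s: "?s \<in> ops" using t by simp
  have "hn (t x) \<le> sqrt (onrm ?s) * hn x" if x: "x \<in> carrier H" for x
  proof -
    have "(hn (t x))\<^sup>2 = nrm A (ip x (?s x))" using t x by (simp add: hn_square ip_hadj)
    also have "\<dots> \<le> hn x * hn (?s x)" using t x by (intro cauchy_schwarz) auto
    also have "\<dots> \<le> hn x * (onrm ?s * hn x)" using s x onrm[OF s x] by (intro mult_left_mono) auto
    also have "\<dots> = (sqrt (onrm ?s) * hn x)\<^sup>2"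
      using onrm_nonneg[OF s] by (simp add: power_mult_distrib power2_eq_square[of "hn x"])
    finally show ?thesis by (rule power2_le_imp_le) (use x onrm_nonneg[OF s] in auto)
  qed
  then have "onrm t \<le> sqrt (onrm ?s)" using onrm_nonneg[OF s] by (intro onrm_le) auto
  then show ?thesis using onrm_nonneg[OF t] onrm_nonneg[OF s] by (simp add: real_le_rsqrt power2_le_iff_abs_le real_sqrt_le_iff sqrt_ge_absD)
qed

lemma onrm_mult: assumes s: "s \<in> ops" and t: "t \<in> ops" shows "onrm (\<lambda>x\<in>carrier H. s (t x)) \<le> onrm s * onrm t"
proof (rule onrm_le)
  fix x assume x: "x \<in> carrier H"
  have "hn (s (t x)) \<le> onrm s * hn (t x)" using s t x by (intro onrm) auto
  also have "\<dots> \<le> onrm s * (onrm t * hn x)" using s t x by (intro mult_left_mono onrm onrm_nonneg) auto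
  finally show "hn ((\<lambda>x\<in>carrier H. s (t x)) x) \<le> onrm s * onrm t * hn x" using x by (simp add: mult.assoc)
qed (use assms onrm_nonneg in auto)

lemma onrm_hadj: assumes t: "t \<in> ops" shows "onrm (hadj t) = onrm t"
proof -
  have le: "onrm s \<le> onrm (hadj s)" if s: "s \<in> ops" for s
  proof (cases "onrm s = 0")
    case False
    then have p: "onrm s > 0" using onrm_nonneg[OF s] by linarith
    have "(onrm s)\<^sup>2 \<le> onrm (hadj s) * onrm s" using onrm_hadj_le[OF s] onrm_mult[OF hadj_ops[OF s] s] by linarith
    then show ?thesis using p by (simp add: power2_eq_square)
  qed (use s onrm_nonneg in simp)
  show ?thesis using le[OF t] le[OF hadj_ops[OF t]] t by simp
qed

lemma ip_limit:
  assumes "\<And>n. f n \<in> carrier H" "l \<in> carrier H" "x \<in> carrier H" "(\<lambda>n. hn (f n \<ominus>\<^bsub>H\<^esub> l)) \<longlonglongrightarrow> 0"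
  shows "(\<lambda>n. nrm A (ip x (f n) \<ominus> ip x l)) \<longlonglongrightarrow> 0"
proof (rule tendsto_sandwich[OF _ _ tendsto_const])
  show "(\<lambda>n. hn x * hn (f n \<ominus>\<^bsub>H\<^esub> l)) \<longlonglongrightarrow> 0" using tendsto_mult_right_zero[OF assms(4)] .
  have "nrm A (ip x (f n) \<ominus> ip x l) \<le> hn x * hn (f n \<ominus>\<^bsub>H\<^esub> l)" for n
    using cauchy_schwarz[of x "f n \<ominus>\<^bsub>H\<^esub> l"] assms by (simp add: ip_diff)
  then show "\<forall>\<^sub>F n in sequentially. nrm A (ip x (f n) \<ominus> ip x l) \<le> hn x * hn (f n \<ominus>\<^bsub>H\<^esub> l)" by simp
qed (use assms A.nrm_nonneg in auto)

text \<open>The frame coefficients of a Cauchy sequence converge in \<open>A\<close>, and the frame reassembles their limits.\<close>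

lemma hn_cauchy_limit:
  assumes f: "\<And>n. f n \<in> carrier H"
    and c: "\<And>e. e > 0 \<Longrightarrow> \<exists>K. \<forall>m\<ge>K. \<forall>n\<ge>K. hn (f m \<ominus>\<^bsub>H\<^esub> f n) < e"
  shows "\<exists>l\<in>carrier H. (\<lambda>n. hn (f n \<ominus>\<^bsub>H\<^esub> l)) \<longlonglongrightarrow> 0"
proof -
  have "\<exists>b\<in>carrier A. (\<lambda>n. nrm A (ip (u i) (f n) \<ominus> b)) \<longlonglongrightarrow> 0" if i: "i < k" for i
  proof -
    have ui: "u i \<in> carrier H" using u_closed[OF i] .
    have "\<exists>K. \<forall>m\<ge>K. \<forall>n\<ge>K. nrm A (ip (u i) (f m) \<ominus> ip (u i) (f n)) < e" if e: "e > 0" for e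
    proof -
      have p: "hn (u i) + 1 > 0" using hn_nonneg[OF ui] by linarith
      obtain K where K: "\<And>m n. \<lbrakk>m \<ge> K; n \<ge> K\<rbrakk> \<Longrightarrow> hn (f m \<ominus>\<^bsub>H\<^esub> f n) < e / (hn (u i) + 1)"
        using c[of "e / (hn (u i) + 1)"] e p by auto
      have "nrm A (ip (u i) (f m) \<ominus> ip (u i) (f n)) < e" if "m \<ge> K" "n \<ge> K" for m n
      proof -
        have "nrm A (ip (u i) (f m) \<ominus> ip (u i) (f n)) \<le> hn (u i) * hn (f m \<ominus>\<^bsub>H\<^esub> f n)"
          using cauchy_schwarz[of "u i" "f m \<ominus>\<^bsub>H\<^esub> f n"] ui f by (simp add: ip_diff)
        also have "\<dots> \<le> (hn (u i) + 1) * hn (f m \<ominus>\<^bsub>H\<^esub> f n)" using f by (intro mult_right_mono) auto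
        also have "\<dots> < e" using K[OF that] p by (simp add: field_simps)
        finally show ?thesis .
      qed
      then show ?thesis by blast
    qed
    moreover have "ip (u i) (f n) \<in> carrier A" for n using ui f by simp
    ultimately show ?thesis
      using A.cauchy_limit[of "\<lambda>n. ip (u i) (f n)" ?thesis] by blast
  qed
  then obtain b where b: "\<And>i. i < k \<Longrightarrow> b i \<in> carrier A" "\<And>i. i < k \<Longrightarrow> (\<lambda>n. nrm A (ip (u i) (f n) \<ominus> b i)) \<longlonglongrightarrow> 0"
    by metis
  define l where "l = (\<Oplus>\<^bsub>H\<^esub>i\<in>{..<k}. ra (u i) (b i))"
  have l: "l \<in> carrier H" unfolding l_def using u_closed b by (intro H.finsum_closed) auto
  have le: "hn (f n \<ominus>\<^bsub>H\<^esub> l) \<le> (\<Sum>i<k. hn (u i) * nrm A (ip (u i) (f n) \<ominus> b i))" for n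
  proof -
    have "f n \<ominus>\<^bsub>H\<^esub> l = (\<Oplus>\<^bsub>H\<^esub>i\<in>{..<k}. ra (u i) (ip (u i) (f n))) \<ominus>\<^bsub>H\<^esub> l" by (simp flip: frame[OF f])
    also have "\<dots> = (\<Oplus>\<^bsub>H\<^esub>i\<in>{..<k}. ra (u i) (ip (u i) (f n)) \<ominus>\<^bsub>H\<^esub> ra (u i) (b i))"
      unfolding l_def using u_closed b f by (intro H.finsum_diff) auto
    also have "\<dots> = (\<Oplus>\<^bsub>H\<^esub>i\<in>{..<k}. ra (u i) (ip (u i) (f n) \<ominus> b i))"
    proof (rule H.finsum_cong')
      fix i assume "i \<in> {..<k}"
      then have i: "u i \<in> carrier H" "b i \<in> carrier A" using u_closed b by auto
      show "ra (u i) (ip (u i) (f n)) \<ominus>\<^bsub>H\<^esub> ra (u i) (b i) = ra (u i) (ip (u i) (f n) \<ominus> b i)"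
        using i f by (intro ip_ext) (auto simp: ip_diff ip_ra A.r_diff)
    qed (use u_closed b f in auto)
    finally have "hn (f n \<ominus>\<^bsub>H\<^esub> l) \<le> (\<Sum>i<k. hn (ra (u i) (ip (u i) (f n) \<ominus> b i)))"
      using hn_finsum[of "{..<k}" "\<lambda>i. ra (u i) (ip (u i) (f n) \<ominus> b i)"] u_closed b f by (simp add: Pi_def)
    also have "\<dots> \<le> (\<Sum>i<k. hn (u i) * nrm A (ip (u i) (f n) \<ominus> b i))"
      using u_closed b f by (intro sum_mono hn_ra) auto
    finally show ?thesis .
  qed
  have "(\<lambda>n. \<Sum>i<k. hn (u i) * nrm A (ip (u i) (f n) \<ominus> b i)) \<longlonglongrightarrow> (\<Sum>i<k. 0)"
    using b(2) by (intro tendsto_sum tendsto_mult_right_zero) auto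
  then have lim: "(\<lambda>n. \<Sum>i<k. hn (u i) * nrm A (ip (u i) (f n) \<ominus> b i)) \<longlonglongrightarrow> 0" by simp
  have "(\<lambda>n. hn (f n \<ominus>\<^bsub>H\<^esub> l)) \<longlonglongrightarrow> 0"
    using le f l by (intro tendsto_sandwich[OF _ _ tendsto_const lim]) auto
  then show ?thesis using l by blast
qed

text \<open>Both the operators and their adjoints converge pointwise, and the two limits are adjoint to each
  other.\<close>

lemma ops_complete:
  assumes f: "\<And>n. f n \<in> ops"
    and c: "\<And>e. e > 0 \<Longrightarrow> \<exists>K. \<forall>m\<ge>K. \<forall>n\<ge>K. onrm (f m \<ominus>\<^bsub>opalg\<^esub> f n) < e"
  shows "\<exists>l\<in>ops. (\<lambda>n. onrm (f n \<ominus>\<^bsub>opalg\<^esub> l)) \<longlonglongrightarrow> 0"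
proof -
  interpret O: ring opalg by (rule opalg_ring)
  have pt: "hn (g m x \<ominus>\<^bsub>H\<^esub> g n x) \<le> onrm (g m \<ominus>\<^bsub>opalg\<^esub> g n) * hn x"
    if "\<And>n. g n \<in> ops" "x \<in> carrier H" for g :: "nat \<Rightarrow> 'h \<Rightarrow> 'h" and m n x
    using onrm[of "g m \<ominus>\<^bsub>opalg\<^esub> g n" x] O.minus_closed[of "g m" "g n"] that by (simp add: opalg_diff)
  have pointwise: "\<exists>l. \<forall>x\<in>carrier H. l x \<in> carrier H \<and> (\<lambda>n. hn (g n x \<ominus>\<^bsub>H\<^esub> l x)) \<longlonglongrightarrow> 0"
    if g: "\<And>n. g n \<in> ops"
      and gc: "\<And>e. e > 0 \<Longrightarrow> \<exists>K. \<forall>m\<ge>K. \<forall>n\<ge>K. onrm (g m \<ominus>\<^bsub>opalg\<^esub> g n) < e" for g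
  proof (rule bchoice[of _ "\<lambda>x y. y \<in> carrier H \<and> (\<lambda>n. hn (g n x \<ominus>\<^bsub>H\<^esub> y)) \<longlonglongrightarrow> 0"], rule ballI)
    fix x assume x: "x \<in> carrier H"
    have "\<exists>K. \<forall>m\<ge>K. \<forall>n\<ge>K. hn (g m x \<ominus>\<^bsub>H\<^esub> g n x) < e" if e: "e > 0" for e
    proof -
      have p: "hn x + 1 > 0" using hn_nonneg[OF x] by linarith
      obtain K where K: "\<And>m n. \<lbrakk>m \<ge> K; n \<ge> K\<rbrakk> \<Longrightarrow> onrm (g m \<ominus>\<^bsub>opalg\<^esub> g n) < e / (hn x + 1)"
        using gc[of "e / (hn x + 1)"] e p by auto
      have "hn (g m x \<ominus>\<^bsub>H\<^esub> g n x) < e" if "m \<ge> K" "n \<ge> K" for m n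
      proof -
        have "hn (g m x \<ominus>\<^bsub>H\<^esub> g n x) \<le> onrm (g m \<ominus>\<^bsub>opalg\<^esub> g n) * (hn x + 1)"
          using pt[where g=g and x=x and m=m and n=n, OF g x] onrm_nonneg[of "g m \<ominus>\<^bsub>opalg\<^esub> g n"] O.minus_closed[of "g m" "g n"] g
          by (simp add: algebra_simps)
        also have "\<dots> < e" using K[OF that] p by (simp add: field_simps)
        finally show ?thesis .
      qed
      then show ?thesis by blast
    qed
    then show "\<exists>y. y \<in> carrier H \<and> (\<lambda>n. hn (g n x \<ominus>\<^bsub>H\<^esub> y)) \<longlonglongrightarrow> 0"
      using hn_cauchy_limit[of "\<lambda>n. g n x"] g x by auto
  qed
  have hf: "hadj (f n) \<in> ops" for n using f by simp
  have hd: "onrm (hadj (f m) \<ominus>\<^bsub>opalg\<^esub> hadj (f n)) = onrm (f m \<ominus>\<^bsub>opalg\<^esub> f n)" for m n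
  proof -
    have "hadj (f m \<ominus>\<^bsub>opalg\<^esub> f n) = hadj (f m) \<ominus>\<^bsub>opalg\<^esub> hadj (f n)"
      using f O.minus_closed[of "f m" "f n"] O.minus_closed[of "hadj (f m)" "hadj (f n)"]
      by (intro hadj_unique) (auto simp: opalg_diff ip_diff ip_diff_left ip_hadj)
    then show ?thesis using onrm_hadj[of "f m \<ominus>\<^bsub>opalg\<^esub> f n"] O.minus_closed[of "f m" "f n"] f by simp
  qed
  obtain t where t: "\<And>x. x \<in> carrier H \<Longrightarrow> t x \<in> carrier H"
      "\<And>x. x \<in> carrier H \<Longrightarrow> (\<lambda>n. hn (f n x \<ominus>\<^bsub>H\<^esub> t x)) \<longlonglongrightarrow> 0"
    using pointwise[OF f c] by blast
  obtain s where s: "\<And>x. x \<in> carrier H \<Longrightarrow> s x \<in> carrier H"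
      "\<And>x. x \<in> carrier H \<Longrightarrow> (\<lambda>n. hn (hadj (f n) x \<ominus>\<^bsub>H\<^esub> s x)) \<longlonglongrightarrow> 0"
  proof -
    have "\<exists>l. \<forall>x\<in>carrier H. l x \<in> carrier H \<and> (\<lambda>n. hn (hadj (f n) x \<ominus>\<^bsub>H\<^esub> l x)) \<longlonglongrightarrow> 0"
      by (rule pointwise) (use hf c in \<open>simp_all add: hd\<close>)
    then show ?thesis using that by blast
  qed
  have "ip (t x) y = ip x (s y)" if x: "x \<in> carrier H" and y: "y \<in> carrier H" for x y
  proof -
    have 1: "(\<lambda>n. nrm A (ip x (hadj (f n) y) \<ominus> ip x (s y))) \<longlonglongrightarrow> 0"
      using ip_limit[of "\<lambda>n. hadj (f n) y" "s y" x] hf s x y by simp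
    have "(\<lambda>n. nrm A (ip y (f n x) \<ominus> ip y (t x))) \<longlonglongrightarrow> 0"
      using ip_limit[of "\<lambda>n. f n x" "t x" y] f t x y by simp
    then have "(\<lambda>n. nrm A (star A (ip y (f n x)) \<ominus> star A (ip y (t x)))) \<longlonglongrightarrow> 0"
      using f t x y by (intro A.limit_star) auto
    then have "(\<lambda>n. nrm A (ip x (hadj (f n) y) \<ominus> ip (t x) y)) \<longlonglongrightarrow> 0"
      using f t x y by (simp add: ip_star ip_hadj)
    then show ?thesis using A.limit_unique[OF _ _ _ _ 1] hf f t s x y by auto
  qed
  then have l: "restrict t (carrier H) \<in> ops" (is "?l \<in> _") using t s by (intro opsI) auto
  have "(\<lambda>n. onrm (f n \<ominus>\<^bsub>opalg\<^esub> ?l)) \<longlonglongrightarrow> 0"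
  proof (rule LIMSEQ_I)
    fix e :: real assume e: "e > 0"
    obtain K where K: "\<And>m n. \<lbrakk>m \<ge> K; n \<ge> K\<rbrakk> \<Longrightarrow> onrm (f m \<ominus>\<^bsub>opalg\<^esub> f n) < e / 2"
      using c[of "e / 2"] e by auto
    have "onrm (f n \<ominus>\<^bsub>opalg\<^esub> ?l) < e" if n: "n \<ge> K" for n
    proof -
      have "hn ((f n \<ominus>\<^bsub>opalg\<^esub> ?l) x) \<le> e / 2 * hn x" if x: "x \<in> carrier H" for x
      proof -
        have "hn (f n x \<ominus>\<^bsub>H\<^esub> t x) \<le> e / 2 * hn x + hn (f m x \<ominus>\<^bsub>H\<^esub> t x)" if m: "m \<ge> K" for m
        proof -
          have "hn (f n x \<ominus>\<^bsub>H\<^esub> t x) \<le> hn (f n x \<ominus>\<^bsub>H\<^esub> f m x) + hn (f m x \<ominus>\<^bsub>H\<^esub> t x)"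
            using f t x by (intro hn_diff_triangle) auto
          moreover have "hn (f n x \<ominus>\<^bsub>H\<^esub> f m x) \<le> e / 2 * hn x"
            by (rule order_trans[OF pt[where g=f and x=x and m=n and n=m, OF f x]
                mult_right_mono[OF less_imp_le[OF K[OF n m]] hn_nonneg[OF x]]])
          ultimately show ?thesis by linarith
        qed
        moreover have "(\<lambda>m. e / 2 * hn x + hn (f m x \<ominus>\<^bsub>H\<^esub> t x)) \<longlonglongrightarrow> e / 2 * hn x + 0"
          using t(2)[OF x] by (intro tendsto_intros)
        ultimately have "hn (f n x \<ominus>\<^bsub>H\<^esub> t x) \<le> e / 2 * hn x + 0"
          by (intro LIMSEQ_le_const) blast+
        then show ?thesis using f l x by (simp add: opalg_diff)
      qed
      then have "onrm (f n \<ominus>\<^bsub>opalg\<^esub> ?l) \<le> e / 2" using e by (intro onrm_le) auto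
      then show ?thesis using e by simp
    qed
    then show "\<exists>K. \<forall>n\<ge>K. norm (onrm (f n \<ominus>\<^bsub>opalg\<^esub> ?l) - 0) < e"
      using onrm_nonneg[of "f n \<ominus>\<^bsub>opalg\<^esub> ?l" for n] O.minus_closed[of "f n" ?l for n] f l by auto
  qed
  then show ?thesis using l by blast
qed

lemma opalg_cstar: "unital_cstar_algebra opalg"
proof (intro unital_cstar_algebra.intro unital_cstar_algebra_axioms.intro)
  interpret O: ring opalg by (rule opalg_ring)
  show "ring opalg" by (rule opalg_ring)
  show "module complex_ring opalg" by (rule opalg_module)
  have zero: "nrm opalg t = 0 \<longleftrightarrow> t = \<zero>\<^bsub>opalg\<^esub>" if t: "t \<in> carrier opalg" for t
  proof
    assume "nrm opalg t = 0"
    then have "hn (t x) \<le> 0" if "x \<in> carrier H" for x using onrm[of t x] t that by simp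
    then have "hn (t x) = 0" if "x \<in> carrier H" for x
      using hn_nonneg[of "t x"] t that by (intro antisym) auto
    then show "t = \<zero>\<^bsub>opalg\<^esub>" using t hn_eq_0 by (auto intro!: ops_eqI)
  next
    assume "t = \<zero>\<^bsub>opalg\<^esub>"
    then show "nrm opalg t = 0" using onrm_le[of "\<lambda>x\<in>carrier H. \<zero>\<^bsub>H\<^esub>" 0] onrm_nonneg[of "\<lambda>x\<in>carrier H. \<zero>\<^bsub>H\<^esub>"] by simp
  qed
  show "nrm opalg t = 0 \<longleftrightarrow> t = \<zero>\<^bsub>opalg\<^esub>" if t: "t \<in> carrier opalg" for t using zero[OF that] .
  show nn: "0 \<le> nrm opalg t" if "t \<in> carrier opalg" for t using that onrm_nonneg by simp
  show tri: "nrm opalg (s \<oplus>\<^bsub>opalg\<^esub> t) \<le> nrm opalg s + nrm opalg t" if "s \<in> carrier opalg" "t \<in> carrier opalg" for s t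
  proof -
    have st: "s \<in> ops" "t \<in> ops" using that by simp_all
    have "onrm (\<lambda>x\<in>carrier H. s x \<oplus>\<^bsub>H\<^esub> t x) \<le> onrm s + onrm t"
    proof (rule onrm_le)
      fix x assume x: "x \<in> carrier H"
      show "hn ((\<lambda>x\<in>carrier H. s x \<oplus>\<^bsub>H\<^esub> t x) x) \<le> (onrm s + onrm t) * hn x"
        using hn_triangle[of "s x" "t x"] onrm[OF st(1) x] onrm[OF st(2) x] st x by (simp add: algebra_simps)
    qed (use st onrm_nonneg in auto)
    then show ?thesis by simp
  qed
  have sm: "nrm opalg (z \<odot>\<^bsub>opalg\<^esub> t) \<le> cmod z * nrm opalg t" if "t \<in> carrier opalg" for z t
    using that onrm[of t] onrm_nonneg[of t]
    by (auto intro!: onrm_le mult_left_mono simp: hn_smult mult.assoc)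
  show sme: "nrm opalg (z \<odot>\<^bsub>opalg\<^esub> t) = cmod z * nrm opalg t" if t: "t \<in> carrier opalg" for z t
  proof (cases "z = 0")
    case True
    then have "z \<odot>\<^bsub>opalg\<^esub> t = \<zero>\<^bsub>opalg\<^esub>" using t by (auto intro!: restrict_ext)
    then show ?thesis using True zero[of "\<zero>\<^bsub>opalg\<^esub>"] O.zero_closed by (simp del: opalg_simps)
  next
    case False
    have "(1 / z) \<odot>\<^bsub>opalg\<^esub> (z \<odot>\<^bsub>opalg\<^esub> t) = t"
      using t False by (auto intro!: trans[OF restrict_ext ops_ext])
    then have "nrm opalg t \<le> cmod (1 / z) * nrm opalg (z \<odot>\<^bsub>opalg\<^esub> t)"
      using sm[of "z \<odot>\<^bsub>opalg\<^esub> t" "1 / z"] t by simp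
    then have "cmod z * nrm opalg t \<le> nrm opalg (z \<odot>\<^bsub>opalg\<^esub> t)"
      using False by (simp add: norm_divide field_simps del: opalg_simps)
    then show ?thesis using sm[OF t, of z] by (simp del: opalg_simps)
  qed
  show "nrm opalg (s \<otimes>\<^bsub>opalg\<^esub> t) \<le> nrm opalg s * nrm opalg t" if "s \<in> carrier opalg" "t \<in> carrier opalg" for s t
    using that onrm_mult by simp
  show "nrm opalg (star opalg t \<otimes>\<^bsub>opalg\<^esub> t) = (nrm opalg t)\<^sup>2" if "t \<in> carrier opalg" for t
    using that onrm_mult[of "hadj t" t] onrm_hadj_le[of t] onrm_hadj[of t] by (simp add: power2_eq_square)
  have neg: "nrm opalg (\<ominus>\<^bsub>opalg\<^esub> t) = nrm opalg t" if t: "t \<in> carrier opalg" for t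
  proof -
    have "\<ominus>\<^bsub>opalg\<^esub> t = (-1) \<odot>\<^bsub>opalg\<^esub> t" using t by (auto simp: opalg_uminus hsmult_neg_one intro!: restrict_ext)
    then show ?thesis using sme[OF t, of "-1"] by (simp del: opalg_simps)
  qed
  have ms: "Metric_space (carrier opalg) (ndist opalg (nrm opalg))"
    using nn zero neg tri by (intro O.Metric_space_ndist)
  show "ncomplete opalg (nrm opalg)"
    unfolding ncomplete_iff[OF ms] using ops_complete by simp
  show "star opalg (s \<oplus>\<^bsub>opalg\<^esub> t) = star opalg s \<oplus>\<^bsub>opalg\<^esub> star opalg t" if "s \<in> carrier opalg" "t \<in> carrier opalg" for s t
    using that by (auto intro!: hadj_unique simp: ip_add ip_add_left ip_hadj)
  show "star opalg (z \<odot>\<^bsub>opalg\<^esub> t) = cnj z \<odot>\<^bsub>opalg\<^esub> star opalg t" if "t \<in> carrier opalg" for z t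
    using that by (auto intro!: hadj_unique simp: ip_smult ip_smult_left ip_hadj)
  show "star opalg (s \<otimes>\<^bsub>opalg\<^esub> t) = star opalg t \<otimes>\<^bsub>opalg\<^esub> star opalg s" if "s \<in> carrier opalg" "t \<in> carrier opalg" for s t
    using that by (auto intro!: hadj_unique simp: ip_hadj)
qed (auto intro!: restrict_ext simp: ops_smult)

end

section \<open>Conditional expectations of index-finite type\<close>

locale cond_exp = cstar_inclusion A C
  for A and C :: "('c, 'm) cstar_scheme" (structure) + fixes E
  assumes conditional_expectation: "conditional_expectation C A E"
begin

lemma E_sub [simp]: "x \<in> carrier C \<Longrightarrow> E x \<in> A"
  and E_id: "a \<in> A \<Longrightarrow> E a = a"
  and E_add: "\<lbrakk>x \<in> carrier C; y \<in> carrier C\<rbrakk> \<Longrightarrow> E (x \<oplus> y) = E x \<oplus> E y"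
  and E_smult: "x \<in> carrier C \<Longrightarrow> E (z \<odot> x) = z \<odot> E x"
  and E_bimod: "\<lbrakk>a \<in> A; x \<in> carrier C; b \<in> A\<rbrakk> \<Longrightarrow> E (a \<otimes> x \<otimes> b) = a \<otimes> E x \<otimes> b"
  and E_pos_sub: "cstar_positive C x \<Longrightarrow> cstar_positive CA (E x)"
  using conditional_expectation unfolding conditional_expectation_def by auto

lemma E_closed [simp]: "x \<in> carrier C \<Longrightarrow> E x \<in> carrier C"
  using E_sub sub_carrier by blast

lemma E_left: "\<lbrakk>a \<in> A; x \<in> carrier C\<rbrakk> \<Longrightarrow> E (a \<otimes> x) = a \<otimes> E x"
  using E_bimod[of a x \<one>] sub_one sub_carrier by simp

lemma E_right: "\<lbrakk>a \<in> A; x \<in> carrier C\<rbrakk> \<Longrightarrow> E (x \<otimes> a) = E x \<otimes> a"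
  using E_bimod[of \<one> x a] sub_one sub_carrier by simp

lemma E_neg: "x \<in> carrier C \<Longrightarrow> E (\<ominus> x) = \<ominus> E x"
  using E_smult[of x "-1"] by (simp add: C.smult_neg_one)

lemma E_diff: "\<lbrakk>x \<in> carrier C; y \<in> carrier C\<rbrakk> \<Longrightarrow> E (x \<ominus> y) = E x \<ominus> E y"
  by (simp add: C.minus_eq E_add E_neg)

lemma E_finsum: "\<lbrakk>finite I; f \<in> I \<rightarrow> carrier C\<rbrakk> \<Longrightarrow> E (finsum C f I) = (\<Oplus>i\<in>I. E (f i))"
  by (intro additive_finsum C.abelian_group_axioms) (auto simp: E_add)

lemma E_pos: "C.pos x \<Longrightarrow> C.pos (E x)"
  using E_pos_sub sub_pos by blast

text \<open>Positive elements are self-adjoint, so \<open>E\<close> preserves self-adjointness of elements of the form \<open>s - y\<close>,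
  which by linearity is all that is needed.\<close>

lemma E_star: assumes x: "x \<in> carrier C" shows "E (star C x) = star C (E x)"
proof -
  have sa: "star C (E y) = E y" if y: "y \<in> carrier C" "star C y = y" for y
  proof -
    let ?s = "C.sc (nrm C y)"
    have s: "?s \<in> A" unfolding C.sc_def using sub_smult sub_one by blast
    have "C.pos (E (?s \<ominus> y))" using E_pos C.pos_norm_minus[OF y order_refl] by blast
    then have "star C (?s \<ominus> E y) = ?s \<ominus> E y" using C.pos_star y s by (simp add: E_diff E_id)
    then have "?s \<ominus> star C (E y) = ?s \<ominus> E y" using y by (simp add: C.star_diff)
    then have "?s \<ominus> (?s \<ominus> star C (E y)) = ?s \<ominus> (?s \<ominus> E y)" by simp
    then show ?thesis using y by (simp add: C.diff_diff_cancel)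
  qed
  define y where "y = x \<oplus> star C x"
  define w where "w = \<i> \<odot> (x \<ominus> star C x)"
  have y: "y \<in> carrier C" "star C y = y" using x by (auto simp: y_def C.star_add C.a_comm)
  have w: "w \<in> carrier C" "star C w = w"
    using x C.smult_neg[of "star C x \<ominus> x" \<i>] C.smult_a_inv[of "x \<ominus> star C x" \<i>]
      C.smult_a_inv[of "star C x \<ominus> x" \<i>]
    by (auto simp: w_def C.star_smult C.star_add C.minus_eq C.minus_add C.a_comm)
  have "star C x = (1/2) \<odot> (y \<oplus> \<i> \<odot> w)" "x = (1/2) \<odot> (y \<ominus> \<i> \<odot> w)"
  proof -
    have iw: "\<i> \<odot> w = star C x \<ominus> x"
      using x C.smult_neg_one[of "x \<ominus> star C x"] by (simp add: w_def C.minus_eq C.minus_add C.a_comm)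
    have "y \<oplus> \<i> \<odot> w = 2 \<odot> star C x"
      unfolding iw y_def using x C.double_add[of "star C x"]
      by (simp add: C.minus_eq C.a_assoc C.r_neg C.a_comm[of x] C.l_neg)
    then show "star C x = (1/2) \<odot> (y \<oplus> \<i> \<odot> w)" using x by simp
    have "y \<ominus> \<i> \<odot> w = (star C x \<oplus> x) \<ominus> (star C x \<oplus> \<ominus> x)"
      unfolding iw y_def using x by (simp add: C.minus_eq C.a_comm)
    also have "\<dots> = 2 \<odot> x"
      using x C.add_diff_cancel_left[of x "\<ominus> x" "star C x"] C.double_add[of x] by (simp add: C.minus_eq)
    finally show "x = (1/2) \<odot> (y \<ominus> \<i> \<odot> w)" using x by simp
  qed
  then have "E (star C x) = (1/2) \<odot> (E y \<oplus> \<i> \<odot> E w)" "E x = (1/2) \<odot> (E y \<ominus> \<i> \<odot> E w)"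
    using y w by (metis (no_types, lifting) E_add E_smult C.smult_cl C.a_closed)
      (metis (no_types, lifting) \<open>x = (1/2) \<odot> (y \<ominus> \<i> \<odot> w)\<close> y(1) w(1) E_diff E_smult C.smult_cl C.minus_closed)
  then show ?thesis
    using y w sa[OF y] sa[OF w] C.smult_neg[of "E w" "\<i> / 2"]
    by (simp add: C.star_smult C.star_diff C.minus_eq C.smult_addr C.smult_a_inv C.star_add)
qed

lemma E_adjoint: "\<lbrakk>x \<in> carrier C; y \<in> carrier C\<rbrakk> \<Longrightarrow> star C (E (star C x \<otimes> y)) = E (star C y \<otimes> x)"
  using E_star[of "star C x \<otimes> y"] by (simp add: C.star_mult)

text \<open>One of the two expansions in a quasi-basis is the adjoint of the other one.\<close>

lemma index_finiteI:
  assumes I: "finite I" and w: "\<And>i. i \<in> I \<Longrightarrow> w i \<in> carrier C"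
    and left: "\<And>c. c \<in> carrier C \<Longrightarrow> (\<Oplus>i\<in>I. w i \<otimes> E (star C (w i) \<otimes> c)) = c"
  shows "index_finite_expectation C A E"
proof -
  obtain f where f: "bij_betw f {..<card I} I" using ex_bij_betw_nat_finite[OF I] atLeast0LessThan by metis
  have wf: "w (f i) \<in> carrier C" if "i < card I" for i using f w that by (auto simp: bij_betw_def)
  have left': "(\<Oplus>i\<in>{..<card I}. w (f i) \<otimes> E (star C (w (f i)) \<otimes> c)) = c" if c: "c \<in> carrier C" for c
  proof -
    have "c = (\<Oplus>i\<in>f ` {..<card I}. w i \<otimes> E (star C (w i) \<otimes> c))"
      using left[OF c] f by (simp add: bij_betw_def)
    also have "\<dots> = (\<Oplus>i\<in>{..<card I}. w (f i) \<otimes> E (star C (w (f i)) \<otimes> c))"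
      using f w c by (intro C.finsum_reindex) (auto simp: bij_betw_def)
    finally show ?thesis by simp
  qed
  have "(\<Oplus>i\<in>{..<card I}. E (c \<otimes> w (f i)) \<otimes> star C (w (f i))) = c" if c: "c \<in> carrier C" for c
  proof -
    have "c = star C (\<Oplus>i\<in>{..<card I}. w (f i) \<otimes> E (star C (w (f i)) \<otimes> star C c))"
      using left'[of "star C c"] c by simp
    also have "\<dots> = (\<Oplus>i\<in>{..<card I}. star C (w (f i) \<otimes> E (star C (w (f i)) \<otimes> star C c)))"
      using wf c by (intro C.star_finsum) auto
    also have "\<dots> = (\<Oplus>i\<in>{..<card I}. E (c \<otimes> w (f i)) \<otimes> star C (w (f i)))"
      using wf c by (intro C.finsum_cong') (auto simp: C.star_mult simp flip: E_star)
    finally show ?thesis by simp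
  qed
  then have "quasi_basis C E (card I) (\<lambda>i. w (f i))"
    unfolding quasi_basis_def using wf left' by auto
  then show ?thesis unfolding index_finite_expectation_def using conditional_expectation by blast
qed

end

locale index_finite = cond_exp A C E
  for A and C :: "('c, 'm) cstar_scheme" (structure) and E +
  fixes k :: nat and u :: "nat \<Rightarrow> 'c"
  assumes quasi_basis: "quasi_basis C E k u"
begin

lemma u_closed: "i < k \<Longrightarrow> u i \<in> carrier C"
  using quasi_basis unfolding quasi_basis_def by blast

lemma qb_left: "c \<in> carrier C \<Longrightarrow> (\<Oplus>i\<in>{..<k}. u i \<otimes> E (star C (u i) \<otimes> c)) = c"
  and qb_right: "c \<in> carrier C \<Longrightarrow> (\<Oplus>i\<in>{..<k}. E (c \<otimes> u i) \<otimes> star C (u i)) = c"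
  using quasi_basis unfolding quasi_basis_def by blast+

lemma framed: "framed_hilbert_module CA C (\<lambda>x a. x \<otimes> a) (\<lambda>x y. E (star C x \<otimes> y)) k u"
proof (intro framed_hilbert_module.intro framed_hilbert_module_axioms.intro sub_cstar C.complex_module)
  fix x y a assume "x \<in> carrier C" "y \<in> carrier C" "a \<in> carrier CA"
  then show "E (star C x \<otimes> (y \<otimes> a)) = E (star C x \<otimes> y) \<otimes>\<^bsub>CA\<^esub> a"
    using E_right[of a "star C x \<otimes> y"] by (simp add: C.m_assoc sub_carrier)
next
  fix x y assume "x \<in> carrier C" "y \<in> carrier C"
  then show "star CA (E (star C x \<otimes> y)) = E (star C y \<otimes> x)" by (simp add: E_adjoint)
next
  fix x assume "x \<in> carrier C"
  then show "cstar_positive CA (E (star C x \<otimes> x))" by (intro E_pos_sub C.pos_star_mult)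
next
  fix x assume "x \<in> carrier C"
  then show "x = (\<Oplus>i\<in>{..<k}. u i \<otimes> E (star C (u i) \<otimes> x))" by (simp add: qb_left)
qed (simp_all add: sub_carrier C.r_distr E_add E_smult u_closed)

sublocale H: framed_hilbert_module CA C "\<lambda>x a. x \<otimes> a" "\<lambda>x y. E (star C x \<otimes> y)" k u
  by (rule framed)

lemma ops_eq: "H.ops = adjointable_operators C A E"
proof
  show "adjointable_operators C A E \<subseteq> H.ops"
    unfolding adjointable_operators_def H.ops_def adjoint_pair_def by blast
  show "H.ops \<subseteq> adjointable_operators C A E"
  proof
    fix t assume t: "t \<in> H.ops"
    then have "\<exists>s\<in>carrier C \<rightarrow> carrier C. adjoint_pair C E t s"
      unfolding H.ops_def adjoint_pair_def by blast
    then show "t \<in> adjointable_operators C A E"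
      unfolding adjointable_operators_def
      using H.ops_PiE[OF t] H.ops_additive[OF t] H.ops_smult[OF t] H.ops_ra[OF t] by simp
  qed
qed

text \<open>A right \<open>A\<close>-linear map \<open>t\<close> is determined by its values on the quasi-basis, and \<open>y \<mapsto> \<Sum> u i E ((t (u i))* y)\<close>
  is an adjoint of it. So adjoints never have to be produced by hand below.\<close>

lemma linear_ops:
  assumes t: "\<And>x. x \<in> carrier C \<Longrightarrow> t x \<in> carrier C"
    and add: "\<And>x y. \<lbrakk>x \<in> carrier C; y \<in> carrier C\<rbrakk> \<Longrightarrow> t (x \<oplus> y) = t x \<oplus> t y"
    and right: "\<And>x a. \<lbrakk>x \<in> carrier C; a \<in> A\<rbrakk> \<Longrightarrow> t (x \<otimes> a) = t x \<otimes> a"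
  shows "restrict t (carrier C) \<in> H.ops"
proof (rule H.opsI)
  let ?s = "\<lambda>y. \<Oplus>i\<in>{..<k}. u i \<otimes> E (star C (t (u i)) \<otimes> y)"
  show "?s y \<in> carrier C" if "y \<in> carrier C" for y
    using u_closed t that by (intro C.finsum_closed) auto
  fix x y assume x: "x \<in> carrier C" and y: "y \<in> carrier C"
  have "t x = t (\<Oplus>i\<in>{..<k}. u i \<otimes> E (star C (u i) \<otimes> x))" using qb_left[OF x] by simp
  also have "\<dots> = (\<Oplus>i\<in>{..<k}. t (u i \<otimes> E (star C (u i) \<otimes> x)))"
    using t add u_closed x by (intro additive_finsum C.abelian_group_axioms) auto
  also have "\<dots> = (\<Oplus>i\<in>{..<k}. t (u i) \<otimes> E (star C (u i) \<otimes> x))"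
    using t u_closed x by (intro C.finsum_cong') (auto simp: right)
  finally have tx: "t x = (\<Oplus>i\<in>{..<k}. t (u i) \<otimes> E (star C (u i) \<otimes> x))" .
  have "star C (t x) \<otimes> y = (\<Oplus>i\<in>{..<k}. star C (t (u i) \<otimes> E (star C (u i) \<otimes> x))) \<otimes> y"
    unfolding tx using t u_closed x by (subst C.star_finsum) auto
  also have "\<dots> = (\<Oplus>i\<in>{..<k}. star C (t (u i) \<otimes> E (star C (u i) \<otimes> x)) \<otimes> y)"
    using t u_closed x y by (intro C.finsum_ldistr) auto
  also have "\<dots> = (\<Oplus>i\<in>{..<k}. E (star C x \<otimes> u i) \<otimes> (star C (t (u i)) \<otimes> y))"
    using t u_closed x y by (intro C.finsum_cong') (auto simp: C.star_mult C.m_assoc E_adjoint)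
  finally have "E (star C (t x) \<otimes> y) = (\<Oplus>i\<in>{..<k}. E (E (star C x \<otimes> u i) \<otimes> (star C (t (u i)) \<otimes> y)))"
    using t u_closed x y by (simp add: E_finsum Pi_def)
  also have "\<dots> = (\<Oplus>i\<in>{..<k}. E (star C x \<otimes> (u i \<otimes> E (star C (t (u i)) \<otimes> y))))"
  proof (rule C.finsum_cong')
    fix i assume "i \<in> {..<k}"
    then have i: "u i \<in> carrier C" using u_closed by simp
    have "star C x \<otimes> (u i \<otimes> E (star C (t (u i)) \<otimes> y)) = star C x \<otimes> u i \<otimes> E (star C (t (u i)) \<otimes> y)"
      using i t x y by (simp add: C.m_assoc)
    then show "E (E (star C x \<otimes> u i) \<otimes> (star C (t (u i)) \<otimes> y))
        = E (star C x \<otimes> (u i \<otimes> E (star C (t (u i)) \<otimes> y)))"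
      using i t x y by (simp add: E_left E_right)
  qed (use t u_closed x y in auto)
  also have "\<dots> = E (star C x \<otimes> ?s y)"
    using t u_closed x y by (subst C.finsum_rdistr) (auto simp: E_finsum Pi_def)
  finally show "E (star C (t x) \<otimes> y) = E (star C x \<otimes> ?s y)" .
qed (use t in auto)

subsection \<open>The index\<close>

text \<open>With \<open>f\<close> the identity and \<open>c = 1\<close> this is the independence of the index of the quasi-basis; with one
  quasi-basis and arbitrary \<open>c\<close> it is the centrality of the index.\<close>

lemma qb_shift:
  assumes qb': "quasi_basis C E k' u'" and c: "c \<in> carrier C"
    and f: "\<And>x. x \<in> carrier C \<Longrightarrow> f x \<in> carrier C"
    and add: "\<And>x y. \<lbrakk>x \<in> carrier C; y \<in> carrier C\<rbrakk> \<Longrightarrow> f (x \<oplus> y) = f x \<oplus> f y"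
    and right: "\<And>x a. \<lbrakk>x \<in> carrier C; a \<in> A\<rbrakk> \<Longrightarrow> f (x \<otimes> a) = f x \<otimes> a"
  shows "(\<Oplus>i\<in>{..<k'}. f (c \<otimes> u' i) \<otimes> star C (u' i)) = (\<Oplus>j\<in>{..<k}. f (u j) \<otimes> star C (u j)) \<otimes> c"
proof -
  interpret Q: index_finite A C E k' u' by unfold_locales fact
  have fx: "f x = (\<Oplus>j\<in>{..<k}. f (u j) \<otimes> E (star C (u j) \<otimes> x))" if x: "x \<in> carrier C" for x
  proof -
    have "f x = f (\<Oplus>i\<in>{..<k}. u i \<otimes> E (star C (u i) \<otimes> x))" using qb_left[OF x] by simp
    also have "\<dots> = (\<Oplus>i\<in>{..<k}. f (u i \<otimes> E (star C (u i) \<otimes> x)))"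
      using f add u_closed x by (intro additive_finsum C.abelian_group_axioms) auto
    also have "\<dots> = (\<Oplus>i\<in>{..<k}. f (u i) \<otimes> E (star C (u i) \<otimes> x))"
      using f u_closed x by (intro C.finsum_cong') (auto simp: right)
    finally show ?thesis .
  qed
  have "(\<Oplus>i\<in>{..<k'}. f (c \<otimes> u' i) \<otimes> star C (u' i))
      = (\<Oplus>i\<in>{..<k'}. \<Oplus>j\<in>{..<k}. f (u j) \<otimes> (E (star C (u j) \<otimes> c \<otimes> u' i) \<otimes> star C (u' i)))"
  proof (rule C.finsum_cong')
    fix i assume "i \<in> {..<k'}"
    then have i: "u' i \<in> carrier C" using Q.u_closed by simp
    show "f (c \<otimes> u' i) \<otimes> star C (u' i)
      = (\<Oplus>j\<in>{..<k}. f (u j) \<otimes> (E (star C (u j) \<otimes> c \<otimes> u' i) \<otimes> star C (u' i)))"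
      using i c f u_closed
      by (subst fx) (auto simp: C.finsum_ldistr Pi_def C.m_assoc intro!: C.finsum_cong')
  qed (use c f u_closed Q.u_closed in \<open>auto intro!: C.finsum_closed\<close>)
  also have "\<dots> = (\<Oplus>j\<in>{..<k}. \<Oplus>i\<in>{..<k'}. f (u j) \<otimes> (E (star C (u j) \<otimes> c \<otimes> u' i) \<otimes> star C (u' i)))"
    using c f u_closed Q.u_closed by (intro C.finsum_swap) auto
  also have "\<dots> = (\<Oplus>j\<in>{..<k}. f (u j) \<otimes> star C (u j) \<otimes> c)"
  proof (rule C.finsum_cong')
    fix j assume "j \<in> {..<k}"
    then have j: "u j \<in> carrier C" using u_closed by simp
    show "(\<Oplus>i\<in>{..<k'}. f (u j) \<otimes> (E (star C (u j) \<otimes> c \<otimes> u' i) \<otimes> star C (u' i)))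
      = f (u j) \<otimes> star C (u j) \<otimes> c"
      using j c f Q.u_closed Q.qb_right[of "star C (u j) \<otimes> c"]
      by (subst C.finsum_rdistr[symmetric]) (auto simp: C.m_assoc)
  qed (use c f u_closed in auto)
  also have "\<dots> = (\<Oplus>j\<in>{..<k}. f (u j) \<otimes> star C (u j)) \<otimes> c"
    using c f u_closed by (intro C.finsum_ldistr[symmetric]) auto
  finally show ?thesis .
qed

definition Ind :: 'c where "Ind = (\<Oplus>i\<in>{..<k}. u i \<otimes> star C (u i))"

lemma Ind_closed [simp]: "Ind \<in> carrier C"
  unfolding Ind_def using u_closed by (intro C.finsum_closed) auto

lemma watatani_index_eq: "watatani_index C E = Ind"
  unfolding watatani_index_def
proof (rule the_equality)
  show "\<exists>k u. quasi_basis C E k u \<and> Ind = (\<Oplus>i\<in>{..<k}. u i \<otimes> star C (u i))"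
    using quasi_basis Ind_def by blast
next
  fix w assume "\<exists>k u. quasi_basis C E k u \<and> w = (\<Oplus>i\<in>{..<k}. u i \<otimes> star C (u i))"
  then obtain k' u' where q: "quasi_basis C E k' u'" and w: "w = (\<Oplus>i\<in>{..<k'}. u' i \<otimes> star C (u' i))" by blast
  have u': "u' i \<in> carrier C" if "i < k'" for i using q that unfolding quasi_basis_def by blast
  have "w = (\<Oplus>i\<in>{..<k'}. \<one> \<otimes> u' i \<otimes> star C (u' i))"
    unfolding w using u' by (intro C.finsum_cong') auto
  also have "\<dots> = Ind \<otimes> \<one>" unfolding Ind_def using qb_shift[OF q, of \<one> "\<lambda>x. x"] by simp
  finally show "w = Ind" by simp
qed

lemma Ind_central: assumes c: "c \<in> carrier C" shows "c \<otimes> Ind = Ind \<otimes> c"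
proof -
  have "c \<otimes> Ind = (\<Oplus>i\<in>{..<k}. c \<otimes> u i \<otimes> star C (u i))"
    unfolding Ind_def using c u_closed by (subst C.finsum_rdistr) (auto simp: C.m_assoc intro!: C.finsum_cong')
  also have "\<dots> = Ind \<otimes> c" unfolding Ind_def using qb_shift[OF quasi_basis c, of "\<lambda>x. x"] by simp
  finally show ?thesis .
qed

text \<open>The difference is \<open>\<Sum> (u i - E (u i)) (u i - E (u i))*\<close>. It makes the index invertible.\<close>

lemma Ind_ge_one: "C.pos (Ind \<ominus> \<one>)"
proof -
  have E1: "E \<one> = \<one>" using E_id sub_one by blast
  have r: "(\<Oplus>i\<in>{..<k}. E (u i) \<otimes> star C (u i)) = \<one>"
  proof -
    have "(\<Oplus>i\<in>{..<k}. E (u i) \<otimes> star C (u i)) = (\<Oplus>i\<in>{..<k}. E (\<one> \<otimes> u i) \<otimes> star C (u i))"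
      using u_closed by (intro C.finsum_cong') auto
    then show ?thesis using qb_right[of \<one>] by simp
  qed
  have l: "(\<Oplus>i\<in>{..<k}. u i \<otimes> E (star C (u i))) = \<one>"
  proof -
    have "(\<Oplus>i\<in>{..<k}. u i \<otimes> E (star C (u i))) = (\<Oplus>i\<in>{..<k}. u i \<otimes> E (star C (u i) \<otimes> \<one>))"
      using u_closed by (intro C.finsum_cong') auto
    then show ?thesis using qb_left[of \<one>] by simp
  qed
  have ll: "(\<Oplus>i\<in>{..<k}. E (u i) \<otimes> E (star C (u i))) = \<one>"
  proof -
    have "E \<one> = (\<Oplus>i\<in>{..<k}. E (u i \<otimes> E (star C (u i))))"
      unfolding l[symmetric] using u_closed by (intro E_finsum) auto
    also have "\<dots> = (\<Oplus>i\<in>{..<k}. E (u i) \<otimes> E (star C (u i)))"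
      using u_closed by (intro C.finsum_cong') (auto simp: E_right)
    finally show ?thesis using E1 by simp
  qed
  have "Ind \<ominus> \<one> = (Ind \<ominus> \<one>) \<ominus> (\<one> \<ominus> \<one>)" by (simp add: C.minus_eq C.r_neg)
  also have "\<dots> = (\<Oplus>i\<in>{..<k}. u i \<otimes> star C (u i) \<ominus> E (u i) \<otimes> star C (u i))
      \<ominus> (\<Oplus>i\<in>{..<k}. u i \<otimes> E (star C (u i)) \<ominus> E (u i) \<otimes> E (star C (u i)))"
    using u_closed by (simp add: Ind_def r l ll Pi_def flip: C.finsum_diff)
  also have "\<dots> = (\<Oplus>i\<in>{..<k}. (u i \<otimes> star C (u i) \<ominus> E (u i) \<otimes> star C (u i))
      \<ominus> (u i \<otimes> E (star C (u i)) \<ominus> E (u i) \<otimes> E (star C (u i))))"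
    using u_closed by (intro C.finsum_diff) auto
  also have "\<dots> = (\<Oplus>i\<in>{..<k}. (u i \<ominus> E (u i)) \<otimes> star C (u i \<ominus> E (u i)))"
    using u_closed by (intro C.finsum_cong') (auto simp: C.star_diff C.l_diff C.r_diff E_star)
  finally have "Ind \<ominus> \<one> = (\<Oplus>i\<in>{..<k}. (u i \<ominus> E (u i)) \<otimes> star C (u i \<ominus> E (u i)))" .
  then show ?thesis using u_closed by (auto intro!: C.pos_finsum C.pos_mult_star)
qed

lemma Ind_sqrt:
  obtains h \<kappa> where "h \<in> carrier C" "\<kappa> \<in> carrier C" "star C h = h" "star C \<kappa> = \<kappa>"
    "h \<otimes> \<kappa> = \<one>" "\<kappa> \<otimes> h = \<one>" "\<kappa> \<otimes> \<kappa> = Ind" "inv Ind = h \<otimes> h"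
    "\<And>c. c \<in> carrier C \<Longrightarrow> c \<otimes> h = h \<otimes> c"
proof -
  have "C.pos (Ind \<ominus> C.sc 1)" using Ind_ge_one by simp
  then show ?thesis
  proof (rule C.pos_inverse_sqrt[OF Ind_closed _ zero_less_one])
    fix h \<kappa>
    assume h: "h \<in> carrier C" "\<kappa> \<in> carrier C" "star C h = h" "star C \<kappa> = \<kappa>"
      "h \<otimes> \<kappa> = \<one>" "\<kappa> \<otimes> h = \<one>" "\<kappa> \<otimes> \<kappa> = Ind"
      and hc: "\<And>c. \<lbrakk>c \<in> carrier C; c \<otimes> Ind = Ind \<otimes> c\<rbrakk> \<Longrightarrow> c \<otimes> h = h \<otimes> c"
  have "Ind \<otimes> (h \<otimes> h) = \<kappa> \<otimes> (\<kappa> \<otimes> h) \<otimes> h" unfolding h(7)[symmetric] using h(1,2) by (simp add: C.m_assoc)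
  then have 1: "Ind \<otimes> (h \<otimes> h) = \<one>" using h by simp
  have "(h \<otimes> h) \<otimes> Ind = h \<otimes> (h \<otimes> \<kappa>) \<otimes> \<kappa>" unfolding h(7)[symmetric] using h(1,2) by (simp add: C.m_assoc)
  then have "(h \<otimes> h) \<otimes> Ind = \<one>" using h by simp
  then have "inv Ind = h \<otimes> h" using 1 h by (intro C.inv_char) auto
  then show ?thesis using that[OF h] hc Ind_central by blast
  qed
qed

end

lemma index_finite_expectation_locale:
  assumes "index_finite_expectation C A E"
  obtains k u where "index_finite A C E k u"
proof -
  obtain k u where "conditional_expectation C A E" "quasi_basis C E k u"
    using assms unfolding index_finite_expectation_def by blast
  moreover from this have "unital_inclusion A C" "unital_cstar_algebra C"
    unfolding conditional_expectation_def unital_inclusion_def by auto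
  ultimately have "index_finite A C E k u"
    by (simp add: index_finite_def index_finite_axioms_def cond_exp_def cond_exp_axioms_def
      cstar_inclusion_def cstar_inclusion_axioms_def)
  then show ?thesis using that by blast
qed

section \<open>The basic construction\<close>

text \<open>The data of a basic construction with the representation \<open>p\<close> on \<open>C\<close> fixed, so that identities in \<open>C1\<close>
  can be checked by their action on \<open>C\<close>.\<close>

locale basic = index_finite A C E k u + C1: unital_cstar_algebra C1
  for A and C :: "('c, 'm) cstar_scheme" (structure) and E k u and C1 :: "('t, 'n) cstar_scheme" +
  fixes \<iota> :: "'c \<Rightarrow> 't" and e :: 't and p :: "'t \<Rightarrow> 'c \<Rightarrow> 'c"
  assumes iota_closed [simp]: "c \<in> carrier C \<Longrightarrow> \<iota> c \<in> carrier C1"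
    and e_closed [simp]: "e \<in> carrier C1"
    and p_bij: "bij_betw p (carrier C1) H.ops"
    and p_add: "\<lbrakk>s \<in> carrier C1; t \<in> carrier C1; x \<in> carrier C\<rbrakk> \<Longrightarrow> p (s \<oplus>\<^bsub>C1\<^esub> t) x = p s x \<oplus> p t x"
    and p_mult: "\<lbrakk>s \<in> carrier C1; t \<in> carrier C1; x \<in> carrier C\<rbrakk> \<Longrightarrow> p (s \<otimes>\<^bsub>C1\<^esub> t) x = p s (p t x)"
    and p_smult: "\<lbrakk>t \<in> carrier C1; x \<in> carrier C\<rbrakk> \<Longrightarrow> p (z \<odot>\<^bsub>C1\<^esub> t) x = z \<odot> p t x"
    and p_star: "\<lbrakk>t \<in> carrier C1; x \<in> carrier C; y \<in> carrier C\<rbrakk> \<Longrightarrow>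
      E (star C (p t x) \<otimes> y) = E (star C x \<otimes> p (star C1 t) y)"
    and p_iota [simp]: "\<lbrakk>c \<in> carrier C; x \<in> carrier C\<rbrakk> \<Longrightarrow> p (\<iota> c) x = c \<otimes> x"
    and p_e [simp]: "x \<in> carrier C \<Longrightarrow> p e x = E x"
begin

abbreviation mult1 :: "'t \<Rightarrow> 't \<Rightarrow> 't" (infixl "\<star>" 70) where "s \<star> t \<equiv> s \<otimes>\<^bsub>C1\<^esub> t"

lemma p_ops: "t \<in> carrier C1 \<Longrightarrow> p t \<in> H.ops" using p_bij by (auto simp: bij_betw_def)

lemma p_closed [simp]: "\<lbrakk>t \<in> carrier C1; x \<in> carrier C\<rbrakk> \<Longrightarrow> p t x \<in> carrier C"
  using H.ops_closed[OF p_ops] by blast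

lemma p_surj: assumes "t \<in> H.ops" obtains s where "s \<in> carrier C1" "p s = t"
proof -
  have "t \<in> p ` carrier C1" using p_bij assms by (simp add: bij_betw_def)
  then show ?thesis using that by blast
qed

lemma eq1:
  assumes "s \<in> carrier C1" "t \<in> carrier C1" "\<And>x. x \<in> carrier C \<Longrightarrow> p s x = p t x" shows "s = t"
proof -
  have "p s = p t" using H.ops_eqI[OF p_ops p_ops] assms by blast
  then show ?thesis using p_bij assms by (auto simp: bij_betw_def inj_on_def)
qed

lemma p_right: "\<lbrakk>t \<in> carrier C1; x \<in> carrier C; a \<in> A\<rbrakk> \<Longrightarrow> p t (x \<otimes> a) = p t x \<otimes> a"
  using H.ops_ra[OF p_ops] by simp

lemma p_addx: "\<lbrakk>t \<in> carrier C1; x \<in> carrier C; y \<in> carrier C\<rbrakk> \<Longrightarrow> p t (x \<oplus> y) = p t x \<oplus> p t y"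
  using H.ops_additive[OF p_ops] by blast

lemma p_frame: "\<lbrakk>t \<in> carrier C1; x \<in> carrier C\<rbrakk> \<Longrightarrow> p t x = (\<Oplus>i\<in>{..<k}. p t (u i) \<otimes> E (star C (u i) \<otimes> x))"
  using H.ops_frame[OF p_ops] by simp

lemma p_one [simp]: assumes x: "x \<in> carrier C" shows "p \<one>\<^bsub>C1\<^esub> x = x"
proof -
  obtain s where s: "s \<in> carrier C1" "p s = (\<lambda>x\<in>carrier C. x)" using p_surj[OF H.ops_one] by blast
  have "p s (p \<one>\<^bsub>C1\<^esub> x) = p s x" using p_mult[of s "\<one>\<^bsub>C1\<^esub>" x] s x by simp
  then show ?thesis using s x by simp
qed

lemma p_finsum:
  "\<lbrakk>finite I; f \<in> I \<rightarrow> carrier C1; x \<in> carrier C\<rbrakk> \<Longrightarrow> p (finsum C1 f I) x = (\<Oplus>i\<in>I. p (f i) x)"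
  by (rule additive_finsum[of C1 C "\<lambda>t. p t x"])
    (auto simp: p_add C.abelian_group_axioms C1.abelian_group_axioms)

lemma nondeg: "\<lbrakk>x \<in> carrier C; y \<in> carrier C; \<And>z. z \<in> carrier C \<Longrightarrow> E (star C z \<otimes> x) = E (star C z \<otimes> y)\<rbrakk> \<Longrightarrow> x = y"
  using H.ip_ext by blast

lemma iota_add: "\<lbrakk>c \<in> carrier C; d \<in> carrier C\<rbrakk> \<Longrightarrow> \<iota> (c \<oplus> d) = \<iota> c \<oplus>\<^bsub>C1\<^esub> \<iota> d"
  by (rule eq1) (auto simp: p_add C.l_distr)

lemma iota_mult: "\<lbrakk>c \<in> carrier C; d \<in> carrier C\<rbrakk> \<Longrightarrow> \<iota> (c \<otimes> d) = \<iota> c \<star> \<iota> d"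
  by (rule eq1) (auto simp: p_mult C.m_assoc)

lemma iota_smult: "c \<in> carrier C \<Longrightarrow> \<iota> (z \<odot> c) = z \<odot>\<^bsub>C1\<^esub> \<iota> c"
  by (rule eq1) (auto simp: p_smult)

lemma iota_one: "\<iota> \<one> = \<one>\<^bsub>C1\<^esub>"
  by (rule eq1) auto

lemma iota_star: assumes c: "c \<in> carrier C" shows "\<iota> (star C c) = star C1 (\<iota> c)"
proof (rule eq1)
  fix x assume x: "x \<in> carrier C"
  show "p (\<iota> (star C c)) x = p (star C1 (\<iota> c)) x"
  proof (rule nondeg)
    fix z assume z: "z \<in> carrier C"
    show "E (star C z \<otimes> p (\<iota> (star C c)) x) = E (star C z \<otimes> p (star C1 (\<iota> c)) x)"
      using p_star[of "\<iota> c" z x] c x z by (simp add: C.star_mult C.m_assoc)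
  qed (use c x in auto)
qed (use c in auto)

lemma iota_finsum: "\<lbrakk>finite I; f \<in> I \<rightarrow> carrier C\<rbrakk> \<Longrightarrow> \<iota> (finsum C f I) = finsum C1 (\<lambda>i. \<iota> (f i)) I"
  by (intro additive_finsum C.abelian_group_axioms C1.abelian_group_axioms) (auto simp: iota_add)

lemma iota_diff: "\<lbrakk>c \<in> carrier C; d \<in> carrier C\<rbrakk> \<Longrightarrow> \<iota> (c \<ominus> d) = \<iota> c \<ominus>\<^bsub>C1\<^esub> \<iota> d"
  using iota_smult[of d "-1"]
  by (simp add: C.minus_eq C1.minus_eq iota_add C.smult_neg_one C1.smult_neg_one)

lemma iota_inj: assumes "c \<in> carrier C" "d \<in> carrier C" "\<iota> c = \<iota> d" shows "c = d"
proof -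
  have "c = p (\<iota> c) \<one>" using assms(1) by simp
  also have "\<dots> = p (\<iota> d) \<one>" by (simp only: assms(3))
  also have "\<dots> = d" using assms(2) by simp
  finally show ?thesis .
qed

lemma e_star: "star C1 e = e"
proof (rule eq1)
  fix x assume x: "x \<in> carrier C"
  show "p (star C1 e) x = p e x"
  proof (rule nondeg)
    fix z assume z: "z \<in> carrier C"
    have "E (star C z \<otimes> p (star C1 e) x) = E (star C (E z) \<otimes> x)" using p_star[of e z x] x z by simp
    also have "\<dots> = star C (E z) \<otimes> E x" using x z by (intro E_left sub_star) auto
    also have "\<dots> = E (star C z \<otimes> E x)" using x z by (simp add: E_right E_star)
    finally show "E (star C z \<otimes> p (star C1 e) x) = E (star C z \<otimes> p e x)" using x by simp
  qed (use x in auto)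
qed auto

lemma e_iota_e: "c \<in> carrier C \<Longrightarrow> e \<star> \<iota> c \<star> e = \<iota> (E c) \<star> e"
  by (rule eq1) (auto simp: p_mult E_right)

lemma iota_e_commute: "a \<in> A \<Longrightarrow> \<iota> a \<star> e = e \<star> \<iota> a"
  by (rule eq1) (auto simp: p_mult E_left sub_carrier)

lemma iota_e_inj: assumes "c \<in> carrier C" "d \<in> carrier C" "\<iota> c \<star> e = \<iota> d \<star> e" shows "c = d"
proof -
  have "c = p (\<iota> c \<star> e) \<one>" using assms(1) E_id[OF sub_one] by (simp add: p_mult)
  also have "\<dots> = p (\<iota> d \<star> e) \<one>" by (simp only: assms(3))
  also have "\<dots> = d" using assms(2) E_id[OF sub_one] by (simp add: p_mult)
  finally show ?thesis .
qed

lemma p_word: "\<lbrakk>c \<in> carrier C; d \<in> carrier C; x \<in> carrier C\<rbrakk> \<Longrightarrow> p (\<iota> c \<star> e \<star> \<iota> d) x = c \<otimes> E (d \<otimes> x)"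
  by (simp add: p_mult)

text \<open>An operator \<open>t\<close> is \<open>\<Sum> t (u i) e (u i)*\<close>: apply it to the expansion of an element in the quasi-basis.\<close>

lemma expand: assumes t: "t \<in> carrier C1"
  shows "t = (\<Oplus>\<^bsub>C1\<^esub>i\<in>{..<k}. \<iota> (p t (u i)) \<star> e \<star> \<iota> (star C (u i)))"
proof (rule eq1[OF t])
  show "(\<Oplus>\<^bsub>C1\<^esub>i\<in>{..<k}. \<iota> (p t (u i)) \<star> e \<star> \<iota> (star C (u i))) \<in> carrier C1"
    using t u_closed by (intro C1.finsum_closed) auto
  fix x assume x: "x \<in> carrier C"
  have "p (\<Oplus>\<^bsub>C1\<^esub>i\<in>{..<k}. \<iota> (p t (u i)) \<star> e \<star> \<iota> (star C (u i))) x
      = (\<Oplus>i\<in>{..<k}. p (\<iota> (p t (u i)) \<star> e \<star> \<iota> (star C (u i))) x)"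
    using t u_closed x by (intro p_finsum) auto
  also have "\<dots> = (\<Oplus>i\<in>{..<k}. p t (u i) \<otimes> E (star C (u i) \<otimes> x))"
    using t u_closed x by (intro C.finsum_cong') (auto simp: p_word)
  finally show "p t x = p (\<Oplus>\<^bsub>C1\<^esub>i\<in>{..<k}. \<iota> (p t (u i)) \<star> e \<star> \<iota> (star C (u i))) x"
    using p_frame[OF t x] by simp
qed

lemma span_words:
  "complex_span C1 {\<iota> c \<star> e \<star> \<iota> c' | c c'. c \<in> carrier C \<and> c' \<in> carrier C} = carrier C1" (is "complex_span C1 ?S = _")
proof
  have "submodule (carrier C1) complex_ring C1" by (rule module.carrier_is_submodule[OF C1.complex_module])
  moreover have "?S \<subseteq> carrier C1" by auto
  ultimately show "complex_span C1 ?S \<subseteq> carrier C1" unfolding complex_span_def by blast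
  show "carrier C1 \<subseteq> complex_span C1 ?S"
    unfolding complex_span_def
  proof (rule subsetI, rule InterI)
    fix t G assume t: "t \<in> carrier C1" and "G \<in> {H. submodule H complex_ring C1 \<and> ?S \<subseteq> H}"
    then have G: "submodule G complex_ring C1" "?S \<subseteq> G" by auto
    note sub = module.submoduleE[OF C1.complex_module G(1)]
    have sum: "finsum C1 f I \<in> G" if "finite I" "\<And>i. i \<in> I \<Longrightarrow> f i \<in> G" for f and I :: "nat set"
      using that
    proof (induction I rule: finite_induct)
      case empty
      obtain g where "g \<in> G" using sub(2) by blast
      then have "0 \<odot>\<^bsub>C1\<^esub> g \<in> G" "g \<in> carrier C1" using sub(1,4) by (auto simp: complex_ring_def)
      then show ?case by simp
    next
      case (insert i I)
      have "f \<in> I \<rightarrow> carrier C1" "f i \<in> carrier C1" using insert.prems sub(1) by auto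
      then show ?case using insert sub(5) by simp
    qed
    show "t \<in> G"
      using sum[of "{..<k}" "\<lambda>i. \<iota> (p t (u i)) \<star> e \<star> \<iota> (star C (u i))"] G(2) t u_closed
      unfolding expand[OF t, symmetric] by fastforce
  qed
qed

lemma basic_construction: "basic_construction C A E C1 \<iota> e"
  unfolding basic_construction_def
proof (intro conjI exI[of _ p] ballI allI)
  fix t assume "t \<in> carrier C1"
  then show "adjoint_pair C E (p t) (p (star C1 t))" unfolding adjoint_pair_def using p_star by blast
qed (use p_bij in \<open>simp_all add: span_words ops_eq[symmetric] p_add p_mult p_smult C1.unital_cstar_algebra_axioms\<close>)

subsection \<open>The dual conditional expectation\<close>

text \<open>The unnormalised dual expectation, the linear extension of \<open>c e d \<mapsto> c d\<close>.\<close>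

definition Phi :: "'t \<Rightarrow> 'c" where "Phi t = (\<Oplus>i\<in>{..<k}. p t (u i) \<otimes> star C (u i))"

lemma Phi_closed [simp]: "t \<in> carrier C1 \<Longrightarrow> Phi t \<in> carrier C"
  unfolding Phi_def using u_closed by (intro C.finsum_closed) auto

lemma Phi_add: "\<lbrakk>s \<in> carrier C1; t \<in> carrier C1\<rbrakk> \<Longrightarrow> Phi (s \<oplus>\<^bsub>C1\<^esub> t) = Phi s \<oplus> Phi t"
proof -
  assume st: "s \<in> carrier C1" "t \<in> carrier C1"
  have "Phi (s \<oplus>\<^bsub>C1\<^esub> t) = (\<Oplus>i\<in>{..<k}. p s (u i) \<otimes> star C (u i) \<oplus> p t (u i) \<otimes> star C (u i))"
    unfolding Phi_def using st u_closed by (intro C.finsum_cong') (auto simp: p_add C.l_distr)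
  then show ?thesis unfolding Phi_def using st u_closed by (simp add: C.finsum_addf Pi_def)
qed

lemma Phi_smult: "t \<in> carrier C1 \<Longrightarrow> Phi (z \<odot>\<^bsub>C1\<^esub> t) = z \<odot> Phi t"
  unfolding Phi_def using u_closed
  by (subst C.smult_finsum) (auto simp: p_smult intro!: C.finsum_cong')

lemma Phi_left: "\<lbrakk>c \<in> carrier C; t \<in> carrier C1\<rbrakk> \<Longrightarrow> Phi (\<iota> c \<star> t) = c \<otimes> Phi t"
  unfolding Phi_def using u_closed
  by (subst C.finsum_rdistr) (auto simp: p_mult C.m_assoc intro!: C.finsum_cong')

lemma Phi_right: assumes c: "c \<in> carrier C" and t: "t \<in> carrier C1" shows "Phi (t \<star> \<iota> c) = Phi t \<otimes> c"
proof -
  have "Phi (t \<star> \<iota> c) = (\<Oplus>i\<in>{..<k}. p t (c \<otimes> u i) \<otimes> star C (u i))"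
    unfolding Phi_def using c t u_closed by (intro C.finsum_cong') (auto simp: p_mult)
  also have "\<dots> = Phi t \<otimes> c"
    unfolding Phi_def using qb_shift[OF quasi_basis c, of "p t"] t by (simp add: p_addx p_right)
  finally show ?thesis .
qed

lemma Phi_one: "Phi \<one>\<^bsub>C1\<^esub> = Ind"
  unfolding Phi_def Ind_def using u_closed by (intro C.finsum_cong') auto

lemma Phi_e: "Phi e = \<one>"
proof -
  have "Phi e = (\<Oplus>i\<in>{..<k}. E (\<one> \<otimes> u i) \<otimes> star C (u i))"
    unfolding Phi_def using u_closed by (intro C.finsum_cong') auto
  then show ?thesis using qb_right[of \<one>] by simp
qed

lemma Phi_iota: "c \<in> carrier C \<Longrightarrow> Phi (\<iota> c) = c \<otimes> Ind"
  using Phi_left[of c "\<one>\<^bsub>C1\<^esub>"] by (simp add: Phi_one)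

text \<open>This formula shows the positivity of \<open>Phi\<close>.\<close>

lemma Phi_mult_star:
  assumes s: "s \<in> carrier C1"
  shows "Phi (s \<star> star C1 s) = (\<Oplus>j\<in>{..<k}. p s (u j) \<otimes> star C (p s (u j)))"
proof -
  have "Phi (s \<star> star C1 s)
      = (\<Oplus>i\<in>{..<k}. \<Oplus>j\<in>{..<k}. p s (u j) \<otimes> (E (star C (p s (u j)) \<otimes> u i) \<otimes> star C (u i)))"
    unfolding Phi_def
  proof (rule C.finsum_cong')
    fix i assume "i \<in> {..<k}"
    then have i: "u i \<in> carrier C" using u_closed by simp
    have "p (s \<star> star C1 s) (u i) = p s (p (star C1 s) (u i))" using s i by (simp add: p_mult)
    also have "\<dots> = (\<Oplus>j\<in>{..<k}. p s (u j) \<otimes> E (star C (u j) \<otimes> p (star C1 s) (u i)))"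
      using s i by (intro p_frame) auto
    also have "\<dots> = (\<Oplus>j\<in>{..<k}. p s (u j) \<otimes> E (star C (p s (u j)) \<otimes> u i))"
      using s i u_closed by (intro C.finsum_cong') (auto simp: p_star)
    finally show "p (s \<star> star C1 s) (u i) \<otimes> star C (u i)
        = (\<Oplus>j\<in>{..<k}. p s (u j) \<otimes> (E (star C (p s (u j)) \<otimes> u i) \<otimes> star C (u i)))"
      using s i u_closed by (simp add: C.finsum_ldistr Pi_def C.m_assoc cong: C.finsum_cong)
  qed (use s u_closed in \<open>auto intro!: C.finsum_closed\<close>)
  also have "\<dots> = (\<Oplus>j\<in>{..<k}. \<Oplus>i\<in>{..<k}. p s (u j) \<otimes> (E (star C (p s (u j)) \<otimes> u i) \<otimes> star C (u i)))"
    using s u_closed by (intro C.finsum_swap) auto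
  also have "\<dots> = (\<Oplus>j\<in>{..<k}. p s (u j) \<otimes> star C (p s (u j)))"
  proof (rule C.finsum_cong')
    fix j assume "j \<in> {..<k}"
    then have j: "u j \<in> carrier C" using u_closed by simp
    show "(\<Oplus>i\<in>{..<k}. p s (u j) \<otimes> (E (star C (p s (u j)) \<otimes> u i) \<otimes> star C (u i)))
        = p s (u j) \<otimes> star C (p s (u j))"
      using s j u_closed qb_right[of "star C (p s (u j))"] by (subst C.finsum_rdistr[symmetric]) auto
  qed (use s u_closed in auto)
  finally show ?thesis .
qed

definition E1 :: "'t \<Rightarrow> 't" where "E1 t = \<iota> (inv Ind \<otimes> Phi t)"

lemma inv_Ind: shows inv_Ind_closed [simp]: "inv Ind \<in> carrier C"
  and inv_Ind_left: "inv Ind \<otimes> Ind = \<one>" and inv_Ind_right: "Ind \<otimes> inv Ind = \<one>"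
  and inv_Ind_central: "c \<in> carrier C \<Longrightarrow> c \<otimes> inv Ind = inv Ind \<otimes> c"
proof -
  obtain h \<kappa> where h: "h \<in> carrier C" "\<kappa> \<in> carrier C" "h \<otimes> \<kappa> = \<one>" "\<kappa> \<otimes> h = \<one>" "\<kappa> \<otimes> \<kappa> = Ind" "inv Ind = h \<otimes> h"
    and hc: "\<And>c. c \<in> carrier C \<Longrightarrow> c \<otimes> h = h \<otimes> c" by (rule Ind_sqrt) blast
  show "inv Ind \<in> carrier C" using h by simp
  have "h \<otimes> h \<otimes> (\<kappa> \<otimes> \<kappa>) = h \<otimes> (h \<otimes> \<kappa>) \<otimes> \<kappa>" using h(1,2) by (simp add: C.m_assoc)
  then show "inv Ind \<otimes> Ind = \<one>" using h by simp
  have "\<kappa> \<otimes> \<kappa> \<otimes> (h \<otimes> h) = \<kappa> \<otimes> (\<kappa> \<otimes> h) \<otimes> h" using h(1,2) by (simp add: C.m_assoc)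
  then show "Ind \<otimes> inv Ind = \<one>" using h by simp
  show "c \<otimes> inv Ind = inv Ind \<otimes> c" if c: "c \<in> carrier C"
  proof -
    have "c \<otimes> (h \<otimes> h) = h \<otimes> c \<otimes> h" using hc[OF c] c h(1) by (simp flip: C.m_assoc)
    also have "\<dots> = h \<otimes> h \<otimes> c" using hc[OF c] c h(1) by (simp add: C.m_assoc)
    finally show ?thesis using h(6) by simp
  qed
qed

lemma E1_closed [simp]: "t \<in> carrier C1 \<Longrightarrow> E1 t \<in> carrier C1" by (simp add: E1_def)

lemma E1_iota: "c \<in> carrier C \<Longrightarrow> E1 (\<iota> c) = \<iota> c"
  using inv_Ind_left by (simp add: E1_def Phi_iota Ind_central flip: C.m_assoc)

lemma E1_word: "\<lbrakk>c \<in> carrier C; d \<in> carrier C\<rbrakk> \<Longrightarrow> E1 (\<iota> c \<star> e \<star> \<iota> d) = \<iota> (inv Ind \<otimes> c \<otimes> d)"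
  by (simp add: E1_def Phi_left Phi_right Phi_e C.m_assoc C1.m_assoc)

lemma Phi_pos: assumes "C1.pos t" shows "C.pos (inv Ind \<otimes> Phi t)"
proof -
  obtain z where z: "z \<in> carrier C1" "t = star C1 z \<star> z" using assms unfolding cstar_positive_def by blast
  obtain h \<kappa> where h: "h \<in> carrier C" "star C h = h" "inv Ind = h \<otimes> h"
    and hc: "\<And>c. c \<in> carrier C \<Longrightarrow> c \<otimes> h = h \<otimes> c" by (rule Ind_sqrt) blast
  have "Phi t = (\<Oplus>j\<in>{..<k}. p (star C1 z) (u j) \<otimes> star C (p (star C1 z) (u j)))"
    using Phi_mult_star[of "star C1 z"] z by simp
  then have P: "C.pos (Phi t)" using u_closed z by (auto intro!: C.pos_finsum C.pos_mult_star)
  have "star C h \<otimes> Phi t \<otimes> h = inv Ind \<otimes> Phi t"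
    using h(1,2) hc[of "Phi t"] z by (simp add: h(3) C.m_assoc)
  then show ?thesis using C.pos_conj[OF P h(1)] by simp
qed

lemma iota_pos: assumes "C.pos c" shows "C1.pos (\<iota> c)"
proof -
  obtain z where "z \<in> carrier C" "c = star C z \<otimes> z" using assms unfolding cstar_positive_def by blast
  then show ?thesis by (auto simp: iota_mult iota_star)
qed

lemma iota_isometric: assumes c: "c \<in> carrier C" shows "nrm C1 (\<iota> c) = nrm C c"
proof (rule antisym)
  show "nrm C1 (\<iota> c) \<le> nrm C c"
    by (rule star_hom_contractive[OF C.unital_cstar_algebra_axioms C1.unital_cstar_algebra_axioms])
      (use c in \<open>auto simp: iota_add iota_mult iota_smult iota_star iota_one\<close>)
  let ?s = "(nrm C1 (\<iota> c))\<^sup>2" and ?b = "star C c \<otimes> c"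
  have sc: "C1.sc ?s = \<iota> (C.sc ?s)" by (simp add: C1.sc_def C.sc_def iota_smult iota_one)
  have "C1.pos (C1.sc ?s \<ominus>\<^bsub>C1\<^esub> \<iota> ?b)"
    using C1.cstar_identity[of "\<iota> c"] c
    by (intro C1.pos_norm_minus) (auto simp: iota_mult iota_star C1.star_mult)
  then have "C1.pos (\<iota> (C.sc ?s \<ominus> ?b))" using c by (simp add: sc iota_diff)
  then have "C.pos (inv Ind \<otimes> Phi (\<iota> (C.sc ?s \<ominus> ?b)))" by (rule Phi_pos)
  moreover have "inv Ind \<otimes> Phi (\<iota> (C.sc ?s \<ominus> ?b)) = C.sc ?s \<ominus> ?b"
    using iota_inj[OF _ _ E1_iota[of "C.sc ?s \<ominus> ?b", unfolded E1_def]] c by simp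
  ultimately have "C.pos (C.sc ?s \<ominus> ?b)" by simp
  then have "nrm C ?b \<le> ?s" using C.pos_norm_le[OF C.pos_star_mult[OF c]] by simp
  then have "(nrm C c)\<^sup>2 \<le> ?s" using C.cstar_identity[OF c] by simp
  then show "nrm C c \<le> nrm C1 (\<iota> c)" using C1.nrm_nonneg[of "\<iota> c"] c power2_le_imp_le by simp
qed

text \<open>The embedding is isometric, so its image is complete and hence closed.\<close>

lemma iota_inclusion: "unital_inclusion (\<iota> ` carrier C) C1"
proof (rule C1.unital_inclusionI)
  show "\<one>\<^bsub>C1\<^esub> \<in> \<iota> ` carrier C" using iota_one by force
  fix f :: "nat \<Rightarrow> 't" and l assume f: "\<And>n. f n \<in> \<iota> ` carrier C" and l: "l \<in> carrier C1" "(\<lambda>n. nrm C1 (f n \<ominus>\<^bsub>C1\<^esub> l)) \<longlonglongrightarrow> 0"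
  have "\<exists>c. c \<in> carrier C \<and> f n = \<iota> c" for n using f[of n] by blast
  then obtain g where "\<forall>n. g n \<in> carrier C \<and> f n = \<iota> (g n)" using choice[of "\<lambda>n c. c \<in> carrier C \<and> f n = \<iota> c"] by blast
  then have g: "g n \<in> carrier C" "f n = \<iota> (g n)" for n by auto
  have d: "nrm C (g m \<ominus> g n) = nrm C1 (f m \<ominus>\<^bsub>C1\<^esub> f n)" for m n
    using iota_isometric[of "g m \<ominus> g n"] g by (simp add: iota_diff)
  have cau: "\<exists>K. \<forall>m\<ge>K. \<forall>n\<ge>K. nrm C (g m \<ominus> g n) < r" if r: "r > 0" for r
  proof -
    obtain K where K: "\<And>n. n \<ge> K \<Longrightarrow> nrm C1 (f n \<ominus>\<^bsub>C1\<^esub> l) < r / 2"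
      using LIMSEQ_D[OF l(2), of "r / 2"] r by force
    have "nrm C (g m \<ominus> g n) < r" if "m \<ge> K" "n \<ge> K" for m n
      using C1.nrm_diff_triangle[of "f m" l "f n"] C1.nrm_diff_comm[of l "f n"] K[OF that(1)] K[OF that(2)] l(1) g
      unfolding d by simp
    then show ?thesis by blast
  qed
  obtain c where c: "c \<in> carrier C" "(\<lambda>n. nrm C (g n \<ominus> c)) \<longlonglongrightarrow> 0"
    by (rule C.cauchy_limit[OF g(1) cau]) blast
  have "nrm C (g n \<ominus> c) = nrm C1 (f n \<ominus>\<^bsub>C1\<^esub> \<iota> c)" for n
    using iota_isometric[of "g n \<ominus> c"] g c by (simp add: iota_diff)
  then have "(\<lambda>n. nrm C1 (f n \<ominus>\<^bsub>C1\<^esub> \<iota> c)) \<longlonglongrightarrow> 0" using c by simp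
  then have "l = \<iota> c" using C1.limit_unique[of f l "\<iota> c"] l g c by simp
  then show "l \<in> \<iota> ` carrier C" using c by blast
next
  fix a b assume "a \<in> \<iota> ` carrier C" "b \<in> \<iota> ` carrier C"
  then obtain c d where "c \<in> carrier C" "d \<in> carrier C" "a = \<iota> c" "b = \<iota> d" by blast
  then show "a \<oplus>\<^bsub>C1\<^esub> b \<in> \<iota> ` carrier C" "a \<star> b \<in> \<iota> ` carrier C"
    by (auto simp flip: iota_add iota_mult)
next
  fix a z assume "a \<in> \<iota> ` carrier C"
  then show "z \<odot>\<^bsub>C1\<^esub> a \<in> \<iota> ` carrier C" "star C1 a \<in> \<iota> ` carrier C"
    by (auto simp flip: iota_smult iota_star)
qed auto

lemma E1_conditional_expectation: "conditional_expectation C1 (\<iota> ` carrier C) E1"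
proof -
  interpret I: cstar_inclusion "\<iota> ` carrier C" C1
    by unfold_locales (rule iota_inclusion)
  show ?thesis
    unfolding conditional_expectation_def
  proof (intro conjI ballI allI impI)
    show "unital_inclusion (\<iota> ` carrier C) C1" by (rule iota_inclusion)
    show "E1 \<in> carrier C1 \<rightarrow> \<iota> ` carrier C" by (auto simp: E1_def)
    show "E1 a = a" if "a \<in> \<iota> ` carrier C" for a using that E1_iota by auto
    show "E1 (x \<oplus>\<^bsub>C1\<^esub> y) = E1 x \<oplus>\<^bsub>C1\<^esub> E1 y" if "x \<in> carrier C1" "y \<in> carrier C1" for x y
      using that by (simp add: E1_def Phi_add C.r_distr iota_add)
    show "E1 (z \<odot>\<^bsub>C1\<^esub> x) = z \<odot>\<^bsub>C1\<^esub> E1 x" if "x \<in> carrier C1" for z x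
      using that by (simp add: E1_def Phi_smult iota_smult)
    show "E1 (a \<star> x \<star> b) = a \<star> E1 x \<star> b" if axb: "a \<in> \<iota> ` carrier C" "x \<in> carrier C1" "b \<in> \<iota> ` carrier C" for a x b
    proof -
      obtain c where c: "c \<in> carrier C" "a = \<iota> c" using axb(1) by blast
      obtain d where d: "d \<in> carrier C" "b = \<iota> d" using axb(3) by blast
      note cd = c(1) d(1) c(2) d(2)
      have Px: "Phi x \<in> carrier C" using axb by simp
      have "inv Ind \<otimes> (c \<otimes> Phi x \<otimes> d) = (inv Ind \<otimes> c) \<otimes> (Phi x \<otimes> d)"
        using cd(1,2) Px by (simp add: C.m_assoc)
      also have "\<dots> = (c \<otimes> inv Ind) \<otimes> (Phi x \<otimes> d)" by (simp only: inv_Ind_central[OF cd(1)])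
      also have "\<dots> = c \<otimes> (inv Ind \<otimes> Phi x) \<otimes> d" using cd(1,2) Px by (simp add: C.m_assoc)
      finally have eq: "inv Ind \<otimes> (c \<otimes> Phi x \<otimes> d) = c \<otimes> (inv Ind \<otimes> Phi x) \<otimes> d" .
      have "E1 (a \<star> x \<star> b) = \<iota> (inv Ind \<otimes> (c \<otimes> Phi x \<otimes> d))"
        using cd axb by (simp add: E1_def Phi_left Phi_right)
      also have "\<dots> = a \<star> E1 x \<star> b"
        unfolding eq using cd(1,2) Px by (simp add: E1_def iota_mult cd(3,4))
      finally show ?thesis .
    qed
    show "cstar_positive (C1\<lparr>carrier := \<iota> ` carrier C\<rparr>) (E1 x)" if x: "C1.pos x" for x
      using iota_pos[OF Phi_pos[OF x]] C1.pos_closed[OF x] unfolding I.sub_pos by (auto simp: E1_def)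
  qed
qed

text \<open>If \<open>\<kappa>\<close> is the square root of the index, then the elements \<open>u i e \<kappa>\<close> form a quasi-basis of the dual
  expectation.\<close>

lemma E1_index_finite: "index_finite_expectation C1 (\<iota> ` carrier C) E1"
proof -
  interpret F: cond_exp "\<iota> ` carrier C" C1 E1
    by (intro cond_exp.intro cstar_inclusion.intro cstar_inclusion_axioms.intro cond_exp_axioms.intro
        C1.unital_cstar_algebra_axioms iota_inclusion E1_conditional_expectation)
  obtain h \<kappa> where h: "h \<in> carrier C" "\<kappa> \<in> carrier C" "star C \<kappa> = \<kappa>" "h \<otimes> \<kappa> = \<one>" "\<kappa> \<otimes> h = \<one>" "inv Ind = h \<otimes> h"
    by (rule Ind_sqrt) blast
  define w where "w i = \<iota> (u i) \<star> e \<star> \<iota> \<kappa>" for i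
  have w: "w i \<in> carrier C1" if "i < k" for i using u_closed[OF that] h by (simp add: w_def)
  have ws: "star C1 (w i) = \<iota> \<kappa> \<star> e \<star> \<iota> (star C (u i))" if "i < k" for i
    using u_closed[OF that] h by (simp add: w_def C1.star_mult e_star iota_star[symmetric] C1.m_assoc)
  show ?thesis
  proof (rule F.index_finiteI[of "{..<k}" w])
    fix t assume t: "t \<in> carrier C1"
    show "(\<Oplus>\<^bsub>C1\<^esub>i\<in>{..<k}. w i \<star> E1 (star C1 (w i) \<star> t)) = t"
    proof (rule eq1[OF _ t])
      show "(\<Oplus>\<^bsub>C1\<^esub>i\<in>{..<k}. w i \<star> E1 (star C1 (w i) \<star> t)) \<in> carrier C1"
        using t w by (intro C1.finsum_closed) auto
      fix x assume x: "x \<in> carrier C"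
      have "p (w i \<star> E1 (star C1 (w i) \<star> t)) x = u i \<otimes> E (star C (u i) \<otimes> p t x)" if i: "i < k" for i
      proof -
        have ui: "u i \<in> carrier C" using u_closed[OF i] .
        let ?q = "e \<star> (\<iota> (star C (u i)) \<star> t)"
        have q: "?q \<in> carrier C1" using ui t by simp
        have "star C1 (w i) \<star> t = \<iota> \<kappa> \<star> ?q" using ws[OF i] ui t h by (simp add: C1.m_assoc)
        then have "E1 (star C1 (w i) \<star> t) = \<iota> (h \<otimes> h \<otimes> (\<kappa> \<otimes> Phi ?q))"
          using h q by (simp add: E1_def Phi_left)
        also have "h \<otimes> h \<otimes> (\<kappa> \<otimes> Phi ?q) = h \<otimes> ((h \<otimes> \<kappa>) \<otimes> Phi ?q)"
          using h(1,2) Phi_closed[OF q] by (simp add: C.m_assoc)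
        also have "\<dots> = h \<otimes> Phi ?q" using h Phi_closed[OF q] by simp
        finally have "p (w i \<star> E1 (star C1 (w i) \<star> t)) x = u i \<otimes> E (\<kappa> \<otimes> (h \<otimes> Phi ?q \<otimes> x))"
          using ui h(1,2) Phi_closed[OF q] x by (simp add: w_def p_mult)
        also have "\<kappa> \<otimes> (h \<otimes> Phi ?q \<otimes> x) = (\<kappa> \<otimes> h) \<otimes> (Phi ?q \<otimes> x)"
          using h(1,2) Phi_closed[OF q] x by (simp add: C.m_assoc)
        also have "\<dots> = Phi (?q \<star> \<iota> x)" using h Phi_closed[OF q] Phi_right[OF x q] x by simp
        also have "E (Phi (?q \<star> \<iota> x)) = E (star C (u i) \<otimes> p t x)"
        proof -
          let ?s = "\<iota> (star C (u i)) \<star> t \<star> \<iota> x"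
          have s: "?s \<in> carrier C1" using ui t x by simp
          have "?q \<star> \<iota> x = e \<star> ?s" using ui t x by (simp add: C1.m_assoc)
          then have "E (Phi (?q \<star> \<iota> x)) = (\<Oplus>j\<in>{..<k}. E (E (p ?s (u j)) \<otimes> star C (u j)))"
            unfolding Phi_def using s u_closed by (simp add: E_finsum Pi_def p_mult[of e] cong: C.finsum_cong)
          also have "\<dots> = (\<Oplus>j\<in>{..<k}. E (p ?s (u j) \<otimes> E (star C (u j) \<otimes> \<one>)))"
            using s u_closed by (intro C.finsum_cong') (auto simp: E_left E_right)
          also have "\<dots> = E (p ?s \<one>)"
            unfolding p_frame[OF s C.one_closed] using s u_closed by (intro E_finsum[symmetric]) auto
          finally show ?thesis using ui t x by (simp add: p_mult)
        qed
        finally show ?thesis .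
      qed
      then have "(\<Oplus>i\<in>{..<k}. p (w i \<star> E1 (star C1 (w i) \<star> t)) x) = (\<Oplus>i\<in>{..<k}. u i \<otimes> E (star C (u i) \<otimes> p t x))"
        using t x u_closed by (intro C.finsum_cong') auto
      then show "p (\<Oplus>\<^bsub>C1\<^esub>i\<in>{..<k}. w i \<star> E1 (star C1 (w i) \<star> t)) x = p t x"
        using t w x qb_left[of "p t x"] by (simp add: p_finsum Pi_def)
    qed
  qed (use w in auto)
qed

end

lemma basic_of_basic_construction:
  assumes "index_finite A C E k u" "basic_construction C A E C1 \<iota> e"
  obtains p where "basic A C E k u C1 \<iota> e p"
proof -
  interpret I: index_finite A C E k u by fact
  obtain p where "bij_betw p (carrier C1) (adjointable_operators C A E)"
      "\<forall>s\<in>carrier C1. \<forall>t\<in>carrier C1. \<forall>x\<in>carrier C. p (s \<oplus>\<^bsub>C1\<^esub> t) x = p s x \<oplus>\<^bsub>C\<^esub> p t x"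
      "\<forall>s\<in>carrier C1. \<forall>t\<in>carrier C1. \<forall>x\<in>carrier C. p (s \<otimes>\<^bsub>C1\<^esub> t) x = p s (p t x)"
      "\<forall>z. \<forall>t\<in>carrier C1. \<forall>x\<in>carrier C. p (z \<odot>\<^bsub>C1\<^esub> t) x = z \<odot>\<^bsub>C\<^esub> p t x"
      "\<forall>t\<in>carrier C1. adjoint_pair C E (p t) (p (star C1 t))"
      "\<forall>c\<in>carrier C. \<forall>x\<in>carrier C. p (\<iota> c) x = c \<otimes>\<^bsub>C\<^esub> x" "\<forall>x\<in>carrier C. p e x = E x"
    and c: "unital_cstar_algebra C1" "\<iota> \<in> carrier C \<rightarrow> carrier C1" "e \<in> carrier C1"
    using assms(2) unfolding basic_construction_def by blast
  then have "basic A C E k u C1 \<iota> e p"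
    by (intro basic.intro basic_axioms.intro assms(1)) (auto simp: I.ops_eq adjoint_pair_def)
  then show ?thesis by (rule that)
qed

context index_finite
begin

text \<open>The algebra of adjointable operators is itself a basic construction.\<close>

lemma basic_opalg: "basic A C E k u H.opalg (\<lambda>c. \<lambda>x\<in>carrier C. c \<otimes> x) (\<lambda>x\<in>carrier C. E x) (\<lambda>t. t)"
proof (intro basic.intro basic_axioms.intro index_finite_axioms H.opalg_cstar)
  show "(\<lambda>x\<in>carrier C. c \<otimes> x) \<in> carrier H.opalg" if "c \<in> carrier C" for c
    unfolding H.opalg_simps using that by (intro linear_ops) (auto simp: C.r_distr C.m_assoc sub_carrier)
  show "(\<lambda>x\<in>carrier C. E x) \<in> carrier H.opalg"
    unfolding H.opalg_simps by (intro linear_ops) (auto simp: E_add E_right)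
qed (auto simp: H.ip_hadj bij_betw_def)

end

section \<open>Transport of structure\<close>

text \<open>The structure of \<open>M\<close> on the image of an injection \<open>j\<close> defined on its carrier. It serves to keep all
  algebras of a tower in one type.\<close>

definition transport :: "('a \<Rightarrow> 'b) \<Rightarrow> ('a, 'm) cstar_scheme \<Rightarrow> 'b cstar" where
  "transport j M = (let g = inv_into (carrier M) j in
     \<lparr>carrier = j ` carrier M, mult = (\<lambda>x y. j (g x \<otimes>\<^bsub>M\<^esub> g y)), one = j \<one>\<^bsub>M\<^esub>, ring.zero = j \<zero>\<^bsub>M\<^esub>,
      add = (\<lambda>x y. j (g x \<oplus>\<^bsub>M\<^esub> g y)), smult = (\<lambda>z x. j (z \<odot>\<^bsub>M\<^esub> g x)),
      star = (\<lambda>x. j (star M (g x))), nrm = (\<lambda>x. nrm M (g x))\<rparr>)"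

locale transported = M: unital_cstar_algebra M for M :: "('a, 'm) cstar_scheme" (structure) +
  fixes j :: "'a \<Rightarrow> 'b"
  assumes inj: "inj_on j (carrier M)"
begin

abbreviation "N \<equiv> transport j M"

lemma inv_j [simp]: "x \<in> carrier M \<Longrightarrow> inv_into (carrier M) j (j x) = x"
  using inj by simp

lemma transport_simps [simp]:
  "carrier N = j ` carrier M" "\<one>\<^bsub>N\<^esub> = j \<one>" "\<zero>\<^bsub>N\<^esub> = j \<zero>"
  "\<lbrakk>x \<in> carrier M; y \<in> carrier M\<rbrakk> \<Longrightarrow> j x \<otimes>\<^bsub>N\<^esub> j y = j (x \<otimes> y)"
  "\<lbrakk>x \<in> carrier M; y \<in> carrier M\<rbrakk> \<Longrightarrow> j x \<oplus>\<^bsub>N\<^esub> j y = j (x \<oplus> y)"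
  "x \<in> carrier M \<Longrightarrow> z \<odot>\<^bsub>N\<^esub> j x = j (z \<odot> x)"
  "x \<in> carrier M \<Longrightarrow> star N (j x) = j (star M x)"
  "x \<in> carrier M \<Longrightarrow> nrm N (j x) = nrm M x"
  by (simp_all add: transport_def Let_def)

lemma j_eq [simp]: "\<lbrakk>x \<in> carrier M; y \<in> carrier M\<rbrakk> \<Longrightarrow> j x = j y \<longleftrightarrow> x = y"
  using inj by (simp add: inj_on_eq_iff)

lemma transport_group: "abelian_group N"
proof (rule abelian_groupI)
  fix x assume "x \<in> carrier N"
  then obtain a where "a \<in> carrier M" "x = j a" by auto
  then show "\<exists>y\<in>carrier N. y \<oplus>\<^bsub>N\<^esub> x = \<zero>\<^bsub>N\<^esub>"
    by (intro bexI[of _ "j (\<ominus> a)"]) (auto simp: M.l_neg)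
qed (auto simp: M.a_ac)

lemma transport_ring: "ring N"
proof (rule ringI[OF transport_group])
  show "monoid N" by (rule monoidI) (auto simp: M.m_assoc)
qed (auto simp: M.l_distr M.r_distr)

lemma transport_uminus: assumes "x \<in> carrier M" shows "\<ominus>\<^bsub>N\<^esub> j x = j (\<ominus> x)"
proof -
  interpret N: ring N by (rule transport_ring)
  have "j (\<ominus> x) \<oplus>\<^bsub>N\<^esub> j x = \<zero>\<^bsub>N\<^esub>" using assms by (simp add: M.l_neg)
  then show ?thesis using N.minus_equality[of "j (\<ominus> x)" "j x"] assms by simp
qed

lemma transport_diff: "\<lbrakk>x \<in> carrier M; y \<in> carrier M\<rbrakk> \<Longrightarrow> j x \<ominus>\<^bsub>N\<^esub> j y = j (x \<ominus> y)"
  by (simp add: a_minus_def[of N] transport_uminus M.minus_eq)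

lemma transport_sequence:
  assumes "\<And>n. f n \<in> carrier N" obtains g where "\<And>n. g n \<in> carrier M" "\<And>n. f n = j (g n)"
  using that[of "\<lambda>n. inv_into (carrier M) j (f n)"] assms
  by (metis f_inv_into_f inv_into_into transport_simps(1))

lemma transport_cstar: "unital_cstar_algebra N"
proof (intro unital_cstar_algebra.intro unital_cstar_algebra_axioms.intro transport_ring)
  interpret N: ring N by (rule transport_ring)
  show "module complex_ring N"
    by (rule moduleI[OF cring_complex_ring transport_group])
      (auto simp: complex_ring_def M.smult_addl M.smult_addr)
  have ms: "Metric_space (carrier N) (ndist N (nrm N))"
    by (rule N.Metric_space_ndist)
      (auto simp: M.nrm_nonneg M.nrm_eq_0_iff M.nrm_triangle transport_uminus)
  show "ncomplete N (nrm N)"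
    unfolding ncomplete_iff[OF ms]
  proof (intro allI impI, elim conjE)
    fix f :: "nat \<Rightarrow> 'b"
    assume f: "\<forall>n. f n \<in> carrier N"
      and c: "\<forall>e>0. \<exists>K. \<forall>m\<ge>K. \<forall>n\<ge>K. nrm N (f m \<ominus>\<^bsub>N\<^esub> f n) < e"
    obtain g where g: "\<And>n. g n \<in> carrier M" "\<And>n. f n = j (g n)"
      by (rule transport_sequence[of f]) (use f in auto)
    have "\<exists>K. \<forall>m\<ge>K. \<forall>n\<ge>K. nrm M (g m \<ominus> g n) < e" if "e > 0" for e
      using c that g(1) unfolding g(2) by (simp add: transport_diff)
    then obtain l where l: "l \<in> carrier M" "(\<lambda>n. nrm M (g n \<ominus> l)) \<longlonglongrightarrow> 0"
      by (rule M.cauchy_limit[OF g(1)]) blast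
    have "(\<lambda>n. nrm N (f n \<ominus>\<^bsub>N\<^esub> j l)) \<longlonglongrightarrow> 0" using l g(1) unfolding g(2) by (simp add: transport_diff)
    then show "\<exists>l\<in>carrier N. (\<lambda>n. nrm N (f n \<ominus>\<^bsub>N\<^esub> l)) \<longlonglongrightarrow> 0" using l(1) by auto
  qed
qed (auto simp: M.star_add M.star_smult M.star_mult M.nrm_nonneg M.nrm_eq_0_iff
  M.nrm_triangle M.nrm_smult M.nrm_mult M.cstar_identity)

lemma transport_inclusion: assumes "unital_inclusion A M" shows "unital_inclusion (j ` A) N"
proof -
  interpret I: cstar_inclusion A M by unfold_locales fact
  interpret N: unital_cstar_algebra N by (rule transport_cstar)
  show ?thesis
  proof (rule N.unital_inclusionI)
    show "\<one>\<^bsub>N\<^esub> \<in> j ` A" using I.sub_one by simp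
    show "a \<oplus>\<^bsub>N\<^esub> b \<in> j ` A" if "a \<in> j ` A" "b \<in> j ` A" for a b
      using that by (auto simp: I.sub_carrier I.sub_add)
    show "a \<otimes>\<^bsub>N\<^esub> b \<in> j ` A" if "a \<in> j ` A" "b \<in> j ` A" for a b
      using that by (auto simp: I.sub_carrier I.sub_mult)
    fix f :: "nat \<Rightarrow> 'b" and l
    assume f: "\<And>n. f n \<in> j ` A" and l: "l \<in> carrier N" and lim: "(\<lambda>n. nrm N (f n \<ominus>\<^bsub>N\<^esub> l)) \<longlonglongrightarrow> 0"
    have fc: "f n \<in> carrier N" for n using f[of n] I.sub_carrier by auto
    obtain g where g: "\<And>n. g n \<in> carrier M" "\<And>n. f n = j (g n)"
      by (rule transport_sequence[of f, OF fc]) auto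
    obtain m where m: "m \<in> carrier M" "l = j m" using l by auto
    have "g n \<in> A" for n
    proof -
      obtain a where "a \<in> A" "f n = j a" using f[of n] by blast
      then show ?thesis using g[of n] I.sub_carrier by simp
    qed
    moreover have "(\<lambda>n. nrm M (g n \<ominus> m)) \<longlonglongrightarrow> 0"
      using lim g(1) m(1) unfolding g(2) m(2) by (simp add: transport_diff)
    ultimately show "l \<in> j ` A" using I.sub_limit[of g m] m by blast
  qed (use I.sub_carrier I.sub_smult I.sub_star in auto)
qed

end

lemma (in basic) transport_basic:
  assumes "inj_on j (carrier C1)"
  shows "basic A C E k u (transport j C1) (\<lambda>c. j (\<iota> c)) (j e) (\<lambda>t. p (inv_into (carrier C1) j t))"
proof -
  interpret T: transported C1 j by unfold_locales fact
  show ?thesis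
  proof (intro basic.intro basic_axioms.intro index_finite_axioms T.transport_cstar)
    have "bij_betw (inv_into (carrier C1) j) (carrier T.N) (carrier C1)"
      using bij_betw_inv_into[OF inj_on_imp_bij_betw[OF assms]] by simp
    from bij_betw_trans[OF this p_bij]
    show "bij_betw (\<lambda>t. p (inv_into (carrier C1) j t)) (carrier T.N) H.ops"
      by (simp add: comp_def)
  qed (auto simp: p_add p_mult p_smult p_star)
qed

section \<open>Existence of towers\<close>

text \<open>An operator on \<open>C\<close> is determined by its values on the finite quasi-basis. If the elements of \<open>C\<close> are
  sequences, then these finitely many sequences can be merged into one with a pairing function, and
  so the basic construction fits into the type of \<open>C\<close>.\<close>

lemma basic_exists:
  fixes C :: "(nat \<Rightarrow> 'c) cstar"
  assumes "index_finite A C E k u"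
  obtains C1 :: "(nat \<Rightarrow> 'c) cstar" and \<iota> e p where "basic A C E k u C1 \<iota> e p"
proof -
  interpret I: index_finite A C E k u by fact
  interpret B: basic A C E k u I.H.opalg "\<lambda>c. \<lambda>x\<in>carrier C. c \<otimes>\<^bsub>C\<^esub> x" "\<lambda>x\<in>carrier C. E x" "\<lambda>t. t"
    by (rule I.basic_opalg)
  define j :: "((nat \<Rightarrow> 'c) \<Rightarrow> nat \<Rightarrow> 'c) \<Rightarrow> nat \<Rightarrow> 'c"
    where "j t n = (case prod_decode n of (i, m) \<Rightarrow> t (u i) m)" for t n
  have "inj_on j (carrier I.H.opalg)"
  proof (rule inj_onI)
    fix s t assume st: "s \<in> carrier I.H.opalg" "t \<in> carrier I.H.opalg" "j s = j t"
    have "s (u i) m = t (u i) m" for i m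
      using fun_cong[OF st(3), of "prod_encode (i, m)"] by (simp add: j_def)
    then have "s (u i) = t (u i)" for i by blast
    then show "s = t"
      using B.p_frame[OF st(1)] B.p_frame[OF st(2)] by (intro B.eq1 st(1,2)) simp
  qed
  then show ?thesis using B.transport_basic that by blast
qed

text \<open>The copy of \<open>C\<close> by constant sequences is the start of a recursion within one type.\<close>

lemma jones_tower_exists:
  fixes C :: "'c cstar"
  assumes "index_finite_expectation (transport (\<lambda>c (_::nat). c) C) ((\<lambda>c _. c) ` A) E"
    and "unital_cstar_algebra C"
  shows "\<exists>S :: ('c, nat \<Rightarrow> 'c) tower. jones_tower A C S"
proof -
  define j :: "'c \<Rightarrow> nat \<Rightarrow> 'c" where "j = (\<lambda>c _. c)"
  interpret C: unital_cstar_algebra C by fact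
  interpret T: transported C j by unfold_locales (auto simp: inj_on_def j_def fun_eq_iff)
  define P where "P = (\<lambda>(M :: (nat \<Rightarrow> 'c) cstar, B, F). index_finite_expectation M B F)"
  define R where "R = (\<lambda>(M :: (nat \<Rightarrow> 'c) cstar, B, F) (M' :: (nat \<Rightarrow> 'c) cstar, B', F') (\<iota>, e).
    basic_construction M B F M' \<iota> e \<and> B' = \<iota> ` carrier M \<and>
    (\<forall>c\<in>carrier M. \<forall>c'\<in>carrier M. F' (\<iota> c \<otimes>\<^bsub>M'\<^esub> e \<otimes>\<^bsub>M'\<^esub> \<iota> c')
      = \<iota> (inv\<^bsub>M\<^esub> (watatani_index M F) \<otimes>\<^bsub>M\<^esub> c \<otimes>\<^bsub>M\<^esub> c')))"
  let ?x0 = "(transport j C, j ` A, E)"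
  have "\<exists>y. P y \<and> (\<exists>z. R x y z)" if x: "P x" for x
  proof -
    obtain M B F where xe: "x = (M, B, F)" by (cases x)
    have "index_finite_expectation M B F" using x unfolding P_def xe by simp
    then obtain k u where I: "index_finite B M F k u" by (rule index_finite_expectation_locale)
    interpret I: index_finite B M F k u by (rule I)
    obtain M' :: "(nat \<Rightarrow> 'c) cstar" and \<iota> e p where B: "basic B M F k u M' \<iota> e p" by (rule basic_exists[OF I])
    interpret B: basic B M F k u M' \<iota> e p by (rule B)
    have "P (M', \<iota> ` carrier M, B.E1)" "R x (M', \<iota> ` carrier M, B.E1) (\<iota>, e)"
      unfolding P_def R_def xe
      using B.E1_index_finite B.basic_construction B.E1_word by (auto simp: I.watatani_index_eq)
    then show ?thesis by blast
  qed
  moreover have "P ?x0" using assms(1) by (simp add: P_def j_def)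
  ultimately have "\<exists>f. \<forall>n. (P (f n) \<and> (n = 0 \<longrightarrow> f n = ?x0)) \<and> (\<exists>z. R (f n) (f (Suc n)) z)"
    by (intro dependent_nat_choice) auto
  then obtain f where "\<forall>n. (P (f n) \<and> (n = 0 \<longrightarrow> f n = ?x0)) \<and> (\<exists>z. R (f n) (f (Suc n)) z)" by blast
  then have f: "P (f n)" "\<exists>z. R (f n) (f (Suc n)) z" and f0: "f 0 = ?x0" for n by blast+
  obtain z where z: "\<And>n. R (f n) (f (Suc n)) (z n)" using f(2) by metis
  define S :: "('c, nat \<Rightarrow> 'c) tower" where
    "S = \<lparr>alg = (\<lambda>n. fst (f n)), base = j, incl = (\<lambda>n. fst (z n)), jones = (\<lambda>n. snd (z n)),
      expec = (\<lambda>n. snd (snd (f n)))\<rparr>"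
  have sub: "fst (snd (f n)) = tower_sub S A n" for n
    using z[of "n - 1"] f0 unfolding R_def
    by (cases n) (auto simp: tower_sub_def S_def split: prod.splits)
  have "jones_tower A C S"
    unfolding jones_tower_def
  proof (intro conjI allI)
    show "star_iso C (alg S 0) (carrier C) (carrier (alg S 0)) (base S)"
      unfolding star_iso_def S_def using f0 by (simp add: inj_on_imp_bij_betw T.inj)
    show "index_finite_expectation (alg S n) (tower_sub S A n) (expec S n)" for n
      using f(1)[of n] unfolding sub[symmetric] by (auto simp: P_def S_def split: prod.splits)
    show "basic_construction (alg S n) (tower_sub S A n) (expec S n) (alg S (Suc n)) (incl S n) (jones S n)" for n
      using z[of n] unfolding sub[symmetric] by (auto simp: R_def S_def split: prod.splits)
    show "\<forall>c\<in>carrier (alg S n). \<forall>c'\<in>carrier (alg S n).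
        expec S (Suc n) (incl S n c \<otimes>\<^bsub>alg S (Suc n)\<^esub> jones S n \<otimes>\<^bsub>alg S (Suc n)\<^esub> incl S n c') =
        incl S n (inv\<^bsub>alg S n\<^esub> (watatani_index (alg S n) (expec S n)) \<otimes>\<^bsub>alg S n\<^esub> c \<otimes>\<^bsub>alg S n\<^esub> c')" for n
      using z[of n] by (auto simp: R_def S_def split: prod.splits)
  qed
  then show ?thesis by blast
qed

section \<open>Comparison of two expectations\<close>

text \<open>The form \<open>E' (x* y)\<close> is a second inner product on the module \<open>C\<close>, given by a positive operator \<open>h\<close>, that is
  \<open>E' (x* y) = E (x* h y)\<close>. It is invertible because the roles of \<open>E\<close> and \<open>E'\<close> can be exchanged, and
  commutes with left multiplications. So does its square root, which therefore is right
  multiplication by an element \<open>\<kappa>\<close>, and right \<open>A\<close>-linearity says that \<open>\<kappa>\<close> commutes with \<open>A\<close>.\<close>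

lemma (in basic) compare_expectations:
  assumes "index_finite A C E' k' w"
  obtains \<kappa> \<kappa>' where "\<kappa> \<in> carrier C" "\<kappa>' \<in> carrier C" "\<kappa> \<otimes> \<kappa>' = \<one>" "\<kappa>' \<otimes> \<kappa> = \<one>"
    "\<And>a. a \<in> A \<Longrightarrow> a \<otimes> \<kappa> = \<kappa> \<otimes> a" "\<And>x. x \<in> carrier C \<Longrightarrow> E' x = E (star C \<kappa> \<otimes> x \<otimes> \<kappa>)"
proof -
  interpret J: index_finite A C E' k' w by fact
  have "\<exists>t. t \<in> carrier C1 \<and> (\<forall>x\<in>carrier C. p t x = E' (star C (w r) \<otimes> x))" if r: "r < k'" for r
  proof -
    have wr: "w r \<in> carrier C" using J.u_closed[OF r] .
    have "(\<lambda>x\<in>carrier C. E' (star C (w r) \<otimes> x)) \<in> H.ops"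
      using wr by (intro linear_ops) (auto simp: C.r_distr J.E_add J.E_right sub_carrier simp flip: C.m_assoc)
    from p_surj[OF this] obtain t where "t \<in> carrier C1" "p t = (\<lambda>x\<in>carrier C. E' (star C (w r) \<otimes> x))" by blast
    then show ?thesis by auto
  qed
  then have "\<exists>\<tau>. \<forall>r. r < k' \<longrightarrow> \<tau> r \<in> carrier C1 \<and> (\<forall>x\<in>carrier C. p (\<tau> r) x = E' (star C (w r) \<otimes> x))"
    by (intro choice) blast
  then obtain \<tau> where \<tau>: "\<And>r. r < k' \<Longrightarrow> \<tau> r \<in> carrier C1"
      "\<And>r x. \<lbrakk>r < k'; x \<in> carrier C\<rbrakk> \<Longrightarrow> p (\<tau> r) x = E' (star C (w r) \<otimes> x)" by blast
  define h where "h = (\<Oplus>\<^bsub>C1\<^esub>r\<in>{..<k'}. star C1 (\<tau> r) \<star> \<tau> r)"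
  have hpos: "C1.pos h" unfolding h_def using \<tau> by (intro C1.pos_finsum) auto
  have h: "h \<in> carrier C1" by (rule C1.pos_closed[OF hpos])
  have ph: "E (star C x \<otimes> p h y) = E' (star C x \<otimes> y)" if x: "x \<in> carrier C" and y: "y \<in> carrier C" for x y
  proof -
    have "star C x \<otimes> p h y = (\<Oplus>r\<in>{..<k'}. star C x \<otimes> p (star C1 (\<tau> r)) (p (\<tau> r) y))"
      unfolding h_def using \<tau>(1) x y
      by (simp add: p_finsum Pi_def p_mult C.finsum_rdistr cong: C.finsum_cong)
    then have "E (star C x \<otimes> p h y) = (\<Oplus>r\<in>{..<k'}. E (star C x \<otimes> p (star C1 (\<tau> r)) (p (\<tau> r) y)))"
      using \<tau>(1) x y by (simp add: E_finsum Pi_def)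
    also have "\<dots> = (\<Oplus>r\<in>{..<k'}. E' (star C x \<otimes> (w r \<otimes> E' (star C (w r) \<otimes> y))))"
    proof (rule C.finsum_cong')
      fix r assume "r \<in> {..<k'}"
      then have r: "r < k'" "w r \<in> carrier C" using J.u_closed by auto
      have "E (star C x \<otimes> p (star C1 (\<tau> r)) (p (\<tau> r) y)) = E (star C (p (\<tau> r) x) \<otimes> p (\<tau> r) y)"
        using \<tau>(1)[OF r(1)] x y by (simp add: p_star)
      also have "\<dots> = E (E' (star C x \<otimes> w r) \<otimes> E' (star C (w r) \<otimes> y))"
        using \<tau>(2)[OF r(1)] r x y by (simp add: J.E_adjoint)
      also have "\<dots> = E' (star C x \<otimes> w r) \<otimes> E' (star C (w r) \<otimes> y)"
        using r x y by (intro E_id sub_mult) auto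
      also have "\<dots> = E' (star C x \<otimes> w r \<otimes> E' (star C (w r) \<otimes> y))"
        using r x y by (intro J.E_right[symmetric]) auto
      finally show "E (star C x \<otimes> p (star C1 (\<tau> r)) (p (\<tau> r) y)) = E' (star C x \<otimes> (w r \<otimes> E' (star C (w r) \<otimes> y)))"
        using r x y by (simp add: C.m_assoc)
    qed (use \<tau>(1) J.u_closed x y in auto)
    also have "\<dots> = E' (star C x \<otimes> y)"
      using J.u_closed x y J.qb_left[OF y]
      by (simp add: Pi_def flip: J.E_finsum C.finsum_rdistr)
    finally show ?thesis .
  qed
  \<comment> \<open>the operator that expresses \<open>E\<close> by \<open>E'\<close>, the inverse of \<open>h\<close>\<close>
  define K where "K y = (\<Oplus>r\<in>{..<k'}. w r \<otimes> E (star C (w r) \<otimes> y))" for y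
  have Kc: "K y \<in> carrier C" if "y \<in> carrier C" for y
    unfolding K_def using that J.u_closed by (intro C.finsum_closed) auto
  have "restrict K (carrier C) \<in> H.ops"
  proof (rule linear_ops[OF Kc])
    show "K (x \<oplus> y) = K x \<oplus> K y" if "x \<in> carrier C" "y \<in> carrier C" for x y
    proof -
      have "K (x \<oplus> y) = (\<Oplus>r\<in>{..<k'}. w r \<otimes> E (star C (w r) \<otimes> x) \<oplus> w r \<otimes> E (star C (w r) \<otimes> y))"
        unfolding K_def using that J.u_closed by (intro C.finsum_cong') (auto simp: C.r_distr E_add)
      then show ?thesis unfolding K_def using that J.u_closed by (simp add: C.finsum_addf Pi_def)
    qed
    show "K (x \<otimes> a) = K x \<otimes> a" if "x \<in> carrier C" "a \<in> A" for x a
    proof -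
      have ac: "a \<in> carrier C" using that sub_carrier by blast
      have "E (star C (w r) \<otimes> (x \<otimes> a)) = E (star C (w r) \<otimes> x) \<otimes> a" if r: "r < k'" for r
        using E_right[of a "star C (w r) \<otimes> x"] \<open>x \<in> carrier C\<close> \<open>a \<in> A\<close> ac J.u_closed[OF r] by (simp add: C.m_assoc)
      then show ?thesis
        unfolding K_def using that(1) ac J.u_closed
        by (subst C.finsum_ldistr) (auto simp: C.m_assoc intro!: C.finsum_cong')
    qed
  qed
  from p_surj[OF this] obtain f where f: "f \<in> carrier C1" "p f = restrict K (carrier C)" by blast
  have pf: "E' (star C x \<otimes> p f y) = E (star C x \<otimes> y)" if x: "x \<in> carrier C" and y: "y \<in> carrier C" for x y
  proof -
    have "E' (star C x \<otimes> p f y) = (\<Oplus>r\<in>{..<k'}. E' (star C x \<otimes> (w r \<otimes> E (star C (w r) \<otimes> y))))"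
      using f x y J.u_closed by (simp add: K_def C.finsum_rdistr J.E_finsum Pi_def)
    also have "\<dots> = (\<Oplus>r\<in>{..<k'}. E (E' (star C x \<otimes> w r) \<otimes> star C (w r) \<otimes> y))"
    proof (rule C.finsum_cong')
      fix r assume "r \<in> {..<k'}"
      then have r: "w r \<in> carrier C" using J.u_closed by auto
      have "E' (star C x \<otimes> (w r \<otimes> E (star C (w r) \<otimes> y))) = E' (star C x \<otimes> w r \<otimes> E (star C (w r) \<otimes> y))"
        using r x y by (simp add: C.m_assoc)
      also have "\<dots> = E' (star C x \<otimes> w r) \<otimes> E (star C (w r) \<otimes> y)"
        using r x y by (intro J.E_right) auto
      also have "\<dots> = E (E' (star C x \<otimes> w r) \<otimes> (star C (w r) \<otimes> y))"
        using r x y by (intro E_left[symmetric]) auto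
      finally show "E' (star C x \<otimes> (w r \<otimes> E (star C (w r) \<otimes> y))) = E (E' (star C x \<otimes> w r) \<otimes> star C (w r) \<otimes> y)"
        using r x y by (simp add: C.m_assoc)
    qed (use J.u_closed x y in auto)
    also have "\<dots> = E (star C x \<otimes> y)"
      using J.u_closed x y J.qb_right[of "star C x"] by (simp add: Pi_def flip: E_finsum C.finsum_ldistr)
    finally show ?thesis .
  qed
  have hf: "h \<star> f = \<one>\<^bsub>C1\<^esub>"
  proof (rule eq1)
    fix y assume y: "y \<in> carrier C"
    have "p h (p f y) = y"
      by (rule nondeg) (use h f(1) y in \<open>simp_all add: ph pf\<close>)
    then show "p (h \<star> f) y = p \<one>\<^bsub>C1\<^esub> y" using h f(1) y by (simp add: p_mult)
  qed (use h f in auto)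
  have fh: "f \<star> h = \<one>\<^bsub>C1\<^esub>"
  proof (rule eq1)
    fix y assume y: "y \<in> carrier C"
    have "p f (p h y) = y"
      by (rule J.H.ip_ext) (use h f(1) y in \<open>simp_all add: ph pf\<close>)
    then show "p (f \<star> h) y = p \<one>\<^bsub>C1\<^esub> y" using h f(1) y by (simp add: p_mult)
  qed (use h f in auto)
  define T where "T = nrm C1 f + 1"
  have T: "T > 0" "T \<ge> nrm C1 f" using C1.nrm_nonneg[OF f(1)] by (auto simp: T_def)
  have hT: "C1.pos (h \<ominus>\<^bsub>C1\<^esub> C1.sc (1 / T))"
    using C1.npos_invertible_bound[OF _ f(1) hf fh T] hpos by (simp add: C1.pos_iff_npos)
  have hc: "\<iota> c \<star> h = h \<star> \<iota> c" if c: "c \<in> carrier C" for c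
  proof (rule eq1)
    fix y assume y: "y \<in> carrier C"
    have "c \<otimes> p h y = p h (c \<otimes> y)"
    proof (rule nondeg)
      fix x assume x: "x \<in> carrier C"
      have "E (star C x \<otimes> (c \<otimes> p h y)) = E (star C (star C c \<otimes> x) \<otimes> p h y)"
        using x y c h by (simp add: C.star_mult C.m_assoc)
      also have "\<dots> = E' (star C (star C c \<otimes> x) \<otimes> y)" using x y c by (intro ph) auto
      also have "\<dots> = E' (star C x \<otimes> (c \<otimes> y))" using x y c by (simp add: C.star_mult C.m_assoc)
      also have "\<dots> = E (star C x \<otimes> p h (c \<otimes> y))" using x y c by (intro ph[symmetric]) auto
      finally show "E (star C x \<otimes> (c \<otimes> p h y)) = E (star C x \<otimes> p h (c \<otimes> y))" .
    qed (use h c y in auto)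
    then show "p (\<iota> c \<star> h) y = p (h \<star> \<iota> c) y" using h c y by (simp add: p_mult)
  qed (use h c in auto)
  from T(1) have "1 / T > 0" by simp
  with hT show ?thesis
  proof (rule C1.pos_inverse_sqrt[OF h])
    fix g s
    assume gs: "g \<in> carrier C1" "s \<in> carrier C1" "star C1 g = g" "star C1 s = s"
      "g \<star> s = \<one>\<^bsub>C1\<^esub>" "s \<star> g = \<one>\<^bsub>C1\<^esub>" "s \<star> s = h"
      and sc: "\<And>w. \<lbrakk>w \<in> carrier C1; w \<star> h = h \<star> w\<rbrakk> \<Longrightarrow> w \<star> s = s \<star> w"
      and gc: "\<And>w. \<lbrakk>w \<in> carrier C1; w \<star> h = h \<star> w\<rbrakk> \<Longrightarrow> w \<star> g = g \<star> w"
    have mod: "p t c = c \<otimes> p t \<one>" if t: "t \<in> carrier C1" "\<iota> c \<star> t = t \<star> \<iota> c" and c: "c \<in> carrier C" for t c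
      using arg_cong[OF t(2), of "\<lambda>t. p t \<one>"] t(1) c by (simp add: p_mult)
    have ps: "p s c = c \<otimes> p s \<one>" and pg: "p g c = c \<otimes> p g \<one>" if c: "c \<in> carrier C" for c
      using mod[OF gs(2) sc[OF iota_closed[OF c] hc[OF c]] c] mod[OF gs(1) gc[OF iota_closed[OF c] hc[OF c]] c] by auto
    have sg1: "p s (p g \<one>) = \<one>" and gs1: "p g (p s \<one>) = \<one>"
      using p_mult[of s g \<one>] p_mult[of g s \<one>] gs(1,2,5,6) by simp_all
    show ?thesis
    proof (rule that[of "p s \<one>" "p g \<one>"])
      show "p s \<one> \<in> carrier C" "p g \<one> \<in> carrier C" using gs by auto
      show "p s \<one> \<otimes> p g \<one> = \<one>" using pg[of "p s \<one>"] gs1 gs(2) by simp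
      show "p g \<one> \<otimes> p s \<one> = \<one>" using ps[of "p g \<one>"] sg1 gs(1) by simp
      show "a \<otimes> p s \<one> = p s \<one> \<otimes> a" if a: "a \<in> A" for a
        using ps[OF sub_carrier[OF a]] p_right[OF gs(2) C.one_closed a] sub_carrier[OF a] by simp
      show "E' x = E (star C (p s \<one>) \<otimes> x \<otimes> p s \<one>)" if x: "x \<in> carrier C" for x
      proof -
        have "E' x = E (star C \<one> \<otimes> p h x)" using ph[of \<one> x] x by simp
        also have "p h x = p s (p s x)" using gs(2) x by (simp add: p_mult flip: gs(7))
        also have "E (star C \<one> \<otimes> p s (p s x)) = E (star C (p s \<one>) \<otimes> p s x)"
          using p_star[of s \<one> "p s x"] gs(2,4) x by simp
        also have "p s x = x \<otimes> p s \<one>" by (rule ps[OF x])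
        finally show ?thesis using x gs(2) by (simp add: C.m_assoc)
      qed
    qed
  qed
qed

section \<open>Full corners\<close>

text \<open>The inclusion \<open>A \<subseteq> C\<close> is identified by \<open>\<phi>\<close> with the corner of \<open>L0 \<subseteq> L\<close> cut out by the projection \<open>q\<close>. Fullness is
  expressed by a partition of the unit with elements of \<open>L0\<close>, which then also belong to all
  later algebras of a tower over \<open>L\<close>.\<close>

locale full_corner = C: cstar_inclusion A C + L: cstar_inclusion L0 L
  for A and C :: "('c, 'm) cstar_scheme" and L0 and L :: "('l, 'n) cstar_scheme" (structure) +
  fixes q :: 'l and \<phi> :: "'c \<Rightarrow> 'l" and n :: nat and a :: "nat \<Rightarrow> 'l"
  assumes q_sub: "q \<in> L0" and q_idem: "q \<otimes> q = q" and q_star: "star L q = q"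
    and phi_closed [simp]: "c \<in> carrier C \<Longrightarrow> \<phi> c \<in> carrier L"
    and phi_add: "\<lbrakk>c \<in> carrier C; d \<in> carrier C\<rbrakk> \<Longrightarrow> \<phi> (c \<oplus>\<^bsub>C\<^esub> d) = \<phi> c \<oplus> \<phi> d"
    and phi_mult: "\<lbrakk>c \<in> carrier C; d \<in> carrier C\<rbrakk> \<Longrightarrow> \<phi> (c \<otimes>\<^bsub>C\<^esub> d) = \<phi> c \<otimes> \<phi> d"
    and phi_smult: "c \<in> carrier C \<Longrightarrow> \<phi> (z \<odot>\<^bsub>C\<^esub> c) = z \<odot> \<phi> c"
    and phi_star: "c \<in> carrier C \<Longrightarrow> \<phi> (star C c) = star L (\<phi> c)"
    and phi_inj: "inj_on \<phi> (carrier C)"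
    and phi_image: "\<phi> ` carrier C = {x \<in> carrier L. q \<otimes> x \<otimes> q = x}"
    and phi_sub: "\<phi> ` A = {x \<in> L0. q \<otimes> x \<otimes> q = x}"
    and a_sub: "i < n \<Longrightarrow> a i \<in> L0"
    and full: "(\<Oplus>i\<in>{..<n}. a i \<otimes> q \<otimes> star L (a i)) = \<one>"
begin

abbreviation multC :: "'c \<Rightarrow> 'c \<Rightarrow> 'c" (infixl "\<star>" 70) where "c \<star> d \<equiv> c \<otimes>\<^bsub>C\<^esub> d"

lemma q_closed [simp]: "q \<in> carrier L" using q_sub L.sub_carrier by blast

lemma a_closed: "i < n \<Longrightarrow> a i \<in> carrier L" using a_sub L.sub_carrier by blast

lemma phi_eq_iff [simp]: "\<lbrakk>c \<in> carrier C; d \<in> carrier C\<rbrakk> \<Longrightarrow> \<phi> c = \<phi> d \<longleftrightarrow> c = d"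
  using phi_inj by (simp add: inj_on_eq_iff)

lemma corner_cut: assumes c: "c \<in> carrier C" shows "q \<otimes> \<phi> c = \<phi> c" "\<phi> c \<otimes> q = \<phi> c"
proof -
  have e: "q \<otimes> \<phi> c \<otimes> q = \<phi> c" using phi_image c by blast
  have "q \<otimes> (q \<otimes> \<phi> c \<otimes> q) = q \<otimes> q \<otimes> \<phi> c \<otimes> q" using c by (simp add: L.C.m_assoc)
  then show "q \<otimes> \<phi> c = \<phi> c" by (simp only: e q_idem)
  have "(q \<otimes> \<phi> c \<otimes> q) \<otimes> q = q \<otimes> \<phi> c \<otimes> (q \<otimes> q)" using c by (simp add: L.C.m_assoc)
  then show "\<phi> c \<otimes> q = \<phi> c" by (simp only: e q_idem)
qed

lemma corner_elem: assumes "x \<in> carrier L" "q \<otimes> x \<otimes> q = x" obtains c where "c \<in> carrier C" "\<phi> c = x"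
proof -
  have "x \<in> \<phi> ` carrier C" unfolding phi_image using assms by simp
  then show ?thesis using that by blast
qed

lemma corner_sub_elem: assumes "x \<in> L0" "q \<otimes> x \<otimes> q = x" obtains c where "c \<in> A" "\<phi> c = x"
proof -
  have "x \<in> \<phi> ` A" unfolding phi_sub using assms by simp
  then show ?thesis using that by blast
qed

lemma compress: "x \<in> carrier L \<Longrightarrow> q \<otimes> (q \<otimes> x \<otimes> q) \<otimes> q = q \<otimes> x \<otimes> q"
  using q_idem L.C.m_assoc by (metis L.C.m_closed q_closed)

lemma compress_elem: assumes "x \<in> carrier L" obtains c where "c \<in> carrier C" "\<phi> c = q \<otimes> x \<otimes> q"
  by (rule corner_elem[of "q \<otimes> x \<otimes> q"]) (use assms compress in auto)

lemma compress_sub_elem: assumes "x \<in> L0" obtains c where "c \<in> A" "\<phi> c = q \<otimes> x \<otimes> q"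
  by (rule corner_sub_elem[of "q \<otimes> x \<otimes> q"]) (use assms compress L.sub_mult L.sub_carrier q_sub in auto)

lemma phi_A: "c \<in> A \<Longrightarrow> \<phi> c \<in> L0"
  using phi_sub by blast

lemma phi_one: "\<phi> \<one>\<^bsub>C\<^esub> = q"
proof -
  obtain c where c: "c \<in> carrier C" "\<phi> c = q" by (rule corner_elem[of q]) (auto simp: q_idem)
  have "\<phi> \<one>\<^bsub>C\<^esub> = \<phi> \<one>\<^bsub>C\<^esub> \<otimes> \<phi> c" using corner_cut[of "\<one>\<^bsub>C\<^esub>"] c by simp
  also have "\<dots> = q" using phi_mult[of "\<one>\<^bsub>C\<^esub>" c] c by simp
  finally show ?thesis .
qed

lemma phi_finsum: "\<lbrakk>finite I; f \<in> I \<rightarrow> carrier C\<rbrakk> \<Longrightarrow> \<phi> (finsum C f I) = (\<Oplus>i\<in>I. \<phi> (f i))"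
  by (intro additive_finsum C.C.abelian_group_axioms L.C.abelian_group_axioms) (auto simp: phi_add)

text \<open>Fullness is used by inserting the partition of the unit between two factors: every product becomes
  a sum of products that pass through the corner.\<close>

lemma full_insert:
  assumes "x \<in> carrier L" "y \<in> carrier L"
  shows "(\<Oplus>i\<in>{..<n}. (x \<otimes> a i \<otimes> q) \<otimes> (q \<otimes> star L (a i) \<otimes> y)) = x \<otimes> y"
proof -
  have "x \<otimes> y = x \<otimes> (\<Oplus>i\<in>{..<n}. a i \<otimes> q \<otimes> star L (a i)) \<otimes> y" unfolding full using assms by simp
  also have "\<dots> = (\<Oplus>i\<in>{..<n}. x \<otimes> (a i \<otimes> q \<otimes> star L (a i)) \<otimes> y)"
    using assms a_closed by (simp add: L.C.finsum_rdistr L.C.finsum_ldistr Pi_def)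
  also have "\<dots> = (\<Oplus>i\<in>{..<n}. (x \<otimes> a i \<otimes> q) \<otimes> (q \<otimes> star L (a i) \<otimes> y))"
  proof (rule L.C.finsum_cong')
    fix i assume "i \<in> {..<n}"
    then have i: "a i \<in> carrier L" using a_closed by simp
    have "(x \<otimes> a i \<otimes> q) \<otimes> (q \<otimes> star L (a i) \<otimes> y) = x \<otimes> (a i \<otimes> (q \<otimes> q) \<otimes> star L (a i)) \<otimes> y"
      using assms i by (simp add: L.C.m_assoc)
    then show "x \<otimes> (a i \<otimes> q \<otimes> star L (a i)) \<otimes> y = (x \<otimes> a i \<otimes> q) \<otimes> (q \<otimes> star L (a i) \<otimes> y)"
      by (simp only: q_idem)
  qed (use assms a_closed in auto)
  finally show ?thesis by simp
qed

subsection \<open>Relative commutants\<close>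

text \<open>The inverse sends \<open>c\<close> to \<open>x = \<Sum> a i \<phi> c (a i)*\<close>. It commutes with \<open>y \<in> G\<close> because \<open>q (a j)* y (a i) q\<close> lies in the corner
  \<open>\<phi> ` S\<close> and so commutes with \<open>\<phi> c\<close>.\<close>

lemma commutant_iso:
  assumes S: "S \<subseteq> carrier C" and G: "G \<subseteq> carrier L" "q \<in> G" "\<And>i. i < n \<Longrightarrow> a i \<in> G"
    and SG: "\<phi> ` S = {x \<in> G. q \<otimes> x \<otimes> q = x}"
    and mult: "\<And>x y. \<lbrakk>x \<in> G; y \<in> G\<rbrakk> \<Longrightarrow> x \<otimes> y \<in> G" and star: "\<And>x. x \<in> G \<Longrightarrow> star L x \<in> G"
  shows "bij_betw (\<lambda>x. q \<otimes> x) {x \<in> carrier L. \<forall>y\<in>G. y \<otimes> x = x \<otimes> y} (\<phi> ` {c \<in> carrier C. \<forall>s\<in>S. s \<star> c = c \<star> s})"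
    (is "bij_betw _ ?X (\<phi> ` ?Y)")
  unfolding bij_betw_def
proof
  show "inj_on (\<lambda>x. q \<otimes> x) ?X"
  proof (rule inj_onI)
    fix x y assume x: "x \<in> ?X" and y: "y \<in> ?X" and eq: "q \<otimes> x = q \<otimes> y"
    have rec: "z = (\<Oplus>i\<in>{..<n}. a i \<otimes> (q \<otimes> z) \<otimes> star L (a i))" if z: "z \<in> ?X" for z
    proof -
      have zc: "z \<in> carrier L" using z by simp
      have "z = (\<Oplus>i\<in>{..<n}. a i \<otimes> q \<otimes> star L (a i)) \<otimes> z" unfolding full using zc by simp
      also have "\<dots> = (\<Oplus>i\<in>{..<n}. a i \<otimes> q \<otimes> star L (a i) \<otimes> z)"
        using zc a_closed by (simp add: L.C.finsum_ldistr Pi_def)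
      also have "\<dots> = (\<Oplus>i\<in>{..<n}. a i \<otimes> (q \<otimes> z) \<otimes> star L (a i))"
      proof (rule L.C.finsum_cong')
        fix i assume "i \<in> {..<n}"
        then have i: "a i \<in> carrier L" "star L (a i) \<in> G" using a_closed G star by auto
        have "star L (a i) \<otimes> z = z \<otimes> star L (a i)" using z i by blast
        then show "a i \<otimes> q \<otimes> star L (a i) \<otimes> z = a i \<otimes> (q \<otimes> z) \<otimes> star L (a i)"
          using zc i(1) by (simp add: L.C.m_assoc)
      qed (use zc a_closed in auto)
      finally show ?thesis .
    qed
    show "x = y" using rec[OF x] rec[OF y] unfolding eq by simp
  qed
  show "(\<lambda>x. q \<otimes> x) ` ?X = \<phi> ` ?Y"
  proof
    show "(\<lambda>x. q \<otimes> x) ` ?X \<subseteq> \<phi> ` ?Y"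
    proof (rule image_subsetI)
      fix x assume x: "x \<in> ?X"
      then have xc: "x \<in> carrier L" and qx: "q \<otimes> x = x \<otimes> q" using G(2) by auto
      have "q \<otimes> (q \<otimes> x) \<otimes> q = q \<otimes> q \<otimes> (x \<otimes> q)" using xc by (simp add: L.C.m_assoc)
      also have "\<dots> = q \<otimes> q \<otimes> x" unfolding qx[symmetric] q_idem using xc q_idem by (simp flip: L.C.m_assoc)
      finally have e: "q \<otimes> (q \<otimes> x) \<otimes> q = q \<otimes> x" by (simp only: q_idem)
      obtain c where c: "c \<in> carrier C" "\<phi> c = q \<otimes> x"
        by (rule corner_elem[OF _ e]) (use xc in auto)
      have "s \<star> c = c \<star> s" if s: "s \<in> S" for s
      proof -
        have sc: "s \<in> carrier C" "\<phi> s \<in> G" using s S SG by auto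
        have "\<phi> (s \<star> c) = \<phi> s \<otimes> q \<otimes> x" using sc c xc by (simp add: phi_mult L.C.m_assoc)
        also have "\<dots> = x \<otimes> \<phi> s" using x sc corner_cut[OF sc(1)] by simp
        also have "\<dots> = x \<otimes> q \<otimes> \<phi> s" using xc sc corner_cut[OF sc(1)] by (simp add: L.C.m_assoc)
        also have "\<dots> = \<phi> (c \<star> s)" using sc c qx by (simp add: phi_mult)
        finally show ?thesis using sc c by simp
      qed
      then have "c \<in> ?Y" using c(1) by simp
      from imageI[OF this, of \<phi>] show "q \<otimes> x \<in> \<phi> ` ?Y" by (simp only: c(2))
    qed
    show "\<phi> ` ?Y \<subseteq> (\<lambda>x. q \<otimes> x) ` ?X"
    proof (rule image_subsetI)
      fix c assume c: "c \<in> ?Y"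
      then have cc: "c \<in> carrier C" by simp
      note cut = corner_cut[OF cc]
      have com: "g \<otimes> \<phi> c = \<phi> c \<otimes> g" if g: "g \<in> G" "q \<otimes> g \<otimes> q = g" for g
      proof -
        have "g \<in> \<phi> ` S" unfolding SG using g by simp
        then obtain s where s: "s \<in> S" "g = \<phi> s" by blast
        have "\<phi> (s \<star> c) = \<phi> (c \<star> s)" using c s by simp
        then show ?thesis using s S cc by (auto simp: phi_mult)
      qed
      define x where "x = (\<Oplus>i\<in>{..<n}. a i \<otimes> \<phi> c \<otimes> star L (a i))"
      have xc: "x \<in> carrier L" unfolding x_def using cc a_closed by (intro L.C.finsum_closed) auto
      have g: "q \<otimes> (star L (a j) \<otimes> y \<otimes> a i) \<otimes> q \<in> G" if "y \<in> G" "i < n" "j < n" for y i j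
        using that G mult star by simp
      have key: "(a j \<otimes> \<phi> c \<otimes> star L (a j)) \<otimes> y = (\<Oplus>i\<in>{..<n}. a j \<otimes> q \<otimes> star L (a j) \<otimes> y \<otimes> (a i \<otimes> \<phi> c \<otimes> star L (a i)))"
        if y: "y \<in> G" and j: "j < n" for y j
      proof -
        have yc: "y \<in> carrier L" and jc: "a j \<in> carrier L" using y j G a_closed by auto
        have "(a j \<otimes> \<phi> c \<otimes> star L (a j) \<otimes> y) \<otimes> \<one>
            = (\<Oplus>i\<in>{..<n}. (a j \<otimes> \<phi> c \<otimes> star L (a j) \<otimes> y \<otimes> a i \<otimes> q) \<otimes> (q \<otimes> star L (a i) \<otimes> \<one>))"
          using yc jc cc by (intro full_insert[symmetric]) auto
        also have "\<dots> = (\<Oplus>i\<in>{..<n}. a j \<otimes> q \<otimes> star L (a j) \<otimes> y \<otimes> (a i \<otimes> \<phi> c \<otimes> star L (a i)))"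
        proof (rule L.C.finsum_cong')
          fix i assume "i \<in> {..<n}"
          then have i: "i < n" "a i \<in> carrier L" using a_closed by auto
          let ?g = "q \<otimes> (star L (a j) \<otimes> y \<otimes> a i) \<otimes> q"
          have gG: "?g \<in> G" "q \<otimes> ?g \<otimes> q = ?g" using g[OF y i(1) j] compress yc jc i by auto
          have "(a j \<otimes> \<phi> c \<otimes> star L (a j) \<otimes> y \<otimes> a i \<otimes> q) \<otimes> (q \<otimes> star L (a i) \<otimes> \<one>)
              = a j \<otimes> ((\<phi> c \<otimes> star L (a j) \<otimes> y \<otimes> a i \<otimes> q) \<otimes> (q \<otimes> star L (a i)))"
            using yc jc i(2) cc by (simp add: L.C.m_assoc)
          also have "\<dots> = a j \<otimes> (((\<phi> c \<otimes> q) \<otimes> star L (a j) \<otimes> y \<otimes> a i \<otimes> q) \<otimes> (q \<otimes> star L (a i)))"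
            by (simp only: cut)
          also have "\<dots> = a j \<otimes> ((\<phi> c \<otimes> ?g) \<otimes> (q \<otimes> star L (a i)))"
            using yc jc i(2) cc by (simp add: L.C.m_assoc)
          also have "\<dots> = a j \<otimes> ((?g \<otimes> \<phi> c) \<otimes> (q \<otimes> star L (a i)))" by (simp only: com[OF gG])
          also have "\<dots> = a j \<otimes> q \<otimes> star L (a j) \<otimes> y \<otimes> (a i \<otimes> (q \<otimes> \<phi> c \<otimes> q) \<otimes> star L (a i))"
            using yc jc i(2) cc by (simp add: L.C.m_assoc)
          also have "q \<otimes> \<phi> c \<otimes> q = \<phi> c" by (simp only: cut)
          finally show "(a j \<otimes> \<phi> c \<otimes> star L (a j) \<otimes> y \<otimes> a i \<otimes> q) \<otimes> (q \<otimes> star L (a i) \<otimes> \<one>)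
              = a j \<otimes> q \<otimes> star L (a j) \<otimes> y \<otimes> (a i \<otimes> \<phi> c \<otimes> star L (a i))" .
        qed (use yc jc cc a_closed in auto)
        finally show ?thesis using yc jc cc by simp
      qed
      have "y \<otimes> x = x \<otimes> y" if y: "y \<in> G" for y
      proof -
        have yc: "y \<in> carrier L" using y G by auto
        have "x \<otimes> y = (\<Oplus>j\<in>{..<n}. (a j \<otimes> \<phi> c \<otimes> star L (a j)) \<otimes> y)"
          unfolding x_def using yc cc a_closed by (intro L.C.finsum_ldistr) auto
        also have "\<dots> = (\<Oplus>j\<in>{..<n}. (a j \<otimes> q \<otimes> star L (a j)) \<otimes> (y \<otimes> x))"
        proof (rule L.C.finsum_cong')
          fix j assume "j \<in> {..<n}"
          then have j: "j < n" "a j \<in> carrier L" using a_closed by auto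
          show "(a j \<otimes> \<phi> c \<otimes> star L (a j)) \<otimes> y = (a j \<otimes> q \<otimes> star L (a j)) \<otimes> (y \<otimes> x)"
            unfolding key[OF y j(1)] x_def using yc cc j(2) a_closed
            by (subst L.C.finsum_rdistr[symmetric]) (auto simp: L.C.m_assoc)
        qed (use yc xc a_closed in auto)
        also have "\<dots> = \<one> \<otimes> (y \<otimes> x)"
          unfolding full[symmetric] using yc xc a_closed by (intro L.C.finsum_ldistr[symmetric]) auto
        finally show ?thesis using yc xc by simp
      qed
      then have X: "x \<in> ?X" using xc by auto
      have qx: "q \<otimes> x = \<phi> c"
      proof -
        have "q \<otimes> x = (\<Oplus>i\<in>{..<n}. q \<otimes> (a i \<otimes> \<phi> c \<otimes> star L (a i)))"
          unfolding x_def using cc a_closed by (intro L.C.finsum_rdistr) auto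
        also have "\<dots> = (\<Oplus>i\<in>{..<n}. (\<phi> c \<otimes> a i \<otimes> q) \<otimes> (q \<otimes> star L (a i) \<otimes> \<one>))"
        proof (rule L.C.finsum_cong')
          fix i assume "i \<in> {..<n}"
          then have i: "i < n" "a i \<in> carrier L" using a_closed by auto
          have gG: "q \<otimes> a i \<otimes> q \<in> G" "q \<otimes> (q \<otimes> a i \<otimes> q) \<otimes> q = q \<otimes> a i \<otimes> q"
            using G mult i compress by auto
          have "q \<otimes> (a i \<otimes> (q \<otimes> \<phi> c) \<otimes> star L (a i)) = (q \<otimes> a i \<otimes> q) \<otimes> \<phi> c \<otimes> star L (a i)"
            using cc i(2) by (simp add: L.C.m_assoc)
          also have "\<dots> = \<phi> c \<otimes> (q \<otimes> a i \<otimes> q) \<otimes> star L (a i)" by (simp only: com[OF gG])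
          also have "\<dots> = (\<phi> c \<otimes> q) \<otimes> a i \<otimes> (q \<otimes> star L (a i))" using cc i(2) by (simp add: L.C.m_assoc)
          also have "\<dots> = \<phi> c \<otimes> a i \<otimes> ((q \<otimes> q) \<otimes> star L (a i))" by (simp only: cut q_idem)
          also have "\<dots> = (\<phi> c \<otimes> a i \<otimes> q) \<otimes> (q \<otimes> star L (a i) \<otimes> \<one>)" using cc i(2) by (simp add: L.C.m_assoc)
          finally show "q \<otimes> (a i \<otimes> \<phi> c \<otimes> star L (a i)) = (\<phi> c \<otimes> a i \<otimes> q) \<otimes> (q \<otimes> star L (a i) \<otimes> \<one>)"
            by (simp only: cut)
        qed (use cc a_closed in auto)
        also have "\<dots> = \<phi> c" using full_insert[of "\<phi> c" \<one>] cc by simp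
        finally show ?thesis .
      qed
      from imageI[OF X, of "\<lambda>x. q \<otimes> x"] show "\<phi> c \<in> (\<lambda>x. q \<otimes> x) ` ?X" by (simp only: qx)
    qed
  qed
qed

subsection \<open>Restriction of an expectation to a corner\<close>

definition psi :: "'l \<Rightarrow> 'c" where "psi = inv_into (carrier C) \<phi>"

lemma psi_phi [simp]: "c \<in> carrier C \<Longrightarrow> psi (\<phi> c) = c"
  unfolding psi_def using phi_inj by simp

text \<open>Since \<open>q \<in> L0\<close>, the expectation maps the corner to itself. A positive value \<open>y* y\<close> is the sum of the squares of
  the elements \<open>q (a i)* y q\<close> of the corner, and the elements \<open>q (w r) (a i) q\<close> form a quasi-basis.\<close>

lemma corner_index_finite:
  assumes "index_finite L0 L F k w"
  shows "index_finite_expectation C A (\<lambda>c. psi (F (\<phi> c)))"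
    and "\<And>c. c \<in> carrier C \<Longrightarrow> \<phi> (psi (F (\<phi> c))) = F (\<phi> c)"
proof -
  interpret F: index_finite L0 L F k w by fact
  have Fc: "\<exists>b\<in>A. \<phi> b = F (\<phi> c)" if c: "c \<in> carrier C" for c
  proof -
    have "F (q \<otimes> \<phi> c \<otimes> q) = q \<otimes> F (\<phi> c) \<otimes> q" using c q_sub by (intro F.E_bimod) auto
    then have "q \<otimes> F (\<phi> c) \<otimes> q = F (\<phi> c)" using corner_cut[OF c] c by simp
    from corner_sub_elem[OF F.E_sub this] c show ?thesis by auto
  qed
  define E where "E c = psi (F (\<phi> c))" for c
  have E: "E c \<in> A" and phE: "\<phi> (E c) = F (\<phi> c)" if c: "c \<in> carrier C" for c
  proof -
    obtain b where b: "b \<in> A" "\<phi> b = F (\<phi> c)" using Fc[OF c] by blast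
    then have "E c = b" unfolding E_def using C.sub_carrier by (simp flip: b(2))
    then show "E c \<in> A" "\<phi> (E c) = F (\<phi> c)" using b by auto
  qed
  then show "\<phi> (psi (F (\<phi> c))) = F (\<phi> c)" if "c \<in> carrier C" for c using that unfolding E_def by blast
  have Ec [simp]: "E c \<in> carrier C" if "c \<in> carrier C" for c using E that C.sub_carrier by blast
  have eqI: "c = d" if "c \<in> carrier C" "d \<in> carrier C" "\<phi> c = \<phi> d" for c d using that by simp
  have ce: "conditional_expectation C A E"
    unfolding conditional_expectation_def
  proof (intro conjI ballI allI impI)
    show "unital_inclusion A C" by (rule C.incl)
    show "E \<in> carrier C \<rightarrow> A" using E by blast
    show "E b = b" if b: "b \<in> A" for b
      using b by (intro eqI) (auto simp: phE C.sub_carrier F.E_id phi_A)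
    show "E (x \<oplus>\<^bsub>C\<^esub> y) = E x \<oplus>\<^bsub>C\<^esub> E y" if "x \<in> carrier C" "y \<in> carrier C" for x y
      using that by (intro eqI) (auto simp: phE phi_add F.E_add)
    show "E (z \<odot>\<^bsub>C\<^esub> x) = z \<odot>\<^bsub>C\<^esub> E x" if "x \<in> carrier C" for z x
      using that by (intro eqI) (auto simp: phE phi_smult F.E_smult)
    show "E (b \<star> x \<star> d) = b \<star> E x \<star> d" if "b \<in> A" "x \<in> carrier C" "d \<in> A" for b x d
      using that by (intro eqI) (auto simp: phE phi_mult C.sub_carrier F.E_bimod phi_A)
    show "cstar_positive (C\<lparr>carrier := A\<rparr>) (E x)" if x: "cstar_positive C x" for x
    proof -
      obtain z where z: "z \<in> carrier C" "x = star C z \<star> z" using x unfolding cstar_positive_def by blast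
      have "cstar_positive L (\<phi> x)" using z by (auto simp: phi_mult phi_star)
      then have "cstar_positive (L\<lparr>carrier := L0\<rparr>) (F (\<phi> x))" by (rule F.E_pos_sub)
      then obtain y where y: "y \<in> L0" "F (\<phi> x) = star L y \<otimes> y" unfolding cstar_positive_def by auto
      have yc: "y \<in> carrier L" using y L.sub_carrier by blast
      have xc: "x \<in> carrier C" using z by simp
      have "\<exists>b\<in>A. \<phi> b = q \<otimes> (star L (a i) \<otimes> y) \<otimes> q" if i: "i < n" for i
        using compress_sub_elem[OF L.sub_mult[OF L.sub_star[OF a_sub[OF i]] y(1)]] by blast
      then obtain b where b: "\<And>i. i < n \<Longrightarrow> b i \<in> A" "\<And>i. i < n \<Longrightarrow> \<phi> (b i) = q \<otimes> (star L (a i) \<otimes> y) \<otimes> q"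
        by metis
      have bc: "b i \<in> carrier C" if "i < n" for i using b(1) that C.sub_carrier by blast
      have "F (\<phi> x) = q \<otimes> F (\<phi> x) \<otimes> q" using phE[OF xc] corner_cut[OF Ec[OF xc]] by simp
      also have "\<dots> = (q \<otimes> star L y) \<otimes> (y \<otimes> q)" unfolding y(2) using yc by (simp add: L.C.m_assoc)
      also have "\<dots> = (\<Oplus>i\<in>{..<n}. ((q \<otimes> star L y) \<otimes> a i \<otimes> q) \<otimes> (q \<otimes> star L (a i) \<otimes> (y \<otimes> q)))"
        using yc by (intro full_insert[symmetric]) auto
      also have "\<dots> = (\<Oplus>i\<in>{..<n}. \<phi> (star C (b i) \<star> b i))"
      proof (rule L.C.finsum_cong')
        fix i assume "i \<in> {..<n}"
        then have i: "i < n" "a i \<in> carrier L" using a_closed by auto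
        have "\<phi> (star C (b i) \<star> b i) = star L (\<phi> (b i)) \<otimes> \<phi> (b i)" using bc[OF i(1)] by (simp add: phi_mult phi_star)
        also have "\<dots> = ((q \<otimes> star L y) \<otimes> a i \<otimes> q) \<otimes> (q \<otimes> star L (a i) \<otimes> (y \<otimes> q))"
          using yc i by (simp add: b(2) L.C.star_mult q_star L.C.m_assoc)
        finally show "((q \<otimes> star L y) \<otimes> a i \<otimes> q) \<otimes> (q \<otimes> star L (a i) \<otimes> (y \<otimes> q)) = \<phi> (star C (b i) \<star> b i)" by simp
      qed (use bc in auto)
      also have "\<dots> = \<phi> (\<Oplus>\<^bsub>C\<^esub>i\<in>{..<n}. star C (b i) \<star> b i)" using bc by (intro phi_finsum[symmetric]) auto
      finally have "E x = (\<Oplus>\<^bsub>C\<^esub>i\<in>{..<n}. star C (b i) \<star> b i)"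
        using xc bc by (intro eqI) (auto simp: phE intro!: C.C.finsum_closed)
      then have "cstar_positive C (E x)" using bc by (auto intro!: C.C.pos_finsum)
      then show ?thesis using E[OF xc] C.sub_pos by blast
    qed
  qed
  interpret G: cond_exp A C E
    by (intro cond_exp.intro C.cstar_inclusion_axioms cond_exp_axioms.intro ce)
  have "\<exists>b\<in>carrier C. \<phi> b = q \<otimes> (w r \<otimes> a i) \<otimes> q" if ri: "r < k" "i < n" for r i
  proof -
    have "w r \<otimes> a i \<in> carrier L" using F.u_closed[OF ri(1)] a_closed[OF ri(2)] by simp
    from compress_elem[OF this] show ?thesis by blast
  qed
  then obtain v where v: "\<And>r i. \<lbrakk>r < k; i < n\<rbrakk> \<Longrightarrow> v r i \<in> carrier C"
      "\<And>r i. \<lbrakk>r < k; i < n\<rbrakk> \<Longrightarrow> \<phi> (v r i) = q \<otimes> (w r \<otimes> a i) \<otimes> q" by metis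
  have "index_finite_expectation C A E"
  proof (rule G.index_finiteI[of "{..<k} \<times> {..<n}" "\<lambda>(r, i). v r i"])
    fix c assume c: "c \<in> carrier C"
    let ?f = "\<lambda>r i. v r i \<star> E (star C (v r i) \<star> c)"
    have fc: "?f r i \<in> carrier C" if "r < k" "i < n" for r i using v(1)[OF that] c by simp
    have sumC: "(\<Oplus>\<^bsub>C\<^esub>x\<in>{..<k} \<times> {..<n}. ?f (fst x) (snd x)) = (\<Oplus>\<^bsub>C\<^esub>r\<in>{..<k}. \<Oplus>\<^bsub>C\<^esub>i\<in>{..<n}. ?f r i)"
    proof -
      have "(\<Oplus>\<^bsub>C\<^esub>r\<in>J. \<Oplus>\<^bsub>C\<^esub>i\<in>{..<n}. ?f r i) = (\<Oplus>\<^bsub>C\<^esub>x\<in>J \<times> {..<n}. ?f (fst x) (snd x))"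
        if "finite J" "J \<subseteq> {..<k}" for J
        using that
      proof (induction J rule: finite_induct)
        case (insert r J)
        have "insert r J \<times> {..<n} = Pair r ` {..<n} \<union> J \<times> {..<n}" by auto
        then have "(\<Oplus>\<^bsub>C\<^esub>x\<in>insert r J \<times> {..<n}. ?f (fst x) (snd x))
            = (\<Oplus>\<^bsub>C\<^esub>x\<in>Pair r ` {..<n}. ?f (fst x) (snd x)) \<oplus>\<^bsub>C\<^esub> (\<Oplus>\<^bsub>C\<^esub>x\<in>J \<times> {..<n}. ?f (fst x) (snd x))"
          using insert fc by (simp only:, intro C.C.finsum_Un_disjoint) auto
        also have "(\<Oplus>\<^bsub>C\<^esub>x\<in>Pair r ` {..<n}. ?f (fst x) (snd x)) = (\<Oplus>\<^bsub>C\<^esub>i\<in>{..<n}. ?f (fst (r, i)) (snd (r, i)))"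
          using insert fc by (intro C.C.finsum_reindex) (auto simp: inj_on_def)
        finally show ?case using insert fc by (simp add: Pi_def C.C.finsum_closed subset_iff)
      qed simp
      then show ?thesis by simp
    qed
    have "\<phi> (\<Oplus>\<^bsub>C\<^esub>r\<in>{..<k}. \<Oplus>\<^bsub>C\<^esub>i\<in>{..<n}. ?f r i) = (\<Oplus>r\<in>{..<k}. \<Oplus>i\<in>{..<n}. \<phi> (?f r i))"
      using fc by (simp add: phi_finsum Pi_def C.C.finsum_closed cong: L.C.finsum_cong)
    also have "\<dots> = (\<Oplus>r\<in>{..<k}. q \<otimes> (w r \<otimes> F (star L (w r) \<otimes> \<phi> c)))"
    proof (rule L.C.finsum_cong')
      fix r assume "r \<in> {..<k}"
      then have r: "r < k" "w r \<in> carrier L" using F.u_closed by auto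
      let ?x = "q \<otimes> w r" and ?y = "F (star L (w r) \<otimes> \<phi> c)"
      have "(\<Oplus>i\<in>{..<n}. \<phi> (?f r i)) = (\<Oplus>i\<in>{..<n}. (?x \<otimes> a i \<otimes> q) \<otimes> (q \<otimes> star L (a i) \<otimes> ?y))"
      proof (rule L.C.finsum_cong')
        fix i assume "i \<in> {..<n}"
        then have i: "i < n" "a i \<in> carrier L" "a i \<in> L0" using a_closed a_sub by auto
        note vi = v[OF r(1) i(1)]
        have "\<phi> (?f r i) = \<phi> (v r i) \<otimes> F (star L (\<phi> (v r i)) \<otimes> \<phi> c)"
          using vi(1) c by (simp add: phi_mult phE phi_star)
        also have "star L (\<phi> (v r i)) \<otimes> \<phi> c = (q \<otimes> star L (a i)) \<otimes> (star L (w r) \<otimes> (q \<otimes> \<phi> c))"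
          unfolding vi(2) using r(2) i(2) c by (simp add: L.C.star_mult q_star L.C.m_assoc)
        also have "F \<dots> = (q \<otimes> star L (a i)) \<otimes> F (star L (w r) \<otimes> (q \<otimes> \<phi> c))"
          using r(2) i c q_sub by (intro F.E_left) (auto intro: L.sub_mult L.sub_star)
        also have "q \<otimes> \<phi> c = \<phi> c" using corner_cut[OF c] by simp
        finally show "\<phi> (?f r i) = (?x \<otimes> a i \<otimes> q) \<otimes> (q \<otimes> star L (a i) \<otimes> ?y)"
          unfolding vi(2) using r(2) i(2) c by (simp add: L.C.m_assoc)
      qed (use r c a_closed in auto)
      also have "\<dots> = ?x \<otimes> ?y" using r(2) c by (intro full_insert) auto
      finally show "(\<Oplus>i\<in>{..<n}. \<phi> (?f r i)) = q \<otimes> (w r \<otimes> ?y)" using r(2) c by (simp add: L.C.m_assoc)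
    qed (use F.u_closed c in auto)
    also have "\<dots> = q \<otimes> \<phi> c"
      using F.u_closed c F.qb_left[of "\<phi> c"] by (subst L.C.finsum_rdistr[symmetric]) auto
    also have "\<dots> = \<phi> c" using corner_cut[OF c] by simp
    finally have "(\<Oplus>\<^bsub>C\<^esub>r\<in>{..<k}. \<Oplus>\<^bsub>C\<^esub>i\<in>{..<n}. ?f r i) = c"
      using c fc by (intro eqI) (auto intro!: C.C.finsum_closed)
    then show "(\<Oplus>\<^bsub>C\<^esub>x\<in>{..<k} \<times> {..<n}. (case x of (r, i) \<Rightarrow> v r i) \<star>
        E (star C (case x of (r, i) \<Rightarrow> v r i) \<star> c)) = c"
      using sumC by (simp add: case_prod_beta)
  qed (use v in auto)
  then show "index_finite_expectation C A (\<lambda>c. psi (F (\<phi> c)))" by (simp add: E_def[abs_def])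
qed

end

section \<open>Basic constructions of full corners\<close>

context full_corner
begin

context
  fixes L1 :: "('e, 'f) cstar_scheme"
begin

abbreviation mult_L1 (infixl "\<cdot>" 70) where "s \<cdot> t \<equiv> s \<otimes>\<^bsub>L1\<^esub> t"

text \<open>Let \<open>\<kappa>\<close> relate the given expectation of \<open>C\<close> to the restriction of \<open>F\<close>. The map \<open>\<psi>\<close> is the linear extension of
  \<open>c e d \<mapsto> c \<kappa> e' \<kappa>* d\<close>. On vectors \<open>c \<kappa> e'\<close> the element \<open>\<psi> t\<close> acts as \<open>t\<close> acts on \<open>c\<close>, which shows that \<open>\<psi>\<close> is
  multiplicative and injective. An element of the corner of \<open>L1\<close> is a sum of words \<open>q x e' y q\<close>, and insertion of
  the partition of the unit, which commutes with \<open>e'\<close>, turns \<open>x\<close> and \<open>y\<close> into elements of the corner \<open>C\<close>; this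
  shows surjectivity.\<close>

lemma corner_step:
  assumes "basic L0 L F k' w L1 \<iota>' e' p'" and "basic A C E k u C1 \<iota> e p"
  obtains \<psi> where
    "full_corner (\<iota> ` carrier C) C1 (\<iota>' ` carrier L) L1 (\<iota>' q) \<psi> n (\<lambda>i. \<iota>' (a i))"
    "\<And>c. c \<in> carrier C \<Longrightarrow> \<psi> (\<iota> c) = \<iota>' (\<phi> c)"
proof -
  interpret BL: basic L0 L F k' w L1 \<iota>' e' p' by fact
  interpret BC: basic A C E k u C1 \<iota> e p by fact
  let ?E = "\<lambda>c. psi (F (\<phi> c))"
  obtain k0 u0 where "index_finite A C ?E k0 u0"
    using index_finite_expectation_locale[OF corner_index_finite(1)[OF BL.index_finite_axioms]] .
  then interpret I0: index_finite A C ?E k0 u0 .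
  interpret B0: basic A C ?E k0 u0 I0.H.opalg "\<lambda>c. \<lambda>x\<in>carrier C. c \<star> x" "\<lambda>x\<in>carrier C. ?E x" "\<lambda>t. t"
    by (rule I0.basic_opalg)
  obtain \<kappa> \<kappa>' where \<kappa>: "\<kappa> \<in> carrier C" "\<kappa>' \<in> carrier C" "\<kappa> \<star> \<kappa>' = \<one>\<^bsub>C\<^esub>" "\<kappa>' \<star> \<kappa> = \<one>\<^bsub>C\<^esub>"
      and \<kappa>A: "\<And>b. b \<in> A \<Longrightarrow> b \<star> \<kappa> = \<kappa> \<star> b"
      and \<kappa>E: "\<And>x. x \<in> carrier C \<Longrightarrow> E x = ?E (star C \<kappa> \<star> x \<star> \<kappa>)"
    by (rule B0.compare_expectations[OF BC.index_finite_axioms]) blast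
  have \<kappa>A': "b \<star> star C \<kappa> = star C \<kappa> \<star> b" if b: "b \<in> A" for b
    using arg_cong[OF \<kappa>A[OF C.sub_star[OF b]], of "star C"] b \<kappa>(1) C.sub_carrier[OF b]
    by (simp add: C.C.star_mult)
  have FE: "F (\<phi> (star C \<kappa> \<star> x \<star> \<kappa>)) = \<phi> (E x)" if x: "x \<in> carrier C" for x
    unfolding \<kappa>E[OF x] using x \<kappa>(1) by (intro corner_index_finite(2)[OF BL.index_finite_axioms, symmetric]) simp
  define g where "g c = \<iota>' (\<phi> c)" for c
  have g [simp]: "g c \<in> carrier L1" if "c \<in> carrier C" for c using that by (simp add: g_def)
  have g_add: "g (c \<oplus>\<^bsub>C\<^esub> d) = g c \<oplus>\<^bsub>L1\<^esub> g d" if "c \<in> carrier C" "d \<in> carrier C" for c d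
    using that by (simp add: g_def phi_add BL.iota_add)
  have g_mult: "g (c \<star> d) = g c \<cdot> g d" if "c \<in> carrier C" "d \<in> carrier C" for c d
    using that by (simp add: g_def phi_mult BL.iota_mult)
  have g_star: "g (star C c) = star L1 (g c)" if "c \<in> carrier C" for c
    using that by (simp add: g_def phi_star BL.iota_star)
  have g_smult: "g (z \<odot>\<^bsub>C\<^esub> c) = z \<odot>\<^bsub>L1\<^esub> g c" if "c \<in> carrier C" for c z
    using that by (simp add: g_def phi_smult BL.iota_smult)
  have g_A: "g b \<cdot> e' = e' \<cdot> g b" if "b \<in> A" for b
    using BL.iota_e_commute[OF phi_A[OF that]] by (simp add: g_def)
  have eg: "e' \<cdot> g (star C \<kappa> \<star> x \<star> \<kappa>) \<cdot> e' = g (E x) \<cdot> e'" if x: "x \<in> carrier C" for x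
    using BL.e_iota_e[of "\<phi> (star C \<kappa> \<star> x \<star> \<kappa>)"] x \<kappa>(1) by (simp add: g_def FE)
  have q1: "\<iota>' q \<in> carrier L1" by simp
  have gq: "\<iota>' q \<cdot> g c = g c" "g c \<cdot> \<iota>' q = g c" if c: "c \<in> carrier C" for c
    using corner_cut[OF c] c by (simp_all add: g_def flip: BL.iota_mult)
  \<comment> \<open>the image of \<open>c e d\<close>; since \<open>\<kappa>\<close> commutes with \<open>A\<close> it is balanced over \<open>A\<close>, as \<open>c e d\<close> is\<close>
  define word where "word c d = g (c \<star> \<kappa>) \<cdot> e' \<cdot> g (star C \<kappa> \<star> d)" for c d
  have word [simp]: "word c d \<in> carrier L1" if "c \<in> carrier C" "d \<in> carrier C" for c d
    using that \<kappa> by (simp add: word_def)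
  have word_addl: "word (c \<oplus>\<^bsub>C\<^esub> c') d = word c d \<oplus>\<^bsub>L1\<^esub> word c' d"
    if "c \<in> carrier C" "c' \<in> carrier C" "d \<in> carrier C" for c c' d
    using that \<kappa>(1) by (simp add: word_def C.C.l_distr g_add BL.C1.l_distr)
  have word_addr: "word c (d \<oplus>\<^bsub>C\<^esub> d') = word c d \<oplus>\<^bsub>L1\<^esub> word c d'"
    if "c \<in> carrier C" "d \<in> carrier C" "d' \<in> carrier C" for c d d'
    using that \<kappa>(1) by (simp add: word_def C.C.r_distr g_add BL.C1.r_distr)
  have word_suml: "word (finsum C f {..<k}) d = (\<Oplus>\<^bsub>L1\<^esub>i\<in>{..<k}. word (f i) d)"
    if "f \<in> {..<k} \<rightarrow> carrier C" "d \<in> carrier C" for f d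
    using that word_addl
    by (intro additive_finsum C.C.abelian_group_axioms BL.C1.abelian_group_axioms) auto
  have word_sumr: "word c (finsum C f {..<k}) = (\<Oplus>\<^bsub>L1\<^esub>i\<in>{..<k}. word c (f i))"
    if "f \<in> {..<k} \<rightarrow> carrier C" "c \<in> carrier C" for f c
    using that word_addr
    by (intro additive_finsum C.C.abelian_group_axioms BL.C1.abelian_group_axioms) auto
  have balance: "word (c \<star> b) d = word c (b \<star> d)" if "c \<in> carrier C" "b \<in> A" "d \<in> carrier C" for c b d
  proof -
    have bc: "b \<in> carrier C" using that C.sub_carrier by blast
    have "c \<star> b \<star> \<kappa> = c \<star> \<kappa> \<star> b" using \<kappa>A[OF that(2)] \<kappa>(1) bc that by (simp add: C.C.m_assoc)
    then have "word (c \<star> b) d = g (c \<star> \<kappa>) \<cdot> (g b \<cdot> e') \<cdot> g (star C \<kappa> \<star> d)"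
      using \<kappa>(1) bc that by (simp add: word_def g_mult BL.C1.m_assoc)
    also have "\<dots> = g (c \<star> \<kappa>) \<cdot> (e' \<cdot> g b) \<cdot> g (star C \<kappa> \<star> d)"
      by (simp only: g_A[OF that(2)])
    also have "\<dots> = g (c \<star> \<kappa>) \<cdot> e' \<cdot> g (b \<star> star C \<kappa> \<star> d)"
      using \<kappa>(1) bc that by (simp add: g_mult BL.C1.m_assoc)
    also have "b \<star> star C \<kappa> \<star> d = star C \<kappa> \<star> (b \<star> d)"
      unfolding \<kappa>A'[OF that(2)] using \<kappa>(1) bc that by (simp add: C.C.m_assoc)
    finally show ?thesis by (simp add: word_def)
  qed
  have word_star: "star L1 (word c d) = word (star C d) (star C c)" if "c \<in> carrier C" "d \<in> carrier C" for c d
    using that \<kappa>(1) by (simp add: word_def BL.C1.star_mult BL.e_star C.C.star_mult BL.C1.m_assoc flip: g_star)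
  have word_left: "g b \<cdot> word c d = word (b \<star> c) d" if "b \<in> carrier C" "c \<in> carrier C" "d \<in> carrier C" for b c d
    using that \<kappa>(1) by (simp add: word_def g_mult C.C.m_assoc BL.C1.m_assoc)
  define \<psi> where "\<psi> t = (\<Oplus>\<^bsub>L1\<^esub>i\<in>{..<k}. word (p t (u i)) (star C (u i)))" for t
  have psi1 [simp]: "\<psi> t \<in> carrier L1" if "t \<in> carrier C1" for t
    unfolding \<psi>_def using that BC.u_closed by (intro BL.C1.finsum_closed) auto
  have psi_add: "\<psi> (s \<oplus>\<^bsub>C1\<^esub> t) = \<psi> s \<oplus>\<^bsub>L1\<^esub> \<psi> t" if "s \<in> carrier C1" "t \<in> carrier C1" for s t
  proof -
    have "\<psi> (s \<oplus>\<^bsub>C1\<^esub> t) = (\<Oplus>\<^bsub>L1\<^esub>i\<in>{..<k}. word (p s (u i)) (star C (u i)) \<oplus>\<^bsub>L1\<^esub> word (p t (u i)) (star C (u i)))"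
      unfolding \<psi>_def using that BC.u_closed by (intro BL.C1.finsum_cong') (auto simp: BC.p_add word_addl)
    then show ?thesis unfolding \<psi>_def using that BC.u_closed by (simp add: BL.C1.finsum_addf Pi_def)
  qed
  have psi_smult: "\<psi> (z \<odot>\<^bsub>C1\<^esub> t) = z \<odot>\<^bsub>L1\<^esub> \<psi> t" if t: "t \<in> carrier C1" for z t
  proof -
    have ws: "word (z \<odot>\<^bsub>C\<^esub> c) d = z \<odot>\<^bsub>L1\<^esub> word c d" if "c \<in> carrier C" "d \<in> carrier C" for c d
      using that \<kappa>(1) by (simp add: word_def g_smult)
    have "\<psi> (z \<odot>\<^bsub>C1\<^esub> t) = (\<Oplus>\<^bsub>L1\<^esub>i\<in>{..<k}. z \<odot>\<^bsub>L1\<^esub> word (p t (u i)) (star C (u i)))"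
      unfolding \<psi>_def using t BC.u_closed by (intro BL.C1.finsum_cong') (auto simp: BC.p_smult ws)
    then show ?thesis unfolding \<psi>_def using t BC.u_closed by (simp add: BL.C1.smult_finsum Pi_def)
  qed
  have act: "\<psi> t \<cdot> (g (c \<star> \<kappa>) \<cdot> e') = g (p t c \<star> \<kappa>) \<cdot> e'"
    if t: "t \<in> carrier C1" and c: "c \<in> carrier C" for t c
  proof -
    have "\<psi> t \<cdot> (g (c \<star> \<kappa>) \<cdot> e')
        = (\<Oplus>\<^bsub>L1\<^esub>i\<in>{..<k}. word (p t (u i)) (star C (u i)) \<cdot> (g (c \<star> \<kappa>) \<cdot> e'))"
      unfolding \<psi>_def using t c \<kappa>(1) BC.u_closed by (intro BL.C1.finsum_ldistr) auto
    also have "\<dots> = (\<Oplus>\<^bsub>L1\<^esub>i\<in>{..<k}. g (p t (u i) \<star> E (star C (u i) \<star> c) \<star> \<kappa>) \<cdot> e')"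
    proof (rule BL.C1.finsum_cong')
      fix i assume "i \<in> {..<k}"
      then have i: "u i \<in> carrier C" using BC.u_closed by simp
      let ?x = "star C (u i) \<star> c"
      have x: "?x \<in> carrier C" "E ?x \<in> A" "E ?x \<in> carrier C" using i c by auto
      have "word (p t (u i)) (star C (u i)) \<cdot> (g (c \<star> \<kappa>) \<cdot> e')
          = g (p t (u i) \<star> \<kappa>) \<cdot> (e' \<cdot> g (star C \<kappa> \<star> ?x \<star> \<kappa>) \<cdot> e')"
        using t i c \<kappa>(1) by (simp add: word_def g_mult C.C.m_assoc BL.C1.m_assoc)
      also have "\<dots> = g (p t (u i) \<star> \<kappa>) \<cdot> (g (E ?x) \<cdot> e')" by (simp only: eg[OF x(1)])
      also have "\<dots> = g (p t (u i) \<star> (\<kappa> \<star> E ?x)) \<cdot> e'"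
        using t i x \<kappa>(1) by (simp add: g_mult C.C.m_assoc BL.C1.m_assoc)
      also have "\<dots> = g (p t (u i) \<star> E ?x \<star> \<kappa>) \<cdot> e'"
        unfolding \<kappa>A[OF x(2), symmetric] using t i x \<kappa>(1) by (simp add: C.C.m_assoc)
      finally show "word (p t (u i)) (star C (u i)) \<cdot> (g (c \<star> \<kappa>) \<cdot> e')
          = g (p t (u i) \<star> E ?x \<star> \<kappa>) \<cdot> e'" .
    qed (use t c \<kappa>(1) BC.u_closed in auto)
    also have "\<dots> = g ((\<Oplus>\<^bsub>C\<^esub>i\<in>{..<k}. p t (u i) \<star> E (star C (u i) \<star> c)) \<star> \<kappa>) \<cdot> e'"
    proof (rule additive_finsum[symmetric])
      show "abelian_group C" "abelian_group L1" by (rule C.C.abelian_group_axioms BL.C1.abelian_group_axioms)+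
    qed (use t c \<kappa>(1) BC.u_closed in \<open>auto simp: C.C.l_distr g_add BL.C1.l_distr\<close>)
    also have "(\<Oplus>\<^bsub>C\<^esub>i\<in>{..<k}. p t (u i) \<star> E (star C (u i) \<star> c)) = p t c"
      using BC.p_frame[OF t c] by simp
    finally show ?thesis .
  qed
  have psi_mult: "\<psi> (s \<otimes>\<^bsub>C1\<^esub> t) = \<psi> s \<cdot> \<psi> t" if st: "s \<in> carrier C1" "t \<in> carrier C1" for s t
  proof -
    have "\<psi> s \<cdot> \<psi> t = (\<Oplus>\<^bsub>L1\<^esub>i\<in>{..<k}. \<psi> s \<cdot> word (p t (u i)) (star C (u i)))"
      unfolding \<psi>_def[of t] using st BC.u_closed by (intro BL.C1.finsum_rdistr) auto
    also have "\<dots> = (\<Oplus>\<^bsub>L1\<^esub>i\<in>{..<k}. word (p (s \<otimes>\<^bsub>C1\<^esub> t) (u i)) (star C (u i)))"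
    proof (rule BL.C1.finsum_cong')
      fix i assume "i \<in> {..<k}"
      then have i: "u i \<in> carrier C" using BC.u_closed by simp
      have "\<psi> s \<cdot> word (p t (u i)) (star C (u i))
          = \<psi> s \<cdot> (g (p t (u i) \<star> \<kappa>) \<cdot> e') \<cdot> g (star C \<kappa> \<star> star C (u i))"
        using st i \<kappa>(1) by (simp add: word_def BL.C1.m_assoc)
      also have "\<dots> = word (p (s \<otimes>\<^bsub>C1\<^esub> t) (u i)) (star C (u i))"
        using st i by (subst act) (auto simp: word_def BC.p_mult)
      finally show "\<psi> s \<cdot> word (p t (u i)) (star C (u i)) = word (p (s \<otimes>\<^bsub>C1\<^esub> t) (u i)) (star C (u i))" .
    qed (use st BC.u_closed in auto)
    finally show ?thesis by (simp add: \<psi>_def)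
  qed
  have psi_star: "\<psi> (star C1 t) = star L1 (\<psi> t)" if t: "t \<in> carrier C1" for t
  proof -
    have "\<psi> (star C1 t) = (\<Oplus>\<^bsub>L1\<^esub>i\<in>{..<k}. \<Oplus>\<^bsub>L1\<^esub>j\<in>{..<k}. word (u j) (E (star C (p t (u j)) \<star> u i) \<star> star C (u i)))"
      unfolding \<psi>_def
    proof (rule BL.C1.finsum_cong')
      fix i assume "i \<in> {..<k}"
      then have i: "u i \<in> carrier C" using BC.u_closed by simp
      have "p (star C1 t) (u i) = (\<Oplus>\<^bsub>C\<^esub>j\<in>{..<k}. u j \<star> E (star C (p t (u j)) \<star> u i))"
        using BC.qb_left[of "p (star C1 t) (u i)"] t i BC.u_closed
        by (simp add: BC.p_star cong: C.C.finsum_cong)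
      then have "word (p (star C1 t) (u i)) (star C (u i))
          = (\<Oplus>\<^bsub>L1\<^esub>j\<in>{..<k}. word (u j \<star> E (star C (p t (u j)) \<star> u i)) (star C (u i)))"
        using t i BC.u_closed by (simp add: word_suml Pi_def)
      also have "\<dots> = (\<Oplus>\<^bsub>L1\<^esub>j\<in>{..<k}. word (u j) (E (star C (p t (u j)) \<star> u i) \<star> star C (u i)))"
        using t i BC.u_closed by (intro BL.C1.finsum_cong') (auto simp: balance)
      finally show "word (p (star C1 t) (u i)) (star C (u i))
          = (\<Oplus>\<^bsub>L1\<^esub>j\<in>{..<k}. word (u j) (E (star C (p t (u j)) \<star> u i) \<star> star C (u i)))" .
    qed (use t BC.u_closed in \<open>auto intro!: BL.C1.finsum_closed\<close>)
    also have "\<dots> = (\<Oplus>\<^bsub>L1\<^esub>j\<in>{..<k}. \<Oplus>\<^bsub>L1\<^esub>i\<in>{..<k}. word (u j) (E (star C (p t (u j)) \<star> u i) \<star> star C (u i)))"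
      using t BC.u_closed by (intro BL.C1.finsum_swap) auto
    also have "\<dots> = (\<Oplus>\<^bsub>L1\<^esub>j\<in>{..<k}. star L1 (word (p t (u j)) (star C (u j))))"
    proof (rule BL.C1.finsum_cong')
      fix j assume "j \<in> {..<k}"
      then have j: "u j \<in> carrier C" using BC.u_closed by simp
      have "(\<Oplus>\<^bsub>L1\<^esub>i\<in>{..<k}. word (u j) (E (star C (p t (u j)) \<star> u i) \<star> star C (u i)))
          = word (u j) (\<Oplus>\<^bsub>C\<^esub>i\<in>{..<k}. E (star C (p t (u j)) \<star> u i) \<star> star C (u i))"
        using t j BC.u_closed by (intro word_sumr[symmetric]) auto
      also have "\<dots> = star L1 (word (p t (u j)) (star C (u j)))"
        using t j BC.qb_right[of "star C (p t (u j))"] by (simp add: word_star)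
      finally show "(\<Oplus>\<^bsub>L1\<^esub>i\<in>{..<k}. word (u j) (E (star C (p t (u j)) \<star> u i) \<star> star C (u i)))
          = star L1 (word (p t (u j)) (star C (u j)))" .
    qed (use t BC.u_closed in auto)
    also have "\<dots> = star L1 (\<psi> t)"
      unfolding \<psi>_def using t BC.u_closed by (intro BL.C1.star_finsum[symmetric]) auto
    finally show ?thesis .
  qed
  have psi_inj: "inj_on \<psi> (carrier C1)"
  proof (rule inj_onI)
    fix s t assume st: "s \<in> carrier C1" "t \<in> carrier C1" "\<psi> s = \<psi> t"
    show "s = t"
    proof (rule BC.eq1[OF st(1,2)])
      fix c assume c: "c \<in> carrier C"
      have "g (p s c \<star> \<kappa>) \<cdot> e' = g (p t c \<star> \<kappa>) \<cdot> e'"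
        using act[OF st(1) c] act[OF st(2) c] st(3) by simp
      then have "\<phi> (p s c \<star> \<kappa>) = \<phi> (p t c \<star> \<kappa>)"
        unfolding g_def using st c \<kappa>(1) by (intro BL.iota_e_inj) auto
      then have "p s c \<star> \<kappa> \<star> \<kappa>' = p t c \<star> \<kappa> \<star> \<kappa>'" using st c \<kappa>(1) by simp
      then show "p s c = p t c" using st c \<kappa>(1-3) by (simp add: C.C.m_assoc)
    qed
  qed
  have psi_word: "\<psi> (\<iota> c \<otimes>\<^bsub>C1\<^esub> e \<otimes>\<^bsub>C1\<^esub> \<iota> d) = word c d" if "c \<in> carrier C" "d \<in> carrier C" for c d
  proof -
    have "\<psi> (\<iota> c \<otimes>\<^bsub>C1\<^esub> e \<otimes>\<^bsub>C1\<^esub> \<iota> d) = (\<Oplus>\<^bsub>L1\<^esub>i\<in>{..<k}. word c (E (d \<star> u i) \<star> star C (u i)))"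
      unfolding \<psi>_def using that BC.u_closed
      by (intro BL.C1.finsum_cong') (auto simp: BC.p_word balance)
    also have "\<dots> = word c (\<Oplus>\<^bsub>C\<^esub>i\<in>{..<k}. E (d \<star> u i) \<star> star C (u i))"
      using that BC.u_closed by (intro word_sumr[symmetric]) auto
    finally show ?thesis using BC.qb_right[OF that(2)] by simp
  qed
  have cut: "\<iota>' q \<cdot> \<psi> t = \<psi> t" "\<psi> t \<cdot> \<iota>' q = \<psi> t" if t: "t \<in> carrier C1" for t
  proof -
    have w: "\<iota>' q \<cdot> word c d = word c d" "word c d \<cdot> \<iota>' q = word c d"
      if "c \<in> carrier C" "d \<in> carrier C" for c d
    proof -
      have "\<iota>' q \<cdot> word c d = (\<iota>' q \<cdot> g (c \<star> \<kappa>)) \<cdot> e' \<cdot> g (star C \<kappa> \<star> d)"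
        using that \<kappa>(1) by (simp add: word_def BL.C1.m_assoc)
      then show "\<iota>' q \<cdot> word c d = word c d" using that \<kappa>(1) by (simp add: gq word_def)
      have "word c d \<cdot> \<iota>' q = g (c \<star> \<kappa>) \<cdot> e' \<cdot> (g (star C \<kappa> \<star> d) \<cdot> \<iota>' q)"
        using that \<kappa>(1) by (simp add: word_def BL.C1.m_assoc)
      then show "word c d \<cdot> \<iota>' q = word c d" using that \<kappa>(1) by (simp add: gq word_def)
    qed
    have "\<iota>' q \<cdot> \<psi> t = (\<Oplus>\<^bsub>L1\<^esub>i\<in>{..<k}. \<iota>' q \<cdot> word (p t (u i)) (star C (u i)))"
      unfolding \<psi>_def using t BC.u_closed by (intro BL.C1.finsum_rdistr) auto
    also have "\<dots> = \<psi> t" unfolding \<psi>_def using t BC.u_closed by (intro BL.C1.finsum_cong') (auto simp: w)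
    finally show "\<iota>' q \<cdot> \<psi> t = \<psi> t" .
    have "\<psi> t \<cdot> \<iota>' q = (\<Oplus>\<^bsub>L1\<^esub>i\<in>{..<k}. word (p t (u i)) (star C (u i)) \<cdot> \<iota>' q)"
      unfolding \<psi>_def using t BC.u_closed by (intro BL.C1.finsum_ldistr) auto
    also have "\<dots> = \<psi> t" unfolding \<psi>_def using t BC.u_closed by (intro BL.C1.finsum_cong') (auto simp: w)
    finally show "\<psi> t \<cdot> \<iota>' q = \<psi> t" .
  qed
  have surj: "\<exists>t\<in>carrier C1. \<psi> t = x" if x: "x \<in> carrier L1" "\<iota>' q \<cdot> x \<cdot> \<iota>' q = x" for x
  proof -
    let ?X = "\<lambda>m. q \<otimes> p' x (w m)" and ?Y = "\<lambda>m. star L (w m) \<otimes> q"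
    have XY: "?X m \<in> carrier L" "?Y m \<in> carrier L" if "m < k'" for m using that x(1) BL.u_closed by auto
    have "\<exists>t\<in>carrier C1. \<psi> t = \<iota>' (?X m \<otimes> a i \<otimes> q) \<cdot> e' \<cdot> \<iota>' (q \<otimes> star L (a i) \<otimes> ?Y m)"
      if mi: "m < k'" "i < n" for m i
    proof -
      have wm: "w m \<in> carrier L" "p' x (w m) \<in> carrier L" using BL.u_closed mi x(1) by auto
      have ai: "a i \<in> carrier L" using a_closed mi by blast
      obtain c where c: "c \<in> carrier C" "\<phi> c = q \<otimes> (p' x (w m) \<otimes> a i) \<otimes> q"
        by (rule compress_elem[of "p' x (w m) \<otimes> a i"]) (use wm ai in auto)
      obtain d where d: "d \<in> carrier C" "\<phi> d = q \<otimes> (star L (a i) \<otimes> star L (w m)) \<otimes> q"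
        by (rule compress_elem[of "star L (a i) \<otimes> star L (w m)"]) (use wm ai in auto)
      have "star C \<kappa> \<star> star C \<kappa>' = \<one>\<^bsub>C\<^esub>" using arg_cong[OF \<kappa>(4), of "star C"] \<kappa>(1,2) by (simp add: C.C.star_mult)
      then have "star C \<kappa> \<star> (star C \<kappa>' \<star> d) = d" using \<kappa>(1,2) d(1) by (simp flip: C.C.m_assoc)
      moreover have "c \<star> \<kappa>' \<star> \<kappa> = c" using \<kappa>(1,2,4) c(1) by (simp add: C.C.m_assoc)
      \<comment> \<open>the factors \<open>\<kappa>'\<close> undo the correction by \<open>\<kappa>\<close>\<close>
      ultimately have "word (c \<star> \<kappa>') (star C \<kappa>' \<star> d) = g c \<cdot> e' \<cdot> g d" by (simp add: word_def)
      also have "\<dots> = \<iota>' (?X m \<otimes> a i \<otimes> q) \<cdot> e' \<cdot> \<iota>' (q \<otimes> star L (a i) \<otimes> ?Y m)"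
        unfolding g_def c(2) d(2) using wm ai by (simp add: L.C.m_assoc)
      finally have "\<psi> (\<iota> (c \<star> \<kappa>') \<otimes>\<^bsub>C1\<^esub> e \<otimes>\<^bsub>C1\<^esub> \<iota> (star C \<kappa>' \<star> d))
          = \<iota>' (?X m \<otimes> a i \<otimes> q) \<cdot> e' \<cdot> \<iota>' (q \<otimes> star L (a i) \<otimes> ?Y m)"
        using psi_word[of "c \<star> \<kappa>'" "star C \<kappa>' \<star> d"] c(1) d(1) \<kappa>(2) by simp
      moreover have "\<iota> (c \<star> \<kappa>') \<otimes>\<^bsub>C1\<^esub> e \<otimes>\<^bsub>C1\<^esub> \<iota> (star C \<kappa>' \<star> d) \<in> carrier C1" using c(1) d(1) \<kappa>(2) by simp
      ultimately show ?thesis by blast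
    qed
    then obtain t where t: "\<And>m i. \<lbrakk>m < k'; i < n\<rbrakk> \<Longrightarrow> t m i \<in> carrier C1"
        "\<And>m i. \<lbrakk>m < k'; i < n\<rbrakk> \<Longrightarrow> \<psi> (t m i) = \<iota>' (?X m \<otimes> a i \<otimes> q) \<cdot> e' \<cdot> \<iota>' (q \<otimes> star L (a i) \<otimes> ?Y m)"
      by metis
    have psi_sum: "\<psi> (finsum C1 f I) = (\<Oplus>\<^bsub>L1\<^esub>i\<in>I. \<psi> (f i))" if "finite I" "f \<in> I \<rightarrow> carrier C1" for f and I :: "nat set"
      using that psi_add by (intro additive_finsum BC.C1.abelian_group_axioms BL.C1.abelian_group_axioms) auto
    have one: "\<iota>' (?X m) \<cdot> e' \<cdot> \<iota>' (?Y m) = \<psi> (\<Oplus>\<^bsub>C1\<^esub>i\<in>{..<n}. t m i)" if m: "m < k'" for m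
    proof -
      have qa: "q \<otimes> star L (a i) \<in> L0" if "i < n" for i using that q_sub a_sub L.sub_mult L.sub_star by blast
      have X1: "?X m = (\<Oplus>i\<in>{..<n}. (?X m \<otimes> a i \<otimes> q) \<otimes> (q \<otimes> star L (a i)))"
      proof -
        have "?X m = (\<Oplus>i\<in>{..<n}. (?X m \<otimes> a i \<otimes> q) \<otimes> (q \<otimes> star L (a i) \<otimes> \<one>))"
          using full_insert[of "?X m" \<one>] XY[OF m] by simp
        also have "\<dots> = (\<Oplus>i\<in>{..<n}. (?X m \<otimes> a i \<otimes> q) \<otimes> (q \<otimes> star L (a i)))"
          using XY[OF m] a_closed by (intro L.C.finsum_cong') auto
        finally show ?thesis .
      qed
      have "\<iota>' (?X m) \<cdot> e' \<cdot> \<iota>' (?Y m)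
          = (\<Oplus>\<^bsub>L1\<^esub>i\<in>{..<n}. \<iota>' ((?X m \<otimes> a i \<otimes> q) \<otimes> (q \<otimes> star L (a i)))) \<cdot> e' \<cdot> \<iota>' (?Y m)"
        using XY[OF m] a_closed by (subst X1, subst BL.iota_finsum) auto
      also have "\<dots> = (\<Oplus>\<^bsub>L1\<^esub>i\<in>{..<n}. \<iota>' ((?X m \<otimes> a i \<otimes> q) \<otimes> (q \<otimes> star L (a i))) \<cdot> e' \<cdot> \<iota>' (?Y m))"
        using XY[OF m] a_closed by (simp add: BL.C1.finsum_ldistr Pi_def)
      also have "\<dots> = (\<Oplus>\<^bsub>L1\<^esub>i\<in>{..<n}. \<psi> (t m i))"
      proof (rule BL.C1.finsum_cong')
        fix i assume "i \<in> {..<n}"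
        then have i: "i < n" "a i \<in> carrier L" using a_closed by auto
        let ?P = "\<iota>' (?X m \<otimes> a i \<otimes> q)" and ?Q = "\<iota>' (q \<otimes> star L (a i))"
        have c: "?P \<in> carrier L1" "?Q \<in> carrier L1" "\<iota>' (?Y m) \<in> carrier L1" using XY[OF m] i by auto
        have "\<iota>' ((?X m \<otimes> a i \<otimes> q) \<otimes> (q \<otimes> star L (a i))) \<cdot> e' \<cdot> \<iota>' (?Y m)
            = ?P \<cdot> (?Q \<cdot> e') \<cdot> \<iota>' (?Y m)"
          using XY[OF m] i c by (subst BL.iota_mult) (auto simp: BL.C1.m_assoc)
        also have "\<dots> = ?P \<cdot> (e' \<cdot> ?Q) \<cdot> \<iota>' (?Y m)"
          by (simp only: BL.iota_e_commute[OF qa[OF i(1)]])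
        also have "\<dots> = ?P \<cdot> e' \<cdot> (?Q \<cdot> \<iota>' (?Y m))" using c by (simp add: BL.C1.m_assoc)
        also have "?Q \<cdot> \<iota>' (?Y m) = \<iota>' (q \<otimes> star L (a i) \<otimes> ?Y m)"
          using XY[OF m] i by (intro BL.iota_mult[symmetric]) auto
        finally show "\<iota>' ((?X m \<otimes> a i \<otimes> q) \<otimes> (q \<otimes> star L (a i))) \<cdot> e' \<cdot> \<iota>' (?Y m) = \<psi> (t m i)"
          using t(2)[OF m i(1)] by simp
      qed (use t(1) m in auto)
      also have "\<dots> = \<psi> (\<Oplus>\<^bsub>C1\<^esub>i\<in>{..<n}. t m i)" using t(1) m by (intro psi_sum[symmetric]) auto
      finally show ?thesis .
    qed
    let ?T = "\<Oplus>\<^bsub>C1\<^esub>m\<in>{..<k'}. \<Oplus>\<^bsub>C1\<^esub>i\<in>{..<n}. t m i"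
    have Tc: "?T \<in> carrier C1" "\<And>m. m < k' \<Longrightarrow> (\<Oplus>\<^bsub>C1\<^esub>i\<in>{..<n}. t m i) \<in> carrier C1"
      using t(1) by (auto intro!: BC.C1.finsum_closed)
    have "x = \<iota>' q \<cdot> (\<Oplus>\<^bsub>L1\<^esub>m\<in>{..<k'}. \<iota>' (p' x (w m)) \<cdot> e' \<cdot> \<iota>' (star L (w m))) \<cdot> \<iota>' q"
      unfolding BL.expand[OF x(1), symmetric] using x(2) by simp
    also have "\<dots> = (\<Oplus>\<^bsub>L1\<^esub>m\<in>{..<k'}. \<iota>' q \<cdot> (\<iota>' (p' x (w m)) \<cdot> e' \<cdot> \<iota>' (star L (w m))) \<cdot> \<iota>' q)"
      using x(1) BL.u_closed by (simp add: BL.C1.finsum_rdistr BL.C1.finsum_ldistr Pi_def)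
    also have "\<dots> = (\<Oplus>\<^bsub>L1\<^esub>m\<in>{..<k'}. \<psi> (\<Oplus>\<^bsub>C1\<^esub>i\<in>{..<n}. t m i))"
    proof (rule BL.C1.finsum_cong')
      fix m assume "m \<in> {..<k'}"
      then have m: "m < k'" "w m \<in> carrier L" using BL.u_closed by auto
      have "\<iota>' q \<cdot> (\<iota>' (p' x (w m)) \<cdot> e' \<cdot> \<iota>' (star L (w m))) \<cdot> \<iota>' q
          = \<iota>' (?X m) \<cdot> e' \<cdot> \<iota>' (?Y m)"
        using m x(1) by (simp add: BL.iota_mult BL.C1.m_assoc)
      then show "\<iota>' q \<cdot> (\<iota>' (p' x (w m)) \<cdot> e' \<cdot> \<iota>' (star L (w m))) \<cdot> \<iota>' q
          = \<psi> (\<Oplus>\<^bsub>C1\<^esub>i\<in>{..<n}. t m i)" using one[OF m(1)] by simp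
    qed (use Tc in auto)
    also have "\<dots> = \<psi> ?T" using Tc by (intro psi_sum[symmetric]) auto
    finally show ?thesis using Tc by auto
  qed
  have qq: "\<iota>' q \<cdot> \<iota>' q = \<iota>' q" using BL.iota_mult[of q q] q_idem by simp
  have psi_one: "\<psi> \<one>\<^bsub>C1\<^esub> = \<iota>' q"
  proof -
    obtain t where t: "t \<in> carrier C1" "\<psi> t = \<iota>' q" using surj[of "\<iota>' q"] qq by auto
    have "\<psi> \<one>\<^bsub>C1\<^esub> = \<psi> t \<cdot> \<psi> \<one>\<^bsub>C1\<^esub>" unfolding t(2) by (rule cut[symmetric]) simp
    also have "\<dots> = \<psi> t" using psi_mult[of t "\<one>\<^bsub>C1\<^esub>"] t by simp
    finally show ?thesis using t by simp
  qed
  have ext: "\<psi> (\<iota> c) = \<iota>' (\<phi> c)" if c: "c \<in> carrier C" for c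
  proof -
    have "\<psi> (\<iota> c) = (\<Oplus>\<^bsub>L1\<^esub>i\<in>{..<k}. g c \<cdot> word (p \<one>\<^bsub>C1\<^esub> (u i)) (star C (u i)))"
      unfolding \<psi>_def using c BC.u_closed by (intro BL.C1.finsum_cong') (auto simp: word_left)
    also have "\<dots> = g c \<cdot> \<psi> \<one>\<^bsub>C1\<^esub>"
      unfolding \<psi>_def using c BC.u_closed by (intro BL.C1.finsum_rdistr[symmetric]) auto
    finally show ?thesis using gq(2)[OF c] by (simp add: psi_one g_def)
  qed
  have "full_corner (\<iota> ` carrier C) C1 (\<iota>' ` carrier L) L1 (\<iota>' q) \<psi> n (\<lambda>i. \<iota>' (a i))"
  proof (intro full_corner.intro full_corner_axioms.intro cstar_inclusion.intro cstar_inclusion_axioms.intro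
      BC.C1.unital_cstar_algebra_axioms BL.C1.unital_cstar_algebra_axioms BC.iota_inclusion BL.iota_inclusion)
    show "\<iota>' q \<in> \<iota>' ` carrier L" by simp
    show "\<iota>' q \<cdot> \<iota>' q = \<iota>' q" by (rule qq)
    show "star L1 (\<iota>' q) = \<iota>' q" using BL.iota_star[of q] q_star by simp
    show "\<psi> ` carrier C1 = {x \<in> carrier L1. \<iota>' q \<cdot> x \<cdot> \<iota>' q = x}"
    proof (intro equalityI subsetI)
      fix x assume "x \<in> \<psi> ` carrier C1"
      then show "x \<in> {x \<in> carrier L1. \<iota>' q \<cdot> x \<cdot> \<iota>' q = x}" by (auto simp: cut)
    next
      fix x assume "x \<in> {x \<in> carrier L1. \<iota>' q \<cdot> x \<cdot> \<iota>' q = x}"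
      then obtain t where "t \<in> carrier C1" "\<psi> t = x" using surj[of x] by blast
      then show "x \<in> \<psi> ` carrier C1" by blast
    qed
    show "\<psi> ` \<iota> ` carrier C = {x \<in> \<iota>' ` carrier L. \<iota>' q \<cdot> x \<cdot> \<iota>' q = x}"
    proof (intro equalityI subsetI)
      fix x assume "x \<in> \<psi> ` \<iota> ` carrier C"
      then obtain c where c: "c \<in> carrier C" "x = \<iota>' (\<phi> c)" using ext by auto
      then show "x \<in> {x \<in> \<iota>' ` carrier L. \<iota>' q \<cdot> x \<cdot> \<iota>' q = x}"
        using gq[OF c(1)] by (auto simp: g_def)
    next
      fix x assume x: "x \<in> {x \<in> \<iota>' ` carrier L. \<iota>' q \<cdot> x \<cdot> \<iota>' q = x}"
      then obtain y where y: "y \<in> carrier L" "x = \<iota>' y" by blast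
      then have "\<iota>' (q \<otimes> y \<otimes> q) = \<iota>' y" using x by (simp add: BL.iota_mult)
      then have "q \<otimes> y \<otimes> q = y" using y(1) by (intro BL.iota_inj) auto
      then obtain c where "c \<in> carrier C" "\<phi> c = y" using corner_elem y(1) by blast
      then show "x \<in> \<psi> ` \<iota> ` carrier C" using ext y(2) by force
    qed
    show "\<iota>' (a i) \<in> \<iota>' ` carrier L" if "i < n" for i using a_closed[OF that] by simp
    have "(\<Oplus>\<^bsub>L1\<^esub>i\<in>{..<n}. \<iota>' (a i) \<cdot> \<iota>' q \<cdot> star L1 (\<iota>' (a i))) = (\<Oplus>\<^bsub>L1\<^esub>i\<in>{..<n}. \<iota>' (a i \<otimes> q \<otimes> star L (a i)))"
      using a_closed by (intro BL.C1.finsum_cong') (auto simp: BL.iota_mult BL.iota_star)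
    also have "\<dots> = \<iota>' (\<Oplus>i\<in>{..<n}. a i \<otimes> q \<otimes> star L (a i))"
      using a_closed by (intro BL.iota_finsum[symmetric]) auto
    finally show "(\<Oplus>\<^bsub>L1\<^esub>i\<in>{..<n}. \<iota>' (a i) \<cdot> \<iota>' q \<cdot> star L1 (\<iota>' (a i))) = \<one>\<^bsub>L1\<^esub>"
      by (simp add: full BL.iota_one)
  qed (use psi_add psi_mult psi_smult psi_star psi_inj in auto)
  with ext show ?thesis using that by blast
qed

end

end

section \<open>Extension of an expectation from a corner\<close>

text \<open>From \<open>\<phi> x* \<phi> x \<le> s\<close> one obtains \<open>x* x \<le> s\<close>, because \<open>q z* z q\<close> is a sum of squares of elements of the corner.
  This is needed to see that \<open>L0\<close> is closed.\<close>

lemma (in full_corner) phi_norm_ge: assumes x: "x \<in> carrier C" shows "nrm C x \<le> nrm L (\<phi> x)"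
proof -
  let ?s = "(nrm L (\<phi> x))\<^sup>2" and ?b = "star C x \<star> x"
  have b: "?b \<in> carrier C" using x by simp
  have pb: "\<phi> ?b = star L (\<phi> x) \<otimes> \<phi> x" using x by (simp add: phi_mult phi_star)
  have "cstar_positive L (L.C.sc ?s \<ominus> \<phi> ?b)"
    unfolding pb using x L.C.cstar_identity[of "\<phi> x"] by (intro L.C.pos_norm_minus) (auto simp: L.C.star_mult)
  then obtain z where z: "z \<in> carrier L" "L.C.sc ?s \<ominus> \<phi> ?b = star L z \<otimes> z" unfolding cstar_positive_def by blast
  have "\<exists>c\<in>carrier C. \<phi> c = q \<otimes> (star L (a i) \<otimes> z) \<otimes> q" if i: "i < n" for i
    using compress_elem[of "star L (a i) \<otimes> z"] a_closed[OF i] z(1) by auto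
  then obtain c where c: "\<And>i. i < n \<Longrightarrow> c i \<in> carrier C" "\<And>i. i < n \<Longrightarrow> \<phi> (c i) = q \<otimes> (star L (a i) \<otimes> z) \<otimes> q"
    by metis
  have "\<phi> (C.C.sc ?s \<ominus>\<^bsub>C\<^esub> ?b) = q \<otimes> (L.C.sc ?s \<ominus> \<phi> ?b) \<otimes> q"
  proof -
    have "\<phi> (C.C.sc ?s \<ominus>\<^bsub>C\<^esub> ?b) = \<phi> (C.C.sc ?s) \<ominus> \<phi> ?b"
      using phi_add[of "C.C.sc ?s" "(-1) \<odot>\<^bsub>C\<^esub> ?b"] b phi_smult[OF b, of "-1"]
      by (simp add: C.C.minus_eq L.C.minus_eq C.C.smult_neg_one L.C.smult_neg_one del: C.C.smult_mult)
    moreover have "\<phi> (C.C.sc ?s) = q \<otimes> L.C.sc ?s \<otimes> q"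
      using q_idem by (simp add: C.C.sc_def phi_smult phi_one L.C.sc_def)
    moreover have "\<phi> ?b = q \<otimes> \<phi> ?b \<otimes> q" using corner_cut[OF b] by simp
    ultimately show ?thesis using b by (simp add: L.C.minus_eq L.C.l_distr L.C.r_distr L.C.l_minus L.C.r_minus)
  qed
  also have "\<dots> = (q \<otimes> star L z) \<otimes> (z \<otimes> q)" unfolding z(2) using z(1) by (simp add: L.C.m_assoc)
  also have "\<dots> = (\<Oplus>i\<in>{..<n}. ((q \<otimes> star L z) \<otimes> a i \<otimes> q) \<otimes> (q \<otimes> star L (a i) \<otimes> (z \<otimes> q)))"
    using z(1) by (intro full_insert[symmetric]) auto
  also have "\<dots> = (\<Oplus>i\<in>{..<n}. \<phi> (star C (c i) \<star> c i))"
  proof (rule L.C.finsum_cong')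
    fix i assume "i \<in> {..<n}"
    then have i: "i < n" "a i \<in> carrier L" using a_closed by auto
    have "\<phi> (star C (c i) \<star> c i) = star L (\<phi> (c i)) \<otimes> \<phi> (c i)" using c(1)[OF i(1)] by (simp add: phi_mult phi_star)
    also have "\<dots> = ((q \<otimes> star L z) \<otimes> a i \<otimes> q) \<otimes> (q \<otimes> star L (a i) \<otimes> (z \<otimes> q))"
      using z(1) i by (simp add: c(2) L.C.star_mult q_star L.C.m_assoc)
    finally show "((q \<otimes> star L z) \<otimes> a i \<otimes> q) \<otimes> (q \<otimes> star L (a i) \<otimes> (z \<otimes> q)) = \<phi> (star C (c i) \<star> c i)" by simp
  qed (use c(1) in auto)
  also have "\<dots> = \<phi> (\<Oplus>\<^bsub>C\<^esub>i\<in>{..<n}. star C (c i) \<star> c i)" using c(1) by (intro phi_finsum[symmetric]) auto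
  finally have "C.C.sc ?s \<ominus>\<^bsub>C\<^esub> ?b = (\<Oplus>\<^bsub>C\<^esub>i\<in>{..<n}. star C (c i) \<star> c i)"
    using c(1) b by (subst (asm) phi_eq_iff) (auto intro!: C.C.finsum_closed)
  then have "cstar_positive C (C.C.sc ?s \<ominus>\<^bsub>C\<^esub> ?b)" using c(1) by (auto intro!: C.C.pos_finsum)
  then have "nrm C ?b \<le> ?s" using C.C.pos_norm_le[OF C.C.pos_star_mult[OF x]] by simp
  then have "(nrm C x)\<^sup>2 \<le> ?s" using C.C.cstar_identity[OF x] by simp
  then show ?thesis using L.C.nrm_nonneg[of "\<phi> x"] x by (auto intro: power2_le_imp_le)
qed

text \<open>A full corner \<open>C\<close> of an algebra \<open>L\<close>, without a subalgebra of \<open>L\<close> given. The condition on \<open>star L (a i) \<otimes> a j\<close>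
  is what makes the elements with coefficients in \<open>A\<close> an algebra. Including \<open>q\<close> itself among the \<open>a i\<close> makes
  the corner of that algebra equal to \<open>A\<close>.\<close>

locale linking = K: full_corner "carrier C" C "carrier L" L q \<phi> n a + I: index_finite A C E k u
  for A and C :: "('c, 'm) cstar_scheme" and E k u and L :: "('l, 'n) cstar_scheme" (structure)
    and q \<phi> n a +
  assumes a_q: "i < n \<Longrightarrow> a i \<otimes> q = a i" and a_0: "0 < n" "a 0 = q"
    and gram: "\<lbrakk>i < n; j < n\<rbrakk> \<Longrightarrow> star L (a i) \<otimes> a j \<in> \<phi> ` A"
begin

abbreviation "psi \<equiv> K.psi"

text \<open>The matrix coefficients of \<open>t\<close>. They are compressed to the corner because \<open>a i \<otimes> q = a i\<close>.\<close>

definition entry :: "nat \<Rightarrow> nat \<Rightarrow> 'l \<Rightarrow> 'c" where "entry i j t = psi (star L (a i) \<otimes> t \<otimes> a j)"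

definition L0 :: "'l set" where "L0 = {t \<in> carrier L. \<forall>i<n. \<forall>j<n. entry i j t \<in> A}"

lemma q_a: "i < n \<Longrightarrow> q \<otimes> star L (a i) = star L (a i)"
  using arg_cong[OF a_q, of i "star L"] K.a_closed[of i] by (simp add: K.L.C.star_mult K.q_star)

lemma entry:
  assumes "i < n" "j < n" "t \<in> carrier L"
  shows entry_closed: "entry i j t \<in> carrier C" and phi_entry: "\<phi> (entry i j t) = star L (a i) \<otimes> t \<otimes> a j"
proof -
  have ai: "a i \<in> carrier L" "a j \<in> carrier L" using K.a_closed assms by auto
  have "q \<otimes> (star L (a i) \<otimes> t \<otimes> a j) \<otimes> q = (q \<otimes> star L (a i)) \<otimes> t \<otimes> (a j \<otimes> q)"
    using ai assms(3) by (simp add: K.L.C.m_assoc)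
  then have "q \<otimes> (star L (a i) \<otimes> t \<otimes> a j) \<otimes> q = star L (a i) \<otimes> t \<otimes> a j" using q_a a_q assms by simp
  then obtain c where c: "c \<in> carrier C" "\<phi> c = star L (a i) \<otimes> t \<otimes> a j"
    by (rule K.corner_elem[rotated]) (use ai assms in auto)
  then have "entry i j t = c" unfolding entry_def by (simp flip: c(2))
  then show "entry i j t \<in> carrier C" "\<phi> (entry i j t) = star L (a i) \<otimes> t \<otimes> a j" using c by auto
qed

lemma full': "(\<Oplus>i\<in>{..<n}. a i \<otimes> star L (a i)) = \<one>"
proof -
  have "(\<Oplus>i\<in>{..<n}. a i \<otimes> star L (a i)) = (\<Oplus>i\<in>{..<n}. a i \<otimes> q \<otimes> star L (a i))"
    using K.a_closed a_q by (intro K.L.C.finsum_cong') auto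
  then show ?thesis using K.full by simp
qed

lemma resolve_left: assumes x: "x \<in> carrier L" shows "x = (\<Oplus>i\<in>{..<n}. a i \<otimes> (star L (a i) \<otimes> x))"
proof -
  have "x = (\<Oplus>i\<in>{..<n}. a i \<otimes> star L (a i)) \<otimes> x" unfolding full' using x by simp
  also have "\<dots> = (\<Oplus>i\<in>{..<n}. a i \<otimes> (star L (a i) \<otimes> x))"
    using x K.a_closed by (simp add: K.L.C.finsum_ldistr Pi_def K.L.C.m_assoc cong: K.L.C.finsum_cong)
  finally show ?thesis .
qed

lemma resolve_right: assumes x: "x \<in> carrier L" shows "x = (\<Oplus>i\<in>{..<n}. x \<otimes> a i \<otimes> star L (a i))"
proof -
  have "x = x \<otimes> (\<Oplus>i\<in>{..<n}. a i \<otimes> star L (a i))" unfolding full' using x by simp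
  also have "\<dots> = (\<Oplus>i\<in>{..<n}. x \<otimes> a i \<otimes> star L (a i))"
    using x K.a_closed by (simp add: K.L.C.finsum_rdistr Pi_def K.L.C.m_assoc cong: K.L.C.finsum_cong)
  finally show ?thesis .
qed

lemma entry_eqI:
  assumes s: "s \<in> carrier L" and t: "t \<in> carrier L"
    and e: "\<And>i j. \<lbrakk>i < n; j < n\<rbrakk> \<Longrightarrow> entry i j s = entry i j t"
  shows "s = t"
proof -
  have e': "star L (a i) \<otimes> s \<otimes> a j = star L (a i) \<otimes> t \<otimes> a j" if "i < n" "j < n" for i j
    using e[OF that] phi_entry[OF that s] phi_entry[OF that t] by simp
  have e'': "star L (a i) \<otimes> s = star L (a i) \<otimes> t" if i: "i < n" for i
  proof -
    have "star L (a i) \<otimes> s = (\<Oplus>j\<in>{..<n}. star L (a i) \<otimes> s \<otimes> a j \<otimes> star L (a j))"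
      using s K.a_closed[OF i] by (intro resolve_right) simp
    also have "\<dots> = (\<Oplus>j\<in>{..<n}. star L (a i) \<otimes> t \<otimes> a j \<otimes> star L (a j))"
      using e'[OF i] s t K.a_closed i by (intro K.L.C.finsum_cong') auto
    also have "\<dots> = star L (a i) \<otimes> t"
      using t K.a_closed[OF i] by (intro resolve_right[symmetric]) simp
    finally show ?thesis .
  qed
  have "s = (\<Oplus>i\<in>{..<n}. a i \<otimes> (star L (a i) \<otimes> s))" by (rule resolve_left[OF s])
  also have "\<dots> = (\<Oplus>i\<in>{..<n}. a i \<otimes> (star L (a i) \<otimes> t))"
    using e'' s t K.a_closed by (intro K.L.C.finsum_cong') auto
  also have "\<dots> = t" by (rule resolve_left[OF t, symmetric])
  finally show ?thesis .
qed

lemma entry_I: "\<lbrakk>i < n; j < n; t \<in> carrier L; c \<in> carrier C; \<phi> c = star L (a i) \<otimes> t \<otimes> a j\<rbrakk> \<Longrightarrow> entry i j t = c"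
  using entry[of i j t] K.phi_eq_iff by metis

lemma entry_add: "\<lbrakk>i < n; j < n; s \<in> carrier L; t \<in> carrier L\<rbrakk> \<Longrightarrow> entry i j (s \<oplus> t) = entry i j s \<oplus>\<^bsub>C\<^esub> entry i j t"
  using K.a_closed by (intro entry_I) (auto simp: entry K.phi_add K.L.C.r_distr K.L.C.l_distr)

lemma entry_smult: "\<lbrakk>i < n; j < n; t \<in> carrier L\<rbrakk> \<Longrightarrow> entry i j (z \<odot> t) = z \<odot>\<^bsub>C\<^esub> entry i j t"
  using K.a_closed by (intro entry_I) (auto simp: entry K.phi_smult)

lemma entry_star: "\<lbrakk>i < n; j < n; t \<in> carrier L\<rbrakk> \<Longrightarrow> entry i j (star L t) = star C (entry j i t)"
  using K.a_closed by (intro entry_I) (auto simp: entry K.phi_star K.L.C.star_mult K.L.C.m_assoc)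

lemma entry_finsum:
  "\<lbrakk>i < n; j < n; finite J; f \<in> J \<rightarrow> carrier L\<rbrakk> \<Longrightarrow> entry i j (finsum L f J) = finsum C (\<lambda>x. entry i j (f x)) J"
  by (intro additive_finsum K.L.C.abelian_group_axioms K.C.C.abelian_group_axioms) (auto simp: entry_add entry_closed)

text \<open>Matrix multiplication, by insertion of the partition of the unit.\<close>

lemma entry_mult:
  assumes ij: "i < n" "j < n" and s: "s \<in> carrier L" and t: "t \<in> carrier L"
  shows "entry i j (s \<otimes> t) = (\<Oplus>\<^bsub>C\<^esub>r\<in>{..<n}. entry i r s \<star> entry r j t)"
proof (rule entry_I[OF ij])
  have aij: "a i \<in> carrier L" "a j \<in> carrier L" using K.a_closed ij by auto
  show "(\<Oplus>\<^bsub>C\<^esub>r\<in>{..<n}. entry i r s \<star> entry r j t) \<in> carrier C"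
    using ij s t by (intro K.C.C.finsum_closed) (auto simp: entry_closed)
  have "\<phi> (\<Oplus>\<^bsub>C\<^esub>r\<in>{..<n}. entry i r s \<star> entry r j t) = (\<Oplus>r\<in>{..<n}. \<phi> (entry i r s \<star> entry r j t))"
    using ij s t by (intro K.phi_finsum) (auto simp: entry_closed)
  also have "\<dots> = (\<Oplus>r\<in>{..<n}. star L (a i) \<otimes> s \<otimes> (a r \<otimes> (star L (a r) \<otimes> (t \<otimes> a j))))"
    using ij s t K.a_closed aij by (intro K.L.C.finsum_cong') (auto simp: K.phi_mult entry K.L.C.m_assoc)
  also have "\<dots> = star L (a i) \<otimes> s \<otimes> (\<Oplus>r\<in>{..<n}. a r \<otimes> (star L (a r) \<otimes> (t \<otimes> a j)))"
    using s t K.a_closed aij by (intro K.L.C.finsum_rdistr[symmetric]) auto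
  also have "\<dots> = star L (a i) \<otimes> (s \<otimes> t) \<otimes> a j"
    using resolve_left[of "t \<otimes> a j"] s t aij by (simp add: K.L.C.m_assoc)
  finally show "\<phi> (\<Oplus>\<^bsub>C\<^esub>r\<in>{..<n}. entry i r s \<star> entry r j t) = star L (a i) \<otimes> (s \<otimes> t) \<otimes> a j" .
qed (use s t in auto)

lemma gram_entry: assumes "i < n" "j < n" shows "entry i j \<one> \<in> A"
proof -
  obtain b where b: "b \<in> A" "\<phi> b = star L (a i) \<otimes> a j" using gram[OF assms] by auto
  have "entry i j \<one> = b"
    using assms b K.a_closed I.sub_carrier by (intro entry_I) auto
  then show ?thesis using b by simp
qed

lemma L0_I: "\<lbrakk>t \<in> carrier L; \<And>i j. \<lbrakk>i < n; j < n\<rbrakk> \<Longrightarrow> entry i j t \<in> A\<rbrakk> \<Longrightarrow> t \<in> L0"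
  by (simp add: L0_def)

lemma L0_closed: "t \<in> L0 \<Longrightarrow> t \<in> carrier L" by (simp add: L0_def)
lemma L0_entry: "\<lbrakk>t \<in> L0; i < n; j < n\<rbrakk> \<Longrightarrow> entry i j t \<in> A" by (simp add: L0_def)

lemma L0_mult: "\<lbrakk>s \<in> L0; t \<in> L0\<rbrakk> \<Longrightarrow> s \<otimes> t \<in> L0"
  by (rule L0_I) (auto simp: L0_closed entry_mult L0_entry I.sub_mult intro!: I.sub_finsum)

lemma L0_inclusion: "unital_inclusion L0 L"
proof (rule K.L.C.unital_inclusionI)
  show "L0 \<subseteq> carrier L" using L0_closed by blast
  show "\<one> \<in> L0" by (rule L0_I) (auto simp: gram_entry)
  show "s \<oplus> t \<in> L0" if "s \<in> L0" "t \<in> L0" for s t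
    using that by (intro L0_I) (auto simp: L0_closed entry_add L0_entry I.sub_add)
  show "s \<otimes> t \<in> L0" if "s \<in> L0" "t \<in> L0" for s t using that by (rule L0_mult)
  show "z \<odot> t \<in> L0" if "t \<in> L0" for z t
    using that by (intro L0_I) (auto simp: L0_closed entry_smult L0_entry I.sub_smult)
  show "star L t \<in> L0" if "t \<in> L0" for t
    using that by (intro L0_I) (auto simp: L0_closed entry_star L0_entry I.sub_star)
  fix f :: "nat \<Rightarrow> 'l" and l
  assume f: "\<And>m. f m \<in> L0" and l: "l \<in> carrier L" and lim: "(\<lambda>m. nrm L (f m \<ominus> l)) \<longlonglongrightarrow> 0"
  have fc: "f m \<in> carrier L" for m using f L0_closed by blast
  show "l \<in> L0"
  proof (rule L0_I[OF l])
    fix i j assume ij: "i < n" "j < n"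
    have aij: "a i \<in> carrier L" "a j \<in> carrier L" using K.a_closed ij by auto
    have "(\<lambda>m. nrm L (star L (a i) \<otimes> f m \<ominus> star L (a i) \<otimes> l)) \<longlonglongrightarrow> 0"
      using fc l aij lim by (intro K.L.C.limit_lmult) auto
    then have "(\<lambda>m. nrm L (star L (a i) \<otimes> f m \<otimes> a j \<ominus> star L (a i) \<otimes> l \<otimes> a j)) \<longlonglongrightarrow> 0"
      using fc l aij by (intro K.L.C.limit_rmult) auto
    then have 1: "(\<lambda>m. nrm L (\<phi> (entry i j (f m)) \<ominus> \<phi> (entry i j l))) \<longlonglongrightarrow> 0"
      using ij fc l by (simp add: phi_entry)
    have "nrm C (entry i j (f m) \<ominus>\<^bsub>C\<^esub> entry i j l) \<le> nrm L (\<phi> (entry i j (f m)) \<ominus> \<phi> (entry i j l))" for m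
    proof -
      have e: "entry i j (f m) \<in> carrier C" "entry i j l \<in> carrier C" using ij fc l entry_closed by auto
      have "\<phi> (entry i j (f m) \<ominus>\<^bsub>C\<^esub> entry i j l) = \<phi> (entry i j (f m)) \<ominus> \<phi> (entry i j l)"
        using e K.phi_smult[of "entry i j l" "-1"]
        by (simp add: K.C.C.minus_eq K.L.C.minus_eq K.phi_add K.C.C.smult_neg_one K.L.C.smult_neg_one)
      then show ?thesis using K.phi_norm_ge[of "entry i j (f m) \<ominus>\<^bsub>C\<^esub> entry i j l"] e by simp
    qed
    then have "(\<lambda>m. nrm C (entry i j (f m) \<ominus>\<^bsub>C\<^esub> entry i j l)) \<longlonglongrightarrow> 0"
      using ij fc l entry_closed K.C.C.nrm_nonneg
      by (intro tendsto_sandwich[OF _ _ tendsto_const 1]) auto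
    then show "entry i j l \<in> A"
      using I.sub_limit[of "\<lambda>m. entry i j (f m)" "entry i j l"] L0_entry[OF f ij] entry_closed[OF ij l] by blast
  qed
qed

lemma a_L0: assumes r: "r < n" shows "a r \<in> L0"
proof (rule L0_I)
  fix i j assume ij: "i < n" "j < n"
  have c: "a i \<in> carrier L" "a j \<in> carrier L" "a r \<in> carrier L" using K.a_closed ij r by auto
  have "entry i j (a r) = entry i r \<one> \<star> entry 0 j \<one>"
  proof (rule entry_I[OF ij c(3)])
    show "entry i r \<one> \<star> entry 0 j \<one> \<in> carrier C" using ij r a_0 by (simp add: entry_closed)
    have "\<phi> (entry i r \<one> \<star> entry 0 j \<one>) = (star L (a i) \<otimes> a r) \<otimes> (q \<otimes> a j)"
      using ij r a_0 c by (simp add: K.phi_mult entry K.q_star)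
    also have "\<dots> = star L (a i) \<otimes> (a r \<otimes> q) \<otimes> a j" using c by (simp add: K.L.C.m_assoc)
    finally show "\<phi> (entry i r \<one> \<star> entry 0 j \<one>) = star L (a i) \<otimes> a r \<otimes> a j" using a_q[OF r] by simp
  qed
  then show "entry i j (a r) \<in> A" using gram_entry ij r a_0 I.sub_mult by simp
qed (use K.a_closed r in auto)

lemma q_L0: "q \<in> L0" using a_L0[OF a_0(1)] a_0(2) by simp

lemma phi_L0: assumes "c \<in> carrier C" shows "\<phi> c \<in> L0 \<longleftrightarrow> c \<in> A"
proof
  have e: "entry i j (\<phi> c) = entry i 0 \<one> \<star> c \<star> entry 0 j \<one>" if ij: "i < n" "j < n" for i j
  proof (rule entry_I[OF ij])
    have cc: "a i \<in> carrier L" "a j \<in> carrier L" using K.a_closed ij by auto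
    have "\<phi> (entry i 0 \<one> \<star> c \<star> entry 0 j \<one>) = (star L (a i) \<otimes> q) \<otimes> \<phi> c \<otimes> (q \<otimes> a j)"
      using ij a_0 assms cc by (simp add: K.phi_mult entry K.q_star)
    also have "\<dots> = star L (a i) \<otimes> (q \<otimes> \<phi> c \<otimes> q) \<otimes> a j" using assms cc by (simp add: K.L.C.m_assoc)
    finally show "\<phi> (entry i 0 \<one> \<star> c \<star> entry 0 j \<one>) = star L (a i) \<otimes> \<phi> c \<otimes> a j"
      using K.corner_cut[OF assms] by simp
  qed (use assms ij a_0 entry_closed in auto)
  show "\<phi> c \<in> L0" if "c \<in> A"
    using that assms a_0 by (intro L0_I) (auto simp: e gram_entry I.sub_mult)
  assume "\<phi> c \<in> L0"
  then have "entry 0 0 (\<phi> c) \<in> A" using L0_entry a_0 by blast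
  moreover have "entry 0 0 (\<phi> c) = c"
    using a_0 assms K.corner_cut[OF assms] by (intro entry_I) (auto simp: K.q_star)
  ultimately show "c \<in> A" by simp
qed

lemma linking_corner: "full_corner A C L0 L q \<phi> n a"
proof (intro full_corner.intro full_corner_axioms.intro I.cstar_inclusion_axioms)
  show "cstar_inclusion L0 L"
    by (intro cstar_inclusion.intro cstar_inclusion_axioms.intro K.L.C.unital_cstar_algebra_axioms L0_inclusion)
  show "\<phi> ` A = {x \<in> L0. q \<otimes> x \<otimes> q = x}"
  proof (intro equalityI subsetI)
    fix x assume "x \<in> \<phi> ` A"
    then obtain c where c: "c \<in> A" "x = \<phi> c" by blast
    then show "x \<in> {x \<in> L0. q \<otimes> x \<otimes> q = x}" using phi_L0[of c] I.sub_carrier K.corner_cut[of c] by auto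
  next
    fix x assume x: "x \<in> {x \<in> L0. q \<otimes> x \<otimes> q = x}"
    then obtain c where "c \<in> carrier C" "\<phi> c = x" using K.corner_elem[of x] L0_closed by blast
    then show "x \<in> \<phi> ` A" using phi_L0[of c] x by blast
  qed
qed (use q_L0 a_L0 K.q_idem K.q_star K.phi_add K.phi_mult K.phi_smult K.phi_star K.phi_inj K.phi_image K.full in auto)

definition F :: "'l \<Rightarrow> 'l" where
  "F t = (\<Oplus>i\<in>{..<n}. \<Oplus>j\<in>{..<n}. a i \<otimes> \<phi> (E (entry i j t)) \<otimes> star L (a j))"

lemma F_closed [simp]: "t \<in> carrier L \<Longrightarrow> F t \<in> carrier L"
  unfolding F_def using K.a_closed by (auto intro!: K.L.C.finsum_closed simp: entry_closed)

text \<open>The coefficients of a sum \<open>\<Sum> a i \<phi> (c i j) (a j)*\<close> are not \<open>c i j\<close> but are altered by the matrix of the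
  \<open>entry i j \<one>\<close>. The latter has coefficients in \<open>A\<close>, so it can be moved through \<open>E\<close>.\<close>

lemma entry_F:
  assumes rs: "r < n" "s < n" and t: "t \<in> carrier L"
  shows "entry r s (F t) = E (entry r s t)"
proof -
  have summand: "entry r s (a i \<otimes> \<phi> c \<otimes> star L (a j)) = entry r i \<one> \<star> c \<star> entry j s \<one>"
    if "i < n" "j < n" "c \<in> carrier C" for i j c
  proof (rule entry_I[OF rs])
    have cc: "a i \<in> carrier L" "a j \<in> carrier L" "a r \<in> carrier L" "a s \<in> carrier L" using K.a_closed that rs by auto
    show "\<phi> (entry r i \<one> \<star> c \<star> entry j s \<one>) = star L (a r) \<otimes> (a i \<otimes> \<phi> c \<otimes> star L (a j)) \<otimes> a s"
      using that rs cc by (simp add: K.phi_mult entry K.L.C.m_assoc)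
  qed (use that rs K.a_closed entry_closed in auto)
  have "entry r s (F t) = (\<Oplus>\<^bsub>C\<^esub>i\<in>{..<n}. \<Oplus>\<^bsub>C\<^esub>j\<in>{..<n}. entry r i \<one> \<star> E (entry i j t) \<star> entry j s \<one>)"
    unfolding F_def using rs t K.a_closed
    by (simp add: entry_finsum Pi_def K.L.C.finsum_closed entry_closed summand cong: K.C.C.finsum_cong)
  also have "\<dots> = (\<Oplus>\<^bsub>C\<^esub>i\<in>{..<n}. \<Oplus>\<^bsub>C\<^esub>j\<in>{..<n}. E (entry r i \<one> \<star> entry i j t \<star> entry j s \<one>))"
    using rs t by (intro K.C.C.finsum_cong') (auto simp: I.E_bimod gram_entry entry_closed intro!: K.C.C.finsum_cong' K.C.C.finsum_closed)
  also have "\<dots> = E (\<Oplus>\<^bsub>C\<^esub>i\<in>{..<n}. \<Oplus>\<^bsub>C\<^esub>j\<in>{..<n}. entry r i \<one> \<star> entry i j t \<star> entry j s \<one>)"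
    using rs t by (simp add: I.E_finsum Pi_def entry_closed K.C.C.finsum_closed cong: K.C.C.finsum_cong)
  also have "(\<Oplus>\<^bsub>C\<^esub>i\<in>{..<n}. \<Oplus>\<^bsub>C\<^esub>j\<in>{..<n}. entry r i \<one> \<star> entry i j t \<star> entry j s \<one>) = entry r s (\<one> \<otimes> (t \<otimes> \<one>))"
    using rs t by (simp add: entry_mult entry_closed K.C.C.finsum_rdistr K.C.C.m_assoc Pi_def
      del: K.L.C.r_one K.L.C.l_one cong: K.C.C.finsum_cong)
  finally show ?thesis using t by simp
qed

text \<open>The value of \<open>E\<close> on a Gram matrix of elements of \<open>C\<close> is a sum of Gram matrices of elements of \<open>A\<close>. This
  is the complete positivity of \<open>E\<close>, which makes \<open>F\<close> positive.\<close>

lemma E_mult_star: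
  assumes c: "c \<in> carrier C" and d: "d \<in> carrier C"
  shows "E (c \<star> star C d) = (\<Oplus>\<^bsub>C\<^esub>l\<in>{..<k}. E (c \<star> u l) \<star> star C (E (d \<star> u l)))"
proof -
  have "E (c \<star> star C d) = E (c \<star> (\<Oplus>\<^bsub>C\<^esub>l\<in>{..<k}. u l \<star> E (star C (u l) \<star> star C d)))"
    using I.qb_left[of "star C d"] d by simp
  also have "\<dots> = (\<Oplus>\<^bsub>C\<^esub>l\<in>{..<k}. E (c \<star> (u l \<star> E (star C (u l) \<star> star C d))))"
    using c d I.u_closed by (simp add: K.C.C.finsum_rdistr I.E_finsum Pi_def)
  also have "\<dots> = (\<Oplus>\<^bsub>C\<^esub>l\<in>{..<k}. E (c \<star> u l) \<star> star C (E (d \<star> u l)))"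
  proof (rule K.C.C.finsum_cong')
    fix l assume "l \<in> {..<k}"
    then have l: "u l \<in> carrier C" using I.u_closed by simp
    have "E (c \<star> (u l \<star> E (star C (u l) \<star> star C d))) = E (c \<star> u l \<star> E (star C (u l) \<star> star C d))"
      using c d l by (simp add: K.C.C.m_assoc)
    also have "\<dots> = E (c \<star> u l) \<star> E (star C (u l) \<star> star C d)" using c d l by (intro I.E_right) auto
    finally show "E (c \<star> (u l \<star> E (star C (u l) \<star> star C d))) = E (c \<star> u l) \<star> star C (E (d \<star> u l))"
      using I.E_star[of "d \<star> u l"] c d l by (simp add: K.C.C.star_mult)
  qed (use c d I.u_closed in auto)
  finally show ?thesis .
qed

lemma F_L0: "t \<in> carrier L \<Longrightarrow> F t \<in> L0"
  by (intro L0_I) (auto simp: entry_F entry_closed)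

lemma F_conditional_expectation: "conditional_expectation L L0 F"
proof -
  interpret J: cstar_inclusion L0 L
    by (intro cstar_inclusion.intro cstar_inclusion_axioms.intro K.L.C.unital_cstar_algebra_axioms L0_inclusion)
  show ?thesis
    unfolding conditional_expectation_def
  proof (intro conjI ballI allI impI)
    show "unital_inclusion L0 L" by (rule L0_inclusion)
    show "F \<in> carrier L \<rightarrow> L0" using F_L0 by blast
    show "F t = t" if "t \<in> L0" for t
      using that L0_closed by (intro entry_eqI) (auto simp: entry_F I.E_id L0_entry)
    show "F (s \<oplus> t) = F s \<oplus> F t" if "s \<in> carrier L" "t \<in> carrier L" for s t
      using that by (intro entry_eqI) (auto simp: entry_F entry_add entry_closed I.E_add)
    show "F (z \<odot> t) = z \<odot> F t" if "t \<in> carrier L" for z t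
      using that by (intro entry_eqI) (auto simp: entry_F entry_smult entry_closed I.E_smult)
    show "F (x \<otimes> t \<otimes> y) = x \<otimes> F t \<otimes> y" if x: "x \<in> L0" and t: "t \<in> carrier L" and y: "y \<in> L0" for x t y
    proof (rule entry_eqI)
      note xc = L0_closed[OF x] and yc = L0_closed[OF y]
      fix i j assume ij: "i < n" "j < n"
      have e: "entry i j (x \<otimes> s \<otimes> y) = (\<Oplus>\<^bsub>C\<^esub>r\<in>{..<n}. \<Oplus>\<^bsub>C\<^esub>r'\<in>{..<n}. entry i r' x \<star> entry r' r s \<star> entry r j y)"
        if "s \<in> carrier L" for s
        using ij xc yc that by (simp add: entry_mult entry_closed K.C.C.finsum_ldistr Pi_def cong: K.C.C.finsum_cong)
      have "entry i j (F (x \<otimes> t \<otimes> y)) = E (\<Oplus>\<^bsub>C\<^esub>r\<in>{..<n}. \<Oplus>\<^bsub>C\<^esub>r'\<in>{..<n}. entry i r' x \<star> entry r' r t \<star> entry r j y)"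
        using ij xc yc t by (simp add: entry_F e)
      also have "\<dots> = (\<Oplus>\<^bsub>C\<^esub>r\<in>{..<n}. \<Oplus>\<^bsub>C\<^esub>r'\<in>{..<n}. E (entry i r' x \<star> entry r' r t \<star> entry r j y))"
        using ij xc yc t by (simp add: I.E_finsum Pi_def entry_closed K.C.C.finsum_closed cong: K.C.C.finsum_cong)
      also have "\<dots> = (\<Oplus>\<^bsub>C\<^esub>r\<in>{..<n}. \<Oplus>\<^bsub>C\<^esub>r'\<in>{..<n}. entry i r' x \<star> entry r' r (F t) \<star> entry r j y)"
        using ij xc yc t L0_entry[OF x] L0_entry[OF y]
        by (intro K.C.C.finsum_cong') (auto simp: I.E_bimod entry_F entry_closed intro!: K.C.C.finsum_cong' K.C.C.finsum_closed)
      also have "\<dots> = entry i j (x \<otimes> F t \<otimes> y)" using t by (simp add: e)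
      finally show "entry i j (F (x \<otimes> t \<otimes> y)) = entry i j (x \<otimes> F t \<otimes> y)" .
    qed (use L0_closed[OF x] L0_closed[OF y] t in auto)
    show "cstar_positive (L\<lparr>carrier := L0\<rparr>) (F t)" if "cstar_positive L t" for t
    proof -
      obtain z' where z': "z' \<in> carrier L" "t = star L z' \<otimes> z'" using \<open>cstar_positive L t\<close> unfolding cstar_positive_def by blast
      define z where "z = star L z'"
      have z: "z \<in> carrier L" "t = z \<otimes> star L z" using z' by (auto simp: z_def)
      have tc: "t \<in> carrier L" using z by simp
      define f where "f r i l = E (entry r i z \<star> u l)" for r i l
      have f: "f r i l \<in> A" "f r i l \<in> carrier C" if "r < n" "i < n" "l < k" for r i l
        using that z I.u_closed by (auto simp: f_def entry_closed)
      define y where "y i l = (\<Oplus>r\<in>{..<n}. a r \<otimes> \<phi> (f r i l))" for i l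
      have y: "y i l \<in> carrier L" if "i < n" "l < k" for i l
        unfolding y_def using that f K.a_closed by (intro K.L.C.finsum_closed) auto
      have ay: "star L (a r) \<otimes> y i l = \<phi> (f r i l)" if ril: "r < n" "i < n" "l < k" for r i l
      proof -
        have ar: "a r \<in> carrier L" and ul: "u l \<in> carrier C" using K.a_closed I.u_closed ril by auto
        have "star L (a r) \<otimes> y i l = (\<Oplus>s\<in>{..<n}. star L (a r) \<otimes> (a s \<otimes> \<phi> (f s i l)))"
          unfolding y_def using ril f K.a_closed by (intro K.L.C.finsum_rdistr) auto
        also have "\<dots> = (\<Oplus>s\<in>{..<n}. \<phi> (entry r s \<one> \<star> f s i l))"
          using ril f K.a_closed ar
          by (intro K.L.C.finsum_cong') (auto simp: K.phi_mult entry K.L.C.m_assoc)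
        also have "\<dots> = \<phi> (\<Oplus>\<^bsub>C\<^esub>s\<in>{..<n}. entry r s \<one> \<star> f s i l)"
          using ril f by (intro K.phi_finsum[symmetric]) (auto simp: entry_closed)
        also have "(\<Oplus>\<^bsub>C\<^esub>s\<in>{..<n}. entry r s \<one> \<star> f s i l) = (\<Oplus>\<^bsub>C\<^esub>s\<in>{..<n}. E (entry r s \<one> \<star> entry s i z \<star> u l))"
          using ril z ul f(2)
          by (intro K.C.C.finsum_cong') (auto simp: f_def I.E_left gram_entry entry_closed K.C.C.m_assoc)
        also have "\<dots> = E ((\<Oplus>\<^bsub>C\<^esub>s\<in>{..<n}. entry r s \<one> \<star> entry s i z) \<star> u l)"
          using ril z ul by (simp add: K.C.C.finsum_ldistr I.E_finsum Pi_def entry_closed)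
        also have "(\<Oplus>\<^bsub>C\<^esub>s\<in>{..<n}. entry r s \<one> \<star> entry s i z) = entry r i z"
          using ril z entry_mult[of r i \<one> z] by simp
        finally show ?thesis by (simp add: f_def)
      qed
      let ?P = "\<Oplus>i\<in>{..<n}. \<Oplus>l\<in>{..<k}. y i l \<otimes> star L (y i l)"
      have Pc: "?P \<in> carrier L" using y by (auto intro!: K.L.C.finsum_closed)
      have "F t = ?P"
      proof (rule entry_eqI[OF F_closed[OF tc] Pc])
        fix r s assume rs: "r < n" "s < n"
        have ars: "a r \<in> carrier L" "a s \<in> carrier L" using K.a_closed rs by auto
        have summand: "entry r s (y i l \<otimes> star L (y i l)) = f r i l \<star> star C (f s i l)" if "i < n" "l < k" for i l
        proof (rule entry_I[OF rs])
          have "\<phi> (f r i l \<star> star C (f s i l)) = (star L (a r) \<otimes> y i l) \<otimes> star L (star L (a s) \<otimes> y i l)"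
            using rs that f by (simp add: K.phi_mult K.phi_star ay)
          then show "\<phi> (f r i l \<star> star C (f s i l)) = star L (a r) \<otimes> (y i l \<otimes> star L (y i l)) \<otimes> a s"
            using ars y[OF that] by (simp add: K.L.C.star_mult K.L.C.m_assoc)
        qed (use rs that f y in auto)
        have "entry r s (F t) = E (\<Oplus>\<^bsub>C\<^esub>i\<in>{..<n}. entry r i z \<star> star C (entry s i z))"
          using rs tc z by (simp add: entry_F entry_mult entry_star entry_closed cong: K.C.C.finsum_cong)
        also have "\<dots> = (\<Oplus>\<^bsub>C\<^esub>i\<in>{..<n}. E (entry r i z \<star> star C (entry s i z)))"
          using rs z by (simp add: I.E_finsum Pi_def entry_closed)
        also have "\<dots> = (\<Oplus>\<^bsub>C\<^esub>i\<in>{..<n}. \<Oplus>\<^bsub>C\<^esub>l\<in>{..<k}. f r i l \<star> star C (f s i l))"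
        proof (rule K.C.C.finsum_cong')
          fix i assume "i \<in> {..<n}"
          then show "E (entry r i z \<star> star C (entry s i z)) = (\<Oplus>\<^bsub>C\<^esub>l\<in>{..<k}. f r i l \<star> star C (f s i l))"
            unfolding f_def using rs z by (intro E_mult_star) (auto simp: entry_closed)
        qed (use rs f(2) in \<open>auto intro!: K.C.C.finsum_closed\<close>)
        also have "\<dots> = entry r s ?P"
          using rs y f by (simp add: entry_finsum Pi_def K.L.C.finsum_closed summand cong: K.C.C.finsum_cong)
        finally show "entry r s (F t) = entry r s ?P" .
      qed
      moreover have "cstar_positive L ?P" using y by (auto intro!: K.L.C.pos_finsum K.L.C.pos_mult_star)
      ultimately show ?thesis using F_L0[OF tc] unfolding J.sub_pos by simp
    qed
  qed
qed

text \<open>The quasi-basis of \<open>F\<close> consists of the elements \<open>a r \<otimes> \<phi> (u m)\<close>.\<close>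

lemma F_index_finite: "index_finite_expectation L L0 F"
proof -
  interpret J: cond_exp L0 L F
    by (intro cond_exp.intro cstar_inclusion.intro cstar_inclusion_axioms.intro cond_exp_axioms.intro
      K.L.C.unital_cstar_algebra_axioms L0_inclusion F_conditional_expectation)
  let ?w = "\<lambda>r m. a r \<otimes> \<phi> (u m)"
  have w: "?w r m \<in> carrier L" if "r < n" "m < k" for r m using that K.a_closed I.u_closed by simp
  show ?thesis
  proof (rule J.index_finiteI[of "{..<n} \<times> {..<k}" "\<lambda>x. ?w (fst x) (snd x)"])
    fix t assume t: "t \<in> carrier L"
    let ?f = "\<lambda>r m. ?w r m \<otimes> F (star L (?w r m) \<otimes> t)"
    have fc: "?f r m \<in> carrier L" if "r < n" "m < k" for r m using w[OF that] t by simp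
    have "(\<Oplus>x\<in>{..<n} \<times> {..<k}. ?f (fst x) (snd x)) = (\<Oplus>r\<in>{..<n}. \<Oplus>m\<in>{..<k}. ?f r m)"
      using fc by (intro K.L.C.finsum_times) auto
    also have "\<dots> = t"
    proof (rule entry_eqI[OF _ t])
      show "(\<Oplus>r\<in>{..<n}. \<Oplus>m\<in>{..<k}. ?f r m) \<in> carrier L" using fc by (auto intro!: K.L.C.finsum_closed)
      fix i j assume ij: "i < n" "j < n"
      have aij: "a i \<in> carrier L" "a j \<in> carrier L" using K.a_closed ij by auto
      have summand: "entry i j (?f r m) = entry i r \<one> \<star> (u m \<star> E (star C (u m) \<star> entry r j t))" if rm: "r < n" "m < k" for r m
      proof (rule entry_I[OF ij fc[OF rm]])
        have ar: "a r \<in> carrier L" and um: "u m \<in> carrier C" using K.a_closed I.u_closed rm by auto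
        let ?X = "star L (?w r m) \<otimes> t"
        have Xc: "?X \<in> carrier L" using w[OF rm] t by simp
        have X0: "entry 0 j ?X = star C (u m) \<star> entry r j t"
        proof (rule entry_I[OF a_0(1) ij(2) Xc])
          have "\<phi> (star C (u m) \<star> entry r j t) = star L (\<phi> (u m)) \<otimes> (star L (a r) \<otimes> t \<otimes> a j)"
            using um rm ij t by (simp add: K.phi_mult K.phi_star entry)
          also have "star L (\<phi> (u m)) = q \<otimes> star L (\<phi> (u m))"
            using K.corner_cut(1)[of "star C (u m)"] um by (simp add: K.phi_star)
          finally show "\<phi> (star C (u m) \<star> entry r j t) = star L (a 0) \<otimes> ?X \<otimes> a j"
            using um ar t aij by (simp add: a_0 K.q_star K.L.C.star_mult K.L.C.m_assoc)
        qed (use um rm ij t entry_closed in auto)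
        have "\<phi> (u m \<star> E (star C (u m) \<star> entry r j t)) = \<phi> (u m) \<otimes> \<phi> (entry 0 j (F ?X))"
          using um rm ij t Xc a_0 by (simp add: K.phi_mult entry_F X0 entry_closed)
        also have "\<dots> = \<phi> (u m) \<otimes> (q \<otimes> F ?X \<otimes> a j)"
          using ij Xc a_0 by (simp add: phi_entry K.q_star)
        also have "\<dots> = (\<phi> (u m) \<otimes> q) \<otimes> (F ?X \<otimes> a j)" using um Xc aij by (simp add: K.L.C.m_assoc)
        also have "\<dots> = \<phi> (u m) \<otimes> (F ?X \<otimes> a j)" using K.corner_cut[OF um] by simp
        finally have "\<phi> (u m \<star> E (star C (u m) \<star> entry r j t)) = \<phi> (u m) \<otimes> (F ?X \<otimes> a j)" .
        then show "\<phi> (entry i r \<one> \<star> (u m \<star> E (star C (u m) \<star> entry r j t))) = star L (a i) \<otimes> ?f r m \<otimes> a j"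
          using um rm ij t Xc ar aij entry_closed[OF rm(1) ij(2) t] entry_closed[OF ij(1) rm(1)]
          by (subst K.phi_mult) (auto simp: phi_entry K.L.C.m_assoc)
      qed (use rm ij t I.u_closed entry_closed in auto)
      have "entry i j (\<Oplus>r\<in>{..<n}. \<Oplus>m\<in>{..<k}. ?f r m)
          = (\<Oplus>\<^bsub>C\<^esub>r\<in>{..<n}. \<Oplus>\<^bsub>C\<^esub>m\<in>{..<k}. entry i r \<one> \<star> (u m \<star> E (star C (u m) \<star> entry r j t)))"
        using ij fc t I.u_closed by (simp add: entry_finsum Pi_def K.L.C.finsum_closed summand entry_closed cong: K.C.C.finsum_cong)
      also have "\<dots> = (\<Oplus>\<^bsub>C\<^esub>r\<in>{..<n}. entry i r \<one> \<star> entry r j t)"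
      proof (rule K.C.C.finsum_cong')
        fix r assume "r \<in> {..<n}"
        then have r: "entry i r \<one> \<in> carrier C" "entry r j t \<in> carrier C" using entry_closed ij t by auto
        show "(\<Oplus>\<^bsub>C\<^esub>m\<in>{..<k}. entry i r \<one> \<star> (u m \<star> E (star C (u m) \<star> entry r j t))) = entry i r \<one> \<star> entry r j t"
          using r I.u_closed I.qb_left[OF r(2)] by (subst K.C.C.finsum_rdistr[symmetric]) auto
      qed (use ij t entry_closed in auto)
      also have "\<dots> = entry i j t" using ij t entry_mult[of i j \<one> t] by simp
      finally show "entry i j (\<Oplus>r\<in>{..<n}. \<Oplus>m\<in>{..<k}. ?f r m) = entry i j t" .
    qed
    finally show "(\<Oplus>x\<in>{..<n} \<times> {..<k}. ?w (fst x) (snd x) \<otimes> F (star L (?w (fst x) (snd x)) \<otimes> t)) = t" .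
  qed (use w in auto)
qed

end

section \<open>Partitions of the unit\<close>

text \<open>Sums without coefficients: the set of inner products is already closed under scalar multiples.\<close>

inductive_set finite_sums :: "('a, 'm) ring_scheme \<Rightarrow> 'a set \<Rightarrow> 'a set" for M S where
  zero: "\<zero>\<^bsub>M\<^esub> \<in> finite_sums M S"
| add: "\<lbrakk>s \<in> S; t \<in> finite_sums M S\<rbrakk> \<Longrightarrow> s \<oplus>\<^bsub>M\<^esub> t \<in> finite_sums M S"

lemma (in unital_cstar_algebra) complex_span_subset_finite_sums:
  assumes S: "S \<subseteq> carrier M" and scale: "\<And>z s. s \<in> S \<Longrightarrow> z \<odot> s \<in> S"
  shows "complex_span M S \<subseteq> finite_sums M S" and "finite_sums M S \<subseteq> carrier M"
proof -
  have car: "t \<in> carrier M" if "t \<in> finite_sums M S" for t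
    using that S by induction auto
  then show "finite_sums M S \<subseteq> carrier M" by blast
  have plus: "s \<oplus> t \<in> finite_sums M S" if "s \<in> finite_sums M S" "t \<in> finite_sums M S" for s t
    using that
  proof (induction s)
    case (add a s)
    have "a \<oplus> s \<oplus> t = a \<oplus> (s \<oplus> t)" using add.hyps add.prems S car by (intro a_assoc) auto
    then show ?case using add finite_sums.add by metis
  qed (simp add: car)
  have sm: "z \<odot> s \<in> finite_sums M S" if "s \<in> finite_sums M S" for z s
    using that
  proof induction
    case (add a s)
    have "z \<odot> (a \<oplus> s) = z \<odot> a \<oplus> z \<odot> s" using add.hyps S car by (intro smult_addr) auto
    then show ?case using add scale finite_sums.add by metis
  qed (simp add: finite_sums.zero)
  have "submodule (finite_sums M S) complex_ring M"
  proof (rule module.submoduleI[OF complex_module])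
    show "\<ominus> s \<in> finite_sums M S" if "s \<in> finite_sums M S" for s
      using sm[OF that, of "-1"] smult_neg_one[OF car[OF that]] by simp
  qed (use car plus sm finite_sums.zero in auto)
  moreover have "S \<subseteq> finite_sums M S"
  proof
    fix s assume "s \<in> S"
    then show "s \<in> finite_sums M S" using finite_sums.add[OF _ finite_sums.zero, of s S M] S by auto
  qed
  ultimately show "complex_span M S \<subseteq> finite_sums M S" unfolding complex_span_def by blast
qed

text \<open>Stated for a form \<open>r\<close> in order to apply to the left and to the right inner product. The inner
  square of \<open>x - y\<close> gives \<open>r x y + r y x \<le> r x x + r y y\<close>, so for \<open>g\<close> in the span of the values the element
  \<open>g + g*\<close> is dominated by a sum \<open>G\<close> of inner squares. If \<open>g\<close> is close to \<open>1\<close>, then \<open>G \<ge> 1\<close>, and acting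
  with \<open>h = G\<^sup>-\<^sup>1\<^sup>/\<^sup>2 \<in> A\<close> on the vectors normalises the sum.\<close>

lemma (in cstar_inclusion) unit_frame:
  fixes r :: "'v \<Rightarrow> 'v \<Rightarrow> 'c"
  assumes rA: "\<And>x y. \<lbrakk>x \<in> V; y \<in> V\<rbrakk> \<Longrightarrow> r x y \<in> A"
    and rpos: "\<And>x. x \<in> V \<Longrightarrow> cstar_positive C (r x x)"
    and rstar: "\<And>x y. \<lbrakk>x \<in> V; y \<in> V\<rbrakk> \<Longrightarrow> star C (r x y) = r y x"
    and rscale: "\<And>x y z. \<lbrakk>x \<in> V; y \<in> V\<rbrakk> \<Longrightarrow> \<exists>x'\<in>V. \<exists>y'\<in>V. z \<odot> r x y = r x' y'"
    and rdiff: "\<And>x y. \<lbrakk>x \<in> V; y \<in> V\<rbrakk> \<Longrightarrow> \<exists>w\<in>V. r w w = (r x x \<ominus> r x y) \<ominus> (r y x \<ominus> r y y)"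
    and ract: "\<And>x h. \<lbrakk>x \<in> V; h \<in> A; star C h = h\<rbrakk> \<Longrightarrow> \<exists>w\<in>V. r w w = h \<otimes> r x x \<otimes> h"
    and dense: "\<one> \<in> cstar_closure C (complex_span C {r x y | x y. x \<in> V \<and> y \<in> V})"
  shows "\<exists>(N::nat) z. (\<forall>i<N. z i \<in> V) \<and> (\<Oplus>i\<in>{..<N}. r (z i) (z i)) = \<one>"
proof -
  let ?S = "{r x y | x y. x \<in> V \<and> y \<in> V}"
  have rc: "r x y \<in> carrier C" if "x \<in> V" "y \<in> V" for x y using rA that sub_carrier by blast
  have S: "?S \<subseteq> carrier C" using rc by blast
  have "z \<odot> s \<in> ?S" if s: "s \<in> ?S" for z s
  proof -
    obtain x y where "x \<in> V" "y \<in> V" "s = r x y" using s by blast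
    then show ?thesis using rscale[of x y z] by auto
  qed
  note span = C.complex_span_subset_finite_sums[OF S this]
  have dom: "\<exists>(N::nat) z. (\<forall>i<N. z i \<in> V) \<and> C.pos ((\<Oplus>i\<in>{..<N}. r (z i) (z i)) \<ominus> (g \<oplus> star C g))"
    if "g \<in> finite_sums C ?S" for g
    using that
  proof induction
    case zero
    show ?case by (rule exI[of _ 0]) (simp add: C.minus_eq)
  next
    case (add s g)
    obtain x y where xy: "x \<in> V" "y \<in> V" "s = r x y" using add.hyps by blast
    have gc: "g \<in> carrier C" using add.hyps span(2) by blast
    obtain N :: nat and z where z: "\<And>i. i < N \<Longrightarrow> z i \<in> V" and p: "C.pos ((\<Oplus>i\<in>{..<N}. r (z i) (z i)) \<ominus> (g \<oplus> star C g))"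
      using add.IH by blast
    obtain w where w: "w \<in> V" "r w w = (r x x \<ominus> r x y) \<ominus> (r y x \<ominus> r y y)" using rdiff xy by blast
    \<comment> \<open>the new vectors \<open>x\<close> and \<open>y\<close> account for the new summand \<open>r x y\<close>\<close>
    define z' where "z' = case_nat x (case_nat y z)"
    let ?G = "\<Oplus>i\<in>{..<N}. r (z i) (z i)"
    have Gc: "?G \<in> carrier C" using z rc by (intro C.finsum_closed) auto
    have z': "z' i \<in> V" if "i < Suc (Suc N)" for i using that xy z by (auto simp: z'_def split: nat.splits)
    have z'_simps: "z' 0 = x" "z' (Suc 0) = y" "z' (Suc (Suc i)) = z i" for i by (simp_all add: z'_def)
    have z'c: "r (z' i) (z' i) \<in> carrier C" if "i < Suc (Suc N)" for i using z'[OF that] rc by blast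
    have "(\<Oplus>i\<in>{..<Suc (Suc N)}. r (z' i) (z' i)) = r x x \<oplus> (\<Oplus>i\<in>{..<Suc N}. r (z' (Suc i)) (z' (Suc i)))"
      using C.finsum_lessThan_Suc[of "Suc N" "\<lambda>i. r (z' i) (z' i)", OF z'c] by (simp only: z'_simps)
    also have "(\<Oplus>i\<in>{..<Suc N}. r (z' (Suc i)) (z' (Suc i))) = r y y \<oplus> ?G"
      using C.finsum_lessThan_Suc[of N "\<lambda>i. r (z' (Suc i)) (z' (Suc i))"] z'c by (simp only: z'_simps Suc_less_eq)
    finally have "(\<Oplus>i\<in>{..<Suc (Suc N)}. r (z' i) (z' i)) \<ominus> (s \<oplus> g \<oplus> star C (s \<oplus> g))
        = r w w \<oplus> (?G \<ominus> (g \<oplus> star C g))"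
      using xy gc Gc rc rstar
      by (simp add: w(2) C.star_add C.minus_eq C.minus_add C.a_ac)
    then have "C.pos ((\<Oplus>i\<in>{..<Suc (Suc N)}. r (z' i) (z' i)) \<ominus> (s \<oplus> g \<oplus> star C (s \<oplus> g)))"
      using C.pos_add[OF rpos[OF w(1)] p] by simp
    then show ?case using z' by blast
  qed
  have spanC: "complex_span C ?S \<subseteq> carrier C" using span by blast
  obtain g where g: "g \<in> complex_span C ?S" "nrm C (\<one> \<ominus> g) < 1 / 2"
    using dense unfolding C.in_cstar_closure[OF spanC] by (meson half_gt_zero zero_less_one)
  have gc: "g \<in> carrier C" using g spanC by blast
  obtain N :: nat and z where z: "\<And>i. i < N \<Longrightarrow> z i \<in> V" and p: "C.pos ((\<Oplus>i\<in>{..<N}. r (z i) (z i)) \<ominus> (g \<oplus> star C g))"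
    using dom[of g] g span by blast
  define G where "G = (\<Oplus>i\<in>{..<N}. r (z i) (z i))"
  have GA: "G \<in> A" unfolding G_def using z rA by (intro sub_finsum) auto
  have Gc: "G \<in> carrier C" using GA sub_carrier by blast
  define d where "d = (\<one> \<ominus> g) \<oplus> star C (\<one> \<ominus> g)"
  have d: "d \<in> carrier C" "star C d = d" using gc by (auto simp: d_def C.star_add C.star_diff C.a_comm)
  have "nrm C d \<le> 1" using C.nrm_triangle[of "\<one> \<ominus> g" "star C (\<one> \<ominus> g)"] g gc by (simp add: d_def)
  then have "C.pos (C.sc 1 \<ominus> d)" using C.pos_norm_minus[OF d, of 1] by simp
  moreover have "C.sc 1 \<ominus> d = (g \<oplus> star C g) \<ominus> C.sc 1"
  proof -
    have sg: "star C (\<one> \<ominus> g) = \<one> \<ominus> star C g" using gc by (simp add: C.star_diff)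
    have "C.sc 1 \<ominus> d = (\<one> \<ominus> (\<one> \<ominus> g)) \<ominus> (\<one> \<ominus> star C g)"
      using gc unfolding d_def sg by (simp add: C.minus_eq C.minus_add C.a_assoc)
    also have "\<dots> = g \<ominus> (\<one> \<ominus> star C g)" using gc by (simp add: C.diff_diff_cancel)
    also have "\<dots> = (g \<oplus> star C g) \<ominus> C.sc 1" using gc by (simp add: C.minus_eq C.minus_add C.a_ac)
    finally show ?thesis .
  qed
  ultimately have "C.pos ((g \<oplus> star C g) \<ominus> C.sc 1)" by simp
  then have "C.pos (G \<ominus> C.sc 1)"
    using C.pos_diff_trans[OF _ p[folded G_def], of "C.sc 1"] gc Gc by simp
  moreover have scA: "C.sc 1 \<in> A" using sub_one by simp
  ultimately have "cstar_positive CA (G \<ominus>\<^bsub>CA\<^esub> S.sc 1)"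
    unfolding sub_pos sub_sc using GA sub_a_minus[OF GA scA] sub_diff[OF GA scA] by simp
  then obtain h where h: "h \<in> A" "star C h = h" "h \<otimes> G \<otimes> h = \<one>"
  proof (rule S.pos_inverse_sqrt[rotated])
    show "G \<in> carrier CA" using GA by simp
    show "(0::real) < 1" by simp
    fix h k assume hk: "h \<in> carrier CA" "k \<in> carrier CA" "star CA h = h"
      "h \<otimes>\<^bsub>CA\<^esub> k = \<one>\<^bsub>CA\<^esub>" "k \<otimes>\<^bsub>CA\<^esub> h = \<one>\<^bsub>CA\<^esub>" "k \<otimes>\<^bsub>CA\<^esub> k = G"
    then have c: "h \<in> carrier C" "k \<in> carrier C" using sub_carrier by auto
    have "h \<otimes> (k \<otimes> k) \<otimes> h = (h \<otimes> k) \<otimes> (k \<otimes> h)" using c by (simp add: C.m_assoc)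
    then have "h \<otimes> G \<otimes> h = \<one>" using hk by simp
    then show thesis using that hk by simp
  qed
  have hc: "h \<in> carrier C" using h sub_carrier by blast
  have "\<exists>w. w \<in> V \<and> r w w = h \<otimes> r (z i) (z i) \<otimes> h" if "i < N" for i using ract[OF z[OF that] h(1,2)] by blast
  then obtain v where v: "\<And>i. i < N \<Longrightarrow> v i \<in> V" "\<And>i. i < N \<Longrightarrow> r (v i) (v i) = h \<otimes> r (z i) (z i) \<otimes> h" by metis
  have "(\<Oplus>i\<in>{..<N}. r (v i) (v i)) = (\<Oplus>i\<in>{..<N}. h \<otimes> r (z i) (z i) \<otimes> h)"
    using v(2) z rc hc by (intro C.finsum_cong') auto
  also have "\<dots> = h \<otimes> G \<otimes> h"
    unfolding G_def using z rc hc by (simp add: C.finsum_rdistr C.finsum_ldistr Pi_def)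
  finally show ?thesis using v(1) h(3) by metis
qed

section \<open>The linking algebra of an equivalence bimodule\<close>

locale framed_bimodule = equivalence_bimodule C D Y
  for C :: "('c, 'm) cstar_scheme" and D :: "('d, 'n) cstar_scheme"
    and Y :: "('c, 'd, 'y, 'k) bimodule_scheme" +
  fixes N :: nat and z :: "nat \<Rightarrow> 'y"
  assumes z_closed: "i < N \<Longrightarrow> z i \<in> carrier Y"
    and z_sum: "(\<Oplus>\<^bsub>C\<^esub>i\<in>{..<N}. linner Y (z i) (z i)) = \<one>\<^bsub>C\<^esub>"
begin

sublocale Y: abelian_group Y using complex_module by (simp add: module_def)

lemmas [simp] = lact_closed ract_closed linner_closed rinner_closed

lemma ysmult_closed [simp]: "x \<in> carrier Y \<Longrightarrow> c \<odot>\<^bsub>Y\<^esub> x \<in> carrier Y"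
  using module.smult_closed[OF complex_module] by (simp add: complex_ring_def)

lemma ysmult_addl: "x \<in> carrier Y \<Longrightarrow> (c + d) \<odot>\<^bsub>Y\<^esub> x = c \<odot>\<^bsub>Y\<^esub> x \<oplus>\<^bsub>Y\<^esub> d \<odot>\<^bsub>Y\<^esub> x"
  using module.smult_l_distr[OF complex_module] by (simp add: complex_ring_def)

lemma ysmult_addr: "\<lbrakk>x \<in> carrier Y; y \<in> carrier Y\<rbrakk> \<Longrightarrow> c \<odot>\<^bsub>Y\<^esub> (x \<oplus>\<^bsub>Y\<^esub> y) = c \<odot>\<^bsub>Y\<^esub> x \<oplus>\<^bsub>Y\<^esub> c \<odot>\<^bsub>Y\<^esub> y"
  using module.smult_r_distr[OF complex_module] by (simp add: complex_ring_def)

lemma ysmult_smult: "x \<in> carrier Y \<Longrightarrow> c \<odot>\<^bsub>Y\<^esub> (d \<odot>\<^bsub>Y\<^esub> x) = (c * d) \<odot>\<^bsub>Y\<^esub> x"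
  using module.smult_assoc1[OF complex_module] by (simp add: complex_ring_def)

lemma ysmult_one [simp]: "x \<in> carrier Y \<Longrightarrow> 1 \<odot>\<^bsub>Y\<^esub> x = x"
  using module.smult_one[OF complex_module] by (simp add: complex_ring_def)

lemma ysmult_zero [simp]: "x \<in> carrier Y \<Longrightarrow> 0 \<odot>\<^bsub>Y\<^esub> x = \<zero>\<^bsub>Y\<^esub>"
  using module.smult_l_null[OF complex_module] by (simp add: complex_ring_def)

lemma ysmult_zero_right [simp]: "c \<odot>\<^bsub>Y\<^esub> \<zero>\<^bsub>Y\<^esub> = \<zero>\<^bsub>Y\<^esub>"
  using ysmult_smult[of "\<zero>\<^bsub>Y\<^esub>" c 0] by simp

lemma ract_zero [simp]: "d \<in> carrier D \<Longrightarrow> ract Y \<zero>\<^bsub>Y\<^esub> d = \<zero>\<^bsub>Y\<^esub>"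
  using ract_smult_left[of "\<zero>\<^bsub>Y\<^esub>" d 0] by simp

lemma ract_zero_right [simp]: "x \<in> carrier Y \<Longrightarrow> ract Y x \<zero>\<^bsub>D\<^esub> = \<zero>\<^bsub>Y\<^esub>"
  using ract_smult_right[of x "\<zero>\<^bsub>D\<^esub>" 0] by simp

lemma rinner_zero [simp]: "x \<in> carrier Y \<Longrightarrow> rinner Y x \<zero>\<^bsub>Y\<^esub> = \<zero>\<^bsub>D\<^esub>"
  using rinner_smult[of x "\<zero>\<^bsub>Y\<^esub>" 0] by simp

lemma rinner_zero_left [simp]: "x \<in> carrier Y \<Longrightarrow> rinner Y \<zero>\<^bsub>Y\<^esub> x = \<zero>\<^bsub>D\<^esub>"
  using rinner_star[of x "\<zero>\<^bsub>Y\<^esub>"] by simp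

lemma lact_zero_left [simp]: "x \<in> carrier Y \<Longrightarrow> lact Y \<zero>\<^bsub>C\<^esub> x = \<zero>\<^bsub>Y\<^esub>"
  using lact_smult_left[of "\<zero>\<^bsub>C\<^esub>" x 0] by simp

lemma rinner_ract_left: "\<lbrakk>x \<in> carrier Y; y \<in> carrier Y; d \<in> carrier D\<rbrakk> \<Longrightarrow>
  rinner Y (ract Y x d) y = star D d \<otimes>\<^bsub>D\<^esub> rinner Y x y"
  using rinner_star[of y "ract Y x d"] rinner_star[of y x] by (simp add: rinner_ract D.star_mult)

lemma lact_one [simp]: assumes y: "y \<in> carrier Y" shows "lact Y \<one>\<^bsub>C\<^esub> y = y"
proof -
  let ?w = "lact Y \<one>\<^bsub>C\<^esub> y \<oplus>\<^bsub>Y\<^esub> (-1) \<odot>\<^bsub>Y\<^esub> y"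
  have w: "?w \<in> carrier Y" using y by simp
  have "linner Y ?w ?w = linner Y y ?w \<oplus>\<^bsub>C\<^esub> (-1) \<odot>\<^bsub>C\<^esub> linner Y y ?w"
    using y w by (simp add: linner_add linner_smult linner_lact)
  also have "\<dots> = \<zero>\<^bsub>C\<^esub>" using y w C.smult_neg_one[of "linner Y y ?w"] by (simp add: C.r_neg)
  finally have "?w = \<zero>\<^bsub>Y\<^esub>" using linner_definite w by blast
  moreover have "y \<oplus>\<^bsub>Y\<^esub> (-1) \<odot>\<^bsub>Y\<^esub> y = \<zero>\<^bsub>Y\<^esub>" using ysmult_addl[of y 1 "-1"] y by simp
  ultimately show ?thesis using y
    Y.minus_equality[of "lact Y \<one>\<^bsub>C\<^esub> y" "(-1) \<odot>\<^bsub>Y\<^esub> y"] Y.minus_equality[of y "(-1) \<odot>\<^bsub>Y\<^esub> y"]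
    by (metis Y.minus_minus lact_closed C.one_closed ysmult_closed)
qed

lemma lact_finsum: "\<lbrakk>finite I; f \<in> I \<rightarrow> carrier C; y \<in> carrier Y\<rbrakk> \<Longrightarrow> lact Y (finsum C f I) y = (\<Oplus>\<^bsub>Y\<^esub>i\<in>I. lact Y (f i) y)"
  by (rule additive_finsum[of C Y "\<lambda>c. lact Y c y"])
    (auto simp: lact_add_left C.abelian_group_axioms Y.abelian_group_axioms)

lemma z_frame: assumes y: "y \<in> carrier Y" shows "(\<Oplus>\<^bsub>Y\<^esub>i\<in>{..<N}. ract Y (z i) (rinner Y (z i) y)) = y"
proof -
  have "(\<Oplus>\<^bsub>Y\<^esub>i\<in>{..<N}. ract Y (z i) (rinner Y (z i) y)) = (\<Oplus>\<^bsub>Y\<^esub>i\<in>{..<N}. lact Y (linner Y (z i) (z i)) y)"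
    using z_closed y by (intro Y.finsum_cong') (auto simp: imprimitivity)
  also have "\<dots> = lact Y \<one>\<^bsub>C\<^esub> y"
    unfolding z_sum[symmetric] using z_closed y by (intro lact_finsum[symmetric]) auto
  finally show ?thesis using y by simp
qed

text \<open>The Hilbert \<open>D\<close>-module \<open>Y \<oplus> D\<close>; its action, inner product and frame are \<open>hra\<close>, \<open>hip\<close> and \<open>hu\<close>.\<close>

definition HM :: "(complex, 'y \<times> 'd) module" where
  "HM = \<lparr>carrier = carrier Y \<times> carrier D, mult = undefined, one = undefined, ring.zero = (\<zero>\<^bsub>Y\<^esub>, \<zero>\<^bsub>D\<^esub>),
     add = (\<lambda>s t. (fst s \<oplus>\<^bsub>Y\<^esub> fst t, snd s \<oplus>\<^bsub>D\<^esub> snd t)), smult = (\<lambda>c t. (c \<odot>\<^bsub>Y\<^esub> fst t, c \<odot>\<^bsub>D\<^esub> snd t))\<rparr>"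

lemma HM_simps [simp]:
  "carrier HM = carrier Y \<times> carrier D" "\<zero>\<^bsub>HM\<^esub> = (\<zero>\<^bsub>Y\<^esub>, \<zero>\<^bsub>D\<^esub>)"
  "s \<oplus>\<^bsub>HM\<^esub> t = (fst s \<oplus>\<^bsub>Y\<^esub> fst t, snd s \<oplus>\<^bsub>D\<^esub> snd t)" "c \<odot>\<^bsub>HM\<^esub> t = (c \<odot>\<^bsub>Y\<^esub> fst t, c \<odot>\<^bsub>D\<^esub> snd t)"
  by (simp_all add: HM_def)

lemma HM_group: "abelian_group HM"
proof (rule abelian_groupI)
  fix t assume t: "t \<in> carrier HM"
  show "\<exists>s\<in>carrier HM. s \<oplus>\<^bsub>HM\<^esub> t = \<zero>\<^bsub>HM\<^esub>"
    using t by (intro bexI[of _ "(\<ominus>\<^bsub>Y\<^esub> fst t, \<ominus>\<^bsub>D\<^esub> snd t)"]) (auto simp: Y.l_neg D.l_neg)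
qed (auto simp: Y.a_ac D.a_ac)

lemma HM_module: "module complex_ring HM"
  by (rule moduleI[OF cring_complex_ring HM_group])
    (auto simp: complex_ring_def ysmult_addl ysmult_addr ysmult_smult D.smult_addl D.smult_addr)

definition hra :: "'y \<times> 'd \<Rightarrow> 'd \<Rightarrow> 'y \<times> 'd" where "hra t d = (ract Y (fst t) d, snd t \<otimes>\<^bsub>D\<^esub> d)"
definition hip :: "'y \<times> 'd \<Rightarrow> 'y \<times> 'd \<Rightarrow> 'd" where
  "hip s t = rinner Y (fst s) (fst t) \<oplus>\<^bsub>D\<^esub> star D (snd s) \<otimes>\<^bsub>D\<^esub> snd t"
definition hu :: "nat \<Rightarrow> 'y \<times> 'd" where "hu i = (case i of 0 \<Rightarrow> (\<zero>\<^bsub>Y\<^esub>, \<one>\<^bsub>D\<^esub>) | Suc j \<Rightarrow> (z j, \<zero>\<^bsub>D\<^esub>))"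

lemma framed: "framed_hilbert_module D HM hra hip (Suc N) hu"
proof (intro framed_hilbert_module.intro framed_hilbert_module_axioms.intro D.unital_cstar_algebra_axioms HM_module)
  interpret HM: abelian_group HM by (rule HM_group)
  show hu: "hu i \<in> carrier HM" if "i < Suc N" for i using that z_closed by (auto simp: hu_def split: nat.splits)
  fix x assume x: "x \<in> carrier HM"
  show "cstar_positive D (hip x x)"
    using x unfolding hip_def by (intro D.pos_add rinner_positive D.pos_star_mult) auto
  have c: "hra (hu i) (hip (hu i) x) \<in> carrier HM" if "i < Suc N" for i
    using hu[OF that] x by (auto simp: hra_def hip_def)
  have "(\<Oplus>\<^bsub>HM\<^esub>i\<in>{..<Suc N}. hra (hu i) (hip (hu i) x))
      = hra (hu 0) (hip (hu 0) x) \<oplus>\<^bsub>HM\<^esub> (\<Oplus>\<^bsub>HM\<^esub>i\<in>{..<N}. hra (hu (Suc i)) (hip (hu (Suc i)) x))"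
    using c by (rule HM.finsum_lessThan_Suc)
  also have "hra (hu 0) (hip (hu 0) x) = (\<zero>\<^bsub>Y\<^esub>, snd x)" using x by (auto simp: hra_def hip_def hu_def)
  also have "(\<Oplus>\<^bsub>HM\<^esub>i\<in>{..<N}. hra (hu (Suc i)) (hip (hu (Suc i)) x))
      = (\<Oplus>\<^bsub>HM\<^esub>i\<in>{..<N}. (ract Y (z i) (rinner Y (z i) (fst x)), \<zero>\<^bsub>D\<^esub>))"
    using x z_closed by (intro HM.finsum_cong') (auto simp: hra_def hip_def hu_def)
  also have "\<dots> = (\<Oplus>\<^bsub>Y\<^esub>i\<in>{..<N}. ract Y (z i) (rinner Y (z i) (fst x)), \<zero>\<^bsub>D\<^esub>)"
    using x z_closed
    by (intro additive_finsum[of Y HM "\<lambda>y. (y, \<zero>\<^bsub>D\<^esub>)", symmetric] Y.abelian_group_axioms HM_group) auto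
  also have "(\<Oplus>\<^bsub>Y\<^esub>i\<in>{..<N}. ract Y (z i) (rinner Y (z i) (fst x))) = fst x" using x by (intro z_frame) auto
  finally show "x = (\<Oplus>\<^bsub>HM\<^esub>i\<in>{..<Suc N}. hra (hu i) (hip (hu i) x))" using x by auto
qed (auto simp: hra_def hip_def rinner_add rinner_smult rinner_ract rinner_star D.star_add D.star_mult
  D.r_distr D.l_distr D.smult_addr D.a_ac D.m_assoc)

sublocale H: framed_hilbert_module D HM hra hip "Suc N" hu by (rule framed)

abbreviation "L \<equiv> H.opalg"

text \<open>The linking algebra in matrix form: \<open>e0\<close> and \<open>e1\<close> are the projections onto the summands, \<open>pc\<close> and \<open>pd\<close> embed
  \<open>C\<close> and \<open>D\<close> on the diagonal, and \<open>cr\<close> and \<open>an\<close> embed \<open>Y\<close> and its dual off the diagonal.\<close>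

definition e0 where "e0 = (\<lambda>t\<in>carrier HM. (fst t, \<zero>\<^bsub>D\<^esub>))"
definition e1 where "e1 = (\<lambda>t\<in>carrier HM. (\<zero>\<^bsub>Y\<^esub>, snd t))"
definition pc where "pc c = (\<lambda>t\<in>carrier HM. (lact Y c (fst t), \<zero>\<^bsub>D\<^esub>))"
definition pd where "pd d = (\<lambda>t\<in>carrier HM. (\<zero>\<^bsub>Y\<^esub>, d \<otimes>\<^bsub>D\<^esub> snd t))"
definition cr where "cr x = (\<lambda>t\<in>carrier HM. (ract Y x (snd t), \<zero>\<^bsub>D\<^esub>))"
definition an where "an x = (\<lambda>t\<in>carrier HM. (\<zero>\<^bsub>Y\<^esub>, rinner Y x (fst t)))"

lemma op_hadj:
  assumes "\<And>t. t \<in> carrier HM \<Longrightarrow> f t \<in> carrier HM" "\<And>t. t \<in> carrier HM \<Longrightarrow> g t \<in> carrier HM"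
    and "\<And>s t. \<lbrakk>s \<in> carrier HM; t \<in> carrier HM\<rbrakk> \<Longrightarrow> hip (f s) t = hip s (g t)"
  shows "restrict f (carrier HM) \<in> H.ops" "H.hadj (restrict f (carrier HM)) = restrict g (carrier HM)"
proof -
  show 1: "restrict f (carrier HM) \<in> H.ops" using assms by (rule H.opsI)
  show "H.hadj (restrict f (carrier HM)) = restrict g (carrier HM)"
    using assms by (intro H.hadj_unique[OF 1]) auto
qed

lemma e0 [simp]: "e0 \<in> H.ops" "H.hadj e0 = e0"
  unfolding e0_def by (rule op_hadj[where f = "\<lambda>t. (fst t, \<zero>\<^bsub>D\<^esub>)" and g = "\<lambda>t. (fst t, \<zero>\<^bsub>D\<^esub>)"]; auto simp: hip_def)+

lemma e1 [simp]: "e1 \<in> H.ops" "H.hadj e1 = e1"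
  unfolding e1_def by (rule op_hadj[where f = "\<lambda>t. (\<zero>\<^bsub>Y\<^esub>, snd t)" and g = "\<lambda>t. (\<zero>\<^bsub>Y\<^esub>, snd t)"]; auto simp: hip_def)+

lemma pc [simp]: assumes "c \<in> carrier C" shows "pc c \<in> H.ops" "H.hadj (pc c) = pc (star C c)"
  unfolding pc_def by (rule op_hadj[where f = "\<lambda>t. (lact Y c (fst t), \<zero>\<^bsub>D\<^esub>)" and g = "\<lambda>t. (lact Y (star C c) (fst t), \<zero>\<^bsub>D\<^esub>)"]; use assms in \<open>auto simp: hip_def rinner_lact\<close>)+

lemma pd [simp]: assumes "d \<in> carrier D" shows "pd d \<in> H.ops" "H.hadj (pd d) = pd (star D d)"
  unfolding pd_def by (rule op_hadj[where f = "\<lambda>t. (\<zero>\<^bsub>Y\<^esub>, d \<otimes>\<^bsub>D\<^esub> snd t)" and g = "\<lambda>t. (\<zero>\<^bsub>Y\<^esub>, (star D d) \<otimes>\<^bsub>D\<^esub> snd t)"]; use assms in \<open>auto simp: hip_def D.star_mult D.m_assoc\<close>)+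

lemma cr [simp]: assumes "x \<in> carrier Y" shows "cr x \<in> H.ops" "H.hadj (cr x) = an x"
  unfolding cr_def an_def by (rule op_hadj[where f = "\<lambda>t. (ract Y x (snd t), \<zero>\<^bsub>D\<^esub>)" and g = "\<lambda>t. (\<zero>\<^bsub>Y\<^esub>, rinner Y x (fst t))"]; use assms in \<open>auto simp: hip_def rinner_ract_left\<close>)+

lemma an [simp]: assumes "x \<in> carrier Y" shows "an x \<in> H.ops" "H.hadj (an x) = cr x"
  using cr[OF assms] H.hadj_hadj[OF cr(1)[OF assms]] H.hadj_ops[OF cr(1)[OF assms]] by simp_all

lemmas op_defs = e0_def e1_def pc_def pd_def cr_def an_def

lemma op_mult:
  "e0 \<otimes>\<^bsub>L\<^esub> e0 = e0" "e1 \<otimes>\<^bsub>L\<^esub> e1 = e1"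
  "x \<in> carrier Y \<Longrightarrow> an x \<otimes>\<^bsub>L\<^esub> e0 = an x" "x \<in> carrier Y \<Longrightarrow> cr x \<otimes>\<^bsub>L\<^esub> e0 = pc \<zero>\<^bsub>C\<^esub>"
  "x \<in> carrier Y \<Longrightarrow> e0 \<otimes>\<^bsub>L\<^esub> an x = pc \<zero>\<^bsub>C\<^esub>" "x \<in> carrier Y \<Longrightarrow> e0 \<otimes>\<^bsub>L\<^esub> cr x = cr x"
  "x \<in> carrier Y \<Longrightarrow> cr x \<otimes>\<^bsub>L\<^esub> e1 = cr x" "x \<in> carrier Y \<Longrightarrow> e1 \<otimes>\<^bsub>L\<^esub> an x = an x"
  "\<lbrakk>x \<in> carrier Y; y \<in> carrier Y\<rbrakk> \<Longrightarrow> an x \<otimes>\<^bsub>L\<^esub> cr y = pd (rinner Y x y)"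
  "\<lbrakk>x \<in> carrier Y; y \<in> carrier Y\<rbrakk> \<Longrightarrow> cr x \<otimes>\<^bsub>L\<^esub> an y = pc (linner Y x y)"
  "\<lbrakk>x \<in> carrier Y; y \<in> carrier Y\<rbrakk> \<Longrightarrow> cr x \<otimes>\<^bsub>L\<^esub> cr y = pc \<zero>\<^bsub>C\<^esub>"
  "\<lbrakk>x \<in> carrier Y; d \<in> carrier D\<rbrakk> \<Longrightarrow> cr x \<otimes>\<^bsub>L\<^esub> pd d = cr (ract Y x d)"
  "d \<in> carrier D \<Longrightarrow> e0 \<otimes>\<^bsub>L\<^esub> pd d = pc \<zero>\<^bsub>C\<^esub>"
  "d \<in> carrier D \<Longrightarrow> e1 \<otimes>\<^bsub>L\<^esub> pd d = pd d" "d \<in> carrier D \<Longrightarrow> pd d \<otimes>\<^bsub>L\<^esub> e1 = pd d"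
  "t \<in> H.ops \<Longrightarrow> pc \<zero>\<^bsub>C\<^esub> \<otimes>\<^bsub>L\<^esub> t = pc \<zero>\<^bsub>C\<^esub>"
  using H.ops_closed[of t]
  by (auto simp: op_defs rinner_ract imprimitivity ract_mult mem_Times_iff intro!: restrict_ext)

lemma pc_one: "pc \<one>\<^bsub>C\<^esub> = e0"
  by (auto simp: op_defs intro!: restrict_ext)

lemma pd_one: "pd \<one>\<^bsub>D\<^esub> = e1"
  by (auto simp: op_defs intro!: restrict_ext)

lemma e0_e1: "e0 \<oplus>\<^bsub>L\<^esub> e1 = \<one>\<^bsub>L\<^esub>" "e1 \<oplus>\<^bsub>L\<^esub> e0 = \<one>\<^bsub>L\<^esub>"
  by (auto simp: op_defs intro!: restrict_ext)

lemma pc_add: "\<lbrakk>c \<in> carrier C; c' \<in> carrier C\<rbrakk> \<Longrightarrow> pc (c \<oplus>\<^bsub>C\<^esub> c') = pc c \<oplus>\<^bsub>L\<^esub> pc c'"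
  by (auto simp: op_defs lact_add_left intro!: restrict_ext)
lemma pc_mult: "\<lbrakk>c \<in> carrier C; c' \<in> carrier C\<rbrakk> \<Longrightarrow> pc (c \<otimes>\<^bsub>C\<^esub> c') = pc c \<otimes>\<^bsub>L\<^esub> pc c'"
  by (auto simp: op_defs lact_mult intro!: restrict_ext)
lemma pc_smult: "c \<in> carrier C \<Longrightarrow> pc (w \<odot>\<^bsub>C\<^esub> c) = w \<odot>\<^bsub>L\<^esub> pc c"
  by (auto simp: op_defs lact_smult_left intro!: restrict_ext)
lemma pd_add: "\<lbrakk>d \<in> carrier D; d' \<in> carrier D\<rbrakk> \<Longrightarrow> pd (d \<oplus>\<^bsub>D\<^esub> d') = pd d \<oplus>\<^bsub>L\<^esub> pd d'"
  by (auto simp: op_defs D.l_distr intro!: restrict_ext)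
lemma pd_mult: "\<lbrakk>d \<in> carrier D; d' \<in> carrier D\<rbrakk> \<Longrightarrow> pd (d \<otimes>\<^bsub>D\<^esub> d') = pd d \<otimes>\<^bsub>L\<^esub> pd d'"
  by (auto simp: op_defs D.m_assoc intro!: restrict_ext)
lemma pd_smult: "d \<in> carrier D \<Longrightarrow> pd (w \<odot>\<^bsub>D\<^esub> d) = w \<odot>\<^bsub>L\<^esub> pd d"
  by (auto simp: op_defs intro!: restrict_ext)

lemma linner_sum: assumes c: "c \<in> carrier C"
  shows "c = (\<Oplus>\<^bsub>C\<^esub>i\<in>{..<N}. linner Y (lact Y c (z i)) (z i))"
proof -
  have "c = c \<otimes>\<^bsub>C\<^esub> (\<Oplus>\<^bsub>C\<^esub>i\<in>{..<N}. linner Y (z i) (z i))" using c by (simp add: z_sum)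
  also have "\<dots> = (\<Oplus>\<^bsub>C\<^esub>i\<in>{..<N}. linner Y (lact Y c (z i)) (z i))"
    using c z_closed by (simp add: C.finsum_rdistr Pi_def linner_lact cong: C.finsum_cong)
  finally show ?thesis .
qed

lemma pc_inj: "inj_on pc (carrier C)"
proof (rule inj_onI)
  fix c c' assume c: "c \<in> carrier C" "c' \<in> carrier C" "pc c = pc c'"
  have "lact Y c y = lact Y c' y" if "y \<in> carrier Y" for y
    using fun_cong[OF c(3), of "(y, \<zero>\<^bsub>D\<^esub>)"] that by (simp add: pc_def)
  then have "(\<Oplus>\<^bsub>C\<^esub>i\<in>{..<N}. linner Y (lact Y c (z i)) (z i)) = (\<Oplus>\<^bsub>C\<^esub>i\<in>{..<N}. linner Y (lact Y c' (z i)) (z i))"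
    using z_closed c by (intro C.finsum_cong') auto
  then show "c = c'" by (simp only: linner_sum[OF c(1), symmetric] linner_sum[OF c(2), symmetric])
qed

lemma pd_inj: "inj_on pd (carrier D)"
proof (rule inj_onI)
  fix d d' assume d: "d \<in> carrier D" "d' \<in> carrier D" and "pd d = pd d'"
  then have "pd d (\<zero>\<^bsub>Y\<^esub>, \<one>\<^bsub>D\<^esub>) = pd d' (\<zero>\<^bsub>Y\<^esub>, \<one>\<^bsub>D\<^esub>)" by simp
  then show "d = d'" using d by (simp add: pd_def)
qed

text \<open>An operator \<open>T\<close> on \<open>Y\<close> is the action of \<open>\<Sum> \<langle>T (z i), z i\<rangle>\<close>, by the imprimitivity relation.\<close>

lemma e0_corner: assumes t: "t \<in> H.ops" "e0 \<otimes>\<^bsub>L\<^esub> t \<otimes>\<^bsub>L\<^esub> e0 = t" shows "t \<in> pc ` carrier C"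
proof -
  define T where "T y = fst (t (y, \<zero>\<^bsub>D\<^esub>))" for y
  have tc: "t (y, d) \<in> carrier Y \<times> carrier D" if "y \<in> carrier Y" "d \<in> carrier D" for y d
    using H.ops_closed[OF t(1), of "(y, d)"] that by simp
  have T: "T y \<in> carrier Y" if "y \<in> carrier Y" for y using tc[OF that D.zero_closed] by (auto simp: T_def)
  have teq: "t (y, d) = (T y, \<zero>\<^bsub>D\<^esub>)" if "y \<in> carrier Y" "d \<in> carrier D" for y d
    using fun_cong[OF t(2), of "(y, d)"] tc[OF that(1) D.zero_closed] that by (auto simp: e0_def T_def)
  have add: "T (y \<oplus>\<^bsub>Y\<^esub> y') = T y \<oplus>\<^bsub>Y\<^esub> T y'" if "y \<in> carrier Y" "y' \<in> carrier Y" for y y'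
    using H.ops_additive[OF t(1), of "(y, \<zero>\<^bsub>D\<^esub>)" "(y', \<zero>\<^bsub>D\<^esub>)"] that by (simp add: T_def)
  have ra: "T (ract Y y d) = ract Y (T y) d" if "y \<in> carrier Y" "d \<in> carrier D" for y d
    using H.ops_ra[OF t(1), of "(y, \<zero>\<^bsub>D\<^esub>)" d] that by (simp add: T_def hra_def)
  define c where "c = (\<Oplus>\<^bsub>C\<^esub>i\<in>{..<N}. linner Y (T (z i)) (z i))"
  have c: "c \<in> carrier C" unfolding c_def using z_closed T by (intro C.finsum_closed) auto
  have "lact Y c y = T y" if y: "y \<in> carrier Y" for y
  proof -
    have "lact Y c y = (\<Oplus>\<^bsub>Y\<^esub>i\<in>{..<N}. lact Y (linner Y (T (z i)) (z i)) y)"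
      unfolding c_def using z_closed T y by (intro lact_finsum) auto
    also have "\<dots> = (\<Oplus>\<^bsub>Y\<^esub>i\<in>{..<N}. T (ract Y (z i) (rinner Y (z i) y)))"
      using z_closed T y by (intro Y.finsum_cong') (auto simp: imprimitivity ra)
    also have "\<dots> = T (\<Oplus>\<^bsub>Y\<^esub>i\<in>{..<N}. ract Y (z i) (rinner Y (z i) y))"
      using z_closed T y add by (intro additive_finsum[symmetric] Y.abelian_group_axioms) auto
    finally show ?thesis using z_frame[OF y] by simp
  qed
  then have "pc c = t"
    using \<open>\<And>y. y \<in> carrier Y \<Longrightarrow> lact Y c y = T y\<close>
    by (intro H.ops_eqI[OF pc(1)[OF c] t(1)]) (auto simp: pc_def teq)
  then show ?thesis using c by blast
qed

lemma e1_corner: assumes t: "t \<in> H.ops" "e1 \<otimes>\<^bsub>L\<^esub> t \<otimes>\<^bsub>L\<^esub> e1 = t" shows "t \<in> pd ` carrier D"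
proof -
  define T where "T d = snd (t (\<zero>\<^bsub>Y\<^esub>, d))" for d
  have tc: "t (y, d) \<in> carrier Y \<times> carrier D" if "y \<in> carrier Y" "d \<in> carrier D" for y d
    using H.ops_closed[OF t(1), of "(y, d)"] that by simp
  have T: "T d \<in> carrier D" if "d \<in> carrier D" for d using tc[OF Y.zero_closed that] by (auto simp: T_def)
  have teq: "t (y, d) = (\<zero>\<^bsub>Y\<^esub>, T d)" if "y \<in> carrier Y" "d \<in> carrier D" for y d
    using fun_cong[OF t(2), of "(y, d)"] tc[OF Y.zero_closed that(2)] that by (auto simp: e1_def T_def)
  have ra: "T d = T \<one>\<^bsub>D\<^esub> \<otimes>\<^bsub>D\<^esub> d" if "d \<in> carrier D" for d
    using H.ops_ra[OF t(1), of "(\<zero>\<^bsub>Y\<^esub>, \<one>\<^bsub>D\<^esub>)" d] that by (simp add: T_def hra_def)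
  have "pd (T \<one>\<^bsub>D\<^esub>) = t"
    by (intro H.ops_eqI[OF pd(1)[OF T[OF D.one_closed]] t(1)]) (auto simp: pd_def teq ra[symmetric])
  then show ?thesis using T by blast
qed

declare H.opalg_simps [simp del]

sublocale OA: unital_cstar_algebra H.opalg by (rule H.opalg_cstar)

lemma op_carrier [simp]:
  "e0 \<in> carrier L" "e1 \<in> carrier L" "c \<in> carrier C \<Longrightarrow> pc c \<in> carrier L" "d \<in> carrier D \<Longrightarrow> pd d \<in> carrier L"
  "y \<in> carrier Y \<Longrightarrow> cr y \<in> carrier L" "y \<in> carrier Y \<Longrightarrow> an y \<in> carrier L"
  by (simp_all add: H.opalg_simps)

lemma op_star [simp]:
  "star L e0 = e0" "star L e1 = e1" "c \<in> carrier C \<Longrightarrow> star L (pc c) = pc (star C c)"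
  "d \<in> carrier D \<Longrightarrow> star L (pd d) = pd (star D d)"
  "y \<in> carrier Y \<Longrightarrow> star L (cr y) = an y" "y \<in> carrier Y \<Longrightarrow> star L (an y) = cr y"
  by (simp_all add: H.opalg_simps)

lemma pc_zero_mult: "t \<in> carrier L \<Longrightarrow> pc \<zero>\<^bsub>C\<^esub> \<otimes>\<^bsub>L\<^esub> t = pc \<zero>\<^bsub>C\<^esub>"
  using op_mult(16) by (simp add: H.opalg_simps(1))

lemmas op_mult_simps = op_mult(1-15) pc_zero_mult

lemma pc_finsum: "\<lbrakk>finite I; f \<in> I \<rightarrow> carrier C\<rbrakk> \<Longrightarrow> pc (finsum C f I) = (\<Oplus>\<^bsub>L\<^esub>i\<in>I. pc (f i))"
  by (intro additive_finsum C.abelian_group_axioms OA.abelian_group_axioms) (auto simp: pc_add)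

lemma pd_finsum: "\<lbrakk>finite I; f \<in> I \<rightarrow> carrier D\<rbrakk> \<Longrightarrow> pd (finsum D f I) = (\<Oplus>\<^bsub>L\<^esub>i\<in>I. pd (f i))"
  by (intro additive_finsum D.abelian_group_axioms OA.abelian_group_axioms) (auto simp: pd_add)

lemma pc_image: "pc ` carrier C = {t \<in> carrier L. e0 \<otimes>\<^bsub>L\<^esub> t \<otimes>\<^bsub>L\<^esub> e0 = t}"
proof -
  have "e0 \<otimes>\<^bsub>L\<^esub> pc c \<otimes>\<^bsub>L\<^esub> e0 = pc c" if "c \<in> carrier C" for c
    using that unfolding pc_one[symmetric] by (simp flip: pc_mult)
  then show ?thesis using e0_corner by (auto simp: H.opalg_simps(1))
qed

lemma pd_image: "pd ` carrier D = {t \<in> carrier L. e1 \<otimes>\<^bsub>L\<^esub> t \<otimes>\<^bsub>L\<^esub> e1 = t}"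
  using e1_corner by (auto simp: op_mult_simps H.opalg_simps(1))

end

text \<open>The family \<open>z\<close> is normalised for the left and \<open>x\<close> for the right inner product; both lie in \<open>V\<close>. The
  family \<open>x\<close> makes the corner \<open>C\<close> full and \<open>z\<close> the corner \<open>D\<close>.\<close>

locale framed_morita = framed_bimodule C D Y N z + I: index_finite A C E k u + J: cstar_inclusion B D
  for A and C :: "('c, 'm) cstar_scheme" and E k u and B and D :: "('d, 'n) cstar_scheme"
    and Y :: "('c, 'd, 'y, 'k) bimodule_scheme" and N z +
  fixes V :: "'y set" and M :: nat and x :: "nat \<Rightarrow> 'y"
  assumes V_closed: "v \<in> V \<Longrightarrow> v \<in> carrier Y"
    and V_lact: "\<lbrakk>c \<in> A; v \<in> V\<rbrakk> \<Longrightarrow> lact Y c v \<in> V" and V_ract: "\<lbrakk>d \<in> B; v \<in> V\<rbrakk> \<Longrightarrow> ract Y v d \<in> V"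
    and V_linner: "\<lbrakk>v \<in> V; w \<in> V\<rbrakk> \<Longrightarrow> linner Y v w \<in> A" and V_rinner: "\<lbrakk>v \<in> V; w \<in> V\<rbrakk> \<Longrightarrow> rinner Y v w \<in> B"
    and z_V: "i < N \<Longrightarrow> z i \<in> V" and x_V: "i < M \<Longrightarrow> x i \<in> V"
    and x_sum: "(\<Oplus>\<^bsub>D\<^esub>i\<in>{..<M}. rinner Y (x i) (x i)) = \<one>\<^bsub>D\<^esub>"
begin

definition a where "a = case_nat e0 (\<lambda>i. an (x i))"
definition b where "b = case_nat e1 (\<lambda>j. cr (z j))"

lemma a_simps [simp]: "a 0 = e0" "a (Suc i) = an (x i)" by (simp_all add: a_def)
lemma b_simps [simp]: "b 0 = e1" "b (Suc i) = cr (z i)" by (simp_all add: b_def)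

lemma x_closed [simp]: "i < M \<Longrightarrow> x i \<in> carrier Y" using x_V V_closed by blast

lemma a_carrier: "i < Suc M \<Longrightarrow> a i \<in> carrier L" by (cases i) auto
lemma b_carrier: "i < Suc N \<Longrightarrow> b i \<in> carrier L" using z_closed by (cases i) auto

lemma linking: "linking A C E k u L e0 pc (Suc M) a"
proof (intro linking.intro linking_axioms.intro full_corner.intro full_corner_axioms.intro
    cstar_inclusion.intro cstar_inclusion_axioms.intro C.carrier_inclusion OA.carrier_inclusion I.index_finite_axioms)
  show "unital_cstar_algebra C" by (rule C.unital_cstar_algebra_axioms)
  show "unital_cstar_algebra L" by (rule OA.unital_cstar_algebra_axioms)
  have "(\<Oplus>\<^bsub>L\<^esub>i\<in>{..<Suc M}. a i \<otimes>\<^bsub>L\<^esub> e0 \<otimes>\<^bsub>L\<^esub> star L (a i))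
      = e0 \<oplus>\<^bsub>L\<^esub> (\<Oplus>\<^bsub>L\<^esub>i\<in>{..<M}. pd (rinner Y (x i) (x i)))"
  proof -
    have "(\<Oplus>\<^bsub>L\<^esub>i\<in>{..<M}. a (Suc i) \<otimes>\<^bsub>L\<^esub> e0 \<otimes>\<^bsub>L\<^esub> star L (a (Suc i))) = (\<Oplus>\<^bsub>L\<^esub>i\<in>{..<M}. pd (rinner Y (x i) (x i)))"
      by (intro OA.finsum_cong') (auto simp: op_mult_simps)
    then show ?thesis using a_carrier by (subst OA.finsum_lessThan_Suc) (auto simp: op_mult_simps)
  qed
  also have "(\<Oplus>\<^bsub>L\<^esub>i\<in>{..<M}. pd (rinner Y (x i) (x i))) = e1"
    unfolding pd_one[symmetric] x_sum[symmetric] by (intro pd_finsum[symmetric]) auto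
  finally show "(\<Oplus>\<^bsub>L\<^esub>i\<in>{..<Suc M}. a i \<otimes>\<^bsub>L\<^esub> e0 \<otimes>\<^bsub>L\<^esub> star L (a i)) = \<one>\<^bsub>L\<^esub>" by (simp add: e0_e1)
  have e0A: "e0 \<in> pc ` A" using I.sub_one pc_one by force
  show "star L (a i) \<otimes>\<^bsub>L\<^esub> a j \<in> pc ` A" if "i < Suc M" "j < Suc M" for i j
    using that x_V
    by (cases i; cases j) (auto simp: op_mult_simps I.sub_zero V_linner e0A)
  show "a i \<otimes>\<^bsub>L\<^esub> e0 = a i" if "i < Suc M" for i
    using that by (cases i) (auto simp: op_mult_simps)
qed (use a_carrier in \<open>auto simp: op_mult_simps pc_add pc_mult pc_smult pc_image pc_inj\<close>)

sublocale K: linking A C E k u H.opalg e0 pc "Suc M" a by (rule linking)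

lemma L0_member:
  assumes "t \<in> carrier L" "\<And>i j. \<lbrakk>i < Suc M; j < Suc M\<rbrakk> \<Longrightarrow> star L (a i) \<otimes>\<^bsub>L\<^esub> t \<otimes>\<^bsub>L\<^esub> a j \<in> pc ` A"
  shows "t \<in> K.L0"
proof (rule K.L0_I[OF assms(1)])
  fix i j assume ij: "i < Suc M" "j < Suc M"
  obtain c where c: "c \<in> A" "star L (a i) \<otimes>\<^bsub>L\<^esub> t \<otimes>\<^bsub>L\<^esub> a j = pc c" using assms(2)[OF ij] by blast
  show "K.entry i j t \<in> A" using K.entry_I[OF ij assms(1), of c] c I.sub_carrier by simp
qed

lemma cr_L0: "v \<in> V \<Longrightarrow> cr v \<in> K.L0"
proof (rule L0_member)
  fix i j assume v: "v \<in> V" and "i < Suc M" "j < Suc M"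
  then show "star L (a i) \<otimes>\<^bsub>L\<^esub> cr v \<otimes>\<^bsub>L\<^esub> a j \<in> pc ` A"
    using x_V V_closed[OF v] by (cases i; cases j) (auto simp: op_mult_simps I.sub_zero V_linner)
qed (simp add: V_closed)

interpretation L0: cstar_inclusion K.L0 L
  by (intro cstar_inclusion.intro OA.unital_cstar_algebra_axioms cstar_inclusion_axioms.intro K.L0_inclusion)

lemma e1_L0: "e1 \<in> K.L0"
proof -
  have "e1 = \<one>\<^bsub>L\<^esub> \<ominus>\<^bsub>L\<^esub> e0" unfolding e0_e1(2)[symmetric] by (simp add: OA.minus_eq OA.a_assoc OA.r_neg)
  then show ?thesis using L0.sub_diff[OF L0.sub_one K.q_L0] by simp
qed

lemma b_L0: "i < Suc N \<Longrightarrow> b i \<in> K.L0" using z_V by (cases i) (auto simp: e1_L0 cr_L0)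

text \<open>If all \<open>\<langle>x i d, x j\<rangle>\<close> lie in \<open>A\<close>, then \<open>d\<close> is the sum of the elements
  \<open>\<langle>x i, \<langle>x i d, x j\<rangle> x j\<rangle>\<close>, which lie in \<open>B\<close>.\<close>

lemma pd_L0: assumes d: "d \<in> carrier D" shows "pd d \<in> K.L0 \<longleftrightarrow> d \<in> B"
proof
  assume "d \<in> B"
  then show "pd d \<in> K.L0"
  proof (intro L0_member)
    fix i j assume "d \<in> B" "i < Suc M" "j < Suc M"
    then show "star L (a i) \<otimes>\<^bsub>L\<^esub> pd d \<otimes>\<^bsub>L\<^esub> a j \<in> pc ` A"
      using x_V d by (cases i; cases j) (auto simp: op_mult_simps I.sub_zero V_linner V_ract)
  qed (simp add: d)
next
  assume dL: "pd d \<in> K.L0"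
  have A: "linner Y (ract Y (x i) d) (x j) \<in> A" if ij: "i < M" "j < M" for i j
  proof -
    have s: "Suc i < Suc M" "Suc j < Suc M" using ij by auto
    have "K.entry (Suc i) (Suc j) (pd d) = linner Y (ract Y (x i) d) (x j)"
      using ij d by (intro K.entry_I[OF s]) (auto simp: op_mult_simps)
    then show ?thesis using K.L0_entry[OF dL s] by simp
  qed
  have B: "rinner Y (x i) (x i) \<otimes>\<^bsub>D\<^esub> d \<otimes>\<^bsub>D\<^esub> rinner Y (x j) (x j) \<in> B" if ij: "i < M" "j < M" for i j
  proof -
    have "rinner Y (x i) (x i) \<otimes>\<^bsub>D\<^esub> d \<otimes>\<^bsub>D\<^esub> rinner Y (x j) (x j)
        = rinner Y (x i) (lact Y (linner Y (ract Y (x i) d) (x j)) (x j))"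
      using ij d by (simp add: imprimitivity rinner_ract)
    then show ?thesis using V_rinner[OF x_V V_lact[OF A x_V]] ij by simp
  qed
  let ?s = "\<Oplus>\<^bsub>D\<^esub>i\<in>{..<M}. rinner Y (x i) (x i)"
  have "d = ?s \<otimes>\<^bsub>D\<^esub> d \<otimes>\<^bsub>D\<^esub> ?s" using d by (simp add: x_sum)
  also have "\<dots> = (\<Oplus>\<^bsub>D\<^esub>i\<in>{..<M}. rinner Y (x i) (x i) \<otimes>\<^bsub>D\<^esub> d \<otimes>\<^bsub>D\<^esub> ?s)"
    using d by (simp add: D.finsum_ldistr Pi_def D.finsum_closed)
  also have "\<dots> = (\<Oplus>\<^bsub>D\<^esub>i\<in>{..<M}. \<Oplus>\<^bsub>D\<^esub>j\<in>{..<M}. rinner Y (x i) (x i) \<otimes>\<^bsub>D\<^esub> d \<otimes>\<^bsub>D\<^esub> rinner Y (x j) (x j))"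
    using d by (intro D.finsum_cong') (auto simp: D.finsum_rdistr Pi_def intro!: D.finsum_closed)
  finally have "d = (\<Oplus>\<^bsub>D\<^esub>i\<in>{..<M}. \<Oplus>\<^bsub>D\<^esub>j\<in>{..<M}. rinner Y (x i) (x i) \<otimes>\<^bsub>D\<^esub> d \<otimes>\<^bsub>D\<^esub> rinner Y (x j) (x j))" .
  moreover have "\<dots> \<in> B" using B by (intro J.sub_finsum) auto
  ultimately show "d \<in> B" by simp
qed

text \<open>Here \<open>e1\<close> is the complement of \<open>e0\<close>, and the partition of the unit is the one of \<open>z\<close>.\<close>

lemma opposite_corner: "full_corner B D K.L0 L e1 pd (Suc N) b"
proof (intro full_corner.intro full_corner_axioms.intro J.cstar_inclusion_axioms L0.cstar_inclusion_axioms)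
  show "pd ` B = {t \<in> K.L0. e1 \<otimes>\<^bsub>L\<^esub> t \<otimes>\<^bsub>L\<^esub> e1 = t}"
  proof (rule Set.set_eqI)
    fix t
    have "t \<in> pd ` B \<longleftrightarrow> t \<in> pd ` carrier D \<and> t \<in> K.L0" using pd_L0 J.sub_carrier by auto
    then show "t \<in> pd ` B \<longleftrightarrow> t \<in> {t \<in> K.L0. e1 \<otimes>\<^bsub>L\<^esub> t \<otimes>\<^bsub>L\<^esub> e1 = t}"
      unfolding pd_image using K.L0_closed by auto
  qed
  have "(\<Oplus>\<^bsub>L\<^esub>i\<in>{..<Suc N}. b i \<otimes>\<^bsub>L\<^esub> e1 \<otimes>\<^bsub>L\<^esub> star L (b i))
      = e1 \<oplus>\<^bsub>L\<^esub> (\<Oplus>\<^bsub>L\<^esub>i\<in>{..<N}. pc (linner Y (z i) (z i)))"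
  proof -
    have "(\<Oplus>\<^bsub>L\<^esub>i\<in>{..<N}. b (Suc i) \<otimes>\<^bsub>L\<^esub> e1 \<otimes>\<^bsub>L\<^esub> star L (b (Suc i))) = (\<Oplus>\<^bsub>L\<^esub>i\<in>{..<N}. pc (linner Y (z i) (z i)))"
      using z_closed by (intro OA.finsum_cong') (auto simp: op_mult_simps)
    then show ?thesis using b_carrier by (subst OA.finsum_lessThan_Suc) (auto simp: op_mult_simps)
  qed
  also have "(\<Oplus>\<^bsub>L\<^esub>i\<in>{..<N}. pc (linner Y (z i) (z i))) = e0"
    unfolding pc_one[symmetric] z_sum[symmetric] using z_closed by (intro pc_finsum[symmetric]) auto
  finally show "(\<Oplus>\<^bsub>L\<^esub>i\<in>{..<Suc N}. b i \<otimes>\<^bsub>L\<^esub> e1 \<otimes>\<^bsub>L\<^esub> star L (b i)) = \<one>\<^bsub>L\<^esub>" by (simp add: e0_e1)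
qed (auto simp: op_mult_simps pd_add pd_mult pd_smult pd_image[symmetric] pd_inj e1_L0 b_L0)

end

text \<open>The two families exist by density of the inner products, applied to each of them in turn.\<close>

lemma morita_linking_inclusion:
  fixes C :: "'c cstar" and D :: "'d cstar" and Y :: "('c, 'd, 'y) bimodule"
  assumes CD: "unital_inclusion A C" "unital_inclusion B D"
    and Y: "strongly_Morita_equivalent_via A C B D Y V" and E: "index_finite_expectation C A E"
  obtains L0 and L :: "('y \<times> 'd \<Rightarrow> 'y \<times> 'd) cstar" and F q \<phi> n a q' \<psi> n' b where
    "index_finite_expectation L L0 F"
    "full_corner A C L0 L q \<phi> n a" "full_corner B D L0 L q' \<psi> n' b"
proof -
  interpret I: cstar_inclusion A C using CD unfolding unital_inclusion_def
    by (intro cstar_inclusion.intro cstar_inclusion_axioms.intro CD) auto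
  interpret J: cstar_inclusion B D using CD unfolding unital_inclusion_def
    by (intro cstar_inclusion.intro cstar_inclusion_axioms.intro CD) auto
  interpret Y: equivalence_bimodule C D Y using Y unfolding strongly_Morita_equivalent_via_def by blast
  have sub: "submodule V complex_ring Y"
    and lV: "\<And>c v. \<lbrakk>c \<in> A; v \<in> V\<rbrakk> \<Longrightarrow> lact Y c v \<in> V" and rV: "\<And>d v. \<lbrakk>d \<in> B; v \<in> V\<rbrakk> \<Longrightarrow> ract Y v d \<in> V"
    and lA: "\<And>v w. \<lbrakk>v \<in> V; w \<in> V\<rbrakk> \<Longrightarrow> linner Y v w \<in> A" and rB: "\<And>v w. \<lbrakk>v \<in> V; w \<in> V\<rbrakk> \<Longrightarrow> rinner Y v w \<in> B"
    and ldense: "cstar_closure C (complex_span C {linner Y x y | x y. x \<in> V \<and> y \<in> V}) = A"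
    and rdense: "cstar_closure D (complex_span D {rinner Y x y | x y. x \<in> V \<and> y \<in> V}) = B"
    using Y unfolding strongly_Morita_equivalent_via_def by blast+
  have Vc: "V \<subseteq> carrier Y" and Vadd: "\<And>v w. \<lbrakk>v \<in> V; w \<in> V\<rbrakk> \<Longrightarrow> v \<oplus>\<^bsub>Y\<^esub> w \<in> V"
    and Vs: "\<And>c v. v \<in> V \<Longrightarrow> c \<odot>\<^bsub>Y\<^esub> v \<in> V"
    using module.submoduleE[OF Y.complex_module sub] by (auto simp: complex_ring_def)
  have Vc': "v \<in> carrier Y" if "v \<in> V" for v using that Vc by blast
  have linner_add_right: "linner Y v (w \<oplus>\<^bsub>Y\<^esub> w') = linner Y v w \<oplus>\<^bsub>C\<^esub> linner Y v w'"
    if "v \<in> V" "w \<in> V" "w' \<in> V" for v w w'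
    using that Vc' Vadd Y.linner_star[of "w \<oplus>\<^bsub>Y\<^esub> w'" v] Y.linner_star[of w v] Y.linner_star[of w' v]
    by (simp add: Y.linner_add I.C.star_add Y.linner_closed)
  have linner_smult_right: "linner Y v (c \<odot>\<^bsub>Y\<^esub> w) = cnj c \<odot>\<^bsub>C\<^esub> linner Y v w"
    if "v \<in> V" "w \<in> V" for v w c
    using that Vc' Vs Y.linner_star[of "c \<odot>\<^bsub>Y\<^esub> w" v] Y.linner_star[of w v]
    by (simp add: Y.linner_smult I.C.star_smult Y.linner_closed)
  have linner_lact_right: "linner Y v (lact Y c w) = linner Y v w \<otimes>\<^bsub>C\<^esub> star C c"
    if "v \<in> V" "w \<in> V" "c \<in> A" for v w c
    using that Vc' lV I.sub_carrier Y.linner_star[of "lact Y c w" v] Y.linner_star[of w v]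
    by (simp add: Y.linner_lact I.C.star_mult Y.linner_closed)
  have rinner_add_left: "rinner Y (w \<oplus>\<^bsub>Y\<^esub> w') v = rinner Y w v \<oplus>\<^bsub>D\<^esub> rinner Y w' v"
    if "v \<in> V" "w \<in> V" "w' \<in> V" for v w w'
    using that Vc' Vadd Y.rinner_star[of v "w \<oplus>\<^bsub>Y\<^esub> w'"] Y.rinner_star[of v w] Y.rinner_star[of v w']
    by (simp add: Y.rinner_add J.C.star_add Y.rinner_closed)
  have rinner_smult_left: "rinner Y (c \<odot>\<^bsub>Y\<^esub> w) v = cnj c \<odot>\<^bsub>D\<^esub> rinner Y w v"
    if "v \<in> V" "w \<in> V" for v w c
    using that Vc' Vs Y.rinner_star[of v "c \<odot>\<^bsub>Y\<^esub> w"] Y.rinner_star[of v w]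
    by (simp add: Y.rinner_smult J.C.star_smult Y.rinner_closed)
  have rinner_ract_left: "rinner Y (ract Y w d) v = star D d \<otimes>\<^bsub>D\<^esub> rinner Y w v"
    if "v \<in> V" "w \<in> V" "d \<in> B" for v w d
    using that Vc' rV J.sub_carrier Y.rinner_star[of v "ract Y w d"] Y.rinner_star[of v w]
    by (simp add: Y.rinner_ract J.C.star_mult Y.rinner_closed)
  have "\<exists>(N::nat) z. (\<forall>i<N. z i \<in> V) \<and> (\<Oplus>\<^bsub>C\<^esub>i\<in>{..<N}. linner Y (z i) (z i)) = \<one>\<^bsub>C\<^esub>"
  proof (rule I.unit_frame[of V "linner Y"])
    show "linner Y x y \<in> A" if "x \<in> V" "y \<in> V" for x y using lA that .
    show "cstar_positive C (linner Y x x)" if "x \<in> V" for x using Y.linner_positive Vc' that by blast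
    show "star C (linner Y x y) = linner Y y x" if "x \<in> V" "y \<in> V" for x y using Y.linner_star Vc' that by blast
    show "\<exists>x'\<in>V. \<exists>y'\<in>V. z \<odot>\<^bsub>C\<^esub> linner Y x y = linner Y x' y'" if "x \<in> V" "y \<in> V" for x y z
      using that Vs Vc' by (intro bexI[of _ "z \<odot>\<^bsub>Y\<^esub> x"] bexI[of _ y]) (auto simp: Y.linner_smult)
    show "\<exists>w\<in>V. linner Y w w = (linner Y x x \<ominus>\<^bsub>C\<^esub> linner Y x y) \<ominus>\<^bsub>C\<^esub> (linner Y y x \<ominus>\<^bsub>C\<^esub> linner Y y y)"
      if xy: "x \<in> V" "y \<in> V" for x y
    proof (rule bexI)
      let ?y = "(-1) \<odot>\<^bsub>Y\<^esub> y"
      show "x \<oplus>\<^bsub>Y\<^esub> ?y \<in> V" using xy Vadd Vs by blast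
      have "linner Y (x \<oplus>\<^bsub>Y\<^esub> ?y) (x \<oplus>\<^bsub>Y\<^esub> ?y)
          = (linner Y x x \<oplus>\<^bsub>C\<^esub> (-1) \<odot>\<^bsub>C\<^esub> linner Y y x) \<oplus>\<^bsub>C\<^esub> (-1) \<odot>\<^bsub>C\<^esub> (linner Y x y \<oplus>\<^bsub>C\<^esub> (-1) \<odot>\<^bsub>C\<^esub> linner Y y y)"
        using xy Vs Vadd Vc'
        by (simp add: Y.linner_add Y.linner_smult linner_add_right linner_smult_right Y.linner_closed)
      then show "linner Y (x \<oplus>\<^bsub>Y\<^esub> ?y) (x \<oplus>\<^bsub>Y\<^esub> ?y)
          = (linner Y x x \<ominus>\<^bsub>C\<^esub> linner Y x y) \<ominus>\<^bsub>C\<^esub> (linner Y y x \<ominus>\<^bsub>C\<^esub> linner Y y y)"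
        using xy Vc' by (simp add: I.C.smult_neg_one Y.linner_closed I.C.minus_eq I.C.minus_add I.C.a_ac)
    qed
    show "\<exists>w\<in>V. linner Y w w = h \<otimes>\<^bsub>C\<^esub> linner Y x x \<otimes>\<^bsub>C\<^esub> h" if "x \<in> V" "h \<in> A" "star C h = h" for x h
      using that lV Vc' I.sub_carrier
      by (intro bexI[of _ "lact Y h x"]) (auto simp: Y.linner_lact linner_lact_right Y.linner_closed I.C.m_assoc)
    show "\<one>\<^bsub>C\<^esub> \<in> cstar_closure C (complex_span C {linner Y x y | x y. x \<in> V \<and> y \<in> V})"
      using ldense I.sub_one by simp
  qed
  then obtain N :: nat and z where z: "\<And>i. i < N \<Longrightarrow> z i \<in> V" "(\<Oplus>\<^bsub>C\<^esub>i\<in>{..<N}. linner Y (z i) (z i)) = \<one>\<^bsub>C\<^esub>"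
    by blast
  have "\<exists>(M::nat) x. (\<forall>i<M. x i \<in> V) \<and> (\<Oplus>\<^bsub>D\<^esub>i\<in>{..<M}. rinner Y (x i) (x i)) = \<one>\<^bsub>D\<^esub>"
  proof (rule J.unit_frame[of V "rinner Y"])
    show "rinner Y x y \<in> B" if "x \<in> V" "y \<in> V" for x y using rB that .
    show "cstar_positive D (rinner Y x x)" if "x \<in> V" for x using Y.rinner_positive Vc' that by blast
    show "star D (rinner Y x y) = rinner Y y x" if "x \<in> V" "y \<in> V" for x y using Y.rinner_star Vc' that by blast
    show "\<exists>x'\<in>V. \<exists>y'\<in>V. z \<odot>\<^bsub>D\<^esub> rinner Y x y = rinner Y x' y'" if "x \<in> V" "y \<in> V" for x y z
      using that Vs Vc' by (intro bexI[of _ x] bexI[of _ "z \<odot>\<^bsub>Y\<^esub> y"]) (auto simp: Y.rinner_smult)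
    show "\<exists>w\<in>V. rinner Y w w = (rinner Y x x \<ominus>\<^bsub>D\<^esub> rinner Y x y) \<ominus>\<^bsub>D\<^esub> (rinner Y y x \<ominus>\<^bsub>D\<^esub> rinner Y y y)"
      if xy: "x \<in> V" "y \<in> V" for x y
    proof (rule bexI)
      let ?y = "(-1) \<odot>\<^bsub>Y\<^esub> y"
      show "x \<oplus>\<^bsub>Y\<^esub> ?y \<in> V" using xy Vadd Vs by blast
      have "rinner Y (x \<oplus>\<^bsub>Y\<^esub> ?y) (x \<oplus>\<^bsub>Y\<^esub> ?y)
          = (rinner Y x x \<oplus>\<^bsub>D\<^esub> (-1) \<odot>\<^bsub>D\<^esub> rinner Y y x) \<oplus>\<^bsub>D\<^esub> (-1) \<odot>\<^bsub>D\<^esub> (rinner Y x y \<oplus>\<^bsub>D\<^esub> (-1) \<odot>\<^bsub>D\<^esub> rinner Y y y)"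
        using xy Vs Vadd Vc'
        by (simp add: Y.rinner_add Y.rinner_smult rinner_add_left rinner_smult_left Y.rinner_closed)
      then show "rinner Y (x \<oplus>\<^bsub>Y\<^esub> ?y) (x \<oplus>\<^bsub>Y\<^esub> ?y)
          = (rinner Y x x \<ominus>\<^bsub>D\<^esub> rinner Y x y) \<ominus>\<^bsub>D\<^esub> (rinner Y y x \<ominus>\<^bsub>D\<^esub> rinner Y y y)"
        using xy Vc' by (simp add: J.C.smult_neg_one Y.rinner_closed J.C.minus_eq J.C.minus_add J.C.a_ac)
    qed
    show "\<exists>w\<in>V. rinner Y w w = h \<otimes>\<^bsub>D\<^esub> rinner Y x x \<otimes>\<^bsub>D\<^esub> h" if "x \<in> V" "h \<in> B" "star D h = h" for x h
      using that rV Vc' J.sub_carrier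
      by (intro bexI[of _ "ract Y x h"]) (auto simp: Y.rinner_ract rinner_ract_left Y.rinner_closed J.C.m_assoc)
    show "\<one>\<^bsub>D\<^esub> \<in> cstar_closure D (complex_span D {rinner Y x y | x y. x \<in> V \<and> y \<in> V})"
      using rdense J.sub_one by simp
  qed
  then obtain M :: nat and x where x: "\<And>i. i < M \<Longrightarrow> x i \<in> V" "(\<Oplus>\<^bsub>D\<^esub>i\<in>{..<M}. rinner Y (x i) (x i)) = \<one>\<^bsub>D\<^esub>"
    by blast
  obtain k u where "index_finite A C E k u" by (rule index_finite_expectation_locale[OF E])
  then interpret framed_morita A C E k u B D Y N z V M x
    by (intro framed_morita.intro framed_morita_axioms.intro framed_bimodule.intro framed_bimodule_axioms.intro
      Y.equivalence_bimodule_axioms J.cstar_inclusion_axioms) (use Vc' lV rV lA rB z x in auto)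
  show ?thesis using that[OF K.F_index_finite K.linking_corner opposite_corner] .
qed

section \<open>Paragroups of full corners\<close>

lemma star_iso_simps:
  assumes "star_iso M N U V f"
  shows "\<And>x. x \<in> U \<Longrightarrow> f x \<in> V" "inj_on f U" "f ` U = V"
    "\<And>x y. \<lbrakk>x \<in> U; y \<in> U\<rbrakk> \<Longrightarrow> f (x \<oplus>\<^bsub>M\<^esub> y) = f x \<oplus>\<^bsub>N\<^esub> f y"
    "\<And>x y. \<lbrakk>x \<in> U; y \<in> U\<rbrakk> \<Longrightarrow> f (x \<otimes>\<^bsub>M\<^esub> y) = f x \<otimes>\<^bsub>N\<^esub> f y"
    "\<And>z x. x \<in> U \<Longrightarrow> f (z \<odot>\<^bsub>M\<^esub> x) = z \<odot>\<^bsub>N\<^esub> f x" "\<And>x. x \<in> U \<Longrightarrow> f (star M x) = star N (f x)"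
  using assms unfolding star_iso_def bij_betw_def by blast+

locale tower_over = cstar_inclusion A C
  for A and C :: "('c, 'm) cstar_scheme" and S :: "('c, 's) tower" +
  assumes tower: "jones_tower A C S"
begin

lemma base_iso: "star_iso C (alg S 0) (carrier C) (carrier (alg S 0)) (base S)"
  using tower unfolding jones_tower_def by blast

lemma stage_inclusion: "cstar_inclusion (tower_sub S A m) (alg S m)"
proof -
  have "unital_inclusion (tower_sub S A m) (alg S m)"
    using tower unfolding jones_tower_def index_finite_expectation_def conditional_expectation_def by blast
  then show ?thesis
    unfolding cstar_inclusion_def cstar_inclusion_axioms_def by (simp add: unital_inclusion_def)
qed

lemma stage_cstar: "unital_cstar_algebra (alg S m)"
  using stage_inclusion unfolding cstar_inclusion_def by blast

lemma stage_basic: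
  "\<exists>k u p. basic (tower_sub S A m) (alg S m) (expec S m) k u (alg S (Suc m)) (incl S m) (jones S m) p"
proof -
  have E: "index_finite_expectation (alg S m) (tower_sub S A m) (expec S m)"
    and B: "basic_construction (alg S m) (tower_sub S A m) (expec S m) (alg S (Suc m)) (incl S m) (jones S m)"
    using tower unfolding jones_tower_def by blast+
  obtain k u where "index_finite (tower_sub S A m) (alg S m) (expec S m) k u"
    using E by (rule index_finite_expectation_locale)
  then show ?thesis using B by (rule basic_of_basic_construction) blast
qed

lemma incl_hom:
  shows "x \<in> carrier (alg S m) \<Longrightarrow> incl S m x \<in> carrier (alg S (Suc m))"
    "\<lbrakk>x \<in> carrier (alg S m); y \<in> carrier (alg S m)\<rbrakk> \<Longrightarrow>
      incl S m (x \<oplus>\<^bsub>alg S m\<^esub> y) = incl S m x \<oplus>\<^bsub>alg S (Suc m)\<^esub> incl S m y"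
    "\<lbrakk>x \<in> carrier (alg S m); y \<in> carrier (alg S m)\<rbrakk> \<Longrightarrow>
      incl S m (x \<otimes>\<^bsub>alg S m\<^esub> y) = incl S m x \<otimes>\<^bsub>alg S (Suc m)\<^esub> incl S m y"
    "x \<in> carrier (alg S m) \<Longrightarrow> incl S m (z \<odot>\<^bsub>alg S m\<^esub> x) = z \<odot>\<^bsub>alg S (Suc m)\<^esub> incl S m x"
    "x \<in> carrier (alg S m) \<Longrightarrow> incl S m (star (alg S m) x) = star (alg S (Suc m)) (incl S m x)"
    "\<lbrakk>x \<in> carrier (alg S m); y \<in> carrier (alg S m); incl S m x = incl S m y\<rbrakk> \<Longrightarrow> x = y"
proof -
  obtain k u p where "basic (tower_sub S A m) (alg S m) (expec S m) k u (alg S (Suc m)) (incl S m) (jones S m) p"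
    using stage_basic by blast
  then interpret B: basic "tower_sub S A m" "alg S m" "expec S m" k u "alg S (Suc m)" "incl S m" "jones S m" p .
  show "x \<in> carrier (alg S m) \<Longrightarrow> incl S m x \<in> carrier (alg S (Suc m))" by simp
  show "\<lbrakk>x \<in> carrier (alg S m); y \<in> carrier (alg S m)\<rbrakk> \<Longrightarrow>
      incl S m (x \<oplus>\<^bsub>alg S m\<^esub> y) = incl S m x \<oplus>\<^bsub>alg S (Suc m)\<^esub> incl S m y" by (rule B.iota_add)
  show "\<lbrakk>x \<in> carrier (alg S m); y \<in> carrier (alg S m)\<rbrakk> \<Longrightarrow>
      incl S m (x \<otimes>\<^bsub>alg S m\<^esub> y) = incl S m x \<otimes>\<^bsub>alg S (Suc m)\<^esub> incl S m y" by (rule B.iota_mult)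
  show "x \<in> carrier (alg S m) \<Longrightarrow> incl S m (z \<odot>\<^bsub>alg S m\<^esub> x) = z \<odot>\<^bsub>alg S (Suc m)\<^esub> incl S m x"
    by (rule B.iota_smult)
  show "x \<in> carrier (alg S m) \<Longrightarrow> incl S m (star (alg S m) x) = star (alg S (Suc m)) (incl S m x)"
    by (rule B.iota_star)
  show "\<lbrakk>x \<in> carrier (alg S m); y \<in> carrier (alg S m); incl S m x = incl S m y\<rbrakk> \<Longrightarrow> x = y" by (rule B.iota_inj)
qed

lemma emb_closed: "c \<in> carrier C \<Longrightarrow> tower_emb S m c \<in> carrier (alg S m)"
  by (induction m) (auto simp: star_iso_simps(1)[OF base_iso] incl_hom(1))

lemma emb_mult: "\<lbrakk>c \<in> carrier C; d \<in> carrier C\<rbrakk> \<Longrightarrow>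
  tower_emb S m (c \<otimes>\<^bsub>C\<^esub> d) = tower_emb S m c \<otimes>\<^bsub>alg S m\<^esub> tower_emb S m d"
  by (induction m) (auto simp: star_iso_simps(5)[OF base_iso] incl_hom(3) emb_closed)

lemma emb_star: "c \<in> carrier C \<Longrightarrow> tower_emb S m (star C c) = star (alg S m) (tower_emb S m c)"
  by (induction m) (auto simp: star_iso_simps(7)[OF base_iso] incl_hom(5) emb_closed)

lemma emb_inj: "\<lbrakk>c \<in> carrier C; d \<in> carrier C\<rbrakk> \<Longrightarrow> tower_emb S m c = tower_emb S m d \<longleftrightarrow> c = d"
proof (induction m)
  case 0
  then show ?case using star_iso_simps(2)[OF base_iso] by (simp add: inj_on_eq_iff)
next
  case (Suc m)
  then show ?case using incl_hom(6)[OF emb_closed emb_closed, of c d m] by auto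
qed

lemma emb_cut:
  assumes G: "G \<subseteq> carrier C" and q: "q \<in> carrier C"
  shows "{y \<in> tower_emb S m ` G. tower_emb S m q \<otimes>\<^bsub>alg S m\<^esub> y \<otimes>\<^bsub>alg S m\<^esub> tower_emb S m q = y}
    = tower_emb S m ` {x \<in> G. q \<otimes>\<^bsub>C\<^esub> x \<otimes>\<^bsub>C\<^esub> q = x}"
proof -
  have "tower_emb S m q \<otimes>\<^bsub>alg S m\<^esub> tower_emb S m x \<otimes>\<^bsub>alg S m\<^esub> tower_emb S m q = tower_emb S m x
      \<longleftrightarrow> q \<otimes>\<^bsub>C\<^esub> x \<otimes>\<^bsub>C\<^esub> q = x" if "x \<in> G" for x
    using that G q by (auto simp: emb_inj subset_iff simp flip: emb_mult)
  then show ?thesis by auto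
qed

text \<open>The relative commutants are *-algebras, increasing along the tower; hence *-isomorphisms of them
  can be inverted.\<close>

lemma relative_commutant_closed:
  assumes G: "G \<subseteq> carrier C" "\<forall>s\<in>G. star C s \<in> G" and x: "x \<in> relative_commutant S G m"
  shows "x \<in> carrier (alg S m)" "z \<odot>\<^bsub>alg S m\<^esub> x \<in> relative_commutant S G m"
    "star (alg S m) x \<in> relative_commutant S G m" "incl S m x \<in> relative_commutant S G (Suc m)"
    "y \<in> relative_commutant S G m \<Longrightarrow> x \<oplus>\<^bsub>alg S m\<^esub> y \<in> relative_commutant S G m"
    "y \<in> relative_commutant S G m \<Longrightarrow> x \<otimes>\<^bsub>alg S m\<^esub> y \<in> relative_commutant S G m"
proof -
  interpret M: unital_cstar_algebra "alg S m" by (rule stage_cstar)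
  have e: "tower_emb S m s \<in> carrier (alg S m)" if "s \<in> G" for s using that G emb_closed by blast
  show xc: "x \<in> carrier (alg S m)" using x by (simp add: relative_commutant_def)
  have xs: "tower_emb S m s \<otimes>\<^bsub>alg S m\<^esub> x = x \<otimes>\<^bsub>alg S m\<^esub> tower_emb S m s" if "s \<in> G" for s
    using x that by (simp add: relative_commutant_def)
  show "z \<odot>\<^bsub>alg S m\<^esub> x \<in> relative_commutant S G m"
    unfolding relative_commutant_def using xc e xs by (simp add: M.smult_mult_left M.smult_mult_right)
  have "tower_emb S m s \<otimes>\<^bsub>alg S m\<^esub> star (alg S m) x = star (alg S m) x \<otimes>\<^bsub>alg S m\<^esub> tower_emb S m s" if s: "s \<in> G" for s
  proof -
    have sc: "s \<in> carrier C" using s G by blast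
    have "star (alg S m) (tower_emb S m (star C s) \<otimes>\<^bsub>alg S m\<^esub> x) = star (alg S m) (x \<otimes>\<^bsub>alg S m\<^esub> tower_emb S m (star C s))"
      using xs[of "star C s"] G(2) s by simp
    then show ?thesis using xc e[OF s] sc by (simp add: emb_star M.star_mult)
  qed
  then show "star (alg S m) x \<in> relative_commutant S G m" unfolding relative_commutant_def using xc by simp
  have "tower_emb S (Suc m) s \<otimes>\<^bsub>alg S (Suc m)\<^esub> incl S m x = incl S m x \<otimes>\<^bsub>alg S (Suc m)\<^esub> tower_emb S (Suc m) s"
    if s: "s \<in> G" for s
    using arg_cong[OF xs[OF s], of "incl S m"] xc e[OF s] by (simp add: incl_hom(3))
  then show "incl S m x \<in> relative_commutant S G (Suc m)" unfolding relative_commutant_def using incl_hom(1)[OF xc] by blast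
  assume y: "y \<in> relative_commutant S G m"
  then have yc: "y \<in> carrier (alg S m)"
    and ys: "tower_emb S m s \<otimes>\<^bsub>alg S m\<^esub> y = y \<otimes>\<^bsub>alg S m\<^esub> tower_emb S m s" if "s \<in> G" for s
    using that by (auto simp: relative_commutant_def)
  have yc: "y \<in> carrier (alg S m)" using y by (simp add: relative_commutant_def)
  show "x \<oplus>\<^bsub>alg S m\<^esub> y \<in> relative_commutant S G m"
    unfolding relative_commutant_def using xc yc e xs ys by (simp add: M.l_distr M.r_distr)
  have "tower_emb S m s \<otimes>\<^bsub>alg S m\<^esub> (x \<otimes>\<^bsub>alg S m\<^esub> y) = x \<otimes>\<^bsub>alg S m\<^esub> y \<otimes>\<^bsub>alg S m\<^esub> tower_emb S m s" if s: "s \<in> G" for s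
  proof -
    have "tower_emb S m s \<otimes>\<^bsub>alg S m\<^esub> (x \<otimes>\<^bsub>alg S m\<^esub> y) = (tower_emb S m s \<otimes>\<^bsub>alg S m\<^esub> x) \<otimes>\<^bsub>alg S m\<^esub> y"
      using xc yc e[OF s] by (simp add: M.m_assoc)
    also have "\<dots> = x \<otimes>\<^bsub>alg S m\<^esub> (tower_emb S m s \<otimes>\<^bsub>alg S m\<^esub> y)"
      unfolding xs[OF s] using xc yc e[OF s] by (simp add: M.m_assoc)
    also have "\<dots> = x \<otimes>\<^bsub>alg S m\<^esub> y \<otimes>\<^bsub>alg S m\<^esub> tower_emb S m s"
      unfolding ys[OF s] using xc yc e[OF s] by (simp add: M.m_assoc)
    finally show ?thesis .
  qed
  then show "x \<otimes>\<^bsub>alg S m\<^esub> y \<in> relative_commutant S G m" unfolding relative_commutant_def using xc yc by simp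
qed

lemma relative_commutant_carrier: "relative_commutant S (carrier C) m \<subseteq> relative_commutant S A m"
  unfolding relative_commutant_def using sub_carrier by blast

end

text \<open>Invert the first isomorphism and compose it with the second one.\<close>

lemma isomorphic_paragroups_cospan:
  assumes U: "tower_over L0 L U"
    and S: "isomorphic_paragroups L0 L U A C S" and T: "isomorphic_paragroups L0 L U B D T"
  shows "isomorphic_paragroups A C S B D T"
proof -
  interpret U: tower_over L0 L U by fact
  let ?R = "relative_commutant U L0"
  have L0: "L0 \<subseteq> carrier L" "\<forall>s\<in>L0. star L s \<in> L0" using U.sub_carrier U.sub_star by blast+
  note rc = U.relative_commutant_closed[OF L0]
  obtain \<theta> where th: "\<And>n. star_iso (alg U n) (alg S n) (?R n) (relative_commutant S A n) (\<theta> n)"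
    "\<And>n x. x \<in> ?R n \<Longrightarrow> \<theta> (Suc n) (incl U n x) = incl S n (\<theta> n x)"
    "\<And>n. \<theta> n ` relative_commutant U (carrier L) n = relative_commutant S (carrier C) n"
    using S unfolding isomorphic_paragroups_def by blast
  obtain \<eta> where et: "\<And>n. star_iso (alg U n) (alg T n) (?R n) (relative_commutant T B n) (\<eta> n)"
    "\<And>n x. x \<in> ?R n \<Longrightarrow> \<eta> (Suc n) (incl U n x) = incl T n (\<eta> n x)"
    "\<And>n. \<eta> n ` relative_commutant U (carrier L) n = relative_commutant T (carrier D) n"
    using T unfolding isomorphic_paragroups_def by blast
  note th1 = star_iso_simps[OF th(1)] and et1 = star_iso_simps[OF et(1)]
  define \<zeta> where "\<zeta> n x = \<eta> n (inv_into (?R n) (\<theta> n) x)" for n x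
  have z: "\<zeta> n (\<theta> n x) = \<eta> n x" if "x \<in> ?R n" for n x
    unfolding \<zeta>_def using that by (simp add: inv_into_f_f[OF th1(2)])
  have ex: "\<exists>y. y \<in> ?R n \<and> x = \<theta> n y" if "x \<in> relative_commutant S A n" for n x
    using that th1(3)[of n] by blast
  show ?thesis
    unfolding isomorphic_paragroups_def
  proof (intro exI[of _ \<zeta>] allI conjI ballI)
    fix n
    show "star_iso (alg S n) (alg T n) (relative_commutant S A n) (relative_commutant T B n) (\<zeta> n)"
      unfolding star_iso_def
    proof (intro conjI allI ballI)
      have "bij_betw (inv_into (?R n) (\<theta> n)) (relative_commutant S A n) (?R n)"
        using th(1)[of n] bij_betw_inv_into unfolding star_iso_def by blast
      moreover have "bij_betw (\<eta> n) (?R n) (relative_commutant T B n)" using et(1)[of n] unfolding star_iso_def by blast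
      ultimately show "bij_betw (\<zeta> n) (relative_commutant S A n) (relative_commutant T B n)"
        using bij_betw_trans[of "inv_into (?R n) (\<theta> n)" _ _ "\<eta> n"] by (simp add: \<zeta>_def[abs_def] comp_def)
      fix x assume "x \<in> relative_commutant S A n"
      then obtain x' where x: "x' \<in> ?R n" "x = \<theta> n x'" using ex by blast
      show "\<zeta> n (c \<odot>\<^bsub>alg S n\<^esub> x) = c \<odot>\<^bsub>alg T n\<^esub> \<zeta> n x" for c
        using x rc(2)[OF x(1)] z[OF rc(2)[OF x(1), of c]] by (simp add: z th1(6) et1(6))
      show "\<zeta> n (star (alg S n) x) = star (alg T n) (\<zeta> n x)"
        using x z[OF rc(3)[OF x(1)]] by (simp add: z th1(7) et1(7))
      fix y assume "y \<in> relative_commutant S A n"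
      then obtain y' where y: "y' \<in> ?R n" "y = \<theta> n y'" using ex by blast
      show "\<zeta> n (x \<oplus>\<^bsub>alg S n\<^esub> y) = \<zeta> n x \<oplus>\<^bsub>alg T n\<^esub> \<zeta> n y"
        using x y z[OF rc(5)[OF x(1) y(1)]] by (simp add: z th1(4) et1(4))
      show "\<zeta> n (x \<otimes>\<^bsub>alg S n\<^esub> y) = \<zeta> n x \<otimes>\<^bsub>alg T n\<^esub> \<zeta> n y"
        using x y z[OF rc(6)[OF x(1) y(1)]] by (simp add: z th1(5) et1(5))
    qed
    show "\<zeta> (Suc n) (incl S n x) = incl T n (\<zeta> n x)" if x: "x \<in> relative_commutant S A n" for x
    proof -
      obtain x' where x: "x' \<in> ?R n" "x = \<theta> n x'" using ex[OF x] by blast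
      show ?thesis using x z[OF rc(4)[OF x(1)]] by (simp add: z th(2) et(2))
    qed
    have "\<zeta> n ` \<theta> n ` relative_commutant U (carrier L) n = \<eta> n ` relative_commutant U (carrier L) n"
      unfolding image_image using z U.relative_commutant_carrier by (intro image_cong) auto
    then show "\<zeta> n ` relative_commutant S (carrier C) n = relative_commutant T (carrier D) n"
      by (simp only: th(3) et(3))
  qed
qed

lemma (in full_corner) corner_tower_base:
  assumes S: "tower_over A C S" and U: "tower_over L0 L U"
  shows "full_corner (tower_sub S A 0) (alg S 0) (tower_sub U L0 0) (alg U 0) (base U q)
    (\<lambda>x. base U (\<phi> (inv_into (carrier C) (base S) x))) n (\<lambda>i. base U (a i))"
proof -
  interpret S: tower_over A C S by fact
  interpret U: tower_over L0 L U by fact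
  interpret S0: cstar_inclusion "tower_sub S A 0" "alg S 0" by (rule S.stage_inclusion)
  interpret U0: cstar_inclusion "tower_sub U L0 0" "alg U 0" by (rule U.stage_inclusion)
  note s = star_iso_simps[OF S.base_iso] and u = star_iso_simps[OF U.base_iso]
  let ?b = "inv_into (carrier C) (base S)"
  have b [simp]: "?b (base S c) = c" if "c \<in> carrier C" for c using that by (simp add: inv_into_f_f[OF s(2)])
  have ex: "\<exists>c\<in>carrier C. x = base S c" if "x \<in> carrier (alg S 0)" for x using that s(3) by blast
  have one: "base U \<one> = \<one>\<^bsub>alg U 0\<^esub>"
  proof -
    obtain t where t: "t \<in> carrier L" "base U t = \<one>\<^bsub>alg U 0\<^esub>" using u(3) U0.C.one_closed by (metis imageE)
    have "base U \<one> = base U \<one> \<otimes>\<^bsub>alg U 0\<^esub> base U t" using t u(1) by simp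
    also have "\<dots> = base U t" using u(5)[of "\<one>" t] t by simp
    finally show ?thesis using t by simp
  qed
  have img: "(\<lambda>x. base U (\<phi> (?b x))) ` base S ` X = base U ` \<phi> ` X" if "X \<subseteq> carrier C" for X
    unfolding image_image using that by (intro image_cong) auto
  have cut: "base U ` {x \<in> G. q \<otimes> x \<otimes> q = x}
      = {y \<in> base U ` G. base U q \<otimes>\<^bsub>alg U 0\<^esub> y \<otimes>\<^bsub>alg U 0\<^esub> base U q = y}" if "G \<subseteq> carrier L" for G
    using U.emb_cut[OF that, of q 0] by simp
  show ?thesis
  proof (intro full_corner.intro full_corner_axioms.intro S0.cstar_inclusion_axioms U0.cstar_inclusion_axioms)
    show "base U q \<in> tower_sub U L0 0" using q_sub by (simp add: tower_sub_def)
    show "base U q \<otimes>\<^bsub>alg U 0\<^esub> base U q = base U q" using u(5)[of q q] q_idem by simp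
    show "star (alg U 0) (base U q) = base U q" using u(7)[of q] q_star by simp
    show "inj_on (\<lambda>x. base U (\<phi> (?b x))) (carrier (alg S 0))"
    proof (rule inj_onI)
      fix x y assume "x \<in> carrier (alg S 0)" "y \<in> carrier (alg S 0)" "base U (\<phi> (?b x)) = base U (\<phi> (?b y))"
      moreover from this obtain c d where "c \<in> carrier C" "x = base S c" "d \<in> carrier C" "y = base S d" using ex by metis
      ultimately show "x = y" using u(2) by (simp add: inj_on_eq_iff)
    qed
    show "(\<lambda>x. base U (\<phi> (?b x))) ` carrier (alg S 0)
        = {x \<in> carrier (alg U 0). base U q \<otimes>\<^bsub>alg U 0\<^esub> x \<otimes>\<^bsub>alg U 0\<^esub> base U q = x}"
      using img[of "carrier C"] cut[of "carrier L"] unfolding s(3) u(3) phi_image by simp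
    show "(\<lambda>x. base U (\<phi> (?b x))) ` tower_sub S A 0
        = {x \<in> tower_sub U L0 0. base U q \<otimes>\<^bsub>alg U 0\<^esub> x \<otimes>\<^bsub>alg U 0\<^esub> base U q = x}"
      using img[of A] cut[of L0] C.sub_carrier L.sub_carrier by (simp add: tower_sub_def phi_sub subset_iff)
    show "base U (a i) \<in> tower_sub U L0 0" if "i < n" for i using a_sub[OF that] by (simp add: tower_sub_def)
    have "(\<Oplus>\<^bsub>alg U 0\<^esub>i\<in>{..<n}. base U (a i) \<otimes>\<^bsub>alg U 0\<^esub> base U q \<otimes>\<^bsub>alg U 0\<^esub> star (alg U 0) (base U (a i)))
        = (\<Oplus>\<^bsub>alg U 0\<^esub>i\<in>{..<n}. base U (a i \<otimes> q \<otimes> star L (a i)))"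
      using a_closed u(1) by (intro U0.C.finsum_cong') (auto simp: u(5,7))
    also have "\<dots> = base U (\<Oplus>i\<in>{..<n}. a i \<otimes> q \<otimes> star L (a i))"
      using a_closed u(1,4)
      by (intro additive_finsum[symmetric] L.C.abelian_group_axioms U0.C.abelian_group_axioms) auto
    finally show "(\<Oplus>\<^bsub>alg U 0\<^esub>i\<in>{..<n}. base U (a i) \<otimes>\<^bsub>alg U 0\<^esub> base U q \<otimes>\<^bsub>alg U 0\<^esub> star (alg U 0) (base U (a i))) = \<one>\<^bsub>alg U 0\<^esub>"
      by (simp add: full one)
    fix x assume "x \<in> carrier (alg S 0)"
    then obtain c where c: "c \<in> carrier C" "x = base S c" using ex by blast
    show "base U (\<phi> (?b x)) \<in> carrier (alg U 0)" using c u(1) by simp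
    show "base U (\<phi> (?b (z \<odot>\<^bsub>alg S 0\<^esub> x))) = z \<odot>\<^bsub>alg U 0\<^esub> base U (\<phi> (?b x))" for z
      using c by (simp add: s(6)[symmetric] phi_smult u(6))
    show "base U (\<phi> (?b (star (alg S 0) x))) = star (alg U 0) (base U (\<phi> (?b x)))"
      using c by (simp add: s(7)[symmetric] phi_star u(7))
    fix y assume "y \<in> carrier (alg S 0)"
    then obtain d where d: "d \<in> carrier C" "y = base S d" using ex by blast
    show "base U (\<phi> (?b (x \<oplus>\<^bsub>alg S 0\<^esub> y))) = base U (\<phi> (?b x)) \<oplus>\<^bsub>alg U 0\<^esub> base U (\<phi> (?b y))"
      using c d by (simp add: s(4)[symmetric] phi_add u(4))
    show "base U (\<phi> (?b (x \<otimes>\<^bsub>alg S 0\<^esub> y))) = base U (\<phi> (?b x)) \<otimes>\<^bsub>alg U 0\<^esub> base U (\<phi> (?b y))"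
      using c d by (simp add: s(5)[symmetric] phi_mult u(5))
  qed
qed

text \<open>At stage \<open>Suc m\<close> of a tower the small algebra is all of stage \<open>m\<close>, so \<open>corner_step\<close> delivers the
  corner in the form in which the next step needs it.\<close>

lemma (in full_corner) corner_tower:
  fixes S :: "('c, 's) tower" and U :: "('l, 't) tower"
  assumes S: "tower_over A C S" and U: "tower_over L0 L U"
  obtains \<Phi> where
    "\<And>m. full_corner (tower_sub S A m) (alg S m) (tower_sub U L0 m) (alg U m) (tower_emb U m q) (\<Phi> m)
      n (\<lambda>i. tower_emb U m (a i))"
    "\<And>m c. c \<in> carrier C \<Longrightarrow> \<Phi> m (tower_emb S m c) = tower_emb U m (\<phi> c)"
    "\<And>m x. x \<in> carrier (alg S m) \<Longrightarrow> \<Phi> (Suc m) (incl S m x) = incl U m (\<Phi> m x)"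
proof -
  interpret S: tower_over A C S by fact
  interpret U: tower_over L0 L U by fact
  define P where "P m \<Phi> \<longleftrightarrow> full_corner (tower_sub S A m) (alg S m) (tower_sub U L0 m) (alg U m) (tower_emb U m q) \<Phi>
      n (\<lambda>i. tower_emb U m (a i)) \<and> (\<forall>c\<in>carrier C. \<Phi> (tower_emb S m c) = tower_emb U m (\<phi> c))" for m \<Phi>
  define Q where "Q m \<Phi> \<Psi> \<longleftrightarrow> (\<forall>x\<in>carrier (alg S m). \<Psi> (incl S m x) = incl U m (\<Phi> x))" for m \<Phi> and \<Psi> :: "'s \<Rightarrow> 't"
  have "\<exists>\<Phi>. P 0 \<Phi>"
    unfolding P_def using corner_tower_base[OF S U] star_iso_simps(2)[OF S.base_iso]
    by (intro exI[of _ "\<lambda>x. base U (\<phi> (inv_into (carrier C) (base S) x))"]) (simp add: inv_into_f_f)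
  moreover have "\<exists>\<Psi>. P (Suc m) \<Psi> \<and> Q m \<Phi> \<Psi>" if P: "P m \<Phi>" for m \<Phi>
  proof -
    interpret K: full_corner "tower_sub S A m" "alg S m" "tower_sub U L0 m" "alg U m" "tower_emb U m q" \<Phi>
      n "\<lambda>i. tower_emb U m (a i)" using P unfolding P_def by blast
    obtain k u p where BS: "basic (tower_sub S A m) (alg S m) (expec S m) k u (alg S (Suc m)) (incl S m) (jones S m) p"
      using S.stage_basic by blast
    obtain k' w p' where BU: "basic (tower_sub U L0 m) (alg U m) (expec U m) k' w (alg U (Suc m)) (incl U m) (jones U m) p'"
      using U.stage_basic by blast
    obtain \<Psi> where "full_corner (incl S m ` carrier (alg S m)) (alg S (Suc m)) (incl U m ` carrier (alg U m)) (alg U (Suc m))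
        (incl U m (tower_emb U m q)) \<Psi> n (\<lambda>i. incl U m (tower_emb U m (a i)))"
      and "\<And>x. x \<in> carrier (alg S m) \<Longrightarrow> \<Psi> (incl S m x) = incl U m (\<Phi> x)"
      using K.corner_step[OF BU BS] by blast
    then have "P (Suc m) \<Psi>" "Q m \<Phi> \<Psi>"
      using P unfolding P_def Q_def by (auto simp: tower_sub_def S.emb_closed)
    then show ?thesis by blast
  qed
  ultimately obtain \<Phi> where "\<And>m. P m (\<Phi> m)" "\<And>m. Q m (\<Phi> m) (\<Phi> (Suc m))"
    using dependent_nat_choice[of P Q] by blast
  then show ?thesis using that[of \<Phi>] unfolding P_def Q_def by blast
qed

text \<open>The isomorphism is \<open>x \<mapsto> q x\<close>, read in the corner. It is multiplicative because \<open>q \<in> L0\<close> commutes with the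
  relative commutant.\<close>

lemma (in full_corner) corner_paragroup:
  assumes S: "tower_over A C S" and U: "tower_over L0 L U"
  shows "isomorphic_paragroups L0 L U A C S"
proof -
  interpret S: tower_over A C S by fact
  interpret U: tower_over L0 L U by fact
  obtain \<Phi> where corner: "\<And>m. full_corner (tower_sub S A m) (alg S m) (tower_sub U L0 m) (alg U m) (tower_emb U m q) (\<Phi> m)
      n (\<lambda>i. tower_emb U m (a i))"
    and emb: "\<And>m c. c \<in> carrier C \<Longrightarrow> \<Phi> m (tower_emb S m c) = tower_emb U m (\<phi> c)"
    and inc: "\<And>m x. x \<in> carrier (alg S m) \<Longrightarrow> \<Phi> (Suc m) (incl S m x) = incl U m (\<Phi> m x)"
    using corner_tower[OF S U] by blast
  interpret K: full_corner "tower_sub S A m" "alg S m" "tower_sub U L0 m" "alg U m" "tower_emb U m q" "\<Phi> m"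
    n "\<lambda>i. tower_emb U m (a i)" for m by (rule corner)
  have iso: "bij_betw (\<lambda>x. tower_emb U m q \<otimes>\<^bsub>alg U m\<^esub> x) (relative_commutant U G m) (\<Phi> m ` relative_commutant S X m)"
    if X: "X \<subseteq> carrier C" and G: "G \<subseteq> carrier L" "L0 \<subseteq> G" and XG: "\<phi> ` X = {x \<in> G. q \<otimes> x \<otimes> q = x}"
      and mult: "\<And>x y. \<lbrakk>x \<in> G; y \<in> G\<rbrakk> \<Longrightarrow> x \<otimes> y \<in> G" and star: "\<And>x. x \<in> G \<Longrightarrow> star L x \<in> G" for X G m
  proof -
    have "\<Phi> m ` tower_emb S m ` X = tower_emb U m ` \<phi> ` X"
      unfolding image_image using X emb by (intro image_cong) auto
    also have "\<dots> = {y \<in> tower_emb U m ` G. tower_emb U m q \<otimes>\<^bsub>alg U m\<^esub> y \<otimes>\<^bsub>alg U m\<^esub> tower_emb U m q = y}"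
      using U.emb_cut[OF G(1), of q m] XG by simp
    finally have eq: "\<Phi> m ` tower_emb S m ` X = \<dots>" .
    have Gc: "g \<in> carrier L" if "g \<in> G" for g using that G by blast
    have "bij_betw (\<lambda>x. tower_emb U m q \<otimes>\<^bsub>alg U m\<^esub> x)
        {x \<in> carrier (alg U m). \<forall>y\<in>tower_emb U m ` G. y \<otimes>\<^bsub>alg U m\<^esub> x = x \<otimes>\<^bsub>alg U m\<^esub> y}
        (\<Phi> m ` {c \<in> carrier (alg S m). \<forall>s\<in>tower_emb S m ` X. s \<otimes>\<^bsub>alg S m\<^esub> c = c \<otimes>\<^bsub>alg S m\<^esub> s})"
    proof (rule K.commutant_iso[OF _ _ _ _ eq])
      show "tower_emb S m ` X \<subseteq> carrier (alg S m)" using X S.emb_closed by blast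
      show "tower_emb U m ` G \<subseteq> carrier (alg U m)" using Gc U.emb_closed by blast
      show "tower_emb U m q \<in> tower_emb U m ` G" using q_sub G by blast
      show "tower_emb U m (a i) \<in> tower_emb U m ` G" if "i < n" for i using a_sub[OF that] G by blast
      show "x \<otimes>\<^bsub>alg U m\<^esub> y \<in> tower_emb U m ` G" if xy: "x \<in> tower_emb U m ` G" "y \<in> tower_emb U m ` G" for x y
      proof -
        obtain g h where "g \<in> G" "x = tower_emb U m g" "h \<in> G" "y = tower_emb U m h" using xy by blast
        then show ?thesis using mult Gc U.emb_mult by (metis image_eqI)
      qed
      show "star (alg U m) x \<in> tower_emb U m ` G" if x: "x \<in> tower_emb U m ` G" for x
      proof -
        obtain g where "g \<in> G" "x = tower_emb U m g" using x by blast
        then show ?thesis using star Gc U.emb_star by (metis image_eqI)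
      qed
    qed
    moreover have "{x \<in> carrier (alg U m). \<forall>y\<in>tower_emb U m ` G. y \<otimes>\<^bsub>alg U m\<^esub> x = x \<otimes>\<^bsub>alg U m\<^esub> y} = relative_commutant U G m"
      "{c \<in> carrier (alg S m). \<forall>s\<in>tower_emb S m ` X. s \<otimes>\<^bsub>alg S m\<^esub> c = c \<otimes>\<^bsub>alg S m\<^esub> s} = relative_commutant S X m"
      by (simp_all add: relative_commutant_def)
    ultimately show ?thesis by simp
  qed
  have iso0: "bij_betw (\<lambda>x. tower_emb U m q \<otimes>\<^bsub>alg U m\<^esub> x) (relative_commutant U L0 m) (\<Phi> m ` relative_commutant S A m)" for m
    using C.sub_carrier L.sub_carrier by (intro iso phi_sub) (auto simp: L.sub_mult L.sub_star)
  have iso1: "bij_betw (\<lambda>x. tower_emb U m q \<otimes>\<^bsub>alg U m\<^esub> x) (relative_commutant U (carrier L) m)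
      (\<Phi> m ` relative_commutant S (carrier C) m)" for m
    using L.sub_carrier by (intro iso phi_image) auto
  have rcS: "relative_commutant S X m \<subseteq> carrier (alg S m)" for X m unfolding relative_commutant_def by blast
  have psi_image: "K.psi m ` \<Phi> m ` X = X" if "X \<subseteq> carrier (alg S m)" for X m
    unfolding image_image using that by (auto simp: subset_iff image_iff)
  define \<theta> where "\<theta> m x = K.psi m (tower_emb U m q \<otimes>\<^bsub>alg U m\<^esub> x)" for m x
  have th: "\<exists>c. c \<in> relative_commutant S A m \<and> c \<in> carrier (alg S m) \<and> \<Phi> m c = tower_emb U m q \<otimes>\<^bsub>alg U m\<^esub> x \<and> \<theta> m x = c"
    if x: "x \<in> relative_commutant U L0 m" for m x
  proof -
    have "tower_emb U m q \<otimes>\<^bsub>alg U m\<^esub> x \<in> \<Phi> m ` relative_commutant S A m"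
      using bij_betwE[OF iso0] x by blast
    then obtain c where c: "c \<in> relative_commutant S A m" "tower_emb U m q \<otimes>\<^bsub>alg U m\<^esub> x = \<Phi> m c" by blast
    then have "c \<in> carrier (alg S m)" using rcS by blast
    then show ?thesis using c by (intro exI[of _ c]) (simp add: \<theta>_def)
  qed
  have rcU: "x \<in> carrier (alg U m)" "x \<otimes>\<^bsub>alg U m\<^esub> tower_emb U m q = tower_emb U m q \<otimes>\<^bsub>alg U m\<^esub> x"
    if "x \<in> relative_commutant U L0 m" for x m
    using that q_sub unfolding relative_commutant_def by auto
  show ?thesis
    unfolding isomorphic_paragroups_def
  proof (intro exI[of _ \<theta>] allI conjI ballI)
    fix m
    let ?q = "tower_emb U m q"
    show "star_iso (alg U m) (alg S m) (relative_commutant U L0 m) (relative_commutant S A m) (\<theta> m)"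
      unfolding star_iso_def
    proof (intro conjI allI ballI)
      have "bij_betw (K.psi m) (\<Phi> m ` relative_commutant S A m) (relative_commutant S A m)"
      proof (rule bij_betw_imageI)
        show "inj_on (K.psi m) (\<Phi> m ` relative_commutant S A m)"
          using rcS[of A m] by (auto simp: inj_on_def subset_iff)
        show "K.psi m ` \<Phi> m ` relative_commutant S A m = relative_commutant S A m" by (rule psi_image[OF rcS])
      qed
      then show "bij_betw (\<theta> m) (relative_commutant U L0 m) (relative_commutant S A m)"
        using bij_betw_trans[OF iso0[of m], of "K.psi m"] by (simp add: \<theta>_def[abs_def] comp_def)
      fix x assume x: "x \<in> relative_commutant U L0 m"
      obtain c where c: "c \<in> carrier (alg S m)" "\<Phi> m c = ?q \<otimes>\<^bsub>alg U m\<^esub> x" "\<theta> m x = c" using th[OF x] by blast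
      have "?q \<otimes>\<^bsub>alg U m\<^esub> (z \<odot>\<^bsub>alg U m\<^esub> x) = \<Phi> m (z \<odot>\<^bsub>alg S m\<^esub> c)" for z
        using rcU(1)[OF x] c by (simp add: K.phi_smult K.L.C.smult_mult_right)
      then show "\<theta> m (z \<odot>\<^bsub>alg U m\<^esub> x) = z \<odot>\<^bsub>alg S m\<^esub> \<theta> m x" for z
        using c(1,3) by (simp add: \<theta>_def)
      have "?q \<otimes>\<^bsub>alg U m\<^esub> star (alg U m) x = star (alg U m) (x \<otimes>\<^bsub>alg U m\<^esub> ?q)"
        using rcU(1)[OF x] K.q_closed[of m] K.q_star[of m] by (simp only: K.L.C.star_mult)
      also have "\<dots> = \<Phi> m (star (alg S m) c)" using c by (simp add: rcU(2)[OF x] K.phi_star)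
      finally show "\<theta> m (star (alg U m) x) = star (alg S m) (\<theta> m x)"
        using c(1,3) by (simp add: \<theta>_def)
      fix y assume y: "y \<in> relative_commutant U L0 m"
      obtain d where d: "d \<in> carrier (alg S m)" "\<Phi> m d = ?q \<otimes>\<^bsub>alg U m\<^esub> y" "\<theta> m y = d" using th[OF y] by blast
      have "?q \<otimes>\<^bsub>alg U m\<^esub> (x \<oplus>\<^bsub>alg U m\<^esub> y) = \<Phi> m (c \<oplus>\<^bsub>alg S m\<^esub> d)"
        using rcU(1)[OF x] rcU(1)[OF y] c d by (simp add: K.phi_add K.L.C.r_distr)
      then show "\<theta> m (x \<oplus>\<^bsub>alg U m\<^esub> y) = \<theta> m x \<oplus>\<^bsub>alg S m\<^esub> \<theta> m y"
        using c(1,3) d(1,3) by (simp add: \<theta>_def)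
      have "?q \<otimes>\<^bsub>alg U m\<^esub> (x \<otimes>\<^bsub>alg U m\<^esub> y) = ?q \<otimes>\<^bsub>alg U m\<^esub> ?q \<otimes>\<^bsub>alg U m\<^esub> (x \<otimes>\<^bsub>alg U m\<^esub> y)"
        by (simp only: K.q_idem)
      also have "\<dots> = ?q \<otimes>\<^bsub>alg U m\<^esub> (?q \<otimes>\<^bsub>alg U m\<^esub> x) \<otimes>\<^bsub>alg U m\<^esub> y"
        using rcU(1)[OF x] rcU(1)[OF y] by (simp add: K.L.C.m_assoc)
      also have "\<dots> = ?q \<otimes>\<^bsub>alg U m\<^esub> (x \<otimes>\<^bsub>alg U m\<^esub> ?q) \<otimes>\<^bsub>alg U m\<^esub> y"
        by (simp only: rcU(2)[OF x])
      also have "\<dots> = (?q \<otimes>\<^bsub>alg U m\<^esub> x) \<otimes>\<^bsub>alg U m\<^esub> (?q \<otimes>\<^bsub>alg U m\<^esub> y)"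
        using rcU(1)[OF x] rcU(1)[OF y] by (simp add: K.L.C.m_assoc)
      also have "\<dots> = \<Phi> m (c \<otimes>\<^bsub>alg S m\<^esub> d)" using c d by (simp add: K.phi_mult)
      finally show "\<theta> m (x \<otimes>\<^bsub>alg U m\<^esub> y) = \<theta> m x \<otimes>\<^bsub>alg S m\<^esub> \<theta> m y"
        using c(1,3) d(1,3) by (simp add: \<theta>_def)
    qed
    show "\<theta> (Suc m) (incl U m x) = incl S m (\<theta> m x)" if x: "x \<in> relative_commutant U L0 m" for x
    proof -
      obtain c where c: "c \<in> carrier (alg S m)" "\<Phi> m c = ?q \<otimes>\<^bsub>alg U m\<^esub> x" "\<theta> m x = c" using th[OF x] by blast
      have "tower_emb U (Suc m) q \<otimes>\<^bsub>alg U (Suc m)\<^esub> incl U m x = \<Phi> (Suc m) (incl S m c)"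
        using c rcU(1)[OF x] K.q_closed[of m] by (simp add: inc U.incl_hom(3))
      then show ?thesis using c(1,3) S.incl_hom(1) by (simp add: \<theta>_def del: tower_emb.simps)
    qed
    have "\<theta> m ` relative_commutant U (carrier L) m
        = K.psi m ` (\<lambda>x. ?q \<otimes>\<^bsub>alg U m\<^esub> x) ` relative_commutant U (carrier L) m"
      unfolding image_image \<theta>_def ..
    also have "\<dots> = relative_commutant S (carrier C) m"
      unfolding bij_betw_imp_surj_on[OF iso1] by (rule psi_image[OF rcS])
    finally show "\<theta> m ` relative_commutant U (carrier L) m = relative_commutant S (carrier C) m" .
  qed
qed

section \<open>Strongly Morita equivalent inclusions\<close>

text \<open>An isomorphism is a full corner with \<open>q = 1\<close>, so the expectation can be moved to the copy of \<open>C\<close>.\<close>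

lemma index_finite_tower_exists:
  fixes C :: "'c cstar"
  assumes E: "index_finite_expectation C A E"
  shows "\<exists>S :: ('c, nat \<Rightarrow> 'c) tower. jones_tower A C S"
proof -
  obtain k u where IF: "index_finite A C E k u" by (rule index_finite_expectation_locale[OF E])
  interpret I: index_finite A C E k u by (rule IF)
  define j :: "'c \<Rightarrow> nat \<Rightarrow> 'c" where "j = (\<lambda>c _. c)"
  interpret T: transported C j by unfold_locales (auto simp: inj_on_def j_def fun_eq_iff)
  interpret N: cstar_inclusion "j ` A" "transport j C"
    using T.transport_cstar T.transport_inclusion[OF I.incl]
    by (intro cstar_inclusion.intro cstar_inclusion_axioms.intro)
  have j: "inv_into (carrier C) j (j c) = c" if "c \<in> carrier C" for c
    using that T.inj by simp
  have "full_corner (j ` A) (transport j C) A C \<one>\<^bsub>C\<^esub> (inv_into (carrier C) j) 1 (\<lambda>_. \<one>\<^bsub>C\<^esub>)"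
  proof (intro full_corner.intro full_corner_axioms.intro N.cstar_inclusion_axioms I.cstar_inclusion_axioms)
    show "inj_on (inv_into (carrier C) j) (carrier (transport j C))" by (auto simp: inj_on_def j)
    show "inv_into (carrier C) j ` carrier (transport j C) = {x \<in> carrier C. \<one>\<^bsub>C\<^esub> \<otimes>\<^bsub>C\<^esub> x \<otimes>\<^bsub>C\<^esub> \<one>\<^bsub>C\<^esub> = x}"
      by (auto simp: image_image j)
    show "inv_into (carrier C) j ` j ` A = {x \<in> A. \<one>\<^bsub>C\<^esub> \<otimes>\<^bsub>C\<^esub> x \<otimes>\<^bsub>C\<^esub> \<one>\<^bsub>C\<^esub> = x}"
      using I.sub_carrier by (auto simp: image_image j)
  qed (auto simp: I.sub_one j lessThan_Suc)
  then have "index_finite_expectation (transport j C) (j ` A)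
      (\<lambda>c. full_corner.psi (transport j C) (inv_into (carrier C) j) (E (inv_into (carrier C) j c)))"
    using full_corner.corner_index_finite(1)[OF _ IF] by blast
  then show ?thesis unfolding j_def by (rule jones_tower_exists) (rule I.C.unital_cstar_algebra_axioms)
qed

theorem theorem10p4:
  fixes A :: "'c set" and C :: "'c cstar"
    and B :: "'d set" and D :: "'d cstar"
    and Y :: "('c, 'd, 'y) bimodule" and V :: "'y set"
  assumes "unital_inclusion A C"
    and "unital_inclusion B D"
    and "strongly_Morita_equivalent_via A C B D Y V"
    and "\<exists>E. index_finite_expectation C A E"
  shows "(\<exists>S :: ('c, nat \<Rightarrow> 'c) tower. jones_tower A C S) \<and>
         (\<exists>T :: ('d, nat \<Rightarrow> 'd) tower. jones_tower B D T) \<and>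
         (\<forall>(S :: ('c, 's) tower) (T :: ('d, 't) tower).
            jones_tower A C S \<and> jones_tower B D T \<longrightarrow> isomorphic_paragroups A C S B D T)"
proof -
  obtain E where E: "index_finite_expectation C A E" using assms(4) by blast
  obtain L0 and L :: "('y \<times> 'd \<Rightarrow> 'y \<times> 'd) cstar" and F q \<phi> n a q' \<psi> n' b where
    F: "index_finite_expectation L L0 F"
    and K: "full_corner A C L0 L q \<phi> n a" and K': "full_corner B D L0 L q' \<psi> n' b"
    by (rule morita_linking_inclusion[OF assms(1-3) E])
  interpret K: full_corner A C L0 L q \<phi> n a by (rule K)
  interpret K': full_corner B D L0 L q' \<psi> n' b by (rule K')
  obtain k w where "index_finite L0 L F k w" by (rule index_finite_expectation_locale[OF F])
  note E' = K'.corner_index_finite(1)[OF this]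
  obtain U :: "('y \<times> 'd \<Rightarrow> 'y \<times> 'd, nat \<Rightarrow> 'y \<times> 'd \<Rightarrow> 'y \<times> 'd) tower" where U: "jones_tower L0 L U"
    using index_finite_tower_exists[OF F] by blast
  have U: "tower_over L0 L U"
    by (intro tower_over.intro tower_over_axioms.intro K.L.cstar_inclusion_axioms U)
  have "isomorphic_paragroups A C S B D T" if S: "jones_tower A C S" and T: "jones_tower B D T"
    for S :: "('c, 's) tower" and T :: "('d, 't) tower"
  proof -
    have "tower_over A C S" "tower_over B D T"
      by (intro tower_over.intro tower_over_axioms.intro K.C.cstar_inclusion_axioms K'.C.cstar_inclusion_axioms S T)+
    then show ?thesis
      using isomorphic_paragroups_cospan[OF U] K.corner_paragroup[OF _ U] K'.corner_paragroup[OF _ U] by blast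
  qed
  then show ?thesis using index_finite_tower_exists[OF E] index_finite_tower_exists[OF E'] by blast
qed

end
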